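(* Fix $p\in(1,2)$ and $\alpha>1$. Assuming the Small Set Expansion Hypothesis, there is no $\alpha$-approximation algorithm for Entrywise $\ell_p$-Rank-$k$ Approximation that runs in time $\mathrm{poly}(n)$. Consequently, additionally assuming the Exponential Time Hypothesis, there exists $\delta=\delta(p,\alpha)>0$ such that there is no $\alpha$-approximation algorithm for Entrywise $\ell_p$-Rank-$k$ Approximation that runs in time $2^{k^{\delta}}$.
   Context: Entrywise $\ell_p$-Rank-$k$ Approximation: given an $n\times d$ matrix $A$ ($n\ge d$) with integer entries bounded in absolute value by $\mathrm{poly}(n)$ and a positive integer $k$, output $U\in\mathbb{R}^{n\times k}$, $V\in\mathbb{R}^{k\times d}$ minimizing $\|A-UV\|_p^p=\sum_{i,j}|A_{i,j}-(UV)_{i,j}|^p$; an $\alpha$-approximation outputs $U,V$ with $\|A-UV\|_p^p\le\alpha\cdot\min_{U',V'}\|A-U'V'\|_p^p$. Small Set Expansion Hypothesis: for a regular graph $G=(V,E)$ and $S\subseteq V$ let $\mu(S)=|S|/|V|$ and $\Phi_G(S)$ be the probability that a uniformly random neighbor of a uniformly random vertex of $S$ lies outside $S$; for $\delta\in(0,1)$ let $\Phi_G(\delta)=\min_{S:\mu(S)\le\delta}\Phi_G(S)$. The hypothesis states that for every $\varepsilon>0$ there is $\delta>0$ such that it is NP-hard to decide whether $\Phi_G(\delta)\le\varepsilon$ or $\Phi_G(\delta)\ge1-\varepsilon$. Exponential Time Hypothesis: 3-SAT on $n$ variables cannot be solved in time $2^{o(n)}$.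
   Formalization: The first claim (no poly(n)-time α-approximation under the Small Set Expansion Hypothesis) additionally assumes P ≠ NP, since the hypothesis only asserts NP-hardness and holds trivially if P = NP; the Exponential Time Hypothesis part needs no such addition. *)

theory Defs
  imports
    "HOL-Probability.Probability_Mass_Function"
    "HOL-Library.Landau_Symbols"
    "Jordan_Normal_Form.Matrix"
    "Graph_Theory.Pair_Digraph"
begin

section \<open>Deterministic multi-tape Turing machines\<close>

text \<open>
  States are the numbers below \<open>num_states\<close>, with start state \<open>0\<close> and halting state \<open>num_states\<close>.
  Tape symbols are the numbers below \<open>num_syms\<close>, where \<open>0\<close> is the blank and \<open>1\<close>, \<open>2\<close> represent the
  bits. The transition function maps a state and the list of scanned symbols to the new state and,
  for each tape, the symbol to write and the head movement. Tapes are infinite in both directions.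
\<close>

record tm =
  num_tapes :: nat
  num_states :: nat
  num_syms :: nat
  trans :: "nat \<Rightarrow> nat list \<Rightarrow> nat \<times> (nat \<times> int) list"

text \<open>Well-formedness makes the part of \<open>trans\<close> that is ever consulted a finite table.\<close>

definition wf_tm :: "tm \<Rightarrow> bool" where
  "wf_tm M \<longleftrightarrow> 0 < num_tapes M \<and> 3 \<le> num_syms M \<and>
     (\<forall>q < num_states M. \<forall>ss. length ss = num_tapes M \<and> set ss \<subseteq> {..<num_syms M} \<longrightarrow>
        (case trans M q ss of (q', acts) \<Rightarrow>
           q' \<le> num_states M \<and> length acts = num_tapes M \<and>
           set acts \<subseteq> {..<num_syms M} \<times> {-1, 0, 1}))"

type_synonym tape = "(int \<Rightarrow> nat) \<times> int"  \<comment> \<open>contents and head position\<close>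
type_synonym config = "nat \<times> tape list"

definition act :: "nat \<times> int \<Rightarrow> tape \<Rightarrow> tape" where
  "act a tp = ((fst tp)(snd tp := fst a), snd tp + snd a)"

definition step :: "tm \<Rightarrow> config \<Rightarrow> config" where
  "step M c = (case c of (q, tps) \<Rightarrow>
     if q < num_states M
     then (case trans M q (map (\<lambda>(f, h). f h) tps) of (q', acts) \<Rightarrow> (q', map2 act acts tps))
     else c)"

definition sym_of_bit :: "bool \<Rightarrow> nat" where
  "sym_of_bit b = (if b then 2 else 1)"

definition tape_of :: "bool list \<Rightarrow> int \<Rightarrow> nat" where
  "tape_of w i = (if 0 \<le> i \<and> i < int (length w) then sym_of_bit (w ! nat i) else 0)"

definition init_config :: "tm \<Rightarrow> bool list \<Rightarrow> config" where
  "init_config M x = (0, (tape_of x, 0) # replicate (num_tapes M - 1) (tape_of [], 0))"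

text \<open>
  The output is the bit string on the first tape that starts at cell \<open>0\<close> and is delimited by a blank.
\<close>

definition tape_holds :: "(int \<Rightarrow> nat) \<Rightarrow> bool list \<Rightarrow> bool" where
  "tape_holds f w \<longleftrightarrow> (\<forall>i < length w. f (int i) = sym_of_bit (w ! i)) \<and> f (int (length w)) = 0"

definition computes_within :: "tm \<Rightarrow> bool list \<Rightarrow> bool list \<Rightarrow> real \<Rightarrow> bool" where
  "computes_within M x y T \<longleftrightarrow>
     (\<exists>t q tps. real t \<le> T \<and> (step M ^^ t) (init_config M x) = (q, tps) \<and>
        q = num_states M \<and> tape_holds (fst (hd tps)) y)"


section \<open>Encodings as bit strings\<close>

fun bin :: "nat \<Rightarrow> bool list" where
  "bin n = (if n = 0 then [] else odd n # bin (n div 2))"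

declare bin.simps [simp del]

definition enc_int :: "int \<Rightarrow> bool list" where
  "enc_int z = (z < 0) # bin (nat \<bar>z\<bar>)"

text \<open>A self-delimiting code: each bit of a component is preceded by a 1, and each component is
  closed by a 0.\<close>

definition tuple :: "bool list list \<Rightarrow> bool list" where
  "tuple ws = concat (map (\<lambda>w. concat (map (\<lambda>b. [True, b]) w) @ [False]) ws)"

definition enc_rat :: "rat \<Rightarrow> bool list" where
  "enc_rat r = tuple [enc_int (fst (quotient_of r)), enc_int (snd (quotient_of r))]"

definition enc_mat :: "('a \<Rightarrow> bool list) \<Rightarrow> 'a mat \<Rightarrow> bool list" where
  "enc_mat e A = tuple (bin (dim_row A) # bin (dim_col A) #
     concat (map (\<lambda>i. map (\<lambda>j. e (A $$ (i, j))) [0..<dim_col A]) [0..<dim_row A]))"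

text \<open>Graphs are encoded by adjacency matrices, for vertex set \<open>{..<N}\<close>.\<close>

definition enc_graph :: "nat pair_pre_digraph \<Rightarrow> bool list" where
  "enc_graph G = enc_mat (\<lambda>b. [b])
     (mat (card (pverts G)) (card (pverts G)) (\<lambda>uv. uv \<in> parcs G))"

type_synonym literal = "nat \<times> bool"  \<comment> \<open>variable and sign\<close>
type_synonym cnf = "literal list list"

definition enc_cnf :: "cnf \<Rightarrow> bool list" where
  "enc_cnf F = tuple (map (\<lambda>C. tuple (map (\<lambda>(v, s). s # bin v) C)) F)"


text \<open>The encodings are injective.\<close>

lemma bin_inj: "bin m = bin n \<Longrightarrow> m = n"
proof (induction m arbitrary: n rule: less_induct)
  case (less m)
  show ?case
  proof (cases "m = 0 \<or> n = 0")
    case True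
    with less.prems show ?thesis
      by (metis bin.simps list.distinct(1))
  next
    case False
    then have "odd m = odd n" "bin (m div 2) = bin (n div 2)"
      using less.prems by (metis bin.simps list.inject)+
    with False less.IH[of "m div 2" "n div 2"] have "m div 2 = n div 2" by simp
    with \<open>odd m = odd n\<close> show ?thesis
      by (metis bit_eq_rec)
  qed
qed

lemma enc_int_inj: "enc_int a = enc_int b \<Longrightarrow> a = b"
  unfolding enc_int_def by (drule list.inject[THEN iffD1]) (auto dest!: bin_inj split: if_splits)

lemma component_inj:
  "concat (map (\<lambda>b. [True, b]) v) @ False # x = concat (map (\<lambda>b. [True, b]) w) @ False # y
     \<Longrightarrow> v = w \<and> x = y"
proof (induction v arbitrary: w)
  case Nil
  then show ?case by (cases w) auto
next
  case (Cons a v)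
  then show ?case by (cases w) auto
qed

lemma tuple_inj: "tuple vs = tuple ws \<Longrightarrow> vs = ws"
proof (induction vs arbitrary: ws)
  case Nil
  then show ?case by (cases ws) (auto simp: tuple_def)
next
  case (Cons v vs)
  from Cons.prems obtain w ws' where ws: "ws = w # ws'"
    by (cases ws) (auto simp: tuple_def)
  with Cons.prems have "v = w \<and> tuple vs = tuple ws'"
    by (intro component_inj) (simp add: tuple_def)
  with ws Cons.IH show ?case by blast
qed

lemma enc_rat_inj: "enc_rat a = enc_rat b \<Longrightarrow> a = b"
  unfolding enc_rat_def
  by (drule tuple_inj) (auto dest!: enc_int_inj intro!: quotient_of_inject prod_eqI)

lemma concat_map_inj:
  assumes "concat (map f xs) = concat (map g xs)" "\<And>x. x \<in> set xs \<Longrightarrow> length (f x) = length (g x)"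
  shows "\<forall>x \<in> set xs. f x = g x"
  using assms by (induction xs) auto

lemma enc_mat_inj:
  assumes e: "\<And>a b. e a = e b \<Longrightarrow> a = b" and eq: "enc_mat e A = enc_mat e B"
  shows "A = B"
proof -
  from tuple_inj[OF eq[unfolded enc_mat_def]]
  have dims: "dim_row A = dim_row B" "dim_col A = dim_col B"
    and *: "concat (map (\<lambda>i. map (\<lambda>j. e (A $$ (i, j))) [0..<dim_col A]) [0..<dim_row A]) =
        concat (map (\<lambda>i. map (\<lambda>j. e (B $$ (i, j))) [0..<dim_col B]) [0..<dim_row B])"
    by (auto dest: bin_inj)
  from concat_map_inj[OF *[folded dims]]
  have "e (A $$ (i, j)) = e (B $$ (i, j))" if "i < dim_row A" "j < dim_col A" for i j
    using that by auto
  with e dims show ?thesis by (intro eq_matI) auto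
qed


section \<open>Polynomial time, NP and NP-hardness\<close>

text \<open>Every polynomial is bounded by some \<open>poly_bound c\<close> on the natural numbers.\<close>

definition poly_bound :: "nat \<Rightarrow> nat \<Rightarrow> nat" where
  "poly_bound c n = c * n ^ c + c"

definition poly_time :: "(bool list \<Rightarrow> bool list) \<Rightarrow> bool" where
  "poly_time f \<longleftrightarrow>
     (\<exists>M c. wf_tm M \<and> (\<forall>x. computes_within M x (f x) (poly_bound c (length x))))"

definition class_P :: "bool list set set" where
  "class_P = {L. poly_time (\<lambda>x. [x \<in> L])}"

definition class_NP :: "bool list set set" where
  "class_NP = {L. \<exists>R \<in> class_P. \<exists>c. \<forall>x.
     x \<in> L \<longleftrightarrow> (\<exists>w. length w \<le> poly_bound c (length x) \<and> tuple [x, w] \<in> R)}"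

text \<open>NP-hardness (under polynomial-time many-one reductions) of deciding whether an input is in
  \<open>Y\<close> or in \<open>N\<close>.\<close>

definition NP_hard_promise :: "bool list set \<Rightarrow> bool list set \<Rightarrow> bool" where
  "NP_hard_promise Y N \<longleftrightarrow>
     (\<forall>L \<in> class_NP. \<exists>f. poly_time f \<and>
        (\<forall>x. (x \<in> L \<longrightarrow> f x \<in> Y) \<and> (x \<notin> L \<longrightarrow> f x \<in> N)))"


section \<open>The Small Set Expansion Hypothesis\<close>

text \<open>Simple undirected graphs are symmetric loop-free digraphs (\<open>pair_graph\<close>). The degree is
  required to be positive so that a random neighbor exists.\<close>

definition regular_graph :: "nat pair_pre_digraph \<Rightarrow> bool" where
  "regular_graph G \<longleftrightarrow> pair_graph G \<and>
     (\<exists>r > 0. \<forall>v \<in> pverts G. out_degree (with_proj G) v = r)"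

definition mu :: "'a pair_pre_digraph \<Rightarrow> 'a set \<Rightarrow> real" where
  "mu G S = card S / card (pverts G)"

definition expansion :: "'a pair_pre_digraph \<Rightarrow> 'a set \<Rightarrow> real" where
  "expansion G S = measure_pmf.prob
     (bind_pmf (pmf_of_set S) (\<lambda>v. pmf_of_set {u. (v, u) \<in> parcs G})) (- S)"

definition small_sets :: "'a pair_pre_digraph \<Rightarrow> real \<Rightarrow> 'a set set" where
  "small_sets G \<delta> = {S. S \<subseteq> pverts G \<and> S \<noteq> {} \<and> mu G S \<le> \<delta>}"

definition expansion_profile :: "'a pair_pre_digraph \<Rightarrow> real \<Rightarrow> real" where
  "expansion_profile G \<delta> = Min (expansion G ` small_sets G \<delta>)"

text \<open>Instances are those graphs for which the minimum is taken over a nonempty family.\<close>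

definition sse_instance :: "real \<Rightarrow> nat pair_pre_digraph \<Rightarrow> bool" where
  "sse_instance \<delta> G \<longleftrightarrow>
     (\<exists>N. pverts G = {..<N}) \<and> regular_graph G \<and> small_sets G \<delta> \<noteq> {}"

text \<open>As a statement of NP-hardness, the hypothesis does not entail \<open>P \<noteq> NP\<close>: if \<open>P = NP\<close>, then
  mapping to a fixed yes- or no-instance is a polynomial-time reduction. So lower bounds for polynomial
  time that are deduced from it presuppose \<open>P \<noteq> NP\<close>.\<close>

definition SSEH :: bool where
  "SSEH \<longleftrightarrow> (\<forall>\<epsilon>::real. \<epsilon> > 0 \<longrightarrow> (\<exists>\<delta>::real. 0 < \<delta> \<and> \<delta> < 1 \<and>
     NP_hard_promise
       (enc_graph ` {G. sse_instance \<delta> G \<and> expansion_profile G \<delta> \<le> \<epsilon>})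
       (enc_graph ` {G. sse_instance \<delta> G \<and> expansion_profile G \<delta> \<ge> 1 - \<epsilon>})))"


section \<open>The Exponential Time Hypothesis\<close>

definition is_3cnf :: "cnf \<Rightarrow> bool" where
  "is_3cnf F \<longleftrightarrow> (\<forall>C \<in> set F. length C \<le> 3)"

definition satisfiable :: "cnf \<Rightarrow> bool" where
  "satisfiable F \<longleftrightarrow> (\<exists>\<sigma> :: nat \<Rightarrow> bool. \<forall>C \<in> set F. \<exists>(v, s) \<in> set C. \<sigma> v = s)"

definition num_vars :: "cnf \<Rightarrow> nat" where
  "num_vars F = card (fst ` \<Union> (set ` set F))"

text \<open>A polynomial factor in the input length is allowed besides \<open>2\<^sup>o\<^sup>(\<^sup>n\<^sup>)\<close>: clauses may be repeated and
  variable names may be long, so the input length is not bounded in terms of the number of variables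
  and without this factor the hypothesis would hold trivially.\<close>

definition ETH :: bool where
  "ETH \<longleftrightarrow> \<not> (\<exists>M c. \<exists>f \<in> o(\<lambda>n. real n). wf_tm M \<and>
     (\<forall>F. is_3cnf F \<longrightarrow>
        computes_within M (enc_cnf F) [satisfiable F]
          (poly_bound c (length (enc_cnf F)) * 2 powr f (num_vars F))))"


section \<open>Entrywise low-rank approximation\<close>

text \<open>The \<open>p\<close>-th power of the entrywise \<open>p\<close>-norm.\<close>

definition entrywise_norm_pow :: "real \<Rightarrow> real mat \<Rightarrow> real" where
  "entrywise_norm_pow p B = (\<Sum>i < dim_row B. \<Sum>j < dim_col B. \<bar>B $$ (i, j)\<bar> powr p)"

text \<open>The infimum is a minimum, since the matrices of rank at most \<open>k\<close> form a closed set.\<close>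

definition opt_cost :: "real \<Rightarrow> nat \<Rightarrow> real mat \<Rightarrow> real" where
  "opt_cost p k A =
     (INF (U, V) \<in> carrier_mat (dim_row A) k \<times> carrier_mat k (dim_col A).
        entrywise_norm_pow p (A - U * V))"

text \<open>
  \<open>M\<close> is an \<open>\<alpha>\<close>-approximation algorithm, running in time \<open>T n k\<close>, for the instances whose entries are
  bounded in absolute value by \<open>b n\<close>. Output matrices have rational entries, written as reduced
  fractions. The restriction \<open>k \<le> d\<close> excludes only trivial instances (\<open>UV = A\<close> is attainable for
  \<open>k \<ge> d\<close>), for which the mere size of the output would exceed any bound in terms of \<open>n\<close>.
\<close>

definition approx_algorithm ::
  "real \<Rightarrow> real \<Rightarrow> (nat \<Rightarrow> nat) \<Rightarrow> (nat \<Rightarrow> nat \<Rightarrow> real) \<Rightarrow> tm \<Rightarrow> bool" where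
  "approx_algorithm p \<alpha> b T M \<longleftrightarrow> wf_tm M \<and>
     (\<forall>n d k. \<forall>A \<in> carrier_mat n d. 1 \<le> k \<and> k \<le> d \<and> d \<le> n \<and>
        (\<forall>i < n. \<forall>j < d. \<bar>A $$ (i, j)\<bar> \<le> int (b n)) \<longrightarrow>
        (\<exists>U \<in> carrier_mat n k. \<exists>V \<in> carrier_mat k d.
           computes_within M (tuple [enc_mat enc_int A, bin k])
             (tuple [enc_mat enc_rat U, enc_mat enc_rat V]) (T n k) \<and>
           entrywise_norm_pow p
             (map_mat real_of_int A - map_mat real_of_rat U * map_mat real_of_rat V)
             \<le> \<alpha> * opt_cost p k (map_mat real_of_int A)))"

text \<open>The problem asks for entries bounded by \<open>poly(n)\<close>: it is solvable within a class \<open>\<T>\<close> of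
  running times if, for each polynomial bound on the entries, some algorithm with running time in
  \<open>\<T>\<close> handles all instances obeying that bound.\<close>

definition approximable_in :: "real \<Rightarrow> real \<Rightarrow> (nat \<Rightarrow> nat \<Rightarrow> real) set \<Rightarrow> bool" where
  "approximable_in p \<alpha> \<T> \<longleftrightarrow>
     (\<forall>c. \<exists>T \<in> \<T>. \<exists>M. approx_algorithm p \<alpha> (poly_bound c) T M)"

definition poly_times :: "(nat \<Rightarrow> nat \<Rightarrow> real) set" where
  "poly_times = {\<lambda>n k. real (poly_bound c n) | c. True}"

text \<open>Time \<open>2\<close> to the \<open>k\<^sup>\<delta>\<close>, as usual up to a factor \<open>poly(n)\<close>. Without this factor the running time
  would be constant for each fixed \<open>k\<close>, too short even to read the input.\<close>

definition subexp_times :: "real \<Rightarrow> (nat \<Rightarrow> nat \<Rightarrow> real) set" where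
  "subexp_times \<delta> = {\<lambda>n k. real (poly_bound c n) * 2 powr (real k powr \<delta>) | c. True}"

end

theory Submission
  imports Defs "Jordan_Normal_Form.Determinant" "HOL-Real_Asymp.Real_Asymp"
begin

text \<open>
  Let \<open>G\<close> be an \<open>r\<close>-regular graph on \<open>N\<close> vertices with Laplacian \<open>\<Delta> = r - Adj\<close>, let \<open>D = 64 \<Delta> / R\<close> with
  \<open>r \<le> R \<le> 2r\<close>, and let \<open>1/p + 1/q = 1\<close>. The operator \<open>B = 1 + D\<^sup>2\<^sup>T\<close> with \<open>T\<close> of order \<open>log N\<close> acts almost as
  the identity on the low part of the spectrum and as an expanding map on the high part. If a set of at most \<open>\<delta> N\<close>
  vertices hardly expands, then \<open>x = B\<^sup>-\<^sup>1 1\<^sub>S\<close> satisfies \<open>\<parallel>B x\<parallel>\<^sub>p \<le> 2 (\<delta> N)\<^bsup>2/p-1\<^esup> \<parallel>x\<parallel>\<^sub>q\<close>. If all sets of that size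
  expand, then so do all sets that are larger by a constant factor \<open>M\<close>, and a layer-cake argument on the iterates of \<open>D\<close>
  shows \<open>\<parallel>B x\<parallel>\<^sub>p \<ge> c (M \<delta> N)\<^bsup>2/p-1\<^esup> \<parallel>x\<parallel>\<^sub>q\<close> for all \<open>x\<close>; so the ratio of the two bounds is as large as desired.

  Minimizing \<open>\<parallel>B x\<parallel>\<^sub>p / \<parallel>x\<parallel>\<^sub>q\<close> is approximation of \<open>B\<close> by a singular matrix: the kernel vector \<open>x\<close> of an
  approximation yields one direction, and a rank-one correction along the dual of \<open>x\<close> the other. To read off the
  answer from an approximate solution, \<open>B\<close> (scaled and rounded) is extended by a column that vanishes except for \<open>N\<^sup>2\<close>
  additional rows, where it is a constant \<open>\<beta>\<close>. For rank \<open>N\<close>, it is cheap to make \<open>B\<close> singular in the first case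
  and to drop the new column in the second, and any good approximation has to do likewise; so the sum of the
  approximated new column tells the cases apart.

  For the second claim, formulas are first renamed and freed of repeated clauses, which makes their size polynomial
  in the number of variables; the exponent \<open>\<delta>\<close> depends on the degree of the reduction only.
\<close>


section \<open>Structured Turing machines\<close>

text \<open>The construction is balanced so that all competing norms are of order
  \<open>N powr (2 / p)\<close>: dropping the new column costs \<open>\<beta>\<close> times this
  because there are \<open>N * N\<close> extra rows, rounding the entries costs at most this, and at
  a scale of order \<open>N\<close> so do both bounds on the operator, of the form
  \<open>N * (\<delta> * N) powr (2 / p - 1)\<close>. Hence \<open>\<beta>\<close> may be a
  constant. For \<open>p < 2\<close> the exponent \<open>2 / p - 1\<close> is positive, so a large
  \<open>M\<close> buys any ratio. The price is expansion of sets \<open>M\<close> times larger than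
  the hypothesis speaks of; averaging over subsets recovers it, at a loss of a factor of order
  \<open>M\<close> in \<open>\<epsilon>\<close>. The factor 64 in \<open>D\<close> is small enough
  to keep the indicator of a set with \<open>\<epsilon> \<le> 1 / 128\<close> in the low part of the
  spectrum, and large enough to leave each level-set step with a factor 1 / 32 on the next iterate.
  So logarithmically many iterations suffice, and the entries stay polynomial. Time bounds refer to
  concrete machines, and the reduction has to call an arbitrary approximation algorithm. Therefore
  stack programs are compiled to machines, and machines are also simulated by stack
  programs.\<close>

definition scans :: "tape list \<Rightarrow> nat list" where
  "scans tps = map (\<lambda>(f, h). f h) tps"

text \<open>An upper bound instead of the exact number of steps lets the costs of combined machines
  be rounded up freely.\<close>

definition goes :: "tm \<Rightarrow> tape list \<Rightarrow> tape list \<Rightarrow> nat \<Rightarrow> bool" where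
  "goes M tps tps' t \<longleftrightarrow> (\<exists>t'\<le>t. (step M ^^ t') (0, tps) = (num_states M, tps'))"

lemma length_scans [simp]: "length (scans tps) = length tps"
  by (simp add: scans_def)

lemma step_running:
  "q < num_states M \<Longrightarrow> step M (q, tps) =
     (fst (trans M q (scans tps)), map2 act (snd (trans M q (scans tps))) tps)"
  by (simp add: step_def scans_def split: prod.split)

lemma step_halted: "\<not> q < num_states M \<Longrightarrow> step M (q, tps) = (q, tps)"
  by (simp add: step_def)

lemma steps_halted: "\<not> q < num_states M \<Longrightarrow> (step M ^^ t) (q, tps) = (q, tps)"
  by (induction t) (simp_all add: step_halted)

text \<open>\<open>d\<close> is the offset at which the states of \<open>A\<close> sit inside
  \<open>M\<close>, and \<open>e\<close> is the state of \<open>M\<close> that replaces the halting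
  state of \<open>A\<close>. Sequencing, branching and looping then differ mainly in the choice of
  \<open>e\<close>: the start of the next machine, the common exit, or the loop test.\<close>

definition embeds :: "tm \<Rightarrow> tm \<Rightarrow> nat \<Rightarrow> nat \<Rightarrow> bool" where
  "embeds A M d e \<longleftrightarrow> (\<forall>q<num_states A. \<forall>ss. d + q < num_states M \<and>
     trans M (d + q) ss =
       (if fst (trans A q ss) < num_states A then d + fst (trans A q ss) else e, snd (trans A q ss)))"

lemma embeds_run:
  assumes "embeds A M d e"
  shows "(step A ^^ t) (q, tps) = (num_states A, tps') \<Longrightarrow>
    \<exists>t'\<le>t. (step M ^^ t') (if q < num_states A then d + q else e, tps) = (e, tps')"
proof (induction t arbitrary: q tps)
  case 0
  then show ?case by auto
next
  case (Suc t)
  show ?case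
  proof (cases "q < num_states A")
    case False
    then have "(step A ^^ Suc t) (q, tps) = (q, tps)" by (rule steps_halted)
    with Suc.prems False show ?thesis by (intro exI[of _ 0]) auto
  next
    case True
    let ?q = "fst (trans A q (scans tps))" and ?tps = "map2 act (snd (trans A q (scans tps))) tps"
    from Suc.prems have "(step A ^^ t) (?q, ?tps) = (num_states A, tps')"
      by (simp only: funpow_Suc_right comp_apply step_running[OF True])
    from Suc.IH[OF this] obtain t' where t': "t' \<le> t"
      "(step M ^^ t') (if ?q < num_states A then d + ?q else e, ?tps) = (e, tps')" by blast
    from assms True have "step M (d + q, tps) = (if ?q < num_states A then d + ?q else e, ?tps)"
      by (simp add: embeds_def step_running)
    with t' True have "(step M ^^ Suc t') (if q < num_states A then d + q else e, tps) = (e, tps')"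
      by (simp only: funpow_Suc_right comp_apply if_True)
    with t' show ?thesis by (intro exI[of _ "Suc t'"]) auto
  qed
qed

text \<open>The case distinction covers a machine without states: it has halted already in state 0,
  so entering it means being at the exit \<open>e\<close>.\<close>

lemma embeds_goes:
  assumes "embeds A M d e" "goes A tps tps' t"
  shows "\<exists>t'\<le>t. (step M ^^ t') (if 0 < num_states A then d else e, tps) = (e, tps')"
proof -
  from assms(2) obtain t1 where t1: "t1 \<le> t" "(step A ^^ t1) (0, tps) = (num_states A, tps')"
    by (auto simp: goes_def)
  have "\<exists>t'\<le>t1. (step M ^^ t') (if 0 < num_states A then d else e, tps) = (e, tps')"
    using embeds_run[OF assms(1) t1(2)] unfolding add_0_right .
  with t1(1) show ?thesis by (meson order_trans)
qed

definition frag :: "nat \<Rightarrow> nat \<Rightarrow> tm \<Rightarrow> bool" where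
  "frag K S M \<longleftrightarrow> num_tapes M = K \<and> num_syms M = S \<and> wf_tm M"

lemma fragI:
  assumes "num_tapes M = K" "num_syms M = S" "0 < K" "3 \<le> S"
    "\<And>q ss. q < num_states M \<Longrightarrow> length ss = K \<Longrightarrow> set ss \<subseteq> {..<S} \<Longrightarrow>
       fst (trans M q ss) \<le> num_states M \<and> length (snd (trans M q ss)) = K \<and>
       set (snd (trans M q ss)) \<subseteq> {..<S} \<times> {-1, 0, 1}"
  shows "frag K S M"
proof -
  have "case trans M q ss of (q', acts) \<Rightarrow> q' \<le> num_states M \<and> length acts = num_tapes M \<and>
      set acts \<subseteq> {..<num_syms M} \<times> {-1, 0, 1}"
    if "q < num_states M" "length ss = num_tapes M \<and> set ss \<subseteq> {..<num_syms M}" for q ss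
    using assms(1,2) assms(5)[of q ss] that by (simp add: split_beta)
  note * = this
  show ?thesis
    unfolding frag_def wf_tm_def
  proof (intro conjI allI impI)
    fix q ss assume "q < num_states M" "length ss = num_tapes M \<and> set ss \<subseteq> {..<num_syms M}"
    then show "case trans M q ss of (q', acts) \<Rightarrow> q' \<le> num_states M \<and> length acts = num_tapes M \<and>
      set acts \<subseteq> {..<num_syms M} \<times> {-1, 0, 1}" by (rule *)
  qed (simp_all add: assms(1-4))
qed

lemma fragD:
  assumes "frag K S M" "q < num_states M" "length ss = K" "set ss \<subseteq> {..<S}"
  shows "fst (trans M q ss) \<le> num_states M" "length (snd (trans M q ss)) = K"
    "set (snd (trans M q ss)) \<subseteq> {..<S} \<times> {-1, 0, 1}"
proof -
  have "case trans M q ss of (q', acts) \<Rightarrow>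
      q' \<le> num_states M \<and> length acts = K \<and> set acts \<subseteq> {..<S} \<times> {-1, 0, 1}"
  proof -
    from assms(1) have K: "num_tapes M = K" and S: "num_syms M = S" and wf: "wf_tm M"
      by (simp_all add: frag_def)
    from wf have "\<forall>q<num_states M. \<forall>ss. length ss = K \<and> set ss \<subseteq> {..<S} \<longrightarrow>
      (case trans M q ss of (q', acts) \<Rightarrow>
        q' \<le> num_states M \<and> length acts = K \<and> set acts \<subseteq> {..<S} \<times> {-1, 0, 1})"
      unfolding wf_tm_def K S by (elim conjE)
    then show ?thesis by (elim allE[of _ q] allE[of _ ss] impE) (simp_all add: assms(2-4))
  qed
  then show "fst (trans M q ss) \<le> num_states M" "length (snd (trans M q ss)) = K"
    "set (snd (trans M q ss)) \<subseteq> {..<S} \<times> {-1, 0, 1}"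
    by (simp_all add: split_beta)
qed

lemma frag_pos: "frag K S M \<Longrightarrow> 0 < K \<and> 3 \<le> S"
  by (auto simp: frag_def wf_tm_def)

definition noops :: "nat list \<Rightarrow> (nat \<times> int) list" where
  "noops ss = map (\<lambda>s. (s, 0)) ss"

lemma length_noops [simp]: "length (noops ss) = length ss"
  by (simp add: noops_def)

lemma nth_noops [simp]: "i < length ss \<Longrightarrow> noops ss ! i = (ss ! i, 0)"
  by (simp add: noops_def)

lemma map2_act_noops [simp]: "map2 act (noops (scans tps)) tps = tps"
  by (induction tps) (auto simp: noops_def scans_def act_def)

lemma set_noops: "set ss \<subseteq> {..<S} \<Longrightarrow> set (noops ss) \<subseteq> {..<S} \<times> {-1, 0, 1}"
  by (auto simp: noops_def)

definition tm_atom :: "nat \<Rightarrow> nat \<Rightarrow> (nat list \<Rightarrow> (nat \<times> int) list) \<Rightarrow> tm" where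
  "tm_atom K S a = \<lparr>num_tapes = K, num_states = 1, num_syms = S, trans = \<lambda>q ss. (1, a ss)\<rparr>"

lemma goes_atom: "tps' = map2 act (a (scans tps)) tps \<Longrightarrow> goes (tm_atom K S a) tps tps' 1"
  unfolding goes_def by (intro exI[of _ 1]) (simp add: tm_atom_def step_running)

lemma frag_atom:
  assumes "0 < K" "3 \<le> S"
    "\<And>ss. length ss = K \<Longrightarrow> set ss \<subseteq> {..<S} \<Longrightarrow> length (a ss) = K \<and> set (a ss) \<subseteq> {..<S} \<times> {-1, 0, 1}"
  shows "frag K S (tm_atom K S a)"
  by (rule fragI) (use assms in \<open>auto simp: tm_atom_def\<close>)

definition tm_seq :: "tm \<Rightarrow> tm \<Rightarrow> tm" where
  "tm_seq A B = \<lparr>num_tapes = num_tapes A, num_states = num_states A + num_states B,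
     num_syms = num_syms A, trans = \<lambda>q ss.
       if q < num_states A
       then (if fst (trans A q ss) < num_states A then fst (trans A q ss) else num_states A,
             snd (trans A q ss))
       else (if fst (trans B (q - num_states A) ss) < num_states B
             then num_states A + fst (trans B (q - num_states A) ss) else num_states A + num_states B,
             snd (trans B (q - num_states A) ss))\<rparr>"

lemma goes_seq:
  assumes "goes A tps tps1 t1" "goes B tps1 tps2 t2" "t1 + t2 \<le> t"
  shows "goes (tm_seq A B) tps tps2 t"
proof -
  have "embeds A (tm_seq A B) 0 (num_states A)"
    by (auto simp: embeds_def tm_seq_def)
  from embeds_goes[OF this assms(1)] obtain s1 where
    s1: "s1 \<le> t1" "(step (tm_seq A B) ^^ s1) (0, tps) = (num_states A, tps1)"
    by (auto split: if_splits)
  have "embeds B (tm_seq A B) (num_states A) (num_states A + num_states B)"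
    by (auto simp: embeds_def tm_seq_def)
  from embeds_goes[OF this assms(2)] obtain s2 where
    s2: "s2 \<le> t2" "(step (tm_seq A B) ^^ s2) (num_states A, tps1) = (num_states A + num_states B, tps2)"
    by (auto split: if_splits)
  have "(step (tm_seq A B) ^^ (s2 + s1)) (0, tps) = (num_states A + num_states B, tps2)"
    using s1 s2 by (simp add: funpow_add)
  then show ?thesis
    unfolding goes_def using s1 s2 assms(3) by (intro exI[of _ "s2 + s1"]) (auto simp: tm_seq_def)
qed

lemma frag_seq:
  assumes "frag K S A" "frag K S B"
  shows "frag K S (tm_seq A B)"
proof (rule fragI)
  fix q ss assume q: "q < num_states (tm_seq A B)" and ss: "length ss = K" "set ss \<subseteq> {..<S}"
  show "fst (trans (tm_seq A B) q ss) \<le> num_states (tm_seq A B) \<and>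
      length (snd (trans (tm_seq A B) q ss)) = K \<and>
      set (snd (trans (tm_seq A B) q ss)) \<subseteq> {..<S} \<times> {- 1, 0, 1}"
  proof (cases "q < num_states A")
    case True
    from fragD[OF assms(1) True ss] True show ?thesis by (simp add: tm_seq_def)
  next
    case False
    with q have "q - num_states A < num_states B" by (simp add: tm_seq_def)
    from fragD[OF assms(2) this ss] False show ?thesis by (simp add: tm_seq_def)
  qed
qed (use assms frag_pos in \<open>auto simp: frag_def tm_seq_def\<close>)

definition tm_if :: "(nat list \<Rightarrow> bool) \<Rightarrow> tm \<Rightarrow> tm \<Rightarrow> tm" where
  "tm_if b A B = \<lparr>num_tapes = num_tapes A, num_states = 1 + num_states A + num_states B,
     num_syms = num_syms A, trans = \<lambda>q ss.
       let e = 1 + num_states A + num_states B in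
       if q = 0 then (if b ss then (if 0 < num_states A then 1 else e)
                      else (if 0 < num_states B then 1 + num_states A else e), noops ss)
       else if q < 1 + num_states A
       then (if fst (trans A (q - 1) ss) < num_states A then 1 + fst (trans A (q - 1) ss) else e,
             snd (trans A (q - 1) ss))
       else (if fst (trans B (q - (1 + num_states A)) ss) < num_states B
             then 1 + num_states A + fst (trans B (q - (1 + num_states A)) ss) else e,
             snd (trans B (q - (1 + num_states A)) ss))\<rparr>"

lemma goes_if:
  assumes "if b (scans tps) then goes A tps tps' t1 else goes B tps tps' t1" "1 + t1 \<le> t"
  shows "goes (tm_if b A B) tps tps' t"
proof -
  let ?e = "1 + num_states A + num_states B"
  have A: "embeds A (tm_if b A B) 1 ?e"
    by (auto simp: embeds_def tm_if_def Let_def)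
  have B: "embeds B (tm_if b A B) (1 + num_states A) ?e"
    by (auto simp: embeds_def tm_if_def Let_def)
  have e: "num_states (tm_if b A B) = ?e" by (simp add: tm_if_def)
  have step: "step (tm_if b A B) (0, tps) =
     (if b (scans tps) then (if 0 < num_states A then 1 else ?e)
      else (if 0 < num_states B then 1 + num_states A else ?e), tps)"
    by (subst step_running) (auto simp: tm_if_def Let_def)
  have "\<exists>s\<le>t1. (step (tm_if b A B) ^^ s) (step (tm_if b A B) (0, tps)) = (?e, tps')"
    using embeds_goes[OF A, of tps tps' t1] embeds_goes[OF B, of tps tps' t1] assms(1)
    by (auto simp: step split: if_splits)
  then obtain s where "s \<le> t1" "(step (tm_if b A B) ^^ Suc s) (0, tps) = (?e, tps')"
    by (auto simp: funpow_swap1)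
  then show ?thesis
    unfolding goes_def e using assms(2) by (intro exI[of _ "Suc s"]) auto
qed

lemma frag_if:
  assumes "frag K S A" "frag K S B"
  shows "frag K S (tm_if b A B)"
proof (rule fragI)
  fix q ss assume q: "q < num_states (tm_if b A B)" and ss: "length ss = K" "set ss \<subseteq> {..<S}"
  show "fst (trans (tm_if b A B) q ss) \<le> num_states (tm_if b A B) \<and>
      length (snd (trans (tm_if b A B) q ss)) = K \<and>
      set (snd (trans (tm_if b A B) q ss)) \<subseteq> {..<S} \<times> {- 1, 0, 1}"
  proof -
    consider "q = 0" | "q \<noteq> 0" "q < 1 + num_states A" | "\<not> q < 1 + num_states A" by blast
    then show ?thesis
    proof cases
      case 1
      then show ?thesis using set_noops[OF ss(2)] ss(1) by (simp add: tm_if_def Let_def)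
    next
      case 2
      then have "q - 1 < num_states A" by auto
      from fragD[OF assms(1) this ss] 2 show ?thesis by (simp add: tm_if_def Let_def)
    next
      case 3
      with q have "q - (1 + num_states A) < num_states B" by (auto simp: tm_if_def)
      from fragD[OF assms(2) this ss] 3 show ?thesis by (simp add: tm_if_def Let_def)
    qed
  qed
qed (use assms frag_pos in \<open>auto simp: frag_def tm_if_def\<close>)

text \<open>State 0 is the loop test and also the place to which the body returns, so each test
  costs one step. If the body has no states, a successful test stays in state 0.\<close>

definition tm_while :: "(nat list \<Rightarrow> bool) \<Rightarrow> tm \<Rightarrow> tm" where
  "tm_while b A = \<lparr>num_tapes = num_tapes A, num_states = 1 + num_states A,
     num_syms = num_syms A, trans = \<lambda>q ss.
       if q = 0 then (if b ss then (if 0 < num_states A then 1 else 0) else 1 + num_states A, noops ss)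
       else (if fst (trans A (q - 1) ss) < num_states A then 1 + fst (trans A (q - 1) ss) else 0,
             snd (trans A (q - 1) ss))\<rparr>"

lemma goes_while_False:
  assumes "\<not> b (scans tps)" "1 \<le> t"
  shows "goes (tm_while b A) tps tps t"
proof -
  have "(step (tm_while b A) ^^ 1) (0, tps) = (num_states (tm_while b A), tps)"
    using assms by (simp add: step_running tm_while_def)
  with assms(2) show ?thesis unfolding goes_def by blast
qed

lemma goes_while_True:
  assumes "b (scans tps)" "goes A tps tps1 t1" "goes (tm_while b A) tps1 tps2 t2" "1 + t1 + t2 \<le> t"
  shows "goes (tm_while b A) tps tps2 t"
proof -
  let ?W = "tm_while b A"
  have A: "embeds A ?W 1 0"
    by (auto simp: embeds_def tm_while_def)
  have step: "step ?W (0, tps) = (if 0 < num_states A then 1 else 0, tps)"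
    using assms(1) by (subst step_running) (auto simp: tm_while_def)
  from embeds_goes[OF A assms(2)] obtain s where
    s: "s \<le> t1" "(step ?W ^^ s) (step ?W (0, tps)) = (0, tps1)" unfolding step by auto
  from assms(3) obtain s2 where s2: "s2 \<le> t2" "(step ?W ^^ s2) (0, tps1) = (num_states ?W, tps2)"
    by (auto simp: goes_def)
  have "(step ?W ^^ (s2 + Suc s)) (0, tps) = (step ?W ^^ s2) ((step ?W ^^ Suc s) (0, tps))"
    by (simp only: funpow_add comp_apply)
  also have "\<dots> = (num_states ?W, tps2)"
    using s s2 by (simp add: funpow_swap1)
  finally show ?thesis
    unfolding goes_def using s s2 assms(4) by (intro exI[of _ "s2 + Suc s"]) auto
qed

lemma frag_while:
  assumes "frag K S A"
  shows "frag K S (tm_while b A)"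
proof (rule fragI)
  fix q ss assume q: "q < num_states (tm_while b A)" and ss: "length ss = K" "set ss \<subseteq> {..<S}"
  show "fst (trans (tm_while b A) q ss) \<le> num_states (tm_while b A) \<and>
      length (snd (trans (tm_while b A) q ss)) = K \<and>
      set (snd (trans (tm_while b A) q ss)) \<subseteq> {..<S} \<times> {- 1, 0, 1}"
  proof (cases "q = 0")
    case True
    then show ?thesis using set_noops[OF ss(2)] ss(1) by (simp add: tm_while_def)
  next
    case False
    with q have "q - 1 < num_states A" by (auto simp: tm_while_def)
    from fragD[OF assms(1) this ss] False show ?thesis by (simp add: tm_while_def)
  qed
qed (use assms frag_pos in \<open>auto simp: frag_def tm_while_def\<close>)


section \<open>Programs on stacks\<close>

text \<open>The top of an empty stack reads \<open>0\<close>. Popping a stack whose top reads \<open>0\<close> does nothing, even if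
  it is nonempty, since its tape cannot show the difference.\<close>

type_synonym store = "nat \<Rightarrow> nat list"

datatype com =
    PUSH nat nat
  | POP nat
  | SEQ com com  (infixr ";;" 60)
  | IFTOP nat nat com com
  | UNTIL nat nat com

definition peek :: "nat list \<Rightarrow> nat" where
  "peek xs = (case xs of [] \<Rightarrow> 0 | a # _ \<Rightarrow> a)"

lemma peek_simps [simp]: "peek [] = 0" "peek (a # xs) = a"
  by (simp_all add: peek_def)

text \<open>The costs are those of the compiled machines: a push takes two steps because the head
  first leaves the old top and then writes, a pop erases and moves at once, and each test of a
  branch or loop takes one step.\<close>

inductive exec :: "com \<Rightarrow> store \<Rightarrow> nat \<Rightarrow> store \<Rightarrow> bool" where
  push: "exec (PUSH i a) s 2 (s(i := a # s i))"
| pop: "exec (POP i) s 1 (s(i := (if peek (s i) = 0 then s i else tl (s i))))"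
| seq: "exec c1 s t1 s1 \<Longrightarrow> exec c2 s1 t2 s2 \<Longrightarrow> exec (c1 ;; c2) s (t1 + t2) s2"
| if_True: "peek (s i) = a \<Longrightarrow> exec c1 s t s' \<Longrightarrow> exec (IFTOP i a c1 c2) s (1 + t) s'"
| if_False: "peek (s i) \<noteq> a \<Longrightarrow> exec c2 s t s' \<Longrightarrow> exec (IFTOP i a c1 c2) s (1 + t) s'"
| until_True: "peek (s i) = a \<Longrightarrow> exec (UNTIL i a c) s 1 s"
| until_False: "peek (s i) \<noteq> a \<Longrightarrow> exec c s t1 s1 \<Longrightarrow> exec (UNTIL i a c) s1 t2 s2 \<Longrightarrow>
    exec (UNTIL i a c) s (1 + t1 + t2) s2"

primrec okc :: "nat \<Rightarrow> nat \<Rightarrow> com \<Rightarrow> bool" where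
  "okc K S (PUSH i a) \<longleftrightarrow> i < K \<and> a < S"
| "okc K S (POP i) \<longleftrightarrow> i < K"
| "okc K S (c1 ;; c2) \<longleftrightarrow> okc K S c1 \<and> okc K S c2"
| "okc K S (IFTOP i a c1 c2) \<longleftrightarrow> i < K \<and> okc K S c1 \<and> okc K S c2"
| "okc K S (UNTIL i a c) \<longleftrightarrow> i < K \<and> okc K S c"

lemma okc_mono: "okc K S c \<Longrightarrow> K \<le> K' \<Longrightarrow> S \<le> S' \<Longrightarrow> okc K' S' c"
  by (induction c) auto

lemma okc_exists: "\<exists>K S. 3 \<le> S \<and> 0 < K \<and> okc K S c"
proof (induction c)
  case (PUSH i a)
  show ?case by (rule exI[of _ "Suc i"], rule exI[of _ "a + 3"]) auto
next
  case (POP i)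
  show ?case by (rule exI[of _ "Suc i"], rule exI[of _ "3"]) auto
next
  case (SEQ c1 c2)
  then obtain K S K' S' where "3 \<le> S" "3 \<le> S'" "0 < K" "okc K S c1" "okc K' S' c2" by blast
  then show ?case
    by (intro exI[of _ "max K K'"] exI[of _ "max S S'"]) (auto intro: okc_mono)
next
  case (IFTOP i a c1 c2)
  then obtain K S K' S' where "3 \<le> S" "3 \<le> S'" "okc K S c1" "okc K' S' c2" by blast
  then show ?case
    by (intro exI[of _ "max (Suc i) (max K K')"] exI[of _ "max S S'"]) (auto intro: okc_mono)
next
  case (UNTIL i a c)
  then obtain K S where "3 \<le> S" "okc K S c" by blast
  then show ?case
    by (intro exI[of _ "max (Suc i) K"] exI[of _ S]) (auto intro: okc_mono)
qed

text \<open>The stack grows to the right from cell 1 with the head on its top, hence the reversal.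
  Cell 0 stays blank, so an empty stack scans the symbol 0.\<close>

definition stk :: "nat list \<Rightarrow> tape" where
  "stk xs = (\<lambda>i. if 1 \<le> i \<and> i \<le> int (length xs) then rev xs ! nat (i - 1) else 0, int (length xs))"

definition tapes :: "nat \<Rightarrow> tape \<Rightarrow> store \<Rightarrow> tape list" where
  "tapes K tp s = tp # map (\<lambda>i. stk (s i)) [0..<K]"

lemma scan_stk [simp]: "fst (stk xs) (snd (stk xs)) = peek xs"
  by (cases xs) (auto simp: stk_def nth_append)

lemma act_push_stk: "act (a, 0) (act (fst (stk xs) (snd (stk xs)), 1) (stk xs)) = stk (a # xs)"
proof -
  have "rev (a # xs) ! nat (i - 1) = (if i = int (length xs) + 1 then a else rev xs ! nat (i - 1))"
    if "1 \<le> i" "i \<le> int (length xs) + 1" for i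
  proof (cases "i = int (length xs) + 1")
    case False
    with that have "nat (i - 1) < length xs" by linarith
    with False show ?thesis by (simp add: nth_append)
  qed (simp add: nth_append)
  then have "(\<lambda>i. if i = int (length xs) + 1 then a else fst (stk xs) i) = fst (stk (a # xs))"
    unfolding stk_def by (auto simp: fun_eq_iff simp del: rev.simps)
  then have "(fst (stk xs))(int (length xs) + 1 := a) = fst (stk (a # xs))"
    by (simp only: fun_upd_def)
  moreover have "snd (stk ys) = int (length ys)" for ys
    by (simp add: stk_def)
  ultimately show ?thesis
    by (simp add: act_def prod_eq_iff add.commute)
qed

lemma act_pop_stk: "xs \<noteq> [] \<Longrightarrow> act (0, -1) (stk xs) = stk (tl xs)"
  by (cases xs) (auto simp: act_def stk_def fun_eq_iff nth_append)

declare fun_upd_apply [simp del] fun_upd_same [simp] fun_upd_other [simp]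

lemma length_tapes [simp]: "length (tapes K tp s) = Suc K"
  by (simp add: tapes_def)

lemma nth_tapes_0 [simp]: "tapes K tp s ! 0 = tp"
  by (simp add: tapes_def)

lemma nth_tapes_Suc [simp]: "i < K \<Longrightarrow> tapes K tp s ! Suc i = stk (s i)"
  by (simp add: tapes_def)

lemma scans_nth: "i < length tps \<Longrightarrow> scans tps ! i = fst (tps ! i) (snd (tps ! i))"
  by (simp add: scans_def split_beta)

lemma scans_tapes [simp]:
  "scans (tapes K tp s) ! 0 = fst tp (snd tp)" "i < K \<Longrightarrow> scans (tapes K tp s) ! Suc i = peek (s i)"
  by (simp_all add: scans_nth)

lemma tapes_update: "i < K \<Longrightarrow> (tapes K tp s)[Suc i := stk xs] = tapes K tp (s(i := xs))"
  unfolding tapes_def by (auto intro!: nth_equalityI simp: nth_list_update fun_upd_apply)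

definition on_tape :: "nat \<Rightarrow> (nat \<Rightarrow> nat \<times> int) \<Rightarrow> nat list \<Rightarrow> (nat \<times> int) list" where
  "on_tape j g ss = (noops ss)[j := g (ss ! j)]"

lemma map2_act_update:
  assumes "length as = length tps" "j < length tps"
  shows "map2 act (as[j := a]) tps = (map2 act as tps)[j := act a (tps ! j)]"
  by (intro nth_equalityI) (use assms in \<open>auto simp: nth_list_update\<close>)

lemma map2_act_update2:
  assumes "length as = length tps" "j < length tps" "i < length tps" "i \<noteq> j"
  shows "map2 act (as[j := a, i := b]) tps = (map2 act as tps)[j := act a (tps ! j), i := act b (tps ! i)]"
  using assms by (simp add: map2_act_update)

lemma goes_on_tape:
  assumes "j < length tps"
  shows "goes (tm_atom K S (on_tape j g)) tps (tps[j := act (g (fst (tps ! j) (snd (tps ! j)))) (tps ! j)]) 1"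
  by (rule goes_atom) (use assms in \<open>simp add: on_tape_def map2_act_update scans_nth\<close>)

lemma set_list_update_subset: "set xs \<subseteq> A \<Longrightarrow> a \<in> A \<Longrightarrow> set (xs[i := a]) \<subseteq> A"
  by (meson insert_subset order_trans set_update_subset_insert)

lemma frag_on_tape:
  assumes "j < K" "3 \<le> S" "\<And>s. s < S \<Longrightarrow> g s \<in> {..<S} \<times> {-1, 0, 1}"
  shows "frag K S (tm_atom K S (on_tape j g))"
proof (rule frag_atom)
  fix ss :: "nat list" assume ss: "length ss = K" "set ss \<subseteq> {..<S}"
  with assms have "ss ! j < S" using nth_mem by fastforce
  with assms have "set (on_tape j g ss) \<subseteq> {..<S} \<times> {- 1, 0, 1}"
    unfolding on_tape_def by (intro set_list_update_subset set_noops ss)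
  with ss show "length (on_tape j g ss) = K \<and> set (on_tape j g ss) \<subseteq> {..<S} \<times> {- 1, 0, 1}"
    by (simp add: on_tape_def)
qed (use assms in auto)

primrec compile :: "nat \<Rightarrow> nat \<Rightarrow> com \<Rightarrow> tm" where
  "compile K S (PUSH i a) =
     tm_seq (tm_atom (Suc K) S (on_tape (Suc i) (\<lambda>s. (s, 1)))) (tm_atom (Suc K) S (on_tape (Suc i) (\<lambda>_. (a, 0))))"
| "compile K S (POP i) =
     tm_atom (Suc K) S (on_tape (Suc i) (\<lambda>s. if s = 0 then (0, 0) else (0, -1)))"
| "compile K S (c1 ;; c2) = tm_seq (compile K S c1) (compile K S c2)"
| "compile K S (IFTOP i a c1 c2) = tm_if (\<lambda>ss. ss ! Suc i = a) (compile K S c1) (compile K S c2)"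
| "compile K S (UNTIL i a c) = tm_while (\<lambda>ss. ss ! Suc i \<noteq> a) (compile K S c)"

lemma frag_compile: "3 \<le> S \<Longrightarrow> okc K S c \<Longrightarrow> frag (Suc K) S (compile K S c)"
  by (induction c) (auto intro!: frag_seq frag_on_tape frag_if frag_while)

lemma goes_compile:
  assumes "exec c s t s'" "okc K S c"
  shows "goes (compile K S c) (tapes K tp s) (tapes K tp s') t"
  using assms
proof (induction rule: exec.induct)
  case (push i a s)
  let ?tps = "(tapes K tp s)[Suc i := act (peek (s i), 1) (stk (s i))]"
  from push have i: "i < K" by simp
  have 1: "goes (tm_atom (Suc K) S (on_tape (Suc i) (\<lambda>s. (s, 1)))) (tapes K tp s) ?tps 1"
    using goes_on_tape[of "Suc i" "tapes K tp s" "Suc K" S "\<lambda>s. (s, 1)"] i by simp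
  have "act (a, 0) (?tps ! Suc i) = stk (a # s i)"
    using i act_push_stk[of a "s i"] by simp
  then have 2: "goes (tm_atom (Suc K) S (on_tape (Suc i) (\<lambda>_. (a, 0)))) ?tps (tapes K tp (s(i := a # s i))) 1"
    using goes_on_tape[of "Suc i" ?tps "Suc K" S "\<lambda>_. (a, 0)"] i
    by (simp add: tapes_update)
  show ?case unfolding compile.simps by (rule goes_seq[OF 1 2]) simp
next
  case (pop i s)
  then have i: "i < K" by simp
  show ?case
  proof (cases "peek (s i) = 0")
    case True
    then have "act (0, 0) (stk (s i)) = stk (s i)"
      using scan_stk[of "s i"] by (simp add: act_def prod_eq_iff fun_upd_idem)
    then show ?thesis
      using goes_on_tape[of "Suc i" "tapes K tp s" "Suc K" S "\<lambda>s. if s = 0 then (0, 0) else (0, -1)"] i True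
      by (simp add: tapes_update)
  next
    case False
    then have "s i \<noteq> []" by auto
    then show ?thesis
      using goes_on_tape[of "Suc i" "tapes K tp s" "Suc K" S "\<lambda>s. if s = 0 then (0, 0) else (0, -1)"] i False
      by (simp add: tapes_update act_pop_stk)
  qed
next
  case (seq c1 s t1 s1 c2 t2 s2)
  then show ?case by (simp add: goes_seq)
next
  case (if_True s i a c1 t s' c2)
  then show ?case by (simp add: goes_if)
next
  case (if_False s i a c2 t s' c1)
  then show ?case by (simp add: goes_if)
next
  case (until_True s i a c)
  then show ?case by (simp add: goes_while_False)
next
  case (until_False s i a c t1 s1 t2 s2)
  then have "goes (compile K S c) (tapes K tp s) (tapes K tp s1) t1"
    "goes (compile K S (UNTIL i a c)) (tapes K tp s1) (tapes K tp s2) t2" by simp_all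
  with until_False show ?case
    unfolding compile.simps by (intro goes_while_True[OF _ _ _ order_refl]) auto
qed

text \<open>The first tape serves only for input and output. The word on it is moved to the stack \<open>0\<close>,
  from its end to its beginning.\<close>

definition word :: "nat list \<Rightarrow> int \<Rightarrow> nat" where
  "word w i = (if 0 \<le> i \<and> i < int (length w) then w ! nat i else 0)"

lemma word_update: "(word w)(int (length w) := a) = word (w @ [a])"
  by (auto simp: word_def fun_eq_iff nth_append fun_upd_apply)

lemma word_erase: "(word (w @ [a]))(int (length w) := 0) = word w"
  by (auto simp: word_def fun_eq_iff nth_append fun_upd_apply)

definition bits :: "bool list \<Rightarrow> nat list" where
  "bits x = map sym_of_bit x"

lemma tape_of_word: "tape_of x = word (bits x)"
  by (auto simp: tape_of_def word_def bits_def fun_eq_iff)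

lemma bits_simps [simp]: "bits [] = []" "bits (b # x) = (if b then 2 else 1) # bits x"
  "bits (x @ y) = bits x @ bits y" "length (bits x) = length x" "bits (rev x) = rev (bits x)"
  by (simp_all add: bits_def sym_of_bit_def rev_map)

lemma zero_notin_bits [simp]: "0 \<notin> set (bits x)"
  by (auto simp: bits_def sym_of_bit_def)

definition tm_init :: "nat \<Rightarrow> nat \<Rightarrow> tm" where
  "tm_init K S =
     tm_seq (tm_while (\<lambda>ss. ss ! 0 \<noteq> 0) (tm_atom (Suc K) S (on_tape 0 (\<lambda>s. (s, 1)))))
    (tm_seq (tm_atom (Suc K) S (on_tape 0 (\<lambda>s. (s, -1))))
    (tm_seq (tm_while (\<lambda>ss. ss ! 0 \<noteq> 0)
               (tm_seq (tm_atom (Suc K) S (on_tape 1 (\<lambda>s. (s, 1))))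
                       (tm_atom (Suc K) S (\<lambda>ss. (noops ss)[1 := (ss ! 0, 0), 0 := (0, -1)]))))
            (tm_atom (Suc K) S (on_tape 0 (\<lambda>s. (s, 1))))))"

definition tm_out :: "nat \<Rightarrow> nat \<Rightarrow> tm" where
  "tm_out K S = tm_while (\<lambda>ss. ss ! 1 \<noteq> 0)
     (tm_atom (Suc K) S (\<lambda>ss. (noops ss)[0 := (ss ! 1, 1), 1 := (0, -1)]))"

lemma frag_init: assumes "0 < K" "3 \<le> S" shows "frag (Suc K) S (tm_init K S)"
  unfolding tm_init_def
proof (intro frag_seq frag_while frag_on_tape)
  show "frag (Suc K) S (tm_atom (Suc K) S (\<lambda>ss. (noops ss)[1 := (ss ! 0, 0), 0 := (0, - 1)]))"
  proof (rule frag_atom)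
    fix ss :: "nat list" assume ss: "length ss = Suc K" "set ss \<subseteq> {..<S}"
    then have "ss ! 0 < S" using nth_mem[of 0 ss] by fastforce
    with assms have "set ((noops ss)[1 := (ss ! 0, 0), 0 := (0, - 1)]) \<subseteq> {..<S} \<times> {- 1, 0, 1}"
      by (intro set_list_update_subset set_noops ss) auto
    with ss show "length ((noops ss)[1 := (ss ! 0, 0), 0 := (0, - 1)]) = Suc K \<and>
        set ((noops ss)[1 := (ss ! 0, 0), 0 := (0, - 1)]) \<subseteq> {..<S} \<times> {- 1, 0, 1}"
      by simp
  qed (use assms in auto)
qed (use assms in auto)

lemma frag_out: assumes "0 < K" "3 \<le> S" shows "frag (Suc K) S (tm_out K S)"
  unfolding tm_out_def
proof (intro frag_while)
  show "frag (Suc K) S (tm_atom (Suc K) S (\<lambda>ss. (noops ss)[0 := (ss ! 1, 1), 1 := (0, - 1)]))"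
  proof (rule frag_atom)
    fix ss :: "nat list" assume ss: "length ss = Suc K" "set ss \<subseteq> {..<S}"
    then have "ss ! 1 < S" using nth_mem[of 1 ss] assms by fastforce
    with assms have "set ((noops ss)[0 := (ss ! 1, 1), 1 := (0, - 1)]) \<subseteq> {..<S} \<times> {- 1, 0, 1}"
      by (intro set_list_update_subset set_noops ss) auto
    with ss show "length ((noops ss)[0 := (ss ! 1, 1), 1 := (0, - 1)]) = Suc K \<and>
        set ((noops ss)[0 := (ss ! 1, 1), 1 := (0, - 1)]) \<subseteq> {..<S} \<times> {- 1, 0, 1}"
      by simp
  qed (use assms in auto)
qed

lemma tapes_update_0: "(tapes K tp s)[0 := tp'] = tapes K tp' s"
  by (simp add: tapes_def)

lemma goes_scan_right:
  assumes "0 \<notin> set w" "k \<le> length w"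
  shows "goes (tm_while (\<lambda>ss. ss ! 0 \<noteq> 0) (tm_atom (Suc K) S (on_tape 0 (\<lambda>s. (s, 1)))))
     (tapes K (word w, int k) s) (tapes K (word w, int (length w)) s) (1 + 2 * (length w - k))"
  using assms(2)
proof (induction "length w - k" arbitrary: k)
  case 0
  then have "k = length w" by simp
  show ?case unfolding \<open>k = length w\<close> by (rule goes_while_False) (auto simp: word_def)
next
  case (Suc n)
  then have k: "k < length w" by simp
  with assms(1) have "w ! k \<noteq> 0" using nth_mem[OF k] by metis
  then have nz: "word w (int k) \<noteq> 0" by (simp add: word_def k)
  have "goes (tm_atom (Suc K) S (on_tape 0 (\<lambda>s. (s, 1)))) (tapes K (word w, int k) s) (tapes K (word w, int (Suc k)) s) 1"
    using goes_on_tape[of 0 "tapes K (word w, int k) s" "Suc K" S "\<lambda>s. (s, 1)"]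
    by (simp add: tapes_update_0 act_def add.commute)
  moreover have "goes (tm_while (\<lambda>ss. ss ! 0 \<noteq> 0) (tm_atom (Suc K) S (on_tape 0 (\<lambda>s. (s, 1)))))
     (tapes K (word w, int (Suc k)) s) (tapes K (word w, int (length w)) s) (1 + 2 * (length w - Suc k))"
    using Suc(1)[of "Suc k"] Suc(2) k by simp
  ultimately show ?case
    by (rule goes_while_True[rotated]) (use nz k in auto)
qed

lemma goes_load:
  assumes "0 \<notin> set (u @ v)" "0 < K"
  shows "goes (tm_while (\<lambda>ss. ss ! 0 \<noteq> 0)
               (tm_seq (tm_atom (Suc K) S (on_tape 1 (\<lambda>s. (s, 1))))
                       (tm_atom (Suc K) S (\<lambda>ss. (noops ss)[1 := (ss ! 0, 0), 0 := (0, -1)]))))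
     (tapes K (word u, int (length u) - 1) (s(0 := v))) (tapes K (word [], -1) (s(0 := u @ v))) (1 + 3 * length u)"
  using assms(1)
proof (induction u arbitrary: v rule: rev_induct)
  case Nil
  show ?case by (simp, rule goes_while_False) (auto simp: word_def)
next
  case (snoc a u)
  let ?tp = "(word (u @ [a]), int (length u))"
  let ?tps = "(tapes K ?tp (s(0 := v)))[1 := act (peek v, 1) (stk v)]"
  have scan0: "fst ?tp (snd ?tp) = a" by (simp add: word_def)
  have 1: "goes (tm_atom (Suc K) S (on_tape 1 (\<lambda>s. (s, 1)))) (tapes K ?tp (s(0 := v))) ?tps 1"
    using goes_on_tape[of "Suc 0" "tapes K ?tp (s(0 := v))" "Suc K" S "\<lambda>s. (s, 1)"] assms(2) by simp
  have 2: "goes (tm_atom (Suc K) S (\<lambda>ss. (noops ss)[1 := (ss ! 0, 0), 0 := (0, -1)])) ?tps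
     (tapes K (word u, int (length u) - 1) (s(0 := a # v))) 1"
  proof (rule goes_atom)
    have "scans ?tps ! 0 = a" using scan0 by (simp add: scans_nth)
    moreover have "act (a, 0) (act (peek v, 1) (stk v)) = stk (a # v)"
      using act_push_stk[of a v] by simp
    moreover have "act (0, -1) ?tp = (word u, int (length u) - 1)"
      by (simp add: act_def word_erase)
    moreover have "(tapes K ?tp (s(0 := v)))[1 := stk (a # v)] = tapes K ?tp (s(0 := a # v))"
      using assms(2) tapes_update[of 0 K ?tp "s(0 := v)" "a # v"] by simp
    ultimately show "tapes K (word u, int (length u) - 1) (s(0 := a # v)) =
       map2 act ((noops (scans ?tps))[1 := (scans ?tps ! 0, 0), 0 := (0, -1)]) ?tps"
      using assms(2) by (simp add: map2_act_update2 tapes_update_0)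
  qed
  have 3: "goes (tm_while (\<lambda>ss. ss ! 0 \<noteq> 0)
               (tm_seq (tm_atom (Suc K) S (on_tape 1 (\<lambda>s. (s, 1))))
                       (tm_atom (Suc K) S (\<lambda>ss. (noops ss)[1 := (ss ! 0, 0), 0 := (0, -1)]))))
     (tapes K (word u, int (length u) - 1) (s(0 := a # v))) (tapes K (word [], -1) (s(0 := u @ a # v))) (1 + 3 * length u)"
    using snoc.IH[of "a # v"] snoc.prems by simp
  have "goes (tm_while (\<lambda>ss. ss ! 0 \<noteq> 0)
               (tm_seq (tm_atom (Suc K) S (on_tape 1 (\<lambda>s. (s, 1))))
                       (tm_atom (Suc K) S (\<lambda>ss. (noops ss)[1 := (ss ! 0, 0), 0 := (0, -1)]))))
     (tapes K ?tp (s(0 := v))) (tapes K (word [], -1) (s(0 := u @ a # v))) (1 + (1 + 1) + (1 + 3 * length u))"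
    using scan0 snoc.prems by (intro goes_while_True[OF _ goes_seq[OF 1 2 order_refl] 3 order_refl]) simp
  then show ?case by (simp add: numeral_eq_Suc)
qed

lemma goes_init:
  assumes "0 \<notin> set w" "0 < K"
  shows "goes (tm_init K S) (tapes K (word w, 0) (\<lambda>_. [])) (tapes K (word [], 0) ((\<lambda>_. [])(0 := w))) (5 * length w + 4)"
proof -
  let ?s = "\<lambda>_. [] :: nat list"
  have 1: "goes (tm_while (\<lambda>ss. ss ! 0 \<noteq> 0) (tm_atom (Suc K) S (on_tape 0 (\<lambda>s. (s, 1)))))
     (tapes K (word w, 0) ?s) (tapes K (word w, int (length w)) ?s) (1 + 2 * length w)"
    using goes_scan_right[OF assms(1), of 0 K S ?s] by simp
  have 2: "goes (tm_atom (Suc K) S (on_tape 0 (\<lambda>s. (s, -1)))) (tapes K (word w, int (length w)) ?s)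
     (tapes K (word w, int (length w) - 1) ?s) 1"
    using goes_on_tape[of 0 "tapes K (word w, int (length w)) ?s" "Suc K" S "\<lambda>s. (s, -1)"]
    by (simp add: tapes_update_0 act_def)
  have eq: "?s(0 := []) = ?s" by (rule ext) (simp add: fun_upd_apply)
  have 3: "goes (tm_while (\<lambda>ss. ss ! 0 \<noteq> 0)
               (tm_seq (tm_atom (Suc K) S (on_tape 1 (\<lambda>s. (s, 1))))
                       (tm_atom (Suc K) S (\<lambda>ss. (noops ss)[1 := (ss ! 0, 0), 0 := (0, -1)]))))
     (tapes K (word w, int (length w) - 1) ?s) (tapes K (word [], -1) (?s(0 := w))) (1 + 3 * length w)"
    using goes_load[of w "[]" K S ?s] assms unfolding eq append_Nil2 by simp
  have 4: "goes (tm_atom (Suc K) S (on_tape 0 (\<lambda>s. (s, 1)))) (tapes K (word [], -1) (?s(0 := w)))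
     (tapes K (word [], 0) (?s(0 := w))) 1"
    using goes_on_tape[of 0 "tapes K (word [], -1) (?s(0 := w))" "Suc K" S "\<lambda>s. (s, 1)"]
    by (simp add: tapes_update_0 act_def)
  show ?thesis
    unfolding tm_init_def
    by (rule goes_seq[OF 1 goes_seq[OF 2 goes_seq[OF 3 4 order_refl] order_refl]]) simp
qed

lemma goes_out:
  assumes "0 \<notin> set v" "0 < K" "s 0 = v"
  shows "goes (tm_out K S) (tapes K (word u, int (length u)) s)
     (tapes K (word (u @ v), int (length (u @ v))) (s(0 := []))) (1 + 2 * length v)"
  using assms(1,3)
proof (induction v arbitrary: u s)
  case Nil
  then have "s(0 := []) = s" by (simp add: fun_upd_idem)
  then show ?case
    unfolding tm_out_def by (simp, intro goes_while_False) (use Nil assms(2) in auto)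
next
  case (Cons a v)
  let ?tps = "tapes K (word u, int (length u)) s"
  have 1: "goes (tm_atom (Suc K) S (\<lambda>ss. (noops ss)[0 := (ss ! 1, 1), 1 := (0, -1)])) ?tps
     (tapes K (word (u @ [a]), int (length (u @ [a]))) (s(0 := v))) 1"
  proof (rule goes_atom)
    have "scans ?tps ! 1 = a" using assms(2) Cons.prems by simp
    moreover have "act (a, 1) (word u, int (length u)) = (word (u @ [a]), int (length (u @ [a])))"
      by (simp add: act_def word_update add.commute)
    moreover have "act (0, -1) (stk (s 0)) = stk v"
      using act_pop_stk[of "s 0"] Cons.prems by simp
    moreover have "(tapes K tp s)[1 := stk v] = tapes K tp (s(0 := v))" for tp
      using assms(2) tapes_update[of 0 K tp s v] by simp
    ultimately show "tapes K (word (u @ [a]), int (length (u @ [a]))) (s(0 := v)) =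
        map2 act ((noops (scans ?tps))[0 := (scans ?tps ! 1, 1), 1 := (0, - 1)]) ?tps"
      using assms(2) by (simp add: map2_act_update2 tapes_update_0)
  qed
  have 2: "goes (tm_out K S) (tapes K (word (u @ [a]), int (length (u @ [a]))) (s(0 := v)))
     (tapes K (word (u @ a # v), int (length (u @ a # v))) (s(0 := []))) (1 + 2 * length v)"
    using Cons.IH[of "s(0 := v)" "u @ [a]"] Cons.prems by simp
  show ?case
    unfolding tm_out_def
    by (rule goes_while_True[OF _ 1 2[unfolded tm_out_def]]) (use Cons.prems assms(2) in auto)
qed

text \<open>Loading the input erases it from the first tape, so the output written there is followed
  by a blank, as \<open>tape_holds\<close> demands. The summands beyond \<open>t\<close> are the
  costs of loading and unloading stack 0.\<close>

theorem stack_program_computes: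
  "\<exists>M. wf_tm M \<and> (\<forall>x y t s'. exec c ((\<lambda>_. [])(0 := bits x)) t s' \<longrightarrow> s' 0 = bits y \<longrightarrow>
     computes_within M x y (real (t + 5 * length x + 2 * length y + 5)))"
proof -
  obtain K S where KS: "3 \<le> S" "0 < K" "okc K S c" using okc_exists by blast
  define M where "M = tm_seq (tm_init K S) (tm_seq (compile K S c) (tm_out K S))"
  have frag: "frag (Suc K) S M"
    unfolding M_def by (intro frag_seq frag_init frag_out frag_compile KS)
  have "computes_within M x y (real (t + 5 * length x + 2 * length y + 5))"
    if "exec c ((\<lambda>_. [])(0 := bits x)) t s'" "s' 0 = bits y" for x y t s'
  proof -
    let ?s = "\<lambda>_. [] :: nat list"
    have 1: "goes (tm_init K S) (tapes K (word (bits x), 0) ?s) (tapes K (word [], 0) (?s(0 := bits x))) (5 * length x + 4)"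
      using goes_init[of "bits x" K S] KS by simp
    have 2: "goes (compile K S c) (tapes K (word [], 0) (?s(0 := bits x))) (tapes K (word [], 0) s') t"
      by (rule goes_compile[OF that(1) KS(3)])
    have 3: "goes (tm_out K S) (tapes K (word [], 0) s') (tapes K (word (bits y), int (length y)) (s'(0 := []))) (1 + 2 * length y)"
      using goes_out[of "bits y" K s' S "[]"] KS that(2) by simp
    have "goes M (tapes K (word (bits x), 0) ?s) (tapes K (word (bits y), int (length y)) (s'(0 := []))) (t + 5 * length x + 2 * length y + 5)"
      unfolding M_def by (rule goes_seq[OF 1 goes_seq[OF 2 3 order_refl]]) simp
    then obtain t' where t': "t' \<le> t + 5 * length x + 2 * length y + 5"
      "(step M ^^ t') (0, tapes K (word (bits x), 0) ?s) = (num_states M, tapes K (word (bits y), int (length y)) (s'(0 := [])))"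
      by (auto simp: goes_def)
    have "init_config M x = (0, tapes K (word (bits x), 0) ?s)"
      using frag by (auto simp: init_config_def frag_def tapes_def tape_of_word stk_def word_def fun_eq_iff
          map_replicate_trivial intro!: nth_equalityI)
    moreover have "tape_holds (word (bits y)) y"
      by (auto simp: tape_holds_def word_def bits_def)
    ultimately show ?thesis
      unfolding computes_within_def using t' by (intro exI[of _ t'] exI) (auto simp: tapes_def)
  qed
  with frag show ?thesis unfolding frag_def by blast
qed

section \<open>Stack programs with upper bounds on their running time\<close>

declare fun_upd_apply [simp]

definition ex :: "com \<Rightarrow> store \<Rightarrow> nat \<Rightarrow> store \<Rightarrow> bool" where
  "ex c s T s' \<longleftrightarrow> (\<exists>t\<le>T. exec c s t s')"

lemma ex_mono: "ex c s T s' \<Longrightarrow> T \<le> T' \<Longrightarrow> ex c s T' s'"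
  by (auto simp: ex_def intro: order_trans)

lemma ex_push: "s' = s(i := a # s i) \<Longrightarrow> 2 \<le> T \<Longrightarrow> ex (PUSH i a) s T s'"
  unfolding ex_def using exec.push by blast

lemma ex_pop: "s i = a # xs \<Longrightarrow> a \<noteq> 0 \<Longrightarrow> s' = s(i := xs) \<Longrightarrow> 1 \<le> T \<Longrightarrow> ex (POP i) s T s'"
  unfolding ex_def using exec.pop[of i s] by auto

lemma ex_pop_empty: "s i = [] \<Longrightarrow> 1 \<le> T \<Longrightarrow> ex (POP i) s T s"
  unfolding ex_def using exec.pop[of i s] by (auto simp: fun_upd_idem)

lemma ex_seq: "ex c1 s T1 s1 \<Longrightarrow> ex c2 s1 T2 s2 \<Longrightarrow> T1 + T2 \<le> T \<Longrightarrow> ex (c1 ;; c2) s T s2"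
  unfolding ex_def using exec.seq by (meson add_mono order_trans)

lemma ex_if:
  assumes "if peek (s i) = a then ex c1 s T1 s' else ex c2 s T1 s'" "T1 + 1 \<le> T"
  shows "ex (IFTOP i a c1 c2) s T s'"
proof (cases "peek (s i) = a")
  case True
  with assms obtain t where "t \<le> T1" "exec c1 s t s'" by (auto simp: ex_def)
  with exec.if_True[of s i a c1 t s' c2, OF True] assms(2) show ?thesis
    unfolding ex_def by (intro exI[of _ "1 + t"]) auto
next
  case False
  with assms obtain t where "t \<le> T1" "exec c2 s t s'" by (auto simp: ex_def)
  with exec.if_False[of s i a c2 t s' c1, OF False] assms(2) show ?thesis
    unfolding ex_def by (intro exI[of _ "1 + t"]) auto
qed

lemma ex_until_stop: "peek (s i) = a \<Longrightarrow> 1 \<le> T \<Longrightarrow> ex (UNTIL i a c) s T s"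
  unfolding ex_def using exec.until_True by blast

lemma ex_until_step:
  assumes "peek (s i) \<noteq> a" "ex c s T1 s1" "ex (UNTIL i a c) s1 T2 s2" "1 + T1 + T2 \<le> T"
  shows "ex (UNTIL i a c) s T s2"
proof -
  from assms obtain t1 t2 where "t1 \<le> T1" "exec c s t1 s1" "t2 \<le> T2" "exec (UNTIL i a c) s1 t2 s2"
    by (auto simp: ex_def)
  with exec.until_False[of s i a c t1 s1 t2 s2, OF assms(1)] assms(4) show ?thesis
    unfolding ex_def by (intro exI[of _ "1 + t1 + t2"]) auto
qed

text \<open>A push that is undone at once stands for an empty command; it costs three steps.\<close>

definition SKIP :: com where "SKIP = PUSH 0 1 ;; POP 0"

lemma ex_skip: "3 \<le> T \<Longrightarrow> ex SKIP s T s"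
  unfolding SKIP_def
  by (rule ex_seq[OF ex_push[OF refl order_refl] ex_pop[of _ 0 1 "s 0" s 1]]) (auto simp: fun_eq_iff)

lemma exec_growth: "exec c s t s' \<Longrightarrow> length (s' i) \<le> length (s i) + t"
  by (induction rule: exec.induct) auto

lemma ex_growth: "ex c s T s' \<Longrightarrow> length (s' i) \<le> length (s i) + T"
  unfolding ex_def using exec_growth by (meson add_left_mono order_trans)

text \<open>A symbol 0 on a stack is indistinguishable from its bottom, so \<open>clear\<close>
  would stop there. Programs that never push 0 keep the stacks free of it.\<close>

primrec nonzero :: "com \<Rightarrow> bool" where
  "nonzero (PUSH i a) \<longleftrightarrow> a \<noteq> 0"
| "nonzero (POP i) \<longleftrightarrow> True"
| "nonzero (c1 ;; c2) \<longleftrightarrow> nonzero c1 \<and> nonzero c2"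
| "nonzero (IFTOP i a c1 c2) \<longleftrightarrow> nonzero c1 \<and> nonzero c2"
| "nonzero (UNTIL i a c) \<longleftrightarrow> nonzero c"

lemma exec_nonzero: "exec c s t s' \<Longrightarrow> nonzero c \<Longrightarrow> 0 \<notin> set (s i) \<Longrightarrow> 0 \<notin> set (s' i)"
  by (induction rule: exec.induct) (auto dest: list.set_sel(2)[rotated])

lemma ex_nonzero: "ex c s t s' \<Longrightarrow> nonzero c \<Longrightarrow> 0 \<notin> set (s i) \<Longrightarrow> 0 \<notin> set (s' i)"
  unfolding ex_def using exec_nonzero by blast

text \<open>Commands have no variables, so a branch that depends on the top symbol is a separate
  program for each of finitely many symbols, selected by a chain of tests.\<close>

primrec sw :: "nat \<Rightarrow> nat \<Rightarrow> (nat \<Rightarrow> com) \<Rightarrow> com" where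
  "sw 0 i f = f 0"
| "sw (Suc n) i f = IFTOP i (Suc n) (f (Suc n)) (sw n i f)"

lemma ex_sw: "peek (s i) \<le> n \<Longrightarrow> ex (f (peek (s i))) s T s' \<Longrightarrow> T + n \<le> T' \<Longrightarrow> ex (sw n i f) s T' s'"
proof (induction n arbitrary: T')
  case 0
  then show ?case by (auto intro: ex_mono)
next
  case (Suc n)
  show ?case
  proof (cases "peek (s i) = Suc n")
    case True
    with Suc.prems(2) have "ex (f (Suc n)) s T s'" by simp
    with True Suc.prems(3) show ?thesis by (auto intro!: ex_if[of s i _ _ T])
  next
    case False
    with Suc have "ex (sw n i f) s (T + n) s'" by auto
    with False Suc.prems(3) show ?thesis by (auto intro!: ex_if[of s i _ _ "T + n"])
  qed
qed

lemma nonzero_sw: "(\<And>a. a \<le> n \<Longrightarrow> nonzero (f a)) \<Longrightarrow> nonzero (sw n i f)"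
  by (induction n) auto

definition clear :: "nat \<Rightarrow> com" where
  "clear i = UNTIL i 0 (POP i)"

lemma ex_clear: "0 \<notin> set (s i) \<Longrightarrow> 2 * length (s i) + 1 \<le> T \<Longrightarrow> ex (clear i) s T (s(i := []))"
proof (induction "s i" arbitrary: s T)
  case Nil
  then show ?case unfolding clear_def by (simp add: fun_upd_idem ex_until_stop)
next
  case (Cons a xs)
  then have si: "s i = a # xs" by simp
  have 1: "ex (POP i) s 1 (s(i := xs))"
    by (rule ex_pop[of s i a xs]) (use Cons si in auto)
  have "ex (clear i) (s(i := xs)) (2 * length xs + 1) (s(i := xs, i := []))"
    by (rule Cons.hyps(1)) (use Cons.prems si in auto)
  then have 2: "ex (clear i) (s(i := xs)) (2 * length xs + 1) (s(i := []))" by simp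
  have "peek (s i) \<noteq> 0" using Cons by (cases "s i") auto
  then show ?case
    unfolding clear_def by (rule ex_until_step[OF _ 1 2[unfolded clear_def]]) (use Cons.prems si in auto)
qed

primrec clear_all :: "nat \<Rightarrow> com" where
  "clear_all 0 = SKIP"
| "clear_all (Suc n) = clear_all n ;; clear (Suc n)"

lemma ex_clear_all:
  assumes "\<And>i. 0 < i \<Longrightarrow> i \<le> n \<Longrightarrow> 0 \<notin> set (s i) \<and> length (s i) \<le> L"
  shows "ex (clear_all n) s (n * (2 * L + 1) + 3) (\<lambda>i. if 0 < i \<and> i \<le> n then [] else s i)"
  using assms
proof (induction n)
  case 0
  have "(\<lambda>i. if 0 < i \<and> i \<le> 0 then [] else s i) = s" by auto
  then show ?case using ex_skip by simp
next
  case (Suc n)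
  let ?s = "\<lambda>i. if 0 < i \<and> i \<le> n then [] else s i"
  have 1: "ex (clear_all n) s (n * (2 * L + 1) + 3) ?s"
    using Suc by auto
  have 2: "ex (clear (Suc n)) ?s (2 * L + 1) (?s(Suc n := []))"
    by (rule ex_clear) (use Suc.prems[of "Suc n"] in auto)
  have "?s(Suc n := []) = (\<lambda>i. if 0 < i \<and> i \<le> Suc n then [] else s i)"
    by (auto simp: fun_eq_iff)
  with ex_seq[OF 1 2 order_refl] show ?case by (auto intro: ex_mono)
qed


section \<open>Turing machines as programs on stacks\<close>

text \<open>Tape \<open>j\<close> occupies three stacks: the cells to the left of the head, the cells from the head on,
  and in unary the number of cells to the left of cell \<open>0\<close> that are stored. Symbols are shifted by
  one, since \<open>0\<close> marks an empty stack.\<close>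

definition cells :: "nat list \<Rightarrow> nat \<Rightarrow> int \<Rightarrow> nat" where
  "cells z d i = (if 0 \<le> i + int d \<and> i + int d < int (length z) then z ! nat (i + int d) - 1 else 0)"

definition tape_at :: "nat \<Rightarrow> store \<Rightarrow> nat \<Rightarrow> tape \<Rightarrow> bool" where
  "tape_at S s j tp \<longleftrightarrow> (\<exists>d. s (4 + 3 * j) = replicate d 1 \<and>
     fst tp = cells (rev (s (2 + 3 * j)) @ s (3 + 3 * j)) d \<and>
     snd tp = int (length (s (2 + 3 * j))) - int d \<and>
     set (s (2 + 3 * j)) \<subseteq> {1..S} \<and> set (s (3 + 3 * j)) \<subseteq> {1..S})"

text \<open>The code 1 stands for a blank, so the stored window may grow on the right without
  changing the tape. The next lemma does the same on the left, where the count of cells before cell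
  0 grows too.\<close>

lemma cells_blank_right: "cells (z @ [1]) d = cells z d"
  by (auto simp: cells_def fun_eq_iff nth_append)

lemma cells_blank_left: "cells (1 # z) (Suc d) = cells z d"
proof
  fix i
  show "cells (1 # z) (Suc d) i = cells z d i"
  proof (cases "0 \<le> i + int d")
    case True
    then have "nat (i + int (Suc d)) = Suc (nat (i + int d))" by linarith
    with True show ?thesis by (simp add: cells_def)
  next
    case False
    then show ?thesis by (cases "i + int (Suc d) = 0") (auto simp: cells_def)
  qed
qed

lemma cells_write:
  "(cells (rev l @ a # r) d)(int (length l) - int d := w) = cells (rev l @ (w + 1) # r) d"
proof
  fix i
  show "((cells (rev l @ a # r) d)(int (length l) - int d := w)) i = cells (rev l @ (w + 1) # r) d i"
  proof (cases "i = int (length l) - int d")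
    case True
    then show ?thesis by (simp add: cells_def nth_append)
  next
    case False
    then have "nat (i + int d) \<noteq> length l" if "0 \<le> i + int d" using that by linarith
    with False show ?thesis by (auto simp: cells_def nth_append nth_Cons split: nat.splits)
  qed
qed

lemma cells_head: "cells (rev l @ a # r) d (int (length l) - int d) = a - 1"
  by (simp add: cells_def nth_append)

lemma tape_at_frame:
  "tape_at S s j tp \<Longrightarrow> \<forall>i\<in>{2 + 3 * j, 3 + 3 * j, 4 + 3 * j}. s' i = s i \<Longrightarrow> tape_at S s' j tp"
  by (simp add: tape_at_def)

text \<open>The stack on the right is nonempty when an action is performed, so its top can be
  replaced. A move to the left may leave the stored window; then a blank is added and counted. A
  move to the right may leave nothing under the head, which \<open>extend\<close> repairs before the
  next scan.\<close>

definition tape_act :: "nat \<Rightarrow> nat \<Rightarrow> nat \<times> int \<Rightarrow> com" where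
  "tape_act S j a = POP (3 + 3 * j) ;;
     (if snd a = 1 then PUSH (2 + 3 * j) (fst a + 1)
      else if snd a = 0 then PUSH (3 + 3 * j) (fst a + 1)
      else PUSH (3 + 3 * j) (fst a + 1) ;; sw S (2 + 3 * j) (\<lambda>b.
        if b = 0 then PUSH (3 + 3 * j) 1 ;; PUSH (4 + 3 * j) 1
        else POP (2 + 3 * j) ;; PUSH (3 + 3 * j) b))"

lemma ex_tape_act:
  assumes tp: "tape_at S s j tp" and ne: "s (3 + 3 * j) \<noteq> []" and a: "fst a < S" "snd a \<in> {-1, 0, 1}"
  shows "\<exists>s'. ex (tape_act S j a) s (S + 10) s' \<and> tape_at S s' j (act a tp) \<and>
     (\<forall>i. i \<notin> {2 + 3 * j, 3 + 3 * j, 4 + 3 * j} \<longrightarrow> s' i = s i)"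
proof -
  let ?L = "2 + 3 * j" and ?R = "3 + 3 * j" and ?D = "4 + 3 * j"
  from tp obtain d where d: "s ?D = replicate d 1" "fst tp = cells (rev (s ?L) @ s ?R) d"
    "snd tp = int (length (s ?L)) - int d" "set (s ?L) \<subseteq> {1..S}" "set (s ?R) \<subseteq> {1..S}"
    by (auto simp: tape_at_def)
  from ne obtain b r where r: "s ?R = b # r" by (cases "s ?R") auto
  let ?w = "fst a + 1"
  have f: "(fst tp)(snd tp := fst a) = cells (rev (s ?L) @ ?w # r) d"
    unfolding d r by (rule cells_write)
  have b: "b \<noteq> 0" and rS: "set r \<subseteq> {1..S}" using d(5) r by auto
  have pop: "ex (POP ?R) s 1 (s(?R := r))"
    by (rule ex_pop[of s ?R b r, OF r b]) auto
  consider "snd a = 1" | "snd a = 0" | "snd a = -1" using a(2) by auto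
  then show ?thesis
  proof cases
    case 1
    let ?s = "s(?R := r, ?L := ?w # s ?L)"
    have "ex (tape_act S j a) s (S + 10) ?s"
      unfolding tape_act_def if_P[OF 1] by (rule ex_seq[OF pop ex_push[OF _ order_refl]]) auto
    moreover have "tape_at S ?s j (act a tp)"
      unfolding tape_at_def act_def using d f 1 rS a(1) by (intro exI[of _ d]) auto
    ultimately show ?thesis by (intro exI[of _ ?s]) auto
  next
    case 2
    let ?s = "s(?R := ?w # r)"
    have "ex (PUSH ?R ?w) (s(?R := r)) 2 ?s" by (rule ex_push) auto
    then have "ex (tape_act S j a) s (S + 10) ?s"
      unfolding tape_act_def using 2 by (simp, intro ex_seq[OF pop]) auto
    moreover have "tape_at S ?s j (act a tp)"
      unfolding tape_at_def act_def using d f 2 rS a(1) by (intro exI[of _ d]) auto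
    ultimately show ?thesis by (intro exI[of _ ?s]) auto
  next
    case 3
    let ?s1 = "s(?R := ?w # r)"
    let ?sw = "sw S ?L (\<lambda>b. if b = 0 then PUSH ?R 1 ;; PUSH ?D 1 else POP ?L ;; PUSH ?R b)"
    have push: "ex (PUSH ?R ?w) (s(?R := r)) 2 ?s1" by (rule ex_push) auto
    have "\<exists>s'. ex ?sw ?s1 (S + 5) s' \<and> tape_at S s' j (act a tp) \<and>
       (\<forall>i. i \<notin> {?L, ?R, ?D} \<longrightarrow> s' i = s i)"
    proof (cases "s ?L")
      case Nil
      let ?s = "?s1(?R := 1 # ?w # r, ?D := 1 # s ?D)"
      have "ex (PUSH ?R 1) ?s1 2 (?s1(?R := 1 # ?w # r))" by (rule ex_push) auto
      moreover have "ex (PUSH ?D 1) (?s1(?R := 1 # ?w # r)) 2 ?s" by (rule ex_push) auto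
      ultimately have "ex (PUSH ?R 1 ;; PUSH ?D 1) ?s1 4 ?s" by (rule ex_seq) auto
      then have "ex ?sw ?s1 (S + 5) ?s" using Nil by (intro ex_sw[of _ _ _ _ 4]) auto
      moreover have "tape_at S ?s j (act a tp)"
        unfolding tape_at_def act_def
      proof (intro exI[of _ "Suc d"] conjI)
        have "(fst tp)(snd tp := fst a) = cells (1 # ?w # r) (Suc d)"
          using f Nil cells_blank_left[of "?w # r" d] by simp
        then show "fst ((fst tp)(snd tp := fst a), snd tp + snd a) = cells (rev (?s ?L) @ ?s ?R) (Suc d)"
          using Nil by simp
      qed (use d Nil 3 rS a(1) in auto)
      ultimately show ?thesis by (intro exI[of _ ?s]) auto
    next
      case (Cons e l)
      then have e: "e \<noteq> 0" "e \<le> S" "set l \<subseteq> {1..S}" using d(4) by auto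
      let ?s = "?s1(?L := l, ?R := e # ?w # r)"
      have "ex (POP ?L) ?s1 1 (?s1(?L := l))" by (rule ex_pop[of _ _ e l]) (use Cons e in auto)
      moreover have "ex (PUSH ?R e) (?s1(?L := l)) 2 ?s" by (rule ex_push) auto
      ultimately have "ex (POP ?L ;; PUSH ?R e) ?s1 3 ?s" by (rule ex_seq) auto
      then have "ex ?sw ?s1 (S + 5) ?s" using Cons e by (intro ex_sw[of _ _ _ _ 3]) auto
      moreover have "tape_at S ?s j (act a tp)"
        unfolding tape_at_def act_def using d f 3 rS a(1) Cons e by (intro exI[of _ d]) auto
      ultimately show ?thesis by (intro exI[of _ ?s]) auto
    qed
    then obtain s' where s': "ex ?sw ?s1 (S + 5) s'" "tape_at S s' j (act a tp)"
      "\<forall>i. i \<notin> {?L, ?R, ?D} \<longrightarrow> s' i = s i" by blast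
    have "tape_act S j a = POP ?R ;; PUSH ?R ?w ;; ?sw" using 3 by (simp add: tape_act_def)
    then have "ex (tape_act S j a) s (S + 10) s'"
      by (simp only:) (rule ex_seq[OF pop ex_seq[OF push s'(1) order_refl]], simp)
    with s' show ?thesis by blast
  qed
qed

primrec tape_acts :: "nat \<Rightarrow> nat \<Rightarrow> (nat \<times> int) list \<Rightarrow> com" where
  "tape_acts S j [] = SKIP"
| "tape_acts S j (a # as) = tape_act S j a ;; tape_acts S (Suc j) as"

lemma ex_tape_acts:
  assumes "length tps = length as" "set as \<subseteq> {..<S} \<times> {-1, 0, 1}"
    "\<And>m. m < length as \<Longrightarrow> tape_at S s (j + m) (tps ! m) \<and> s (3 + 3 * (j + m)) \<noteq> []"
  shows "\<exists>s'. ex (tape_acts S j as) s (length as * (S + 10) + 3) s' \<and>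
     (\<forall>m<length as. tape_at S s' (j + m) (map2 act as tps ! m)) \<and> (\<forall>i<2 + 3 * j. s' i = s i)"
  using assms
proof (induction as arbitrary: s j tps)
  case Nil
  then show ?case using ex_skip by auto
next
  case (Cons a as)
  from Cons.prems(1) obtain tp tps' where tps: "tps = tp # tps'" "length tps' = length as"
    by (cases tps) auto
  obtain s1 where s1: "ex (tape_act S j a) s (S + 10) s1" "tape_at S s1 j (act a tp)"
    "\<forall>i. i \<notin> {2 + 3 * j, 3 + 3 * j, 4 + 3 * j} \<longrightarrow> s1 i = s i"
    using ex_tape_act[of S s j tp a] Cons.prems(2) Cons.prems(3)[of 0] tps by auto
  have "tape_at S s1 (Suc j + m) (tps' ! m) \<and> s1 (3 + 3 * (Suc j + m)) \<noteq> []" if "m < length as" for m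
  proof -
    have "tape_at S s (Suc j + m) (tps' ! m)" "s (3 + 3 * (Suc j + m)) \<noteq> []"
      using Cons.prems(3)[of "Suc m"] that tps by auto
    then show ?thesis using s1(3) by (auto intro: tape_at_frame)
  qed
  with Cons.IH[of tps' s1 "Suc j"] tps Cons.prems(2) obtain s2 where
    s2: "ex (tape_acts S (Suc j) as) s1 (length as * (S + 10) + 3) s2"
    "\<forall>m<length as. tape_at S s2 (Suc j + m) (map2 act as tps' ! m)" "\<forall>i<2 + 3 * Suc j. s2 i = s1 i"
    by auto
  have "tape_at S s2 j (act a tp)"
    by (rule tape_at_frame[OF s1(2)]) (use s2(3) in auto)
  then have "tape_at S s2 (j + m) (map2 act (a # as) tps ! m)" if "m < length (a # as)" for m
    using s2(2) that tps by (cases m) auto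
  moreover have "ex (tape_acts S j (a # as)) s (length (a # as) * (S + 10) + 3) s2"
    by (simp, rule ex_seq[OF s1(1) s2(1)]) simp
  moreover have "\<forall>i<2 + 3 * j. s2 i = s i" using s1(3) s2(3) by auto
  ultimately show ?case by blast
qed

primrec extend :: "nat \<Rightarrow> com" where
  "extend 0 = SKIP"
| "extend (Suc k) = extend k ;; IFTOP (3 + 3 * k) 0 (PUSH (3 + 3 * k) 1) SKIP"

lemma ex_extend:
  assumes "\<And>j. j < k \<Longrightarrow> tape_at S s j (tps ! j)" "0 < S"
  shows "\<exists>s'. ex (extend k) s (5 * k + 3) s' \<and>
     (\<forall>j<k. tape_at S s' j (tps ! j) \<and> s' (3 + 3 * j) \<noteq> []) \<and> (\<forall>i. i < 2 \<or> 2 + 3 * k \<le> i \<longrightarrow> s' i = s i)"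
  using assms
proof (induction k)
  case 0
  then show ?case using ex_skip by auto
next
  case (Suc k)
  then obtain s1 where s1: "ex (extend k) s (5 * k + 3) s1"
    "\<forall>j<k. tape_at S s1 j (tps ! j) \<and> s1 (3 + 3 * j) \<noteq> []"
    "\<forall>i. i < 2 \<or> 2 + 3 * k \<le> i \<longrightarrow> s1 i = s i" by auto
  let ?R = "3 + 3 * k"
  have tk: "tape_at S s1 k (tps ! k)"
    by (rule tape_at_frame[OF Suc.prems(1)]) (use s1(3) in auto)
  have "\<exists>s2. ex (IFTOP ?R 0 (PUSH ?R 1) SKIP) s1 4 s2 \<and> tape_at S s2 k (tps ! k) \<and> s2 ?R \<noteq> [] \<and>
     (\<forall>i. i \<noteq> ?R \<longrightarrow> s2 i = s1 i)"
  proof (cases "s1 ?R")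
    case Nil
    let ?s = "s1(?R := [1])"
    have "ex (PUSH ?R 1) s1 2 ?s" by (rule ex_push) (use Nil in auto)
    then have "ex (IFTOP ?R 0 (PUSH ?R 1) SKIP) s1 4 ?s"
      using Nil by (intro ex_if[of _ _ _ _ 2]) auto
    moreover have "tape_at S ?s k (tps ! k)"
      using tk Nil assms(2) cells_blank_right[of "rev (s1 (2 + 3 * k))"] by (auto simp: tape_at_def)
    ultimately show ?thesis by (intro exI[of _ ?s]) auto
  next
    case (Cons b r)
    with tk have "b \<noteq> 0" by (auto simp: tape_at_def)
    then have "peek (s1 ?R) \<noteq> 0" using Cons by simp
    moreover have "ex SKIP s1 3 s1" by (rule ex_skip) simp
    ultimately have "ex (IFTOP ?R 0 (PUSH ?R 1) SKIP) s1 4 s1"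
      by (intro ex_if[of s1 ?R 0 "PUSH ?R 1" 3]) simp_all
    moreover have "s1 ?R \<noteq> []" using Cons by simp
    ultimately show ?thesis using tk by blast
  qed
  then obtain s2 where s2: "ex (IFTOP ?R 0 (PUSH ?R 1) SKIP) s1 4 s2" "tape_at S s2 k (tps ! k)"
     "s2 ?R \<noteq> []" "\<forall>i. i \<noteq> ?R \<longrightarrow> s2 i = s1 i" by blast
  have "tape_at S s2 j (tps ! j) \<and> s2 (3 + 3 * j) \<noteq> []" if "j < Suc k" for j
  proof (cases "j = k")
    case False
    with that have "j < k" by simp
    then have *: "tape_at S s1 j (tps ! j)" "s1 (3 + 3 * j) \<noteq> []" using s1(2) by blast+
    have eq: "s2 i = s1 i" if "i \<in> {2 + 3 * j, 3 + 3 * j, 4 + 3 * j}" for i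
    proof -
      from that have "i = 2 + 3 * j \<or> i = 3 + 3 * j \<or> i = 4 + 3 * j" by blast
      then have "i \<noteq> ?R" using \<open>j < k\<close> by presburger
      with s2(4) show ?thesis by blast
    qed
    show ?thesis using tape_at_frame[OF *(1)] eq *(2) by simp
  qed (use s2 in auto)
  moreover have "ex (extend (Suc k)) s (5 * Suc k + 3) s2"
    unfolding extend.simps by (rule ex_seq[OF s1(1) s2(1)]) simp
  ultimately show ?case using s1(3) s2(4) by (intro exI[of _ s2]) auto
qed

text \<open>Nested case distinctions collect the scanned symbols in \<open>ss\<close>. At each leaf
  they are constants of the program, so \<open>F\<close> can insert the matching line of the
  transition table.\<close>

primrec read_tapes :: "nat \<Rightarrow> nat \<Rightarrow> nat \<Rightarrow> nat list \<Rightarrow> (nat list \<Rightarrow> com) \<Rightarrow> com" where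
  "read_tapes S 0 j ss F = F ss"
| "read_tapes S (Suc m) j ss F = sw S (3 + 3 * j) (\<lambda>a. read_tapes S m (Suc j) (ss @ [a - 1]) F)"

lemma ex_read_tapes:
  assumes "\<And>i. i < m \<Longrightarrow> peek (s (3 + 3 * (j + i))) \<le> S"
    "ex (F (ss @ map (\<lambda>i. peek (s (3 + 3 * (j + i))) - 1) [0..<m])) s T s'"
  shows "ex (read_tapes S m j ss F) s (T + m * S) s'"
  using assms
proof (induction m arbitrary: j ss)
  case 0
  then show ?case by simp
next
  case (Suc m)
  let ?a = "peek (s (3 + 3 * j))"
  have "map (\<lambda>i. peek (s (3 + 3 * (j + i))) - 1) [0..<Suc m] =
     (?a - 1) # map (\<lambda>i. peek (s (3 + 3 * (Suc j + i))) - 1) [0..<m]"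
    by (auto intro!: nth_equalityI simp: nth_Cons split: nat.splits simp del: upt_Suc)
  then have "ex (read_tapes S m (Suc j) (ss @ [?a - 1]) F) s (T + m * S) s'"
    using Suc.prems(1)[of "Suc i" for i] Suc.prems(2) by (intro Suc.IH) auto
  then show ?case
    using Suc.prems(1)[of 0] by (auto intro!: ex_sw)
qed

lemma peek_tape_at:
  assumes "tape_at S s j tp" "s (3 + 3 * j) \<noteq> []"
  shows "peek (s (3 + 3 * j)) \<le> S" "peek (s (3 + 3 * j)) - 1 = fst tp (snd tp)" "fst tp (snd tp) < S"
proof -
  from assms(2) obtain b r where br: "s (3 + 3 * j) = b # r" by (cases "s (3 + 3 * j)") auto
  with assms(1) show "peek (s (3 + 3 * j)) \<le> S" "peek (s (3 + 3 * j)) - 1 = fst tp (snd tp)"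
    "fst tp (snd tp) < S"
    by (auto simp: tape_at_def cells_head)
qed

text \<open>Stack 0 is left to input and output. Stack 1 holds the state plus one, because 0 would
  read as an empty stack.\<close>

definition config_at :: "tm \<Rightarrow> store \<Rightarrow> config \<Rightarrow> bool" where
  "config_at M s c \<longleftrightarrow> fst c \<le> num_states M \<and> s 1 = [fst c + 1] \<and> length (snd c) = num_tapes M \<and>
     (\<forall>j<num_tapes M. tape_at (num_syms M) s j (snd c ! j))"

definition sim_trans :: "tm \<Rightarrow> nat \<Rightarrow> com" where
  "sim_trans M a = read_tapes (num_syms M) (num_tapes M) 0 [] (\<lambda>ss.
     POP 1 ;; PUSH 1 (fst (trans M (a - 1) ss) + 1) ;;
     tape_acts (num_syms M) 0 (snd (trans M (a - 1) ss)))"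

definition sim_step :: "tm \<Rightarrow> com" where
  "sim_step M = extend (num_tapes M) ;;
     sw (num_states M) 1 (\<lambda>a. if a = 0 then SKIP else sim_trans M a)"

definition sim_cost :: "tm \<Rightarrow> nat" where
  "sim_cost M = num_tapes M * (2 * num_syms M + 15) + num_states M + 9"

lemma ex_sim_step:
  assumes wf: "wf_tm M" and c: "config_at M s c" and run: "fst c < num_states M"
  shows "\<exists>s'. ex (sim_step M) s (sim_cost M) s' \<and> config_at M s' (step M c) \<and> s' 0 = s 0"
proof -
  let ?k = "num_tapes M" and ?S = "num_syms M"
  obtain q tps where qt: "c = (q, tps)" by force
  with run have q: "q < num_states M" by simp
  from wf have S: "0 < ?S" by (simp add: wf_tm_def)
  obtain s1 where s1: "ex (extend ?k) s (5 * ?k + 3) s1"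
     "\<forall>j<?k. tape_at ?S s1 j (tps ! j) \<and> s1 (3 + 3 * j) \<noteq> []"
     "\<forall>i. i < 2 \<or> 2 + 3 * ?k \<le> i \<longrightarrow> s1 i = s i"
    using ex_extend[of ?k ?S s tps] c qt S by (auto simp: config_at_def)
  from c qt have st: "s 1 = [q + 1]" "length tps = ?k" by (auto simp: config_at_def)
  define ss where "ss = scans tps"
  have ss: "map (\<lambda>i. peek (s1 (3 + 3 * (0 + i))) - 1) [0..<?k] = ss"
  proof (rule nth_equalityI)
    fix i assume "i < length (map (\<lambda>i. peek (s1 (3 + 3 * (0 + i))) - 1) [0..<?k])"
    then have i: "i < ?k" by simp
    with s1(2) have "peek (s1 (3 + 3 * i)) - 1 = fst (tps ! i) (snd (tps ! i))"
      using peek_tape_at(2) by blast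
    with i st(2) show "map (\<lambda>i. peek (s1 (3 + 3 * (0 + i))) - 1) [0..<?k] ! i = ss ! i"
      by (simp add: ss_def scans_nth)
  qed (simp add: ss_def st(2))
  have lss: "length ss = ?k" "set ss \<subseteq> {..<?S}"
  proof -
    have "fst (tps ! j) (snd (tps ! j)) < ?S" if "j < ?k" for j
      using s1(2) that peek_tape_at(3) by blast
    then show "length ss = ?k" "set ss \<subseteq> {..<?S}"
      using st(2) by (auto simp: ss_def in_set_conv_nth scans_nth)
  qed
  have fr: "frag ?k ?S M" using wf by (simp add: frag_def)
  let ?q = "fst (trans M q ss)" and ?as = "snd (trans M q ss)"
  note tr = fragD[OF fr q lss]
  have s12: "s1 1 = [q + 1]" using s1(3) st by auto
  let ?s2 = "s1(1 := [?q + 1])"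
  have 1: "ex (POP 1) s1 1 (s1(1 := []))"
    by (rule ex_pop[of s1 1 "q + 1" "[]", OF s12]) auto
  have 2: "ex (PUSH 1 (?q + 1)) (s1(1 := [])) 2 ?s2"
    by (rule ex_push) auto
  have "tape_at ?S ?s2 (0 + m) (tps ! m) \<and> ?s2 (3 + 3 * (0 + m)) \<noteq> []" if "m < length ?as" for m
    using that tr(2) s1(2) by (auto intro: tape_at_frame)
  from ex_tape_acts[OF _ tr(3) this] st(2) tr(2) obtain s3 where
    s3: "ex (tape_acts ?S 0 ?as) ?s2 (?k * (?S + 10) + 3) s3"
    "\<forall>m<?k. tape_at ?S s3 m (map2 act ?as tps ! m)" "\<forall>i<2. s3 i = ?s2 i" by auto
  have "ex (POP 1 ;; PUSH 1 (?q + 1) ;; tape_acts ?S 0 ?as) s1 (?k * (?S + 10) + 6) s3"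
    by (rule ex_seq[OF 1 ex_seq[OF 2 s3(1) order_refl]]) simp
  moreover have "peek (s1 (3 + 3 * (0 + i))) \<le> ?S" if "i < ?k" for i
    using s1(2) that peek_tape_at(1) by simp blast
  ultimately have "ex (sim_trans M (q + 1)) s1 (?k * (?S + 10) + 6 + ?k * ?S) s3"
    unfolding sim_trans_def by (intro ex_read_tapes) (simp_all only: ss append_Nil diff_add_inverse2)
  then have "ex (sw (num_states M) 1 (\<lambda>a. if a = 0 then SKIP else sim_trans M a)) s1
     (?k * (?S + 10) + 6 + ?k * ?S + num_states M) s3"
    using s12 q by (intro ex_sw[OF _ _ order_refl]) auto
  then have "ex (sim_step M) s (sim_cost M) s3"
    unfolding sim_step_def sim_cost_def by (rule ex_seq[OF s1(1)]) (simp add: algebra_simps)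
  moreover have "config_at M s3 (step M c)"
    unfolding config_at_def qt step_running[OF q] using tr s3 st(2) by (auto simp: ss_def)
  moreover have "s3 0 = s 0" using s3(3) s1(3) by auto
  ultimately show ?thesis by blast
qed

definition sim_run :: "tm \<Rightarrow> com" where
  "sim_run M = UNTIL 1 (num_states M + 1) (sim_step M)"

lemma ex_sim_run:
  assumes wf: "wf_tm M"
  shows "config_at M s c \<Longrightarrow> (step M ^^ t) c = c' \<Longrightarrow> fst c' = num_states M \<Longrightarrow>
    \<exists>s'. ex (sim_run M) s (t * (sim_cost M + 1) + 1) s' \<and> config_at M s' c' \<and> s' 0 = s 0"
proof (induction t arbitrary: s c)
  case 0
  then show ?case by (auto simp: config_at_def sim_run_def intro!: exI[of _ s] ex_until_stop)
next
  case (Suc t)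
  show ?case
  proof (cases "fst c < num_states M")
    case False
    with Suc.prems steps_halted[of "fst c" M "Suc t" "snd c"] have "c = c'" by simp
    with Suc.prems show ?thesis
      by (auto simp: config_at_def sim_run_def intro!: exI[of _ s] ex_until_stop)
  next
    case True
    obtain s1 where s1: "ex (sim_step M) s (sim_cost M) s1" "config_at M s1 (step M c)" "s1 0 = s 0"
      using ex_sim_step[OF wf Suc.prems(1) True] by blast
    have "(step M ^^ t) (step M c) = c'" using Suc.prems(2) by (simp add: funpow_swap1)
    from Suc.IH[OF s1(2) this Suc.prems(3)] obtain s2 where
      s2: "ex (sim_run M) s1 (t * (sim_cost M + 1) + 1) s2" "config_at M s2 c'" "s2 0 = s1 0" by blast
    have "peek (s 1) \<noteq> num_states M + 1" using Suc.prems(1) True by (auto simp: config_at_def)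
    then have "ex (sim_run M) s (Suc t * (sim_cost M + 1) + 1) s2"
      unfolding sim_run_def
      by (rule ex_until_step[OF _ s1(1) s2(1)[unfolded sim_run_def]]) simp
    with s1 s2 show ?thesis by auto
  qed
qed

text \<open>\<open>max 1 a\<close> only changes the branch for an empty stack, which the loop never
  takes. It keeps \<open>g\<close> away from 0, so that no branch of the program pushes a 0 as long
  as \<open>g\<close> maps positive symbols to positive ones.\<close>

definition transfer :: "nat \<Rightarrow> (nat \<Rightarrow> nat) \<Rightarrow> nat \<Rightarrow> nat \<Rightarrow> com" where
  "transfer S g i j = UNTIL i 0 (sw S i (\<lambda>a. POP i ;; PUSH j (g (max 1 a))))"

lemma ex_transfer:
  assumes "set (s i) \<subseteq> {1..S}" "i \<noteq> j" "length (s i) * (S + 4) + 1 \<le> T"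
  shows "ex (transfer S g i j) s T (s(i := [], j := map g (rev (s i)) @ s j))"
  using assms
proof (induction "s i" arbitrary: s T)
  case Nil
  then have *: "s(i := [], j := map g (rev (s i)) @ s j) = s" by (auto simp: fun_eq_iff)
  show ?case unfolding transfer_def * by (rule ex_until_stop) (use Nil in auto)
next
  case (Cons a xs)
  let ?s = "s(i := xs, j := g a # s j)"
  have a: "a \<noteq> 0" "a \<le> S" "set xs \<subseteq> {1..S}" using Cons(2,3) by (metis atLeastAtMost_iff insert_subset list.simps(15) not_one_le_zero)+
  have 1: "ex (POP i) s 1 (s(i := xs))" by (rule ex_pop[of s i a xs, OF Cons(2)[symmetric] a(1)]) auto
  have 2: "ex (PUSH j (g a)) (s(i := xs)) 2 ?s"
    by (rule ex_push) (use assms(2) in auto)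
  have "ex (POP i ;; PUSH j (g a)) s 3 ?s" by (rule ex_seq[OF 1 2]) simp
  moreover have "max 1 a = a" using a(1) by simp
  ultimately have 3: "ex (sw S i (\<lambda>a. POP i ;; PUSH j (g (max 1 a)))) s (3 + S) ?s"
    using a Cons(2)[symmetric] by (intro ex_sw[OF _ _ order_refl]) (auto simp del: One_nat_def)
  have "ex (transfer S g i j) ?s (length xs * (S + 4) + 1) (?s(i := [], j := map g (rev (?s i)) @ ?s j))"
    by (rule Cons(1)) (use a assms(2) in auto)
  moreover have "?s(i := [], j := map g (rev (?s i)) @ ?s j) = s(i := [], j := map g (rev (s i)) @ s j)"
    using assms(2) Cons(2)[symmetric] by (auto simp: fun_eq_iff)
  ultimately have 4: "ex (transfer S g i j) ?s (length xs * (S + 4) + 1) (s(i := [], j := map g (rev (s i)) @ s j))"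
    by simp
  have "peek (s i) \<noteq> 0" using a(1) Cons(2)[symmetric] by simp
  then show ?case
    unfolding transfer_def
    by (rule ex_until_step[OF _ 3 4[unfolded transfer_def]])
      (use Cons(2)[symmetric] Cons.prems(3) in simp)
qed

text \<open>In shifted symbols 1 is the blank and 2, 3 are the bits. If the stored window ends right
  after the output there is no blank to stop at, so one is pushed when the stack runs empty.\<close>

definition sim_out :: com where
  "sim_out = UNTIL 3 1 (IFTOP 3 0 (PUSH 3 1) (IFTOP 3 2 (POP 3 ;; PUSH 2 1) (POP 3 ;; PUSH 2 2)))"

lemma ex_sim_out:
  assumes "s 3 = map Suc (bits y) @ e" "e = [] \<or> (\<exists>e'. e = 1 # e')"
  shows "\<exists>s'. ex sim_out s (length y * 6 + 5) s' \<and> s' 2 = rev (bits y) @ s 2 \<and> s' 0 = s 0"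
  using assms(1)
proof (induction y arbitrary: s)
  case Nil
  show ?case
  proof (cases e)
    case Nil
    let ?s = "s(3 := [1])"
    have "ex (PUSH 3 1) s 2 ?s" by (rule ex_push) (use \<open>s 3 = _\<close> Nil in auto)
    then have 1: "ex (IFTOP 3 0 (PUSH 3 1) (IFTOP 3 2 (POP 3 ;; PUSH 2 1) (POP 3 ;; PUSH 2 2))) s 3 ?s"
      using \<open>s 3 = _\<close> Nil by (intro ex_if[of _ _ _ _ 2]) auto
    have 2: "ex sim_out ?s 1 ?s" unfolding sim_out_def by (rule ex_until_stop) auto
    have "ex sim_out s 5 ?s"
      unfolding sim_out_def
      by (rule ex_until_step[OF _ 1 2[unfolded sim_out_def]]) (use \<open>s 3 = _\<close> Nil in auto)
    then show ?thesis
      by (intro exI[of _ ?s]) (simp del: fun_upd_apply add: fun_upd_same fun_upd_other)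
  next
    case (Cons e0 e')
    with assms(2) \<open>s 3 = _\<close> have "ex sim_out s 5 s"
      unfolding sim_out_def by (intro ex_until_stop) auto
    then show ?thesis by (intro exI[of _ s]) auto
  qed
next
  case (Cons b y)
  let ?r = "map Suc (bits y) @ e" and ?b = "if b then 2 else 1 :: nat"
  let ?s = "s(3 := ?r, 2 := ?b # s 2)"
  have s3: "s 3 = Suc ?b # ?r" using Cons.prems by simp
  have 1: "ex (POP 3) s 1 (s(3 := ?r))" by (rule ex_pop[of s 3 "Suc ?b" ?r, OF s3]) auto
  have 2: "ex (PUSH 2 ?b) (s(3 := ?r)) 2 ?s" by (rule ex_push) auto
  have "ex (POP 3 ;; PUSH 2 ?b) s 3 ?s" by (rule ex_seq[OF 1 2]) simp
  then have "ex (IFTOP 3 2 (POP 3 ;; PUSH 2 1) (POP 3 ;; PUSH 2 2)) s 4 ?s"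
    using s3 by (intro ex_if[of _ _ _ _ 3]) (auto split: if_splits)
  then have 3: "ex (IFTOP 3 0 (PUSH 3 1) (IFTOP 3 2 (POP 3 ;; PUSH 2 1) (POP 3 ;; PUSH 2 2))) s 5 ?s"
    using s3 by (intro ex_if[of _ _ _ _ 4]) auto
  obtain s' where s': "ex sim_out ?s (length y * 6 + 5) s'" "s' 2 = rev (bits y) @ ?s 2" "s' 0 = ?s 0"
    using Cons.IH[of ?s]
    by (auto simp del: fun_upd_apply simp add: fun_upd_same fun_upd_other)
  have "ex sim_out s (length (b # y) * 6 + 5) s'"
    unfolding sim_out_def
    by (rule ex_until_step[OF _ 3 s'(1)[unfolded sim_out_def]]) (use s3 in auto)
  with s' show ?case by (intro exI[of _ s']) auto
qed

definition sim_drop :: com where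
  "sim_drop = UNTIL 4 0 (POP 4 ;; POP 3)"

lemma ex_sim_drop:
  assumes "s 4 = replicate d 1" "0 \<notin> set (s 3)"
  shows "ex sim_drop s (3 * d + 1) (s(4 := [], 3 := drop d (s 3)))"
  using assms
proof (induction d arbitrary: s)
  case 0
  then have *: "s(4 := [], 3 := drop 0 (s 3)) = s" by (auto simp: fun_eq_iff)
  show ?case unfolding sim_drop_def * by (rule ex_until_stop) (use 0 in auto)
next
  case (Suc d)
  let ?s = "s(4 := replicate d 1, 3 := tl (s 3))"
  have 1: "ex (POP 4) s 1 (s(4 := replicate d 1))"
    by (rule ex_pop[of s 4 1 "replicate d 1"]) (use Suc in auto)
  have 2: "ex (POP 3) (s(4 := replicate d 1)) 1 ?s"
  proof (cases "s 3")
    case Nil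
    then have "?s = s(4 := replicate d 1)" by (auto simp: fun_eq_iff)
    then show ?thesis using Nil by (simp add: ex_pop_empty)
  next
    case (Cons a r)
    then show ?thesis using Suc.prems by (intro ex_pop[of _ 3 a r]) auto
  qed
  have 3: "ex (POP 4 ;; POP 3) s 2 ?s" by (rule ex_seq[OF 1 2]) simp
  have "0 \<notin> set (tl (s 3))" using Suc.prems(2) by (cases "s 3") auto
  then have 4: "ex sim_drop ?s (3 * d + 1) (?s(4 := [], 3 := drop d (?s 3)))"
    by (intro Suc.IH) auto
  have eq: "?s(4 := [], 3 := drop d (?s 3)) = s(4 := [], 3 := drop (Suc d) (s 3))"
    by (auto simp: fun_eq_iff drop_Suc)
  show ?case
    unfolding sim_drop_def
    by (rule ex_until_step[OF _ 3 4[unfolded sim_drop_def eq]]) (use Suc.prems in auto)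
qed

text \<open>The input is reversed twice on its way to stack 3, with the symbols shifted on the first
  pass. After the run the left part of tape 0 is rewound onto stack 3 and the cells before cell 0
  are dropped, since the output starts at cell 0.\<close>

definition sim :: "tm \<Rightarrow> com" where
  "sim M = transfer 2 Suc 0 2 ;; transfer (num_syms M) (\<lambda>a. a) 2 3 ;; PUSH 1 1 ;; sim_run M ;;
     transfer (num_syms M) (\<lambda>a. a) 2 3 ;; sim_drop ;; sim_out ;; transfer 2 (\<lambda>a. a) 2 0"

lemma bits_subset: "set (bits x) \<subseteq> {1..2}"
  by (auto simp: bits_def sym_of_bit_def)

theorem ex_sim:
  assumes wf: "wf_tm M"
  obtains C where "\<And>x y T s. computes_within M x y T \<Longrightarrow> s 0 = bits x \<Longrightarrow>
     (\<forall>i. 0 < i \<and> i < 2 + 3 * num_tapes M \<longrightarrow> s i = []) \<Longrightarrow>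
     \<exists>s' t. real t \<le> T \<and> ex (sim M) s (C * (t + length x + 1)) s' \<and> s' 0 = bits y"
proof -
  let ?k = "num_tapes M" and ?S = "num_syms M"
  from wf have k: "0 < ?k" and S: "3 \<le> ?S" by (auto simp: wf_tm_def)
  define D where "D = sim_cost M + 1"
  define C where "C = (?S + 40) * (?S + 40) * (D + 40)"
  have "\<exists>s' t. real t \<le> T \<and> ex (sim M) s (C * (t + length x + 1)) s' \<and> s' 0 = bits y"
    if cw: "computes_within M x y T" and s0: "s 0 = bits x"
      and empty: "\<forall>i. 0 < i \<and> i < 2 + 3 * ?k \<longrightarrow> s i = []" for x y T s
  proof -
    from cw obtain t tps where t: "real t \<le> T" "(step M ^^ t) (init_config M x) = (num_states M, tps)"
      "tape_holds (fst (hd tps)) y" by (auto simp: computes_within_def)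
    let ?n = "length x"
    have e: "s 1 = []" "s 2 = []" "s 3 = []" "s 4 = []" using empty k by auto
    let ?s1 = "s(0 := [], 2 := map Suc (rev (bits x)))"
    have 1: "ex (transfer 2 Suc 0 2) s (6 * ?n + 1) ?s1"
      using ex_transfer[of s 0 2 2 "6 * ?n + 1" Suc] s0 e bits_subset[of x] by (simp add: algebra_simps)
    let ?s2 = "s(0 := [], 3 := map Suc (bits x))"
    have "set (map Suc (rev (bits x))) \<subseteq> {1..?S}" using bits_subset[of x] S by auto
    then have "ex (transfer ?S (\<lambda>a. a) 2 3) ?s1 (?n * (?S + 4) + 1)
        (?s1(2 := [], 3 := map (\<lambda>a. a) (rev (?s1 2)) @ ?s1 3))"
      by (intro ex_transfer) auto
    moreover have "?s1(2 := [], 3 := map (\<lambda>a. a) (rev (?s1 2)) @ ?s1 3) = ?s2"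
      using e by (auto simp: fun_eq_iff rev_map)
    ultimately have 2: "ex (transfer ?S (\<lambda>a. a) 2 3) ?s1 (?n * (?S + 4) + 1) ?s2" by simp
    let ?s3 = "s(0 := [], 3 := map Suc (bits x), 1 := [1])"
    have 3: "ex (PUSH 1 1) ?s2 2 ?s3" by (rule ex_push) (use e in auto)
    have "config_at M ?s3 (init_config M x)"
      unfolding config_at_def init_config_def
    proof (intro conjI allI impI)
      fix j assume j: "j < ?k"
      show "tape_at ?S ?s3 j (snd (0, (tape_of x, 0) # replicate (?k - 1) (tape_of [], 0)) ! j)"
      proof (cases j)
        case 0
        have "tape_of x = cells (map Suc (bits x)) 0"
          by (auto simp: tape_of_word word_def cells_def fun_eq_iff)
        with 0 e show ?thesis using bits_subset[of x] S by (auto simp: tape_at_def)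
      next
        case (Suc j')
        have "tape_of [] = cells [] 0" by (auto simp: tape_of_def cells_def fun_eq_iff)
        with Suc j empty show ?thesis by (auto simp: tape_at_def)
      qed
    qed (use k in auto)
    from ex_sim_run[OF wf this t(2)] obtain s4 where
      s4: "ex (sim_run M) ?s3 (t * D + 1) s4" "config_at M s4 (num_states M, tps)" "s4 0 = []"
      unfolding D_def by auto
    have grow: "length (s4 i) \<le> ?n + t * D + 2" if "i \<in> {2, 3, 4}" for i
      using ex_growth[OF s4(1), of i] that e by (auto simp: numeral_eq_Suc)
    from s4(2) k have "tape_at ?S s4 0 (tps ! 0)" "length tps = ?k" by (auto simp: config_at_def)
    then obtain d where d: "s4 4 = replicate d 1" "fst (tps ! 0) = cells (rev (s4 2) @ s4 3) d"
      "set (s4 2) \<subseteq> {1..?S}" "set (s4 3) \<subseteq> {1..?S}" by (auto simp: tape_at_def)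
    have hd: "hd tps = tps ! 0" using k \<open>length tps = ?k\<close> by (intro hd_conv_nth) auto
    define z where "z = rev (s4 2) @ s4 3"
    let ?s5 = "s4(2 := [], 3 := z)"
    have "ex (transfer ?S (\<lambda>a. a) 2 3) s4 (length (s4 2) * (?S + 4) + 1)
        (s4(2 := [], 3 := map (\<lambda>a. a) (rev (s4 2)) @ s4 3))"
      by (intro ex_transfer) (use d in auto)
    then have 5: "ex (transfer ?S (\<lambda>a. a) 2 3) s4 ((?n + t * D + 2) * (?S + 4) + 1) ?s5"
      using mult_le_mono1[OF grow[of 2], of "?S + 4"] by (auto simp: z_def elim!: ex_mono)
    have z0: "0 \<notin> set z" using d by (auto simp: z_def)
    let ?s6 = "?s5(4 := [], 3 := drop d z)"
    have "ex sim_drop ?s5 (3 * d + 1) (?s5(4 := [], 3 := drop d (?s5 3)))"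
      by (rule ex_sim_drop) (use d z0 in auto)
    then have 6: "ex sim_drop ?s5 (3 * (?n + t * D + 2) + 1) ?s6"
      using grow[of 4] d(1) by (auto elim!: ex_mono)
    let ?c = "drop d z"
    have cell: "cells z d (int i) = (if i < length ?c then ?c ! i - 1 else 0)" for i
      by (auto simp: cells_def nat_int_add add.commute)
    have hold: "i < length y \<Longrightarrow> cells z d (int i) = bits y ! i" "cells z d (int (length y)) = 0" for i
      using t(3) unfolding hd d(2) z_def[symmetric] by (auto simp: tape_holds_def bits_def)
    \<comment> \<open>Bits are nonzero symbols while cells outside the stored window read 0; hence
      the whole output lies inside the window.\<close>
    have ylen: "i < length ?c \<and> ?c ! i = Suc (bits y ! i)" if "i < length y" for i
    proof -
      have "bits y ! i \<noteq> 0" using that nth_mem[of i "bits y"] by (metis bits_simps(4) zero_notin_bits)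
      with hold(1)[OF that] cell[of i] show ?thesis by (auto split: if_splits)
    qed
    then have ly: "length y \<le> length ?c" by (meson not_le_imp_less less_irrefl)
    have "take (length y) ?c = map Suc (bits y)"
      using ly ylen by (intro nth_equalityI) auto
    then have c: "?c = map Suc (bits y) @ drop (length y) ?c" by (metis append_take_drop_id)
    have en: "drop (length y) ?c = [] \<or> (\<exists>e'. drop (length y) ?c = 1 # e')"
    proof (cases "length y < length ?c")
      case True
      then have "?c ! length y \<in> set z" by (meson in_set_dropD nth_mem)
      with z0 have "?c ! length y \<noteq> 0" by metis
      with hold(2) cell[of "length y"] True have "?c ! length y = 1" by (auto split: if_splits)
      with True show ?thesis by (metis Cons_nth_drop_Suc)
    qed auto
    obtain s7 where s7: "ex sim_out ?s6 (length y * 6 + 5) s7" "s7 2 = rev (bits y)" "s7 0 = []"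
      using ex_sim_out[of ?s6 y, OF _ en] c s4(3) by auto
    have lc: "length y \<le> 2 * (?n + t * D + 2)"
      using ly grow[of 2] grow[of 3] by (auto simp: z_def)
    let ?s8 = "s7(2 := [], 0 := bits y)"
    have "ex (transfer 2 (\<lambda>a. a) 2 0) s7 (length y * 6 + 1) (s7(2 := [], 0 := map (\<lambda>a. a) (rev (s7 2)) @ s7 0))"
      by (rule ex_transfer) (use s7 bits_subset[of y] in auto)
    then have 8: "ex (transfer 2 (\<lambda>a. a) 2 0) s7 (length y * 6 + 1) ?s8"
      using s7 by simp
    let ?T = "(6 * ?n + 1) + ((?n * (?S + 4) + 1) + (2 + ((t * D + 1) +
      (((?n + t * D + 2) * (?S + 4) + 1) + ((3 * (?n + t * D + 2) + 1) + ((length y * 6 + 5) + (length y * 6 + 1)))))))"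
    have run: "ex (sim M) s ?T ?s8"
      unfolding sim_def
      by (rule ex_seq[OF 1 ex_seq[OF 2 ex_seq[OF 3 ex_seq[OF s4(1) ex_seq[OF 5 ex_seq[OF 6 ex_seq[OF s7(1) 8
        order_refl] order_refl] order_refl] order_refl] order_refl] order_refl] order_refl])
    define m where "m = t + ?n + 1"
    define P where "P = ?S + 40"
    define Q where "Q = D + 40"
    have b1: "?n + t * D + 2 \<le> m * Q" by (simp add: m_def Q_def algebra_simps)
    have "?T \<le> 6 * ?n + 13 + ?n * (?S + 4) + t * D + (?n + t * D + 2) * (?S + 4) + 3 * (?n + t * D + 2) + 24 * (?n + t * D + 2)"
    proof -
      have "6 * n + 1 + ((U + 1) + (2 + ((w + 1) + ((V + 1) + ((3 * X + 1) + ((Y * 6 + 5) + (Y * 6 + 1)))))))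
          \<le> 6 * n + 13 + U + w + V + 3 * X + 24 * X" if "Y \<le> 2 * X" for n U w V X Y :: nat
        using that by linarith
      from this[OF lc] show ?thesis .
    qed
    also have "\<dots> \<le> 6 * (m * Q) + 13 * (m * Q) + (m * Q) * (?S + 4) + m * Q + (m * Q) * (?S + 4) + 3 * (m * Q) + 24 * (m * Q)"
    proof -
      have "1 \<le> m * Q" by (simp add: m_def Q_def)
      moreover have "?n \<le> m * Q" "t * D \<le> m * Q" using b1 by linarith+
      moreover from this have "?n * (?S + 4) \<le> m * Q * (?S + 4)"
        "(?n + t * D + 2) * (?S + 4) \<le> m * Q * (?S + 4)"
        using b1 by (simp_all only: mult_le_mono1)
      moreover have "6 * n + 13 + U + w + V + 3 * X + 24 * X \<le> 6 * a + 13 * a + b + a + b + 3 * a + 24 * a"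
        if "1 \<le> a" "n \<le> a" "w \<le> a" "U \<le> b" "V \<le> b" "X \<le> a" for n U w V X a b :: nat
        using that by linarith
      ultimately show ?thesis using b1 by blast
    qed
    also have "\<dots> = (m * Q) * (2 * ?S + 55)" by (simp add: algebra_simps)
    also have "\<dots> \<le> (m * Q) * (P * P)"
    proof (rule mult_le_mono2)
      have "2 * P \<le> P * P" by (rule mult_le_mono1) (simp add: P_def)
      then show "2 * ?S + 55 \<le> P * P" by (simp add: P_def)
    qed
    also have "\<dots> = C * m" by (simp add: C_def P_def Q_def)
    finally have "?T \<le> C * (t + ?n + 1)" by (simp add: m_def)
    with run have "ex (sim M) s (C * (t + ?n + 1)) ?s8" by (rule ex_mono)
    with t(1) show ?thesis by (intro exI[of _ ?s8] exI[of _ t]) auto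
  qed
  then show thesis by (rule that)
qed

section \<open>Functions computed by stack programs in polynomial time\<close>

primrec regs :: "nat \<Rightarrow> com \<Rightarrow> bool" where
  "regs R (PUSH i a) \<longleftrightarrow> i < R"
| "regs R (POP i) \<longleftrightarrow> i < R"
| "regs R (c1 ;; c2) \<longleftrightarrow> regs R c1 \<and> regs R c2"
| "regs R (IFTOP i a c1 c2) \<longleftrightarrow> i < R \<and> regs R c1 \<and> regs R c2"
| "regs R (UNTIL i a c) \<longleftrightarrow> i < R \<and> regs R c"

lemma exec_regs: "exec c s t s' \<Longrightarrow> regs R c \<Longrightarrow> R \<le> i \<Longrightarrow> s' i = s i"
  by (induction rule: exec.induct) auto

lemma ex_regs: "ex c s t s' \<Longrightarrow> regs R c \<Longrightarrow> R \<le> i \<Longrightarrow> s' i = s i"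
  unfolding ex_def using exec_regs by blast

lemma regs_sw: "i < R \<Longrightarrow> (\<And>a. a \<le> n \<Longrightarrow> regs R (f a)) \<Longrightarrow> regs R (sw n i f)"
  by (induction n) auto

lemma regs_tape_acts: "2 + 3 * (j + length as) \<le> R \<Longrightarrow> regs R (tape_acts S j as)"
  by (induction as arbitrary: j) (auto simp: SKIP_def tape_act_def intro!: regs_sw)

lemma nonzero_tape_acts: "nonzero (tape_acts S j as)"
  by (induction as arbitrary: j) (auto simp: SKIP_def tape_act_def intro!: nonzero_sw)

lemma regs_extend: "2 + 3 * k \<le> R \<Longrightarrow> regs R (extend k)"
  by (induction k) (auto simp: SKIP_def)

lemma nonzero_extend: "nonzero (extend k)"
  by (induction k) (auto simp: SKIP_def)

lemma regs_read_tapes: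
  assumes "2 + 3 * (j + m) \<le> R" "0 < S" "set ss \<subseteq> {..<S}"
    "\<And>ss'. length ss' = length ss + m \<Longrightarrow> set ss' \<subseteq> {..<S} \<Longrightarrow> regs R (F ss')"
  shows "regs R (read_tapes S m j ss F)"
  using assms
proof (induction m arbitrary: j ss)
  case (Suc m)
  show ?case
    unfolding read_tapes.simps
  proof (rule regs_sw)
    fix a assume "a \<le> S"
    then show "regs R (read_tapes S m (Suc j) (ss @ [a - 1]) F)"
      using Suc.prems by (intro Suc.IH) auto
  qed (use Suc.prems in auto)
qed auto

lemma nonzero_read_tapes: "(\<And>ss. nonzero (F ss)) \<Longrightarrow> nonzero (read_tapes S m j ss F)"
  by (induction m arbitrary: j ss) (auto intro!: nonzero_sw)

lemma regs_sim:
  assumes "wf_tm M"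
  shows "regs (2 + 3 * num_tapes M) (sim M)"
proof -
  have k: "0 < num_tapes M" and S: "0 < num_syms M" using assms by (auto simp: wf_tm_def)
  have fr: "frag (num_tapes M) (num_syms M) M" using assms by (simp add: frag_def)
  have "regs (2 + 3 * num_tapes M) (sim_trans M a)" if "0 < a" "a \<le> num_states M" for a
    unfolding sim_trans_def
  proof (rule regs_read_tapes)
    fix ss :: "nat list" assume ss: "length ss = length [] + num_tapes M" "set ss \<subseteq> {..<num_syms M}"
    have "length (snd (trans M (a - 1) ss)) = num_tapes M"
      by (rule fragD(2)[OF fr]) (use that ss in auto)
    then show "regs (2 + 3 * num_tapes M) (POP 1 ;; PUSH 1 (fst (trans M (a - 1) ss) + 1) ;;
        tape_acts (num_syms M) 0 (snd (trans M (a - 1) ss)))"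
      by (auto intro!: regs_tape_acts)
  qed (use S in auto)
  then show ?thesis
    using k unfolding sim_def transfer_def sim_run_def sim_step_def sim_drop_def sim_out_def
    by (auto intro!: regs_sw regs_extend simp: SKIP_def)
qed

lemma nonzero_sim: "nonzero (sim M)"
proof -
  have "nonzero (transfer n (\<lambda>a. a) i j)" "nonzero (transfer n Suc i j)" for n i j
    unfolding transfer_def by (auto intro!: nonzero_sw)
  moreover have "nonzero (sim_run M)"
    unfolding sim_run_def sim_step_def sim_trans_def
    by (auto intro!: nonzero_sw nonzero_read_tapes nonzero_tape_acts nonzero_extend simp: SKIP_def)
  ultimately show ?thesis
    unfolding sim_def sim_drop_def sim_out_def by simp
qed

text \<open>A calling convention: argument and result sit in stack 0, the scratch stacks below
  \<open>R\<close> are empty before and after, and all other stacks are preserved. So programs can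
  be chained, and a caller may keep data from stack \<open>R\<close> on.\<close>

definition fn :: "com \<Rightarrow> nat \<Rightarrow> bool list \<Rightarrow> bool list \<Rightarrow> nat \<Rightarrow> bool" where
  "fn c R x y T \<longleftrightarrow> (\<forall>s. s 0 = bits x \<longrightarrow> (\<forall>i. 0 < i \<and> i < R \<longrightarrow> s i = []) \<longrightarrow> ex c s T (s(0 := bits y)))"

lemma fnD: "fn c R x y T \<Longrightarrow> s 0 = bits x \<Longrightarrow> (\<And>i. 0 < i \<Longrightarrow> i < R \<Longrightarrow> s i = []) \<Longrightarrow> ex c s T (s(0 := bits y))"
  unfolding fn_def by blast

lemma fn_mono: "fn c R x y T \<Longrightarrow> R \<le> R' \<Longrightarrow> T \<le> T' \<Longrightarrow> fn c R' x y T'"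
  unfolding fn_def by (meson ex_mono order_less_le_trans)

lemma fn_length: assumes "fn c R x y T" shows "length y \<le> length x + T"
proof -
  have "ex c ((\<lambda>_. [])(0 := bits x)) T (((\<lambda>_. [])(0 := bits x))(0 := bits y))"
    by (rule fnD[OF assms]) auto
  from ex_growth[OF this, of 0] show ?thesis by simp
qed

lemma fn_seq:
  assumes "fn c1 R x y T1" "fn c2 R y z T2"
  shows "fn (c1 ;; c2) R x z (T1 + T2)"
  unfolding fn_def
proof (intro allI impI)
  fix s :: store assume s: "s 0 = bits x" "\<forall>i. 0 < i \<and> i < R \<longrightarrow> s i = []"
  have 1: "ex c1 s T1 (s(0 := bits y))" using fnD[OF assms(1)] s by auto
  have "ex c2 (s(0 := bits y)) T2 ((s(0 := bits y))(0 := bits z))"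
    by (rule fnD[OF assms(2)]) (use s in auto)
  then have 2: "ex c2 (s(0 := bits y)) T2 (s(0 := bits z))" by (simp only: fun_upd_upd)
  show "ex (c1 ;; c2) s (T1 + T2) (s(0 := bits z))" by (rule ex_seq[OF 1 2]) simp
qed

theorem fn_computes:
  "\<exists>M. wf_tm M \<and> (\<forall>x y T. fn c R x y T \<longrightarrow> computes_within M x y (real (T + 5 * length x + 2 * length y + 5)))"
proof -
  from stack_program_computes[of c] obtain M where wf: "wf_tm M" and M: "\<And>x y t s'.
     exec c ((\<lambda>_. [])(0 := bits x)) t s' \<Longrightarrow> s' 0 = bits y \<Longrightarrow>
     computes_within M x y (real (t + 5 * length x + 2 * length y + 5))" by blast
  have "computes_within M x y (real (T + 5 * length x + 2 * length y + 5))" if fn: "fn c R x y T" for x y T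
  proof -
    have "ex c ((\<lambda>_. [])(0 := bits x)) T (((\<lambda>_. [])(0 := bits x))(0 := bits y))"
      by (rule fnD[OF fn]) auto
    then obtain t where t: "t \<le> T" "exec c ((\<lambda>_. [])(0 := bits x)) t (((\<lambda>_. [])(0 := bits x))(0 := bits y))"
      by (auto simp: ex_def)
    have "computes_within M x y (real (t + 5 * length x + 2 * length y + 5))"
      by (rule M[OF t(2)]) simp
    with t(1) show ?thesis unfolding computes_within_def by (meson of_nat_mono add_le_mono1 order_trans)
  qed
  with wf show ?thesis by blast
qed

text \<open>A simulation leaves its scratch stacks dirty, so they are cleared afterwards. Their
  lengths are bounded by the running time and no 0 on them hides the rest, so the total cost remains
  linear.\<close>

theorem fn_sim:
  assumes wf: "wf_tm M"
  obtains c R C where "\<And>x y T. computes_within M x y T \<Longrightarrow> \<exists>t. real t \<le> T \<and> fn c R x y (C * (t + length x + 1))"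
proof -
  obtain C where C: "\<And>x y T s. computes_within M x y T \<Longrightarrow> s 0 = bits x \<Longrightarrow>
     (\<forall>i. 0 < i \<and> i < 2 + 3 * num_tapes M \<longrightarrow> s i = []) \<Longrightarrow>
     \<exists>s' t. real t \<le> T \<and> ex (sim M) s (C * (t + length x + 1)) s' \<and> s' 0 = bits y"
    using ex_sim[OF wf] by blast
  define n where "n = 1 + 3 * num_tapes M"
  define c where "c = sim M ;; clear_all n"
  define D where "D = C + n * (2 * C + 1) + 3"
  have "\<exists>t. real t \<le> T \<and> fn c (Suc n) x y (D * (t + length x + 1))" if cw: "computes_within M x y T" for x y T
  proof -
    \<comment> \<open>\<open>fn\<close> asks for one bound that serves all stores, whereas the
      simulation yields a step count for each store; the floor of \<open>T\<close> dominates them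
      all.\<close>
    define t where "t = nat \<lfloor>T\<rfloor>"
    have T0: "0 \<le> T" using cw by (auto simp: computes_within_def intro: order_trans[rotated])
    then have "real t \<le> T" by (simp add: t_def)
    moreover have "fn c (Suc n) x y (D * (t + length x + 1))"
      unfolding fn_def
    proof (intro allI impI)
      fix s :: store assume s: "s 0 = bits x" "\<forall>i. 0 < i \<and> i < Suc n \<longrightarrow> s i = []"
      have "\<forall>i. 0 < i \<and> i < 2 + 3 * num_tapes M \<longrightarrow> s i = []" using s(2) by (simp add: n_def)
      from C[OF cw s(1) this] obtain s' t' where s': "real t' \<le> T" "ex (sim M) s (C * (t' + length x + 1)) s'"
        "s' 0 = bits y" by blast
      have t': "t' \<le> t" using s'(1) T0 unfolding t_def by (simp add: le_nat_floor)
      let ?L = "C * (t' + length x + 1)"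
      have z: "0 \<notin> set (s' i) \<and> length (s' i) \<le> ?L" if "0 < i" "i \<le> n" for i
        using ex_nonzero[OF s'(2) nonzero_sim, of i] ex_growth[OF s'(2), of i] s(2) that by auto
      have cl: "ex (clear_all n) s' (n * (2 * ?L + 1) + 3) (\<lambda>i. if 0 < i \<and> i \<le> n then [] else s' i)"
        by (rule ex_clear_all) (rule z)
      have "(\<lambda>i. if 0 < i \<and> i \<le> n then [] else s' i) = s(0 := bits y)"
      proof
        fix i
        show "(if 0 < i \<and> i \<le> n then [] else s' i) = (s(0 := bits y)) i"
          using s(2) s'(3) ex_regs[OF s'(2) regs_sim[OF wf], of i] by (auto simp: n_def)
      qed
      with cl have 2: "ex (clear_all n) s' (n * (2 * ?L + 1) + 3) (s(0 := bits y))" by simp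
      have "ex c s (?L + (n * (2 * ?L + 1) + 3)) (s(0 := bits y))"
        unfolding c_def by (rule ex_seq[OF s'(2) 2]) simp
      moreover have "?L + (n * (2 * ?L + 1) + 3) \<le> D * (t + length x + 1)"
      proof -
        let ?m = "t + length x + 1"
        have L: "?L \<le> C * ?m" using t' by simp
        have A: "n * (2 * ?L + 1) \<le> n * (2 * (C * ?m) + ?m)"
          by (rule mult_le_mono2, rule add_mono, rule mult_le_mono2[OF L]) simp
        have B: "3 \<le> 3 * ?m" by simp
        have "?L + (n * (2 * ?L + 1) + 3) \<le> C * ?m + (n * (2 * (C * ?m) + ?m) + 3 * ?m)"
          by (rule add_mono[OF L add_mono[OF A B]])
        also have "\<dots> = D * ?m" by (simp add: D_def algebra_simps)
        finally show ?thesis .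
      qed
      ultimately show "ex c s (D * (t + length x + 1)) (s(0 := bits y))" by (rule ex_mono)
    qed
    ultimately show ?thesis by blast
  qed
  then show thesis by (rule that)
qed

section \<open>Functions of polynomial growth\<close>

definition pl :: "(nat \<Rightarrow> nat) \<Rightarrow> bool" where
  "pl P \<longleftrightarrow> (\<exists>k. \<forall>n. P n \<le> (n + 2) ^ k)"

lemma pl_le: "pl Q \<Longrightarrow> (\<And>n. P n \<le> Q n) \<Longrightarrow> pl P"
  unfolding pl_def by (meson order_trans)

lemma pl_const: "pl (\<lambda>_. c)"
proof -
  have "c \<le> (n + 2) ^ c" for n :: nat
  proof -
    have "c \<le> 2 ^ c" by (simp add: less_imp_le)
    also have "\<dots> \<le> (n + 2) ^ c" by (rule power_mono) auto
    finally show ?thesis .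
  qed
  then show ?thesis unfolding pl_def by blast
qed

lemma pl_id: "pl (\<lambda>n. n)"
  unfolding pl_def by (rule exI[of _ 1]) auto

text \<open>The base \<open>n + 2\<close> is at least 2 for every \<open>n\<close>, so the sum of
  two bounds is absorbed by one more factor.\<close>

lemma pl_add: assumes "pl P" "pl Q" shows "pl (\<lambda>n. P n + Q n)"
proof -
  from assms obtain a b where ab: "\<And>n. P n \<le> (n + 2) ^ a" "\<And>n. Q n \<le> (n + 2) ^ b"
    by (auto simp: pl_def)
  have "P n + Q n \<le> (n + 2) ^ Suc (a + b)" for n
  proof -
    have "(n + 2) ^ a \<le> (n + 2) ^ (a + b)" "(n + 2) ^ b \<le> (n + 2) ^ (a + b)"
      by (intro power_increasing; simp)+
    then have "P n + Q n \<le> 2 * (n + 2) ^ (a + b)" using ab[of n] by linarith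
    also have "\<dots> \<le> (n + 2) * (n + 2) ^ (a + b)" by (intro mult_le_mono1) auto
    finally show ?thesis by simp
  qed
  then show ?thesis unfolding pl_def by blast
qed

lemma pl_mult: assumes "pl P" "pl Q" shows "pl (\<lambda>n. P n * Q n)"
proof -
  from assms obtain a b where ab: "\<And>n. P n \<le> (n + 2) ^ a" "\<And>n. Q n \<le> (n + 2) ^ b"
    by (auto simp: pl_def)
  have "P n * Q n \<le> (n + 2) ^ (a + b)" for n
    unfolding power_add by (intro mult_le_mono ab)
  then show ?thesis unfolding pl_def by blast
qed

lemma pl_power: "pl P \<Longrightarrow> pl (\<lambda>n. P n ^ k)"
  by (induction k) (auto intro: pl_const pl_mult)

lemma pl_comp: assumes "pl P" "pl Q" shows "pl (\<lambda>n. P (Q n))"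
proof -
  from assms obtain a where a: "\<And>n. P n \<le> (n + 2) ^ a" by (auto simp: pl_def)
  show ?thesis
    by (rule pl_le[of "\<lambda>n. (Q n + 2) ^ a"]) (rule pl_power pl_add assms pl_const a)+
qed

lemmas pl_intros = pl_const pl_id pl_add pl_mult pl_power

lemma pl_Suc: "pl P \<Longrightarrow> pl (\<lambda>n. Suc (P n))"
  using pl_add[of P "\<lambda>_. 1"] pl_const by simp

lemma pl_poly_bound: "pl (poly_bound c)"
  unfolding poly_bound_def by (intro pl_intros)

text \<open>For positive \<open>n\<close> the base \<open>n + 2\<close> is at most
  \<open>3 * n\<close>; at 0 the additive constant of \<open>poly_bound\<close> takes over.\<close>

lemma poly_bound_ge: assumes "pl P" shows "\<exists>c. \<forall>n. P n \<le> poly_bound c n"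
proof -
  from assms obtain k where k: "\<And>n. P n \<le> (n + 2) ^ k" by (auto simp: pl_def)
  have "(n + 2) ^ k \<le> poly_bound (3 ^ k + k) n" for n :: nat
  proof (cases "n = 0")
    case True
    have "(2::nat) ^ k \<le> 3 ^ k" by (rule power_mono) auto
    with True show ?thesis by (simp add: poly_bound_def numeral_2_eq_2)
  next
    case False
    then have "(n + 2) ^ k \<le> (3 * n) ^ k" by (intro power_mono) auto
    also have "\<dots> = 3 ^ k * n ^ k" by (simp add: power_mult_distrib)
    also have "\<dots> \<le> (3 ^ k + k) * n ^ (3 ^ k + k)"
      using False by (intro mult_le_mono power_increasing) auto
    finally show ?thesis by (simp add: poly_bound_def)
  qed
  with k show ?thesis by (meson order_trans)
qed

text \<open>The index type restricts the inputs to those that encode an object; nothing is required for other strings.\<close>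

definition pc :: "('i \<Rightarrow> bool list) \<Rightarrow> ('i \<Rightarrow> bool list) \<Rightarrow> bool" where
  "pc u v \<longleftrightarrow> (\<exists>c R k. \<forall>i. fn c R (u i) (v i) ((length (u i) + 2) ^ k))"

lemma pcI: assumes "pl P" "\<And>i. fn c R (u i) (v i) (P (length (u i)))" shows "pc u v"
proof -
  from assms(1) obtain k where "\<And>n. P n \<le> (n + 2) ^ k" by (auto simp: pl_def)
  with assms(2) have "\<forall>i. fn c R (u i) (v i) ((length (u i) + 2) ^ k)" by (meson fn_mono order_refl)
  then show ?thesis unfolding pc_def by blast
qed

lemma pcE:
  assumes "pc u v"
  obtains c R P where "pl P" "mono P" "\<And>i. fn c R (u i) (v i) (P (length (u i)))" "\<And>i. length (v i) \<le> P (length (u i))"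
proof -
  from assms obtain c R k where c: "\<And>i. fn c R (u i) (v i) ((length (u i) + 2) ^ k)" by (auto simp: pc_def)
  define P where "P n = n + (n + 2) ^ k" for n :: nat
  have "pl P" unfolding P_def by (intro pl_intros)
  moreover have "mono P" unfolding P_def by (intro monoI add_mono power_mono) auto
  moreover have "fn c R (u i) (v i) (P (length (u i)))" for i
    using c by (rule fn_mono) (auto simp: P_def)
  moreover have "length (v i) \<le> P (length (u i))" for i
    using fn_length[OF c[of i]] by (simp add: P_def)
  ultimately show thesis by (rule that)
qed

lemma pc_length: "pc u v \<Longrightarrow> \<exists>P. pl P \<and> mono P \<and> (\<forall>i. length (v i) \<le> P (length (u i)))"
  by (metis pcE)

lemma pc_reindex: "pc u v \<Longrightarrow> pc (\<lambda>j. u (h j)) (\<lambda>j. v (h j))"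
  unfolding pc_def by blast

lemma pc_id: "pc u u"
proof (rule pcI)
  show "pl (\<lambda>_. 3)" by (rule pl_const)
  show "fn SKIP 0 (u i) (u i) 3" for i
    unfolding fn_def by (auto intro: ex_skip simp: fun_upd_idem)
qed

lemma pc_comp: assumes "pc u v" "pc v w" shows "pc u w"
proof -
  from assms(1) obtain c1 R1 P1 where 1: "pl P1" "mono P1" "\<And>i. fn c1 R1 (u i) (v i) (P1 (length (u i)))"
    "\<And>i. length (v i) \<le> P1 (length (u i))" by (rule pcE) blast
  from assms(2) obtain c2 R2 P2 where 2: "pl P2" "mono P2" "\<And>i. fn c2 R2 (v i) (w i) (P2 (length (v i)))"
    "\<And>i. length (w i) \<le> P2 (length (v i))" by (rule pcE) blast
  show ?thesis
  proof (rule pcI)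
    show "pl (\<lambda>n. P1 n + P2 (P1 n))" by (rule pl_add[OF 1(1) pl_comp[OF 2(1) 1(1)]])
    show "fn (c1 ;; c2) (max R1 R2) (u i) (w i) (P1 (length (u i)) + P2 (P1 (length (u i))))" for i
    proof (rule fn_seq)
      show "fn c1 (max R1 R2) (u i) (v i) (P1 (length (u i)))" by (rule fn_mono[OF 1(3)]) auto
      show "fn c2 (max R1 R2) (v i) (w i) (P2 (P1 (length (u i))))"
        by (rule fn_mono[OF 2(3)]) (use monoD[OF 2(2) 1(4)] in auto)
    qed
  qed
qed

text \<open>\<open>R\<close> is chosen above the scratch stacks of the programs that are called, so
  stacks \<open>R\<close> and \<open>Suc R\<close> can hold two strings while a program runs on
  stack 0.\<close>

definition st3 :: "store \<Rightarrow> nat \<Rightarrow> bool list \<Rightarrow> bool list \<Rightarrow> bool list \<Rightarrow> store" where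
  "st3 s R u v w = s(0 := bits u, R := bits v, Suc R := bits w)"

definition move :: "nat \<Rightarrow> nat \<Rightarrow> com" where
  "move i j = transfer 2 (\<lambda>a. a) i j"

lemma ex_move:
  assumes "s i = bits u" "s j = bits v" "i \<noteq> j" "s' = s(i := [], j := bits (rev u @ v))" "6 * length u + 1 \<le> T"
  shows "ex (move i j) s T s'"
proof -
  have "ex (transfer 2 (\<lambda>a. a) i j) s T (s(i := [], j := map (\<lambda>a. a) (rev (s i)) @ s j))"
    by (rule ex_transfer) (use assms bits_subset[of u] in auto)
  with assms show ?thesis by (simp add: move_def)
qed

lemma st3_moves:
  assumes "0 < R"
  shows "6 * length u + 1 \<le> T \<Longrightarrow> ex (move 0 R) (st3 s R u v w) T (st3 s R [] (rev u @ v) w)"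
    "6 * length u + 1 \<le> T \<Longrightarrow> ex (move 0 (Suc R)) (st3 s R u v w) T (st3 s R [] v (rev u @ w))"
    "6 * length v + 1 \<le> T \<Longrightarrow> ex (move R 0) (st3 s R u v w) T (st3 s R (rev v @ u) [] w)"
    "6 * length w + 1 \<le> T \<Longrightarrow> ex (move (Suc R) 0) (st3 s R u v w) T (st3 s R (rev w @ u) v [])"
  by (rule ex_move[of _ _ u _ v] ex_move[of _ _ u _ w] ex_move[of _ _ v _ u] ex_move[of _ _ w _ u];
      use assms in \<open>auto simp: st3_def fun_eq_iff\<close>)+

lemma st3_clear:
  assumes "0 < R"
  shows "2 * length u + 1 \<le> T \<Longrightarrow> ex (clear 0) (st3 s R u v w) T (st3 s R [] v w)"
    "2 * length v + 1 \<le> T \<Longrightarrow> ex (clear R) (st3 s R u v w) T (st3 s R u [] w)"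
proof -
  have 1: "(st3 s R u v w)(0 := []) = st3 s R [] v w" "(st3 s R u v w)(R := []) = st3 s R u [] w"
    "st3 s R u v w 0 = bits u" "st3 s R u v w R = bits v"
    using assms by (auto simp: st3_def fun_eq_iff)
  show "2 * length u + 1 \<le> T \<Longrightarrow> ex (clear 0) (st3 s R u v w) T (st3 s R [] v w)"
    using ex_clear[of "st3 s R u v w" 0 T] by (simp only: 1 bits_simps zero_notin_bits simp_thms)
  show "2 * length v + 1 \<le> T \<Longrightarrow> ex (clear R) (st3 s R u v w) T (st3 s R u [] w)"
    using ex_clear[of "st3 s R u v w" R T] by (simp only: 1 bits_simps zero_notin_bits simp_thms)
qed

lemma st3_fn:
  assumes "fn c R' u y T" "R' \<le> R" "0 < R" "\<forall>i. 0 < i \<and> i < R \<longrightarrow> s i = []"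
  shows "ex c (st3 s R u v w) T (st3 s R y v w)"
proof -
  have "ex c (st3 s R u v w) T ((st3 s R u v w)(0 := bits y))"
    by (rule fnD[OF assms(1)]) (use assms in \<open>auto simp: st3_def\<close>)
  moreover have "(st3 s R u v w)(0 := bits y) = st3 s R y v w"
    using assms(3) by (auto simp: st3_def fun_eq_iff)
  ultimately show ?thesis by simp
qed

lemma fn_st3:
  assumes "0 < R" "\<And>s. \<forall>i. 0 < i \<and> i < R \<longrightarrow> s i = [] \<Longrightarrow> ex c (st3 s R x [] []) T (st3 s R y [] [])"
  shows "fn c (Suc (Suc R)) x y T"
  unfolding fn_def
proof (intro allI impI)
  fix s :: store assume s: "s 0 = bits x" "\<forall>i. 0 < i \<and> i < Suc (Suc R) \<longrightarrow> s i = []"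
  have "st3 s R x [] [] = s" "st3 s R y [] [] = s(0 := bits y)"
    using s assms(1) by (auto simp: st3_def fun_eq_iff)
  with assms(2)[of s] s(2) show "ex c s T (s(0 := bits y))" by simp
qed

definition dup :: "nat \<Rightarrow> com" where
  "dup R = UNTIL 0 0 (sw 2 0 (\<lambda>a. POP 0 ;; PUSH R a ;; PUSH (Suc R) a)) ;; move R 0"

lemma st3_dup_loop:
  assumes "0 < R"
  shows "ex (UNTIL 0 0 (sw 2 0 (\<lambda>a. POP 0 ;; PUSH R a ;; PUSH (Suc R) a))) (st3 s R u v w)
     (8 * length u + 1) (st3 s R [] (rev u @ v) (rev u @ w))"
proof (induction u arbitrary: v w)
  case Nil
  show ?case by (simp, rule ex_until_stop) (use assms in \<open>auto simp: st3_def\<close>)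
next
  case (Cons b u)
  let ?a = "if b then 2 else 1 :: nat"
  have 0: "st3 s R (b # u) v w 0 = ?a # bits u" using assms by (simp add: st3_def)
  have 1: "ex (POP 0) (st3 s R (b # u) v w) 1 (st3 s R u v w)"
    by (rule ex_pop[of _ 0 ?a "bits u"]) (use 0 assms in \<open>auto simp: st3_def fun_eq_iff\<close>)
  have 2: "ex (PUSH R ?a) (st3 s R u v w) 2 (st3 s R u (b # v) w)"
    by (rule ex_push) (use assms in \<open>auto simp: st3_def fun_eq_iff\<close>)
  have 3: "ex (PUSH (Suc R) ?a) (st3 s R u (b # v) w) 2 (st3 s R u (b # v) (b # w))"
    by (rule ex_push) (use assms in \<open>auto simp: st3_def fun_eq_iff\<close>)
  have "ex (POP 0 ;; PUSH R ?a ;; PUSH (Suc R) ?a) (st3 s R (b # u) v w) 5 (st3 s R u (b # v) (b # w))"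
    by (rule ex_seq[OF 1 ex_seq[OF 2 3 order_refl]]) simp
  then have 4: "ex (sw 2 0 (\<lambda>a. POP 0 ;; PUSH R a ;; PUSH (Suc R) a)) (st3 s R (b # u) v w) 7 (st3 s R u (b # v) (b # w))"
    by (intro ex_sw[of _ _ _ _ 5]) (simp_all add: 0)
  have p: "peek (st3 s R (b # u) v w 0) \<noteq> 0" by (simp add: 0)
  show ?case
    by (rule ex_until_step[OF p 4]) (use Cons[of "b # v" "b # w"] in auto)
qed

lemma st3_dup:
  assumes "0 < R" "14 * length u + 2 \<le> T"
  shows "ex (dup R) (st3 s R u [] []) T (st3 s R u [] (rev u))"
proof -
  have 1: "ex (UNTIL 0 0 (sw 2 0 (\<lambda>a. POP 0 ;; PUSH R a ;; PUSH (Suc R) a))) (st3 s R u [] [])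
     (8 * length u + 1) (st3 s R [] (rev u) (rev u))"
    using st3_dup_loop[OF assms(1), of s u "[]" "[]"] by simp
  have 2: "ex (move R 0) (st3 s R [] (rev u) (rev u)) (6 * length u + 1) (st3 s R u [] (rev u))"
    using st3_moves(3)[OF assms(1), of "rev u" "6 * length u + 1" s "[]"] by simp
  show ?thesis unfolding dup_def by (rule ex_seq[OF 1 2]) (use assms(2) in simp)
qed

text \<open>Strings grow at the front, so \<open>w\<close> is computed first and parked, and
  \<open>v\<close> is put on top of it at the end. Each move reverses a string; the order of moves
  makes all reversals cancel.\<close>

lemma pc_append:
  assumes "pc u v" "pc u w"
  shows "pc u (\<lambda>i. v i @ w i)"
proof -
  from assms(1) obtain c1 R1 P1 where 1: "pl P1" "mono P1" "\<And>i. fn c1 R1 (u i) (v i) (P1 (length (u i)))"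
    "\<And>i. length (v i) \<le> P1 (length (u i))" by (rule pcE) blast
  from assms(2) obtain c2 R2 P2 where 2: "pl P2" "mono P2" "\<And>i. fn c2 R2 (u i) (w i) (P2 (length (u i)))"
    "\<And>i. length (w i) \<le> P2 (length (u i))" by (rule pcE) blast
  define R where "R = Suc (max R1 R2)"
  define c where "c = dup R ;; c2 ;; move 0 R ;; move (Suc R) 0 ;; c1 ;; move 0 (Suc R) ;; move R 0 ;; move (Suc R) 0"
  have R: "0 < R" "R1 \<le> R" "R2 \<le> R" by (auto simp: R_def)
  show ?thesis
  proof (rule pcI)
    show "pl (\<lambda>n. 14 * n + 2 + (P2 n + (6 * P2 n + 1 + (6 * n + 1 + (P1 n + (6 * P1 n + 1 + (6 * P2 n + 1 + (6 * P1 n + 1))))))))"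
      by (intro pl_intros 1 2)
    fix i
    let ?n = "length (u i)"
    show "fn c (Suc (Suc R)) (u i) (v i @ w i) (14 * ?n + 2 + (P2 ?n + (6 * P2 ?n + 1 + (6 * ?n + 1 +
       (P1 ?n + (6 * P1 ?n + 1 + (6 * P2 ?n + 1 + (6 * P1 ?n + 1))))))))"
    proof (rule fn_st3[OF R(1)])
      fix s :: store assume s: "\<forall>i. 0 < i \<and> i < R \<longrightarrow> s i = []"
      have m: "ex (move 0 R) (st3 s R (w i) [] (rev (u i))) (6 * P2 ?n + 1) (st3 s R [] (rev (w i)) (rev (u i)))"
        using st3_moves(1)[OF R(1), of "w i" "6 * P2 ?n + 1" s "[]"] 2(4)[of i] by simp
      have m2: "ex (move (Suc R) 0) (st3 s R [] (rev (w i)) (rev (u i))) (6 * ?n + 1) (st3 s R (u i) (rev (w i)) [])"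
        using st3_moves(4)[OF R(1), of "rev (u i)" "6 * ?n + 1" s "[]"] by simp
      have m3: "ex (move 0 (Suc R)) (st3 s R (v i) (rev (w i)) []) (6 * P1 ?n + 1) (st3 s R [] (rev (w i)) (rev (v i)))"
        using st3_moves(2)[OF R(1), of "v i" "6 * P1 ?n + 1" s _ "[]"] 1(4)[of i] by simp
      have m4: "ex (move R 0) (st3 s R [] (rev (w i)) (rev (v i))) (6 * P2 ?n + 1) (st3 s R (w i) [] (rev (v i)))"
        using st3_moves(3)[OF R(1), of "rev (w i)" "6 * P2 ?n + 1" s "[]"] 2(4)[of i] by simp
      have m5: "ex (move (Suc R) 0) (st3 s R (w i) [] (rev (v i))) (6 * P1 ?n + 1) (st3 s R (v i @ w i) [] [])"
        using st3_moves(4)[OF R(1), of "rev (v i)" "6 * P1 ?n + 1" s "w i"] 1(4)[of i] by simp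
      show "ex c (st3 s R (u i) [] []) (14 * ?n + 2 + (P2 ?n + (6 * P2 ?n + 1 + (6 * ?n + 1 +
         (P1 ?n + (6 * P1 ?n + 1 + (6 * P2 ?n + 1 + (6 * P1 ?n + 1)))))))) (st3 s R (v i @ w i) [] [])"
        unfolding c_def
        by (rule ex_seq[OF st3_dup[OF R(1) order_refl] ex_seq[OF st3_fn[OF 2(3) R(3) R(1) s] ex_seq[OF m ex_seq[OF m2
           ex_seq[OF st3_fn[OF 1(3) R(2) R(1) s] ex_seq[OF m3 ex_seq[OF m4 m5 order_refl] order_refl] order_refl]
           order_refl] order_refl] order_refl] order_refl])
    qed
  qed
qed

definition tt :: "bool list \<Rightarrow> bool" where
  "tt w \<longleftrightarrow> w \<noteq> [] \<and> hd w"

lemma tt_simps [simp]: "\<not> tt []" "tt (b # w) \<longleftrightarrow> b"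
  by (simp_all add: tt_def)

lemma pc_if:
  assumes "pc u b" "pc u v" "pc u w"
  shows "pc u (\<lambda>i. if tt (b i) then v i else w i)"
proof -
  from assms(1) obtain c0 R0 P0 where 0: "pl P0" "mono P0" "\<And>i. fn c0 R0 (u i) (b i) (P0 (length (u i)))"
    "\<And>i. length (b i) \<le> P0 (length (u i))" by (rule pcE) blast
  from assms(2) obtain c1 R1 P1 where 1: "pl P1" "mono P1" "\<And>i. fn c1 R1 (u i) (v i) (P1 (length (u i)))"
    "\<And>i. length (v i) \<le> P1 (length (u i))" by (rule pcE) blast
  from assms(3) obtain c2 R2 P2 where 2: "pl P2" "mono P2" "\<And>i. fn c2 R2 (u i) (w i) (P2 (length (u i)))"
    "\<And>i. length (w i) \<le> P2 (length (u i))" by (rule pcE) blast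
  define R where "R = Suc (max R0 (max R1 R2))"
  define c where "c = dup R ;; c0 ;; IFTOP 0 2 (clear 0 ;; move (Suc R) 0 ;; c1) (clear 0 ;; move (Suc R) 0 ;; c2)"
  have R: "0 < R" "R0 \<le> R" "R1 \<le> R" "R2 \<le> R" by (auto simp: R_def)
  show ?thesis
  proof (rule pcI)
    show "pl (\<lambda>n. 14 * n + 2 + (P0 n + (2 * P0 n + 1 + (6 * n + 1 + (P1 n + P2 n)) + 1)))"
      by (intro pl_intros 0 1 2)
    fix i
    let ?n = "length (u i)"
    show "fn c (Suc (Suc R)) (u i) (if tt (b i) then v i else w i)
       (14 * ?n + 2 + (P0 ?n + (2 * P0 ?n + 1 + (6 * ?n + 1 + (P1 ?n + P2 ?n)) + 1)))"
    proof (rule fn_st3[OF R(1)])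
      fix s :: store assume s: "\<forall>i. 0 < i \<and> i < R \<longrightarrow> s i = []"
      have cl: "ex (clear 0) (st3 s R (b i) [] (rev (u i))) (2 * P0 ?n + 1) (st3 s R [] [] (rev (u i)))"
        using st3_clear(1)[OF R(1), of "b i" "2 * P0 ?n + 1" s] 0(4)[of i] by simp
      have m: "ex (move (Suc R) 0) (st3 s R [] [] (rev (u i))) (6 * ?n + 1) (st3 s R (u i) [] [])"
        using st3_moves(4)[OF R(1), of "rev (u i)" "6 * ?n + 1" s "[]"] by simp
      have e1: "ex c1 (st3 s R (u i) [] []) (P1 ?n + P2 ?n) (st3 s R (v i) [] [])"
        by (rule ex_mono[OF st3_fn[OF 1(3) R(3) R(1) s]]) simp
      have e2: "ex c2 (st3 s R (u i) [] []) (P1 ?n + P2 ?n) (st3 s R (w i) [] [])"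
        by (rule ex_mono[OF st3_fn[OF 2(3) R(4) R(1) s]]) simp
      have "peek (st3 s R (b i) [] (rev (u i)) 0) = 2 \<longleftrightarrow> tt (b i)"
        using R(1) by (cases "b i") (auto simp: st3_def)
      then have "if peek (st3 s R (b i) [] (rev (u i)) 0) = 2
         then ex (clear 0 ;; move (Suc R) 0 ;; c1) (st3 s R (b i) [] (rev (u i))) (2 * P0 ?n + 1 + (6 * ?n + 1 + (P1 ?n + P2 ?n)))
             (st3 s R (if tt (b i) then v i else w i) [] [])
         else ex (clear 0 ;; move (Suc R) 0 ;; c2) (st3 s R (b i) [] (rev (u i))) (2 * P0 ?n + 1 + (6 * ?n + 1 + (P1 ?n + P2 ?n)))
             (st3 s R (if tt (b i) then v i else w i) [] [])"
        using ex_seq[OF cl ex_seq[OF m e1 order_refl] order_refl] ex_seq[OF cl ex_seq[OF m e2 order_refl] order_refl]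
        by simp
      from ex_if[OF this order_refl]
      show "ex c (st3 s R (u i) [] []) (14 * ?n + 2 + (P0 ?n + (2 * P0 ?n + 1 + (6 * ?n + 1 + (P1 ?n + P2 ?n)) + 1)))
         (st3 s R (if tt (b i) then v i else w i) [] [])"
        unfolding c_def
        by (intro ex_seq[OF st3_dup[OF R(1) order_refl] ex_seq[OF st3_fn[OF 0(3) R(2) R(1) s] _ order_refl] order_refl])
    qed
  qed
qed

lemma pc_Nil: "pc u (\<lambda>_. [])"
proof (rule pcI)
  show "pl (\<lambda>n. 2 * n + 1)" by (intro pl_intros)
  show "fn (clear 0) 0 (u i) [] (2 * length (u i) + 1)" for i
    unfolding fn_def by (auto intro!: ex_clear)
qed

lemma pc_Cons: assumes "pc u v" shows "pc u (\<lambda>i. b # v i)"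
proof (rule pc_comp[OF assms pcI])
  show "pl (\<lambda>_. 2)" by (rule pl_const)
  show "fn (PUSH 0 (if b then 2 else 1)) 0 (v i) (b # v i) 2" for i
    unfolding fn_def by (auto intro!: ex_push)
qed

lemma pc_const: "pc u (\<lambda>_. w)"
  by (induction w) (auto intro: pc_Nil pc_Cons)

lemma pc_tl: assumes "pc u v" shows "pc u (\<lambda>i. tl (v i))"
proof (rule pc_comp[OF assms pcI])
  show "pl (\<lambda>_. 1)" by (rule pl_const)
  show "fn (POP 0) 0 (v i) (tl (v i)) 1" for i
    unfolding fn_def
  proof (intro allI impI)
    fix s :: store assume s: "s 0 = bits (v i)"
    show "ex (POP 0) s 1 (s(0 := bits (tl (v i))))"
    proof (cases "v i")
      case Nil
      with s have "s(0 := bits (tl (v i))) = s" by (auto simp: fun_eq_iff)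
      with s Nil show ?thesis by (simp add: ex_pop_empty)
    next
      case (Cons b x)
      with s show ?thesis by (intro ex_pop[of s 0 "if b then 2 else 1" "bits x"]) auto
    qed
  qed
qed

definition comp1 :: "bool list \<Rightarrow> bool list" where
  "comp1 w = concat (map (\<lambda>b. [True, b]) w) @ [False]"

lemma tuple_simps: "tuple [] = []" "tuple (w # ws) = comp1 w @ tuple ws"
  by (simp_all add: tuple_def comp1_def)

lemma length_comp1: "length (comp1 w) = 2 * length w + 1"
  by (induction w) (auto simp: comp1_def)

lemma comp1_simps: "comp1 [] = [False]" "comp1 (b # w) = True # b # comp1 w"
  by (simp_all add: comp1_def)

definition comp1_loop :: "nat \<Rightarrow> com" where
  "comp1_loop R = UNTIL R 0 (sw 2 R (\<lambda>a. POP R ;; PUSH 0 a ;; PUSH 0 2))"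

lemma st3_comp1_loop:
  assumes "0 < R"
  shows "ex (comp1_loop R) (st3 s R u v w) (8 * length v + 1) (st3 s R (concat (map (\<lambda>b. [True, b]) (rev v)) @ u) [] w)"
proof (induction v arbitrary: u)
  case Nil
  show ?case unfolding comp1_loop_def by (simp, rule ex_until_stop) (use assms in \<open>auto simp: st3_def\<close>)
next
  case (Cons b v)
  let ?a = "if b then 2 else 1 :: nat"
  have 0: "st3 s R u (b # v) w R = ?a # bits v" using assms by (simp add: st3_def)
  have 1: "ex (POP R) (st3 s R u (b # v) w) 1 (st3 s R u v w)"
    by (rule ex_pop[of _ R ?a "bits v"]) (use 0 assms in \<open>auto simp: st3_def fun_eq_iff\<close>)
  have 2: "ex (PUSH 0 ?a) (st3 s R u v w) 2 (st3 s R (b # u) v w)"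
    by (rule ex_push) (use assms in \<open>auto simp: st3_def fun_eq_iff\<close>)
  have 3: "ex (PUSH 0 2) (st3 s R (b # u) v w) 2 (st3 s R (True # b # u) v w)"
    by (rule ex_push) (use assms in \<open>auto simp: st3_def fun_eq_iff\<close>)
  have "ex (POP R ;; PUSH 0 ?a ;; PUSH 0 2) (st3 s R u (b # v) w) 5 (st3 s R (True # b # u) v w)"
    by (rule ex_seq[OF 1 ex_seq[OF 2 3 order_refl]]) simp
  then have 4: "ex (sw 2 R (\<lambda>a. POP R ;; PUSH 0 a ;; PUSH 0 2)) (st3 s R u (b # v) w) 7 (st3 s R (True # b # u) v w)"
    by (intro ex_sw[of _ _ _ _ 5]) (simp_all add: 0)
  have p: "peek (st3 s R u (b # v) w R) \<noteq> 0" by (simp add: 0)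
  show ?case
    unfolding comp1_loop_def
    by (rule ex_until_step[OF p 4]) (use Cons[of "True # b # u"] in \<open>auto simp: comp1_loop_def\<close>)
qed

lemma pc_comp1: assumes "pc u v" shows "pc u (\<lambda>i. comp1 (v i))"
proof (rule pc_comp[OF assms pcI])
  show "pl (\<lambda>n. 6 * n + 1 + (2 + (8 * n + 1)))" by (intro pl_intros)
  fix i
  let ?n = "length (v i)"
  show "fn (move 0 1 ;; PUSH 0 1 ;; comp1_loop 1) (Suc (Suc 1)) (v i) (comp1 (v i)) (6 * ?n + 1 + (2 + (8 * ?n + 1)))"
  proof (rule fn_st3)
    fix s :: store
    have 1: "ex (move 0 1) (st3 s 1 (v i) [] []) (6 * ?n + 1) (st3 s 1 [] (rev (v i)) [])"
      using st3_moves(1)[of 1 "v i" _ s "[]" "[]"] by simp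
    have 2: "ex (PUSH 0 1) (st3 s 1 [] (rev (v i)) []) 2 (st3 s 1 [False] (rev (v i)) [])"
      by (rule ex_push) (auto simp: st3_def fun_eq_iff)
    have 3: "ex (comp1_loop 1) (st3 s 1 [False] (rev (v i)) []) (8 * ?n + 1) (st3 s 1 (comp1 (v i)) [] [])"
      using st3_comp1_loop[of 1 s "[False]" "rev (v i)" "[]"] by (simp add: comp1_def)
    show "ex (move 0 1 ;; PUSH 0 1 ;; comp1_loop 1) (st3 s 1 (v i) [] []) (6 * ?n + 1 + (2 + (8 * ?n + 1)))
        (st3 s 1 (comp1 (v i)) [] [])"
      by (rule ex_seq[OF 1 ex_seq[OF 2 3 order_refl] order_refl])
  qed simp
qed

text \<open>\<open>thd\<close> and \<open>ttl\<close> split a tuple into its first component and the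
  rest. They are total: on a malformed string a component that breaks off ends with the string, so
  decoders never check their input.\<close>

fun thd :: "bool list \<Rightarrow> bool list" where
  "thd (True # b # w) = b # thd w"
| "thd _ = []"

fun ttl :: "bool list \<Rightarrow> bool list" where
  "ttl (True # b # w) = ttl w"
| "ttl (False # w) = w"
| "ttl _ = []"

lemma thd_ttl: "thd (comp1 w @ x) = w" "ttl (comp1 w @ x) = x"
  by (induction w) (auto simp: comp1_simps)

lemma thd_ttl_tuple [simp]: "thd (tuple (w # ws)) = w" "ttl (tuple (w # ws)) = tuple ws"
  by (simp_all add: tuple_simps thd_ttl)

text \<open>A string that breaks off inside a component is completed by a bit \<open>False\<close>.
  So the loop always stops at a closing \<open>False\<close>, which is removed afterwards.\<close>

definition split_body :: com where
  "split_body = IFTOP 0 0 (PUSH 0 1) (POP 0 ;; IFTOP 0 0 SKIP (sw 2 0 (\<lambda>a. POP 0 ;; PUSH 1 a)))"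

lemma st3_split_loop:
  "ex (UNTIL 0 1 split_body) (st3 s 1 x v w) (10 * length x + 5) (st3 s 1 (False # ttl x) (rev (thd x) @ v) w)"
proof (induction x arbitrary: v rule: ttl.induct)
  case (1 b x)
  let ?a = "if b then 2 else 1 :: nat"
  have a: "ex (POP 0) (st3 s 1 (True # b # x) v w) 1 (st3 s 1 (b # x) v w)"
    by (rule ex_pop[of _ 0 2 "bits (b # x)"]) (auto simp: st3_def fun_eq_iff)
  have 0: "st3 s 1 (b # x) v w 0 = ?a # bits x" by (simp add: st3_def)
  have b: "ex (POP 0) (st3 s 1 (b # x) v w) 1 (st3 s 1 x v w)"
    by (rule ex_pop[of _ 0 ?a "bits x"]) (use 0 in \<open>auto simp: st3_def fun_eq_iff\<close>)
  have c: "ex (PUSH 1 ?a) (st3 s 1 x v w) 2 (st3 s 1 x (b # v) w)"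
    by (rule ex_push) (auto simp: st3_def fun_eq_iff)
  have "ex (POP 0 ;; PUSH 1 ?a) (st3 s 1 (b # x) v w) 3 (st3 s 1 x (b # v) w)"
    by (rule ex_seq[OF b c]) simp
  then have "ex (sw 2 0 (\<lambda>a. POP 0 ;; PUSH 1 a)) (st3 s 1 (b # x) v w) 5 (st3 s 1 x (b # v) w)"
    by (intro ex_sw[of _ _ _ _ 3]) (simp_all add: 0 del: One_nat_def)
  then have "ex (IFTOP 0 0 SKIP (sw 2 0 (\<lambda>a. POP 0 ;; PUSH 1 a))) (st3 s 1 (b # x) v w) 6 (st3 s 1 x (b # v) w)"
    by (intro ex_if[of _ _ _ _ 5]) (simp_all add: 0 del: One_nat_def)
  from ex_seq[OF a this, of 7]
  have d: "ex split_body (st3 s 1 (True # b # x) v w) 8 (st3 s 1 x (b # v) w)"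
    unfolding split_body_def by (intro ex_if[of _ _ _ _ 7]) (simp_all add: st3_def)
  have p: "peek (st3 s 1 (True # b # x) v w 0) \<noteq> 1" by (simp add: st3_def)
  have e: "ex (UNTIL 0 1 split_body) (st3 s 1 x (b # v) w) (10 * length x + 5)
      (st3 s 1 (False # ttl (True # b # x)) (rev (thd (True # b # x)) @ v) w)"
    using 1[of "b # v"] by simp
  show ?case by (rule ex_until_step[OF p d e]) simp
next
  case (2 x)
  show ?case by (simp, rule ex_until_stop) (auto simp: st3_def)
next
  case "3_1"
  have "ex (PUSH 0 1) (st3 s 1 [] v w) 2 (st3 s 1 [False] v w)"
    by (rule ex_push) (auto simp: st3_def fun_eq_iff)
  then have d: "ex split_body (st3 s 1 [] v w) 3 (st3 s 1 [False] v w)"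
    unfolding split_body_def by (intro ex_if[of _ _ _ _ 2]) (simp_all add: st3_def)
  have e: "ex (UNTIL 0 1 split_body) (st3 s 1 [False] v w) 1 (st3 s 1 [False] v w)"
    by (rule ex_until_stop) (auto simp: st3_def)
  have "ex (UNTIL 0 1 split_body) (st3 s 1 [] v w) 5 (st3 s 1 [False] v w)"
    by (rule ex_until_step[OF _ d e]) (auto simp: st3_def)
  then show ?case by simp
next
  case "3_2"
  have a: "ex (POP 0) (st3 s 1 [True] v w) 1 (st3 s 1 [] v w)"
    by (rule ex_pop[of _ 0 2 "[]"]) (auto simp: st3_def fun_eq_iff)
  have "ex (IFTOP 0 0 SKIP (sw 2 0 (\<lambda>a. POP 0 ;; PUSH 1 a))) (st3 s 1 [] v w) 4 (st3 s 1 [] v w)"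
    by (rule ex_if[of _ _ _ _ 3]) (auto simp: st3_def intro: ex_skip)
  from ex_seq[OF a this, of 5]
  have b: "ex split_body (st3 s 1 [True] v w) 6 (st3 s 1 [] v w)"
    unfolding split_body_def by (intro ex_if[of _ _ _ _ 5]) (simp_all add: st3_def)
  have "ex (PUSH 0 1) (st3 s 1 [] v w) 2 (st3 s 1 [False] v w)"
    by (rule ex_push) (auto simp: st3_def fun_eq_iff)
  then have d: "ex split_body (st3 s 1 [] v w) 3 (st3 s 1 [False] v w)"
    unfolding split_body_def by (intro ex_if[of _ _ _ _ 2]) (simp_all add: st3_def)
  have e: "ex (UNTIL 0 1 split_body) (st3 s 1 [False] v w) 1 (st3 s 1 [False] v w)"
    by (rule ex_until_stop) (auto simp: st3_def)
  have f: "ex (UNTIL 0 1 split_body) (st3 s 1 [] v w) 5 (st3 s 1 [False] v w)"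
    by (rule ex_until_step[OF _ d e]) (auto simp: st3_def)
  have "ex (UNTIL 0 1 split_body) (st3 s 1 [True] v w) 15 (st3 s 1 [False] v w)"
    by (rule ex_until_step[OF _ b f]) (auto simp: st3_def)
  then show ?case by simp
qed

lemma length_thd_ttl: "length (thd x) \<le> length x" "length (ttl x) \<le> length x"
  by (induction x rule: ttl.induct) auto

lemma pc_thd: assumes "pc u v" shows "pc u (\<lambda>i. thd (v i))"
proof (rule pc_comp[OF assms pcI])
  show "pl (\<lambda>n. 10 * n + 5 + (2 * n + 3 + (6 * n + 1)))" by (intro pl_intros)
  fix i
  let ?n = "length (v i)" and ?x = "v i"
  show "fn (UNTIL 0 1 split_body ;; clear 0 ;; move 1 0) (Suc (Suc 1)) ?x (thd ?x) (10 * ?n + 5 + (2 * ?n + 3 + (6 * ?n + 1)))"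
  proof (rule fn_st3)
    fix s :: store
    have 1: "ex (UNTIL 0 1 split_body) (st3 s 1 ?x [] []) (10 * ?n + 5) (st3 s 1 (False # ttl ?x) (rev (thd ?x)) [])"
      using st3_split_loop[of s ?x "[]" "[]"] by simp
    have 2: "ex (clear 0) (st3 s 1 (False # ttl ?x) (rev (thd ?x)) []) (2 * ?n + 3) (st3 s 1 [] (rev (thd ?x)) [])"
      by (rule st3_clear(1)) (use length_thd_ttl(2)[of ?x] in auto)
    have 3: "ex (move 1 0) (st3 s 1 [] (rev (thd ?x)) []) (6 * ?n + 1) (st3 s 1 (thd ?x) [] [])"
      using st3_moves(3)[of 1 "rev (thd ?x)" "6 * ?n + 1" s "[]"] length_thd_ttl(1)[of ?x] by simp
    show "ex (UNTIL 0 1 split_body ;; clear 0 ;; move 1 0) (st3 s 1 ?x [] []) (10 * ?n + 5 + (2 * ?n + 3 + (6 * ?n + 1))) (st3 s 1 (thd ?x) [] [])"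
      by (rule ex_seq[OF 1 ex_seq[OF 2 3 order_refl] order_refl])
  qed simp
qed

lemma pc_ttl: assumes "pc u v" shows "pc u (\<lambda>i. ttl (v i))"
proof (rule pc_comp[OF assms pcI])
  show "pl (\<lambda>n. 10 * n + 5 + (1 + (2 * n + 1)))" by (intro pl_intros)
  fix i
  let ?n = "length (v i)" and ?x = "v i"
  show "fn (UNTIL 0 1 split_body ;; POP 0 ;; clear 1) (Suc (Suc 1)) ?x (ttl ?x) (10 * ?n + 5 + (1 + (2 * ?n + 1)))"
  proof (rule fn_st3)
    fix s :: store
    have 1: "ex (UNTIL 0 1 split_body) (st3 s 1 ?x [] []) (10 * ?n + 5) (st3 s 1 (False # ttl ?x) (rev (thd ?x)) [])"
      using st3_split_loop[of s ?x "[]" "[]"] by simp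
    have 2: "ex (POP 0) (st3 s 1 (False # ttl ?x) (rev (thd ?x)) []) 1 (st3 s 1 (ttl ?x) (rev (thd ?x)) [])"
      by (rule ex_pop[of _ 0 1 "bits (ttl ?x)"]) (auto simp: st3_def fun_eq_iff)
    have 3: "ex (clear 1) (st3 s 1 (ttl ?x) (rev (thd ?x)) []) (2 * ?n + 1) (st3 s 1 (ttl ?x) [] [])"
      by (rule st3_clear(2)) (use length_thd_ttl(1)[of ?x] in auto)
    show "ex (UNTIL 0 1 split_body ;; POP 0 ;; clear 1) (st3 s 1 ?x [] []) (10 * ?n + 5 + (1 + (2 * ?n + 1))) (st3 s 1 (ttl ?x) [] [])"
      by (rule ex_seq[OF 1 ex_seq[OF 2 3 order_refl] order_refl])
  qed simp
qed

text \<open>Polynomially many polynomial-time steps can still blow up, for example if each one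
  squares the length. The bound \<open>B\<close> on all intermediate strings in terms of the
  original input excludes this. The length of \<open>n i\<close> is the loop counter; the step
  program sees only the current string, not the index \<open>(i, m)\<close>.\<close>

lemma pc_iter:
  assumes n: "pc u n" and init: "pc u (\<lambda>i. st i 0)"
    and step: "pc (\<lambda>(i, m). st i m) (\<lambda>(i, m). st i (Suc m))"
    and bound: "pl B" "\<And>i m. m \<le> length (n i) \<Longrightarrow> length (st i m) \<le> B (length (u i))"
  shows "pc u (\<lambda>i. st i (length (n i)))"
proof -
  from n obtain c0 R0 P0 where 0: "pl P0" "mono P0" "\<And>i. fn c0 R0 (u i) (n i) (P0 (length (u i)))"
    "\<And>i. length (n i) \<le> P0 (length (u i))" by (rule pcE) blast
  from init obtain c1 R1 P1 where 1: "pl P1" "mono P1" "\<And>i. fn c1 R1 (u i) (st i 0) (P1 (length (u i)))"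
    "\<And>i. length (st i 0) \<le> P1 (length (u i))" by (rule pcE) blast
  from step obtain c2 R2 P2 where 2: "pl P2" "mono P2"
    "\<And>j. fn c2 R2 (case j of (i, m) \<Rightarrow> st i m) (case j of (i, m) \<Rightarrow> st i (Suc m)) (P2 (length (case j of (i, m) \<Rightarrow> st i m)))"
    by (rule pcE) blast
  have c2: "fn c2 R2 (st i m) (st i (Suc m)) (P2 (length (st i m)))" for i m
    using 2(3)[of "(i, m)"] by simp
  define R where "R = Suc (max R0 (max R1 R2))"
  define c where "c = dup R ;; c0 ;; move 0 R ;; move (Suc R) 0 ;; c1 ;; UNTIL R 0 (POP R ;; c2)"
  have R: "0 < R" "R0 \<le> R" "R1 \<le> R" "R2 \<le> R" by (auto simp: R_def)
  show ?thesis
  proof (rule pcI)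
    show "pl (\<lambda>n. 14 * n + 2 + (P0 n + (6 * P0 n + 1 + (6 * n + 1 + (P1 n + (P0 n * (P2 (B n) + 2) + 1))))))"
      by (intro pl_intros 0 1 2 bound pl_comp[OF 2(1)])
    fix i
    let ?n = "length (u i)"
    show "fn c (Suc (Suc R)) (u i) (st i (length (n i)))
       (14 * ?n + 2 + (P0 ?n + (6 * P0 ?n + 1 + (6 * ?n + 1 + (P1 ?n + (P0 ?n * (P2 (B ?n) + 2) + 1))))))"
    proof (rule fn_st3[OF R(1)])
      fix s :: store assume s: "\<forall>i. 0 < i \<and> i < R \<longrightarrow> s i = []"
      have m: "ex (move 0 R) (st3 s R (n i) [] (rev (u i))) (6 * P0 ?n + 1) (st3 s R [] (rev (n i)) (rev (u i)))"
        using st3_moves(1)[OF R(1), of "n i" "6 * P0 ?n + 1" s "[]"] 0(4)[of i] by simp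
      have m2: "ex (move (Suc R) 0) (st3 s R [] (rev (n i)) (rev (u i))) (6 * ?n + 1) (st3 s R (u i) (rev (n i)) [])"
        using st3_moves(4)[OF R(1), of "rev (u i)" "6 * ?n + 1" s "[]"] by simp
      have loop: "m + length w = length (n i) \<Longrightarrow>
         ex (UNTIL R 0 (POP R ;; c2)) (st3 s R (st i m) w []) (length w * (P2 (B ?n) + 2) + 1)
           (st3 s R (st i (length (n i))) [] [])" for m w
      proof (induction w arbitrary: m)
        case Nil
        then show ?case by (simp, intro ex_until_stop) (use R(1) in \<open>auto simp: st3_def\<close>)
      next
        case (Cons b w)
        let ?a = "if b then 2 else 1 :: nat"
        have z: "st3 s R (st i m) (b # w) [] R = ?a # bits w" using R(1) by (simp add: st3_def)
        have a: "ex (POP R) (st3 s R (st i m) (b # w) []) 1 (st3 s R (st i m) w [])"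
          by (rule ex_pop[of _ R ?a "bits w"]) (use z R(1) in \<open>auto simp: st3_def fun_eq_iff\<close>)
        have "P2 (length (st i m)) \<le> P2 (B ?n)"
          by (rule monoD[OF 2(2)]) (use bound(2)[of m i] Cons.prems in simp)
        then have b: "ex c2 (st3 s R (st i m) w []) (P2 (B ?n)) (st3 s R (st i (Suc m)) w [])"
          by (rule ex_mono[OF st3_fn[OF c2 R(4) R(1) s]])
        have d: "ex (POP R ;; c2) (st3 s R (st i m) (b # w) []) (P2 (B ?n) + 1) (st3 s R (st i (Suc m)) w [])"
          by (rule ex_seq[OF a b]) simp
        have e: "ex (UNTIL R 0 (POP R ;; c2)) (st3 s R (st i (Suc m)) w []) (length w * (P2 (B ?n) + 2) + 1)
           (st3 s R (st i (length (n i))) [] [])"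
          by (rule Cons.IH) (use Cons.prems in simp)
        have p: "peek (st3 s R (st i m) (b # w) [] R) \<noteq> 0" by (simp add: z)
        show ?case by (rule ex_until_step[OF p d e]) simp
      qed
      have l: "ex (UNTIL R 0 (POP R ;; c2)) (st3 s R (st i 0) (rev (n i)) []) (P0 ?n * (P2 (B ?n) + 2) + 1)
           (st3 s R (st i (length (n i))) [] [])"
        using mult_le_mono1[OF 0(4)[of i], of "P2 (B ?n) + 2"] by (intro ex_mono[OF loop[of 0 "rev (n i)"]]) auto
      show "ex c (st3 s R (u i) [] []) (14 * ?n + 2 + (P0 ?n + (6 * P0 ?n + 1 + (6 * ?n + 1 + (P1 ?n + (P0 ?n * (P2 (B ?n) + 2) + 1))))))
          (st3 s R (st i (length (n i))) [] [])"
        unfolding c_def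
        by (rule ex_seq[OF st3_dup[OF R(1) order_refl] ex_seq[OF st3_fn[OF 0(3) R(2) R(1) s] ex_seq[OF m ex_seq[OF m2
           ex_seq[OF st3_fn[OF 1(3) R(3) R(1) s] l order_refl] order_refl] order_refl] order_refl] order_refl])
    qed
  qed
qed

text \<open>Compilation gives one direction and simulation the other; from here on polynomial time
  can be handled by closure properties of \<open>pc\<close> alone.\<close>

lemma poly_time_iff: "poly_time f \<longleftrightarrow> pc (\<lambda>x. x) f"
proof
  assume "poly_time f"
  then obtain M k where M: "wf_tm M" "\<And>x. computes_within M x (f x) (poly_bound k (length x))"
    by (auto simp: poly_time_def)
  obtain c R C where C: "\<And>x y T. computes_within M x y T \<Longrightarrow> \<exists>t. real t \<le> T \<and> fn c R x y (C * (t + length x + 1))"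
    using fn_sim[OF M(1)] by blast
  show "pc (\<lambda>x. x) f"
  proof (rule pcI)
    show "pl (\<lambda>n. C * (poly_bound k n + n + 1))" by (intro pl_intros pl_poly_bound)
    fix x
    from C[OF M(2)] obtain t where t: "real t \<le> poly_bound k (length x)" "fn c R x (f x) (C * (t + length x + 1))"
      by blast
    show "fn c R x (f x) (C * (poly_bound k (length x) + length x + 1))"
      by (rule fn_mono[OF t(2)]) (use t(1) in auto)
  qed
next
  assume "pc (\<lambda>x. x) f"
  then obtain c R P where P: "pl P" "mono P" "\<And>x. fn c R x (f x) (P (length x))" "\<And>x. length (f x) \<le> P (length x)"
    by (rule pcE) blast
  from fn_computes[of c R] obtain M where M: "wf_tm M"
    "\<And>x y T. fn c R x y T \<Longrightarrow> computes_within M x y (real (T + 5 * length x + 2 * length y + 5))" by blast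
  have "pl (\<lambda>n. P n + 5 * n + 2 * P n + 5)" by (intro pl_intros P)
  then obtain k where k: "\<And>n. P n + 5 * n + 2 * P n + 5 \<le> poly_bound k n" using poly_bound_ge by blast
  have "computes_within M x (f x) (poly_bound k (length x))" for x
  proof -
    have "P (length x) + 5 * length x + 2 * length (f x) + 5 \<le> poly_bound k (length x)"
      using k[of "length x"] P(4)[of x] by linarith
    with M(2)[OF P(3)[of x]] show ?thesis
      unfolding computes_within_def by (meson of_nat_mono order_trans)
  qed
  with M(1) show "poly_time f" unfolding poly_time_def by blast
qed

section \<open>Encoded types and polynomial-time functions between them\<close>

class enc =
  fixes enc :: "'a \<Rightarrow> bool list"
  assumes enc_inj: "enc a = enc b \<Longrightarrow> a = b"

text \<open>A wrapper for strings that are their own encoding; a plain \<open>bool list\<close> is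
  encoded component by component like any other list.\<close>

datatype str = Str (raw: "bool list")

instantiation str :: enc
begin
definition "enc s = raw s"
instance by standard (auto simp: enc_str_def intro: str.expand)
end

instantiation unit :: enc
begin
definition "enc (u :: unit) = []"
instance by standard auto
end

instantiation bool :: enc
begin
definition "enc (b :: bool) = [b]"
instance by standard (auto simp: enc_bool_def)
end

instantiation nat :: enc
begin
definition "enc n = bin n"
instance by standard (auto simp: enc_nat_def intro: bin_inj)
end

instantiation list :: (enc) enc
begin
definition "enc xs = tuple (map enc xs)"
instance
proof
  fix xs ys :: "'a list" assume "enc xs = enc ys"
  then have "map enc xs = map enc ys" by (auto simp: enc_list_def dest: tuple_inj)
  from map_injective[OF this injI[OF enc_inj]] show "xs = ys" .
qed
end

instantiation prod :: (enc, enc) enc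
begin
definition "enc p = tuple [enc (fst p), enc (snd p)]"
instance by standard (auto simp: enc_prod_def dest!: tuple_inj enc_inj)
end

abbreviation sz :: "'a::enc \<Rightarrow> nat" where
  "sz a \<equiv> length (enc a)"

lemma enc_simps:
  "enc () = []" "enc (b :: bool) = [b]" "enc (Str w) = w" "enc ([] :: 'a::enc list) = []"
  "enc (a # as) = comp1 (enc a) @ enc as" "enc (a, c) = comp1 (enc a) @ comp1 (enc c)"
  by (simp_all add: enc_unit_def enc_bool_def enc_str_def enc_list_def enc_prod_def tuple_simps)

lemma enc_append: "enc (xs @ ys) = enc xs @ enc ys"
  by (induction xs) (simp_all add: enc_simps)

lemma sz_simps:
  "sz () = 0" "sz (b :: bool) = Suc 0" "sz (Str w) = length w" "sz ([] :: 'a::enc list) = 0"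
  "sz (a # as) = 2 * sz a + 1 + sz as" "sz (a, c) = 2 * sz a + 2 * sz c + 2"
  "sz (xs @ ys) = sz xs + sz ys"
  by (simp_all add: enc_simps enc_append length_comp1)

lemma length_le_sz: "length xs \<le> sz xs"
  by (induction xs) (simp_all add: sz_simps)

lemma sz_mem: "a \<in> set xs \<Longrightarrow> sz a \<le> sz xs"
  by (induction xs) (auto simp: sz_simps)

lemma sz_units: "sz (us :: unit list) = length us"
  by (induction us) (auto simp: sz_simps)

lemma sz_list_le: "(\<And>a. a \<in> set xs \<Longrightarrow> sz a \<le> m) \<Longrightarrow> sz xs \<le> length xs * (2 * m + 1)"
proof (induction xs)
  case (Cons a xs)
  then have "sz a \<le> m" "sz xs \<le> length xs * (2 * m + 1)" by auto
  then show ?case by (simp add: sz_simps)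
qed (simp add: sz_simps)

definition pt :: "('a::enc \<Rightarrow> 'b::enc) \<Rightarrow> bool" where
  "pt f \<longleftrightarrow> pc enc (\<lambda>a. enc (f a))"

lemma pt_length: "pt f \<Longrightarrow> \<exists>P. pl P \<and> mono P \<and> (\<forall>x. sz (f x) \<le> P (sz x))"
  unfolding pt_def by (rule pc_length)

lemma pt_id: "pt (\<lambda>x. x)"
  unfolding pt_def by (rule pc_id)

lemma pt_const: "pt (\<lambda>_. c)"
  unfolding pt_def by (rule pc_const)

lemma pt_o: assumes "pt F" "pt f" shows "pt (\<lambda>x. F (f x))"
  using pc_comp[of enc "\<lambda>a. enc (f a)" "\<lambda>a. enc (F (f a))"] assms
    pc_reindex[of enc "\<lambda>a. enc (F a)" f] unfolding pt_def by blast

lemma pt_enc: "pt f \<Longrightarrow> pt (\<lambda>x. Str (enc (f x)))"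
  unfolding pt_def enc_simps .

lemma pt_pair: "pt f \<Longrightarrow> pt g \<Longrightarrow> pt (\<lambda>x. (f x, g x))"
  unfolding pt_def enc_simps by (intro pc_append pc_comp1)

lemma pt_fst: assumes "pt f" shows "pt (\<lambda>x. fst (f x))"
proof -
  have "thd (enc (f x)) = enc (fst (f x))" for x by (simp add: enc_prod_def)
  with pc_thd[OF assms[unfolded pt_def]] show ?thesis unfolding pt_def by simp
qed

lemma pt_snd: assumes "pt f" shows "pt (\<lambda>x. snd (f x))"
proof -
  have "thd (ttl (enc (f x))) = enc (snd (f x))" for x by (simp add: enc_prod_def)
  with pc_thd[OF pc_ttl[OF assms[unfolded pt_def]]] show ?thesis unfolding pt_def by simp
qed

lemma pt_if: assumes "pt b" "pt f" "pt g" shows "pt (\<lambda>x. if b x then f x else g x)"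
proof -
  have "tt (enc (b x)) = b x" for x by (simp add: enc_simps)
  with pc_if[OF assms[unfolded pt_def]] show ?thesis
    unfolding pt_def by (simp add: if_distrib[of enc])
qed

lemma pt_not: assumes "pt b" shows "pt (\<lambda>x. \<not> b x)"
proof -
  have "(\<lambda>x. \<not> b x) = (\<lambda>x. if b x then False else True)" by auto
  with pt_if[OF assms pt_const[of False] pt_const[of True]] show ?thesis by simp
qed

lemma pt_conj: assumes "pt a" "pt b" shows "pt (\<lambda>x. a x \<and> b x)"
proof -
  have "(\<lambda>x. a x \<and> b x) = (\<lambda>x. if a x then b x else False)" by auto
  with pt_if[OF assms(1,2) pt_const[of False]] show ?thesis by simp
qed

lemma pt_disj: assumes "pt a" "pt b" shows "pt (\<lambda>x. a x \<or> b x)"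
proof -
  have "(\<lambda>x. a x \<or> b x) = (\<lambda>x. if a x then True else b x)" by auto
  with pt_if[OF assms(1) pt_const[of True] assms(2)] show ?thesis by simp
qed

lemma pt_iff: assumes "pt a" "pt b" shows "pt (\<lambda>x. a x = (b x :: bool))"
proof -
  have "(\<lambda>x. a x = b x) = (\<lambda>x. if a x then b x else \<not> b x)" by auto
  with pt_if[OF assms pt_not[OF assms(2)]] show ?thesis by simp
qed

lemma pt_Cons: "pt f \<Longrightarrow> pt g \<Longrightarrow> pt (\<lambda>x. f x # g x)"
  unfolding pt_def enc_simps by (intro pc_append pc_comp1)

lemma pt_append: "pt f \<Longrightarrow> pt g \<Longrightarrow> pt (\<lambda>x. f x @ g x)"
  unfolding pt_def enc_append by (intro pc_append)

lemma pc_isnil: assumes "pc u v" shows "pc u (\<lambda>i. [v i = []])"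
proof (rule pc_comp[OF assms pcI])
  show "pl (\<lambda>n. (2 * n + 1 + 2) + 1)" by (intro pl_intros)
  fix i
  let ?n = "length (v i)" and ?c = "IFTOP 0 0 (PUSH 0 2) (clear 0 ;; PUSH 0 1)"
  show "fn ?c 0 (v i) [v i = []] ((2 * ?n + 1 + 2) + 1)"
    unfolding fn_def
  proof (intro allI impI)
    fix s :: store assume s: "s 0 = bits (v i)"
    show "ex ?c s ((2 * ?n + 1 + 2) + 1) (s(0 := bits [v i = []]))"
    proof (cases "v i = []")
      case True
      have "ex (PUSH 0 2) s (2 * ?n + 1 + 2) (s(0 := bits [v i = []]))"
        by (rule ex_push) (use s True in auto)
      with True s show ?thesis by (intro ex_if[OF _ order_refl]) auto
    next
      case False
      have 1: "ex (clear 0) s (2 * ?n + 1) (s(0 := []))"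
        by (rule ex_clear) (use s in auto)
      have 2: "ex (PUSH 0 1) (s(0 := [])) 2 (s(0 := bits [v i = []]))"
        by (rule ex_push) (use False in auto)
      have "peek (s 0) \<noteq> 0" using s False by (cases "v i") auto
      with ex_seq[OF 1 2 order_refl] show ?thesis by (intro ex_if[OF _ order_refl]) auto
    qed
  qed
qed

lemma comp1_not_Nil [simp]: "comp1 w \<noteq> []"
  by (simp add: comp1_def)

lemma enc_list_Nil_iff: "enc (xs :: 'a::enc list) = [] \<longleftrightarrow> xs = []"
  by (cases xs) (auto simp: enc_simps comp1_def)

lemma pt_null: assumes "pt f" shows "pt (\<lambda>x. f x = [])"
  using pc_isnil[OF assms[unfolded pt_def]] unfolding pt_def by (simp add: enc_list_Nil_iff enc_simps)

lemma pt_hd: assumes "pt f" shows "pt (\<lambda>x. hd (f x))"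
proof -
  have "pc enc (\<lambda>x. if tt [enc (f x) = []] then enc (hd ([] :: 'b list)) else thd (enc (f x)))"
    using assms unfolding pt_def by (intro pc_if pc_isnil pc_const pc_thd)
  moreover have "(if tt [enc (f x) = []] then enc (hd ([] :: 'b list)) else thd (enc (f x))) = enc (hd (f x))" for x
    by (cases "f x") (simp_all add: enc_list_def tuple_simps(1) enc_list_Nil_iff thd_ttl tuple_simps(2))
  ultimately show ?thesis unfolding pt_def by simp
qed

lemma pt_tl: assumes "pt f" shows "pt (\<lambda>x. tl (f x))"
proof -
  have "ttl (enc (f x)) = enc (tl (f x))" for x
    by (cases "f x") (simp_all add: enc_list_def tuple_simps(1))
  with pc_ttl[OF assms[unfolded pt_def]] show ?thesis unfolding pt_def by simp
qed

lemma pt_tt: assumes "pt f" shows "pt (\<lambda>x. tt (raw (f x)))"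
proof -
  have "pc enc (\<lambda>x. if tt (enc (f x)) then [True] else [False])"
    using assms unfolding pt_def by (intro pc_if pc_const)
  moreover have "(if tt (enc (f x)) then [True] else [False]) = enc (tt (raw (f x)))" for x
    by (simp add: enc_simps enc_str_def)
  ultimately show ?thesis unfolding pt_def by simp
qed

lemma pt_raw_null: "pt f \<Longrightarrow> pt (\<lambda>x. raw (f x) = [])"
  using pc_isnil[of enc "\<lambda>x. enc (f x)"] unfolding pt_def by (simp add: enc_str_def enc_simps)

lemma pt_raw_tl: "pt f \<Longrightarrow> pt (\<lambda>x. Str (tl (raw (f x))))"
  using pc_tl[of enc "\<lambda>x. enc (f x)"] unfolding pt_def by (simp add: enc_str_def)

lemma pt_raw_Cons: assumes "pt b" "pt f" shows "pt (\<lambda>x. Str (b x # raw (f x)))"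
proof -
  have "pc enc (\<lambda>x. if tt (enc (b x)) then True # enc (f x) else False # enc (f x))"
    using assms unfolding pt_def by (intro pc_if pc_Cons)
  moreover have "(if tt (enc (b x)) then True # enc (f x) else False # enc (f x)) = enc (Str (b x # raw (f x)))" for x
    by (simp add: enc_simps enc_str_def)
  ultimately show ?thesis unfolding pt_def by simp
qed

lemma pt_iter:
  fixes F :: "'a::enc \<Rightarrow> 's::enc \<Rightarrow> 's" and c :: "'a \<Rightarrow> 'c::enc"
  assumes F: "pt (\<lambda>y. F (fst y) (snd y))" and s: "pt s" and c: "pt c"
    and B: "pl B" "\<And>x m. m \<le> sz (c x) \<Longrightarrow> sz ((F x ^^ m) (s x)) \<le> B (sz x)"
  shows "pt (\<lambda>x. (F x ^^ sz (c x)) (s x))"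
proof -
  \<comment> \<open>The parameter \<open>x\<close> travels along in the state, since each step has
    to find it there.\<close>
  have "pt (\<lambda>x. (x, (F x ^^ sz (c x)) (s x)))"
    unfolding pt_def
  proof (rule pc_iter[of enc "\<lambda>x. enc (c x)" "\<lambda>x m. enc (x, (F x ^^ m) (s x))"])
    show "pc enc (\<lambda>x. enc (c x))" using c by (simp add: pt_def)
    show "pc enc (\<lambda>x. enc (x, (F x ^^ 0) (s x)))"
      using pt_pair[OF pt_id s] by (simp add: pt_def)
    have "pc enc (\<lambda>y. enc (fst y, F (fst y) (snd y)))"
      using pt_pair[OF pt_fst[OF pt_id] F] by (simp add: pt_def)
    from pc_reindex[OF this, of "\<lambda>(i, m). (i, (F i ^^ m) (s i))"]
    show "pc (\<lambda>(i, m). enc (i, (F i ^^ m) (s i))) (\<lambda>(i, m). enc (i, (F i ^^ Suc m) (s i)))"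
      by (simp add: case_prod_unfold)
    show "pl (\<lambda>n. 2 * n + 2 * B n + 2)" by (intro pl_intros B)
    show "sz (x, (F x ^^ m) (s x)) \<le> 2 * sz x + 2 * B (sz x) + 2" if "m \<le> sz (c x)" for x m
      using B(2)[OF that] by (simp add: sz_simps)
  qed
  from pt_snd[OF this] show ?thesis by simp
qed

text \<open>The fold is an iteration on the pair of accumulator and remaining list that idles once
  the list is empty, so \<open>sz (xs x)\<close> rounds, which are at least as many as the elements,
  do no harm. Intermediate accumulators belong to prefixes of the list, hence the form of the size
  bound.\<close>

lemma pt_foldl:
  fixes F :: "'a::enc \<Rightarrow> 's::enc \<Rightarrow> 'e::enc \<Rightarrow> 's"
  assumes F: "pt (\<lambda>y. F (fst y) (fst (snd y)) (snd (snd y)))" and s: "pt s" and xs: "pt xs"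
    and B: "pl B" "\<And>x ys zs. xs x = ys @ zs \<Longrightarrow> sz (foldl (F x) (s x) ys) \<le> B (sz x)"
  shows "pt (\<lambda>x. foldl (F x) (s x) (xs x))"
proof -
  define G where "G x p = (if snd p = [] then p else (F x (fst p) (hd (snd p)), tl (snd p)))" for x and p :: "'s \<times> 'e list"
  have G: "pt (\<lambda>y. G (fst y) (snd y))"
    unfolding G_def
    by (intro pt_if pt_null pt_snd pt_id pt_pair pt_tl
        pt_o[OF F, of "\<lambda>y. (fst y, fst (snd y), hd (snd (snd y)))", simplified] pt_fst pt_hd)
  have Gs: "G x (a, []) = (a, [])" "G x (a, b # l) = (F x a b, l)" for x a b l
    by (simp_all add: G_def)
  have iter: "(G x ^^ m) (s x, xs x) = (foldl (F x) (s x) (take m (xs x)), drop m (xs x))" for x m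
  proof (induction m)
    case (Suc m)
    show ?case
    proof (cases "m < length (xs x)")
      case True
      then have "drop m (xs x) = xs x ! m # drop (Suc m) (xs x)" by (simp add: Cons_nth_drop_Suc)
      with Suc True show ?thesis by (simp add: Gs take_Suc_conv_app_nth)
    qed (use Suc in \<open>simp add: Gs\<close>)
  qed simp
  obtain P where P: "pl P" "\<And>x. sz (xs x) \<le> P (sz x)" using pt_length[OF xs] by blast
  have "pt (\<lambda>x. (G x ^^ sz (xs x)) (s x, xs x))"
  proof (rule pt_iter[OF G pt_pair[OF s xs] xs])
    show "pl (\<lambda>n. 2 * B n + 2 * P n + 2)" by (intro pl_intros B P)
    fix x m
    have "sz (take m (xs x)) + sz (drop m (xs x)) = sz (xs x)"
      by (simp flip: sz_simps(7))
    then show "sz ((G x ^^ m) (s x, xs x)) \<le> 2 * B (sz x) + 2 * P (sz x) + 2"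
      using B(2)[of x "take m (xs x)" "drop m (xs x)"] P(2)[of x] by (simp add: iter sz_simps)
  qed
  from pt_fst[OF this] show ?thesis
    by (simp add: iter length_le_sz)
qed

lemma pt_map:
  fixes F :: "'a::enc \<Rightarrow> 'e::enc \<Rightarrow> 'b::enc"
  assumes F: "pt (\<lambda>y. F (fst y) (snd y))" and xs: "pt xs"
  shows "pt (\<lambda>x. map (F x) (xs x))"
proof -
  obtain P where P: "pl P" "mono P" "\<And>x a. sz (F x a) \<le> P (sz (x, a))"
    using pt_length[OF F] by (metis fst_conv snd_conv)
  obtain Q where Q: "pl Q" "\<And>x. sz (xs x) \<le> Q (sz x)" using pt_length[OF xs] by blast
  have fold: "foldl (\<lambda>acc a. acc @ [F x a]) [] ys = map (F x) ys" for x ys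
    by (induction ys rule: rev_induct) auto
  have "pt (\<lambda>x. foldl (\<lambda>acc a. acc @ [F x a]) [] (xs x))"
  proof (rule pt_foldl[OF _ pt_const xs])
    show "pt (\<lambda>y. fst (snd y) @ [F (fst y) (snd (snd y))])"
      by (intro pt_append pt_fst pt_snd pt_id pt_Cons pt_const
          pt_o[OF F, of "\<lambda>y. (fst y, snd (snd y))", simplified] pt_pair)
    show "pl (\<lambda>n. Q n * (2 * P (2 * n + 2 * Q n + 2) + 1))"
      by (intro pl_intros Q pl_comp[OF P(1)])
    fix x ys zs assume e: "xs x = ys @ zs"
    have "sz b \<le> P (2 * sz x + 2 * Q (sz x) + 2)" if "b \<in> set (map (F x) ys)" for b
    proof -
      from that obtain a where a: "a \<in> set (xs x)" "b = F x a" using e by auto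
      have "sz b \<le> P (sz (x, a))" using a P(3) by simp
      also have "\<dots> \<le> P (2 * sz x + 2 * Q (sz x) + 2)"
        by (rule monoD[OF P(2)]) (use sz_mem[OF a(1)] Q(2)[of x] in \<open>simp add: sz_simps\<close>)
      finally show ?thesis .
    qed
    then have "sz (map (F x) ys) \<le> length ys * (2 * P (2 * sz x + 2 * Q (sz x) + 2) + 1)"
      using sz_list_le[of "map (F x) ys"] unfolding length_map by blast
    also have "\<dots> \<le> Q (sz x) * (2 * P (2 * sz x + 2 * Q (sz x) + 2) + 1)"
      using length_le_sz[of "xs x"] Q(2)[of x] e by (intro mult_le_mono1) simp
    finally show "sz (foldl (\<lambda>acc a. acc @ [F x a]) [] ys) \<le> Q (sz x) * (2 * P (2 * sz x + 2 * Q (sz x) + 2) + 1)"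
      by (simp add: fold)
  qed
  then show ?thesis by (simp add: fold)
qed

lemma pt_concat:
  fixes xs :: "'a::enc \<Rightarrow> 'b::enc list list"
  assumes "pt xs" shows "pt (\<lambda>x. concat (xs x))"
proof -
  obtain P where P: "pl P" "\<And>x. sz (xs x) \<le> P (sz x)" using pt_length[OF assms] by blast
  have fold: "foldl (@) ys0 ys = ys0 @ concat ys" for ys0 :: "'b list" and ys
    by (induction ys arbitrary: ys0) auto
  have szc: "sz (concat ys) \<le> sz ys" for ys :: "'b list list"
    by (induction ys) (auto simp: sz_simps)
  have "pt (\<lambda>x. foldl (\<lambda>a b. a @ b) [] (xs x))"
  proof (rule pt_foldl[OF _ pt_const assms P(1)])
    show "pt (\<lambda>y :: 'a \<times> 'b list \<times> 'b list. fst (snd y) @ snd (snd y))"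
      by (intro pt_append pt_fst pt_snd pt_id)
    fix x ys zs assume "xs x = ys @ zs"
    then have "sz (concat ys) \<le> P (sz x)"
      using szc[of ys] P(2)[of x] by (simp add: sz_simps)
    then show "sz (foldl (\<lambda>a b. a @ b) [] ys) \<le> P (sz x)" by (simp add: fold)
  qed
  then show ?thesis by (simp add: fold)
qed

lemma pt_filter:
  assumes "pt (\<lambda>y. P (fst y) (snd y))" "pt xs"
  shows "pt (\<lambda>x. filter (P x) (xs x))"
proof -
  have "concat (map (\<lambda>a. if P x a then [a] else []) ys) = filter (P x) ys" for x ys
    by (induction ys) auto
  moreover have "pt (\<lambda>x. concat (map (\<lambda>a. if P x a then [a] else []) (xs x)))"
    using assms by (intro pt_concat pt_map pt_if pt_Cons pt_snd pt_id pt_const)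
  ultimately show ?thesis by simp
qed

lemma pt_Ball:
  assumes "pt (\<lambda>y. P (fst y) (snd y))" "pt xs"
  shows "pt (\<lambda>x. \<forall>a\<in>set (xs x). P x a)"
proof -
  have "(\<forall>a\<in>set ys. P x a) \<longleftrightarrow> filter (\<lambda>a. \<not> P x a) ys = []" for x ys
    by (auto simp: filter_empty_conv)
  moreover have "pt (\<lambda>x. filter (\<lambda>a. \<not> P x a) (xs x) = [])"
    using assms by (intro pt_null pt_filter pt_not)
  ultimately show ?thesis by simp
qed

lemma pt_Bex:
  assumes "pt (\<lambda>y. P (fst y) (snd y))" "pt xs"
  shows "pt (\<lambda>x. \<exists>a\<in>set (xs x). P x a)"
proof -
  have "(\<exists>a\<in>set ys. P x a) \<longleftrightarrow> \<not> (\<forall>a\<in>set ys. \<not> P x a)" for x ys by blast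
  moreover have "pt (\<lambda>x. \<not> (\<forall>a\<in>set (xs x). \<not> P x a))"
    using assms by (intro pt_not pt_Ball)
  ultimately show ?thesis by simp
qed

lemma pt_rev:
  fixes xs :: "'a::enc \<Rightarrow> 'b::enc list"
  assumes "pt xs" shows "pt (\<lambda>x. rev (xs x))"
proof -
  obtain P where P: "pl P" "\<And>x. sz (xs x) \<le> P (sz x)" using pt_length[OF assms] by blast
  have fold: "foldl (\<lambda>acc a. a # acc) zs ys = rev ys @ zs" for zs ys :: "'b list"
    by (induction ys arbitrary: zs) auto
  have szr: "sz (rev ys) = sz ys" for ys :: "'b list"
    by (induction ys) (auto simp: sz_simps)
  have "pt (\<lambda>x. foldl (\<lambda>acc a. a # acc) [] (xs x))"
  proof (rule pt_foldl[OF _ pt_const assms P(1)])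
    show "pt (\<lambda>y :: 'a \<times> 'b list \<times> 'b. snd (snd y) # fst (snd y))"
      by (intro pt_Cons pt_fst pt_snd pt_id)
    fix x ys zs assume "xs x = ys @ zs"
    then show "sz (foldl (\<lambda>acc a. a # acc) [] ys) \<le> P (sz x)"
      using P(2)[of x] by (simp add: fold szr sz_simps)
  qed
  then show ?thesis by (simp add: fold)
qed

lemma pt_units: assumes "pt f" shows "pt (\<lambda>x. replicate (sz (f x)) ())"
proof -
  obtain P where P: "pl P" "\<And>x. sz (f x) \<le> P (sz x)" using pt_length[OF assms] by blast
  have it: "((\<lambda>us. () # us) ^^ m) [] = replicate m ()" for m
    by (induction m) auto
  have "pt (\<lambda>x. ((\<lambda>us. () # us) ^^ sz (f x)) [])"
    by (rule pt_iter[OF _ pt_const assms P(1)])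
      (use P(2) order_trans in \<open>auto simp: it sz_units intro!: pt_Cons pt_const pt_snd pt_id\<close>)
  then show ?thesis by (simp add: it)
qed

lemma pt_repeat:
  fixes F :: "'a::enc \<Rightarrow> 's::enc \<Rightarrow> 's" and us :: "'a \<Rightarrow> 'c::enc list"
  assumes F: "pt (\<lambda>y. F (fst y) (snd y))" and s: "pt s" and us: "pt us"
    and B: "pl B" "\<And>x m. m \<le> length (us x) \<Longrightarrow> sz ((F x ^^ m) (s x)) \<le> B (sz x)"
  shows "pt (\<lambda>x. (F x ^^ length (us x)) (s x))"
proof -
  have "pt (\<lambda>x. (F x ^^ sz (map (\<lambda>_. ()) (us x))) (s x))"
    by (rule pt_iter[OF F s _ B(1)]) (use B(2) in \<open>auto simp: sz_units intro!: pt_map pt_const us\<close>)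
  then show ?thesis by (simp add: sz_units)
qed

lemma pt_zip:
  fixes xs :: "'a::enc \<Rightarrow> 'b::enc list" and ys :: "'a \<Rightarrow> 'c::enc list"
  assumes xs: "pt xs" and ys: "pt ys" shows "pt (\<lambda>x. zip (xs x) (ys x))"
proof -
  obtain P where P: "pl P" "\<And>x. sz (xs x) \<le> P (sz x)" using pt_length[OF xs] by blast
  obtain Q where Q: "pl Q" "\<And>x. sz (ys x) \<le> Q (sz x)" using pt_length[OF ys] by blast
  define G where "G s a = (if snd s = [] then s else (fst s @ [(a, hd (snd s))], tl (snd s)))"
    for s :: "('b \<times> 'c) list \<times> 'c list" and a
  have fold: "foldl G (zs, bs) as = (zs @ zip as bs, drop (length as) bs)" for zs as bs
  proof (induction as arbitrary: zs bs)
    case (Cons a as)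
    then show ?case by (cases bs) (simp_all add: G_def)
  qed simp
  have szz: "sz (zip as bs) \<le> 2 * sz as + 2 * sz bs + length as * 5" for as :: "'b list" and bs :: "'c list"
  proof (induction as arbitrary: bs)
    case (Cons a as)
    show ?case
    proof (cases bs)
      case (Cons b bs')
      then show ?thesis using Cons.IH[of bs'] by (simp add: sz_simps)
    qed (simp add: sz_simps)
  qed (simp add: sz_simps)
  have "pt (\<lambda>x. foldl G ([], ys x) (xs x))"
  proof (rule pt_foldl[OF _ _ xs])
    show "pt (\<lambda>y :: 'a \<times> (('b \<times> 'c) list \<times> 'c list) \<times> 'b. G (fst (snd y)) (snd (snd y)))"
      unfolding G_def by (intro pt_if pt_null pt_snd pt_fst pt_id pt_pair pt_append pt_Cons pt_const pt_hd pt_tl)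
    show "pt (\<lambda>x. ([], ys x))" by (intro pt_pair pt_const ys)
    show "pl (\<lambda>n. 2 * (4 * P n + 4 * Q n + 5 * P n) + 2 * Q n + 2)" by (intro pl_intros P Q)
    fix x as zs assume e: "xs x = as @ zs"
    have "sz (take (length as) (ys x)) + sz (drop (length as) (ys x)) = sz (ys x)"
      by (simp flip: sz_simps(7))
    moreover have "sz as \<le> P (sz x)" using P(2)[of x] e by (simp add: sz_simps)
    ultimately show "sz (foldl G ([], ys x) as) \<le> 2 * (4 * P (sz x) + 4 * Q (sz x) + 5 * P (sz x)) + 2 * Q (sz x) + 2"
      using szz[of as "ys x"] Q(2)[of x] length_le_sz[of as] by (simp add: fold sz_simps)
  qed
  from pt_fst[OF this] show ?thesis by (simp add: fold)
qed

text \<open>Equal leading bits of the two encodings are stripped as long as possible. Both strings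
  are used up iff the encodings agree, and encodings are injective.\<close>

lemma pt_eq:
  fixes f g :: "'a::enc \<Rightarrow> 'b::enc"
  assumes "pt f" "pt g" shows "pt (\<lambda>x. f x = g x)"
proof -
  define G where "G s = (if raw (fst s) = [] \<or> raw (snd s) = [] \<or> tt (raw (fst s)) \<noteq> tt (raw (snd s)) then s
     else (Str (tl (raw (fst s))), Str (tl (raw (snd s)))))" for s
  have G: "pt (\<lambda>y :: 'a \<times> str \<times> str. G (snd y))"
    unfolding G_def
    by (intro pt_if pt_disj pt_raw_null pt_not pt_iff pt_tt pt_fst pt_snd pt_id pt_pair pt_raw_tl)
  have len: "sz ((G ^^ m) s) \<le> sz s" for m s
  proof (induction m)
    case (Suc m)
    have "sz (G s) \<le> sz s" for s :: "str \<times> str"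
      by (cases s) (auto simp: G_def sz_simps enc_str_def)
    from this[of "(G ^^ m) s"] Suc show ?case by simp
  qed simp
  have fin: "(\<exists>w. (G ^^ length u) (Str u, Str v) = (Str [], Str w) \<and> w = []) \<longleftrightarrow> u = v" for u v
  proof (induction u arbitrary: v)
    case (Cons b u)
    show ?case
    proof (cases v)
      case Nil
      then have "G (Str (b # u), Str v) = (Str (b # u), Str v)" by (simp add: G_def)
      then have "(G ^^ m) (Str (b # u), Str v) = (Str (b # u), Str v)" for m by (induction m) auto
      from this[of "length (b # u)"] show ?thesis using Nil by (simp del: funpow.simps length_Cons list.size)
    next
      case (Cons c w)
      show ?thesis
      proof (cases "b = c")
        case True
        then have "G (Str (b # u), Str v) = (Str u, Str w)" using Cons by (simp add: G_def)
        then show ?thesis using Cons.IH[of w] True Cons by (simp add: funpow_swap1)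
      next
        case False
        then have "G (Str (b # u), Str v) = (Str (b # u), Str v)" using Cons by (simp add: G_def)
        then have "(G ^^ m) (Str (b # u), Str v) = (Str (b # u), Str v)" for m by (induction m) auto
        from this[of "length (b # u)"] show ?thesis
          using Cons False by (simp del: funpow.simps length_Cons list.size)
      qed
    qed
  qed auto
  obtain P where P: "pl P" "\<And>x. sz (f x) \<le> P (sz x)" using pt_length[OF assms(1)] by blast
  obtain Q where Q: "pl Q" "\<And>x. sz (g x) \<le> Q (sz x)" using pt_length[OF assms(2)] by blast
  let ?r = "\<lambda>x. (G ^^ sz (f x)) (Str (enc (f x)), Str (enc (g x)))"
  have r: "pt ?r"
  proof (rule pt_iter[OF G _ assms(1)])
    show "pt (\<lambda>x. (Str (enc (f x)), Str (enc (g x))))" by (intro pt_pair pt_enc assms)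
    show "pl (\<lambda>n. 2 * P n + 2 * Q n + 2)" by (intro pl_intros P Q)
    fix x m
    show "sz ((G ^^ m) (Str (enc (f x)), Str (enc (g x)))) \<le> 2 * P (sz x) + 2 * Q (sz x) + 2"
      using len[of m "(Str (enc (f x)), Str (enc (g x)))"] P(2)[of x] Q(2)[of x] by (simp add: sz_simps)
  qed
  have "pt (\<lambda>x. raw (fst (?r x)) = [] \<and> raw (snd (?r x)) = [])"
    by (intro pt_conj pt_raw_null pt_fst pt_snd r)
  moreover have "raw (fst (?r x)) = [] \<and> raw (snd (?r x)) = [] \<longleftrightarrow> f x = g x" for x
  proof -
    obtain a b where r: "?r x = (Str a, Str b)" by (metis str.exhaust surj_pair)
    with fin[of "enc (f x)" "enc (g x)"] have "a = [] \<and> b = [] \<longleftrightarrow> enc (f x) = enc (g x)" by auto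
    with r show ?thesis using enc_inj[of "f x" "g x"] by auto
  qed
  ultimately show ?thesis by simp
qed

lemma pt_mem:
  fixes f :: "'a::enc \<Rightarrow> 'b::enc"
  assumes "pt f" "pt xs" shows "pt (\<lambda>x. f x \<in> set (xs x))"
proof -
  have "pt (\<lambda>x. \<exists>a\<in>set (xs x). f x = a)"
    by (intro pt_Bex pt_eq pt_o[OF assms(1) pt_fst[OF pt_id]] pt_snd pt_id assms(2))
  then show ?thesis by simp
qed


subsection \<open>Binary arithmetic\<close>

lemma bin_simps: "bin 0 = []" "n \<noteq> 0 \<Longrightarrow> bin n = odd n # bin (n div 2)"
  by (subst bin.simps; simp)+

lemma tl_bin: "tl (bin n) = bin (n div 2)"
  by (cases "n = 0") (simp_all add: bin_simps)

lemma tt_bin: "tt (bin n) = odd n"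
  by (cases "n = 0") (simp_all add: bin_simps)

lemma length_bin_le: "n < 2 ^ k \<Longrightarrow> length (bin n) \<le> k"
proof (induction k arbitrary: n)
  case (Suc k)
  then have "length (bin (n div 2)) \<le> k" by (intro Suc.IH) auto
  then show ?case by (cases "n = 0") (simp_all add: bin_simps)
qed (simp add: bin_simps)

lemma less_power_bin: "n < 2 ^ length (bin n)"
proof (induction n rule: less_induct)
  case (less n)
  show ?case
  proof (cases "n = 0")
    case False
    with less[of "n div 2"] show ?thesis by (simp add: bin_simps)
  qed (simp add: bin_simps)
qed

lemma power_bin_le: "n \<noteq> 0 \<Longrightarrow> 2 ^ length (bin n) \<le> 2 * n"
proof (induction n rule: less_induct)
  case (less n)
  show ?case
  proof (cases "n div 2 = 0")
    case True
    with less.prems have "n = 1" by auto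
    then show ?thesis by (simp add: bin_simps)
  next
    case False
    with less.IH[of "n div 2"] less.prems have "2 ^ length (bin (n div 2)) \<le> 2 * (n div 2)" by auto
    also have "\<dots> \<le> n" by simp
    finally show ?thesis using less.prems by (simp add: bin_simps)
  qed
qed

lemma sz_nat: "sz (n :: nat) = length (bin n)"
  by (simp add: enc_nat_def)

lemma sz_nat_le: "n < 2 ^ k \<Longrightarrow> sz (n :: nat) \<le> k"
  by (simp add: sz_nat length_bin_le)

lemma sz_nat_mono: "m \<le> n \<Longrightarrow> sz (m :: nat) \<le> sz n"
  by (rule sz_nat_le) (use less_power_bin[of n] in \<open>simp add: sz_nat\<close>)

lemma sz_nat_self: "sz (n :: nat) \<le> n"
  by (rule sz_nat_le) (rule less_exp)

lemma pt_odd: assumes "pt f" shows "pt (\<lambda>x. odd (f x :: nat))"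
proof -
  have "pt (\<lambda>x. tt (raw (Str (enc (f x)))))" by (intro pt_tt pt_enc assms)
  then show ?thesis by (simp add: enc_nat_def tt_bin)
qed

lemma pt_zero: assumes "pt f" shows "pt (\<lambda>x. (f x :: nat) = 0)"
  by (intro pt_eq assms pt_const)

lemma pt_div2: assumes "pt f" shows "pt (\<lambda>x. (f x :: nat) div 2)"
  using pc_tl[OF assms[unfolded pt_def]] unfolding pt_def by (simp add: enc_nat_def tl_bin)

lemma pt_shift_in:
  assumes "pt f" "pt b" shows "pt (\<lambda>x. 2 * (f x :: nat) + of_bool (b x))"
proof -
  have "pc enc (\<lambda>x. if tt (enc (f x = 0 \<and> \<not> b x)) then [] else enc (Str (b x # raw (Str (enc (f x))))))"
    using pt_conj[OF pt_zero[OF assms(1)] pt_not[OF assms(2)]] pt_raw_Cons[OF assms(2) pt_enc[OF assms(1)]]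
    unfolding pt_def by (intro pc_if pc_const)
  moreover have "(if tt (enc (f x = 0 \<and> \<not> b x)) then [] else enc (Str (b x # raw (Str (enc (f x)))))) =
     enc (2 * f x + of_bool (b x))" for x
    by (cases "b x") (auto simp: enc_simps enc_nat_def bin_simps)
  ultimately show ?thesis unfolding pt_def by simp
qed

definition msb :: "bool list \<Rightarrow> nat" where
  "msb bs = foldl (\<lambda>v b. 2 * v + of_bool b) 0 bs"

lemma msb_aux: "foldl (\<lambda>v b. 2 * v + of_bool b) k bs = k * 2 ^ length bs + msb bs"
proof (induction bs arbitrary: k)
  case (Cons b bs)
  show ?case using Cons[of "2 * k + of_bool b"] Cons[of "of_bool b"] by (simp add: msb_def algebra_simps)
qed (simp add: msb_def)

lemma msb_simps [simp]: "msb [] = 0" "msb (b # bs) = of_bool b * 2 ^ length bs + msb bs"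
  using msb_aux[of "of_bool b" bs] by (simp_all add: msb_def)

lemma msb_less: "msb bs < 2 ^ length bs"
  by (induction bs) auto

lemma pt_msb: assumes "pt f" shows "pt (\<lambda>x. msb (f x))"
proof -
  obtain P where P: "pl P" "\<And>x. sz (f x) \<le> P (sz x)" using pt_length[OF assms] by blast
  show ?thesis
    unfolding msb_def
  proof (rule pt_foldl[OF _ pt_const assms P(1)])
    show "pt (\<lambda>y :: 'a \<times> nat \<times> bool. 2 * fst (snd y) + of_bool (snd (snd y)))"
      by (intro pt_shift_in pt_fst pt_snd pt_id)
    fix x ys zs assume e: "f x = ys @ zs"
    have "sz (msb ys) \<le> length ys" by (rule sz_nat_le) (rule msb_less)
    moreover have "length ys \<le> length (f x)" using e by simp
    ultimately have "sz (msb ys) \<le> P (sz x)"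
      using length_le_sz[of "f x"] P(2)[of x] by linarith
    then show "sz (foldl (\<lambda>v b. 2 * v + of_bool b) (0 :: nat) ys) \<le> P (sz x)"
      by (simp only: msb_def)
  qed
qed

lemma sz_bools: "sz (bs :: bool list) = 3 * length bs"
  by (induction bs) (auto simp: sz_simps)

text \<open>One column of schoolbook addition or subtraction, with \<open>h\<close> the rule for the
  carry or borrow; the digit is an exclusive or in both cases. The latest, most significant digit is
  put in front, which is the order that \<open>msb\<close> reads.\<close>

definition rip :: "(bool \<Rightarrow> bool \<Rightarrow> bool \<Rightarrow> bool) \<Rightarrow> nat \<times> nat \<times> bool \<times> bool list \<Rightarrow> nat \<times> nat \<times> bool \<times> bool list" where
  "rip h s = (fst s div 2, fst (snd s) div 2, h (odd (fst s)) (odd (fst (snd s))) (fst (snd (snd s))),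
     ((odd (fst s) \<noteq> odd (fst (snd s))) \<noteq> fst (snd (snd s))) # snd (snd (snd s)))"

lemma rip_fst:
  "fst ((rip h ^^ m) (a, b, c, l)) = a div 2 ^ m" "fst (snd ((rip h ^^ m) (a, b, c, l))) = b div 2 ^ m"
  "length (snd (snd (snd ((rip h ^^ m) (a, b, c, l))))) = m + length l"
  by (induction m) (auto simp: rip_def div_mult2_eq[symmetric] mult.commute)

lemma pt_rip:
  assumes f: "pt f" and g: "pt g"
    and h: "\<And>a b c :: (('a::enc) \<times> nat \<times> nat \<times> bool \<times> bool list) \<Rightarrow> bool. pt a \<Longrightarrow> pt b \<Longrightarrow> pt c \<Longrightarrow> pt (\<lambda>x. h (a x) (b x) (c x))"
  shows "pt (\<lambda>x :: 'a. (rip h ^^ sz (f x, g x)) (f x, g x, False, []))"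
proof -
  obtain P where P: "pl P" "\<And>x. sz (f x) \<le> P (sz x)" using pt_length[OF f] by blast
  obtain Q where Q: "pl Q" "\<And>x. sz (g x) \<le> Q (sz x)" using pt_length[OF g] by blast
  show ?thesis
  proof (rule pt_iter[OF _ _ pt_pair[OF f g]])
    show "pt (\<lambda>y :: 'a \<times> nat \<times> nat \<times> bool \<times> bool list. rip h (snd y))"
      unfolding rip_def by (intro pt_pair pt_div2 pt_fst pt_snd pt_id h pt_odd pt_Cons pt_not pt_iff)
    show "pt (\<lambda>x. (f x, g x, False, [] :: bool list))" by (intro pt_pair f g pt_const)
    show "pl (\<lambda>n. 2 * P n + 4 * Q n + 8 + 8 + 24 * (2 * P n + 2 * Q n + 2) + 14)" by (intro pl_intros P Q)
    fix x m assume m: "m \<le> sz (f x, g x)"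
    obtain a b c l where s: "(rip h ^^ m) (f x, g x, False, []) = (a, b, c, l)" by (metis surj_pair)
    have "a = f x div 2 ^ m" "b = g x div 2 ^ m" "length l = m"
      using rip_fst[of m h "f x" "g x" False "[]"] s by auto
    then have "sz a \<le> P (sz x)" "sz b \<le> Q (sz x)" "sz l \<le> 3 * (2 * P (sz x) + 2 * Q (sz x) + 2)"
      using sz_nat_mono[of a "f x"] sz_nat_mono[of b "g x"] P(2)[of x] Q(2)[of x] m
      by (auto simp: div_le_dividend sz_bools sz_simps)
    then show "sz ((rip h ^^ m) (f x, g x, False, [])) \<le>
        2 * P (sz x) + 4 * Q (sz x) + 8 + 8 + 24 * (2 * P (sz x) + 2 * Q (sz x) + 2) + 14"
      by (simp add: s sz_simps)
  qed
qed

definition carry :: "bool \<Rightarrow> bool \<Rightarrow> bool \<Rightarrow> bool" where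
  "carry a b c \<longleftrightarrow> (a \<and> b) \<or> (c \<and> (a \<or> b))"

definition borrow :: "bool \<Rightarrow> bool \<Rightarrow> bool \<Rightarrow> bool" where
  "borrow a b c \<longleftrightarrow> (\<not> a \<and> b) \<or> (c \<and> (\<not> a \<or> b))"

lemma sz_pair_less: "a + b < 2 ^ sz (a, b :: nat)" "a < 2 ^ sz (a, b)" "b < 2 ^ sz (a, b)"
proof -
  have "a < 2 ^ (sz a + sz b)" "b < 2 ^ (sz a + sz b)"
    using less_power_bin[of a] less_power_bin[of b]
    by (auto simp: sz_nat power_add intro: less_le_trans)
  then have "a + b < 2 ^ Suc (sz a + sz b)" by simp
  also have "\<dots> \<le> 2 ^ sz (a, b)" by (rule power_increasing) (simp_all add: sz_simps)
  finally show "a + b < 2 ^ sz (a, b)" .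
  then show "a < 2 ^ sz (a, b)" "b < 2 ^ sz (a, b)" by linarith+
qed

lemma pt_add: assumes "pt f" "pt g" shows "pt (\<lambda>x. f x + g x :: nat)"
proof -
  \<comment> \<open>The digits found so far, plus the unread parts and the carry at the next binary
    place, keep a constant value.\<close>
  have inv: "(case (rip carry ^^ m) (a, b, c, l) of (a', b', c', l') \<Rightarrow>
      msb l' + 2 ^ length l' * (a' + b' + of_bool c')) = msb l + 2 ^ length l * (a + b + of_bool c)" for m a b c l
  proof (induction m)
    case (Suc m)
    obtain a' b' c' l' where s: "(rip carry ^^ m) (a, b, c, l) = (a', b', c', l')" by (metis surj_pair)
    have "of_bool ((odd a' \<noteq> odd b') \<noteq> c') + 2 * (a' div 2 + b' div 2 + of_bool (carry (odd a') (odd b') c')) =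
       a' + b' + of_bool c'"
      unfolding carry_def by (cases "odd a'"; cases "odd b'"; cases c') (auto elim!: oddE evenE)
    then have "msb l' + 2 ^ length l' * (of_bool ((odd a' \<noteq> odd b') \<noteq> c') +
       2 * (a' div 2 + b' div 2 + of_bool (carry (odd a') (odd b') c'))) = msb l + 2 ^ length l * (a + b + of_bool c)"
      using Suc s by simp
    moreover have "rip carry (a', b', c', l') = (a' div 2, b' div 2, carry (odd a') (odd b') c', ((odd a' \<noteq> odd b') \<noteq> c') # l')"
      by (simp add: rip_def)
    ultimately show ?case by (simp add: s algebra_simps)
  qed simp
  have eq: "msb (snd (snd (snd ((rip carry ^^ sz (a, b)) (a, b, False, []))))) = a + b" for a b
  proof -
    let ?m = "sz (a, b)"
    obtain a' b' c' l' where s: "(rip carry ^^ ?m) (a, b, False, []) = (a', b', c', l')" by (metis surj_pair)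
    have l: "length l' = ?m" using rip_fst(3)[of ?m carry a b False "[]"] s by simp
    have e: "msb l' + 2 ^ ?m * (a' + b' + of_bool c') = a + b" using inv[of ?m a b False "[]"] s l by simp
    have "a' + b' + of_bool c' = 0"
    proof (rule ccontr)
      assume "a' + b' + of_bool c' \<noteq> 0"
      then have "2 ^ ?m * 1 \<le> 2 ^ ?m * (a' + b' + of_bool c')" by (intro mult_le_mono2) linarith
      with e sz_pair_less(1)[of a b] show False by linarith
    qed
    with e s show ?thesis by simp
  qed
  have "pt (\<lambda>x. msb (snd (snd (snd ((rip carry ^^ sz (f x, g x)) (f x, g x, False, []))))))"
    by (intro pt_msb pt_snd pt_rip assms) (auto simp: carry_def intro!: pt_disj pt_conj)
  then show ?thesis by (simp add: eq)
qed

text \<open>The invariant lives in the integers, since the unread parts may have a negative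
  difference. Once both numbers are used up, the final borrow tells whether \<open>a < b\<close>,
  and otherwise the digits form the difference.\<close>

lemma rip_borrow:
  fixes a b :: nat
  defines "r \<equiv> (rip borrow ^^ sz (a, b)) (a, b, False, [])"
  shows "fst (snd (snd r)) \<longleftrightarrow> a < b" "b \<le> a \<Longrightarrow> msb (snd (snd (snd r))) = a - b"
proof -
  let ?m = "sz (a, b)"
  have inv: "(case (rip borrow ^^ m) (a, b, c, l) of (a', b', c', l') \<Rightarrow>
      int (msb l') + 2 ^ length l' * (int a' - int b' - of_bool c')) =
      int (msb l) + 2 ^ length l * (int a - int b - of_bool c)" for m c l
  proof (induction m)
    case (Suc m)
    obtain a' b' c' l' where s: "(rip borrow ^^ m) (a, b, c, l) = (a', b', c', l')" by (metis surj_pair)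
    have "of_bool ((odd a' \<noteq> odd b') \<noteq> c') + 2 * (int (a' div 2) - int (b' div 2) - of_bool (borrow (odd a') (odd b') c')) =
       int a' - int b' - of_bool c'"
      unfolding borrow_def by (cases "odd a'"; cases "odd b'"; cases c') (auto elim!: oddE evenE)
    then have "int (msb l') + 2 ^ length l' * (of_bool ((odd a' \<noteq> odd b') \<noteq> c') +
       2 * (int (a' div 2) - int (b' div 2) - of_bool (borrow (odd a') (odd b') c'))) =
       int (msb l) + 2 ^ length l * (int a - int b - of_bool c)"
      using Suc s by simp
    moreover have "rip borrow (a', b', c', l') = (a' div 2, b' div 2, borrow (odd a') (odd b') c', ((odd a' \<noteq> odd b') \<noteq> c') # l')"
      by (simp add: rip_def)
    ultimately show ?case by (simp add: s algebra_simps)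
  qed simp
  obtain a' b' c' l' where s: "r = (a', b', c', l')" by (metis surj_pair)
  have z: "a' = 0" "b' = 0" and l: "length l' = ?m"
    using rip_fst[of ?m borrow a b False "[]"] s sz_pair_less(2,3)[of _ b] sz_pair_less(3)[of b a]
    unfolding r_def by auto
  have e: "int (msb l') - 2 ^ ?m * of_bool c' = int a - int b"
    using inv[of ?m False "[]"] s z l unfolding r_def by simp
  have lt: "int (msb l') < 2 ^ ?m" using msb_less[of l'] l by (simp add: of_nat_less_numeral_power_cancel_iff)
  have "c' \<longleftrightarrow> a < b"
  proof (cases c')
    case True
    with e have "int (msb l') - 2 ^ ?m = int a - int b" by simp
    with lt have "int a < int b" by linarith
    with True show ?thesis by simp
  next
    case False
    with e show ?thesis by simp
  qed
  with e s show "fst (snd (snd r)) \<longleftrightarrow> a < b" "b \<le> a \<Longrightarrow> msb (snd (snd (snd r))) = a - b"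
    by auto
qed

lemma pt_borrow:
  assumes "pt f" "pt g" shows "pt (\<lambda>x. (rip borrow ^^ sz (f x, g x)) (f x, g x, False, []))"
  by (intro pt_rip assms) (unfold borrow_def, intro pt_disj pt_conj pt_not; assumption)

lemma pt_less: assumes "pt f" "pt g" shows "pt (\<lambda>x. (f x :: nat) < g x)"
  using pt_fst[OF pt_snd[OF pt_snd[OF pt_borrow[OF assms]]]] by (simp add: rip_borrow)

lemma pt_le: assumes "pt f" "pt g" shows "pt (\<lambda>x. (f x :: nat) \<le> g x)"
  using pt_not[OF pt_less[OF assms(2,1)]] by (simp add: not_less)

lemma pt_diff: assumes "pt f" "pt g" shows "pt (\<lambda>x. (f x :: nat) - g x)"
proof -
  have "pt (\<lambda>x. if f x < g x then 0 else msb (snd (snd (snd ((rip borrow ^^ sz (f x, g x)) (f x, g x, False, []))))))"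
    by (intro pt_if pt_less assms pt_const pt_msb pt_snd pt_borrow)
  moreover have "(if a < b then 0 else msb (snd (snd (snd ((rip borrow ^^ sz (a, b)) (a, b, False, [])))))) = a - b" for a b
    using rip_borrow(2)[of b a] by auto
  ultimately show ?thesis by simp
qed

lemma pt_bits: assumes "pt f" shows "pt (\<lambda>x. rev (bin (f x)))"
proof -
  obtain P where P: "pl P" "\<And>x. sz (f x) \<le> P (sz x)" using pt_length[OF assms] by blast
  define G where "G s = (fst s div 2, odd (fst s) # snd s)" for s :: "nat \<times> bool list"
  have it: "m \<le> length (bin n) \<Longrightarrow> (G ^^ m) (n, []) = (n div 2 ^ m, rev (take m (bin n)))" for m n
  proof (induction m arbitrary: n)
    case (Suc m)
    have d: "drop m (bin n) = bin (n div 2 ^ m)" for m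
      by (induction m arbitrary: n) (auto simp: drop_Suc tl_bin div_mult2_eq)
    have "bin n ! m = odd (n div 2 ^ m)"
      using d[of m] Suc.prems tt_bin[of "n div 2 ^ m"] hd_drop_conv_nth[of m "bin n"]
      by (auto simp: tt_def) 
    with Suc show ?case
      by (simp add: G_def take_Suc_conv_app_nth) (simp flip: div_mult2_eq add: mult.commute)
  qed simp
  have "pt (\<lambda>x. (G ^^ sz (f x)) (f x, []))"
  proof (rule pt_iter[OF _ _ assms])
    show "pt (\<lambda>y :: 'a \<times> nat \<times> bool list. G (snd y))"
      unfolding G_def by (intro pt_pair pt_div2 pt_odd pt_Cons pt_fst pt_snd pt_id)
    show "pt (\<lambda>x. (f x, [] :: bool list))" by (intro pt_pair assms pt_const)
    show "pl (\<lambda>n. 8 * P n + 2)" by (intro pl_intros P)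
    fix x m assume m: "m \<le> sz (f x)"
    then have "sz (f x div 2 ^ m) \<le> P (sz x)" "length (take m (bin (f x))) \<le> P (sz x)"
      using sz_nat_mono[of "f x div 2 ^ m" "f x"] P(2)[of x] by (auto simp: div_le_dividend sz_nat)
    then show "sz ((G ^^ m) (f x, [])) \<le> 8 * P (sz x) + 2"
      using m it[of m "f x"] by (simp add: sz_nat sz_simps sz_bools)
  qed
  from pt_snd[OF this] show ?thesis by (simp add: it sz_nat)
qed

lemma msb_rev_bin: "msb (rev (bin n)) = n"
proof -
  have ap: "msb (xs @ [b]) = 2 * msb xs + of_bool b" for xs b by (simp add: msb_def)
  show ?thesis
  proof (induction n rule: less_induct)
    case (less n)
    then show ?case by (cases "n = 0") (auto simp: bin_simps ap)
  qed
qed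

lemma pt_mult: assumes "pt f" "pt g" shows "pt (\<lambda>x. f x * g x :: nat)"
proof -
  obtain P where P: "pl P" "\<And>x. sz (f x) \<le> P (sz x)" using pt_length[OF assms(1)] by blast
  obtain Q where Q: "pl Q" "\<And>x. sz (g x) \<le> Q (sz x)" using pt_length[OF assms(2)] by blast
  \<comment> \<open>Horner's scheme over the binary digits of \<open>f x\<close>. The summand
    \<open>of_bool False\<close> only casts doubling as an instance of
    \<open>pt_shift_in\<close>.\<close>
  have fold: "foldl (\<lambda>v b. 2 * v + of_bool False + (if b then k else 0)) 0 bs = msb bs * k" for k bs
    by (induction bs rule: rev_induct) (auto simp: msb_def algebra_simps)
  have "pt (\<lambda>x. foldl (\<lambda>v b. 2 * v + of_bool False + (if b then g x else 0)) 0 (rev (bin (f x))))"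
  proof (rule pt_foldl[OF _ pt_const pt_bits[OF assms(1)]])
    show "pt (\<lambda>y :: 'a \<times> nat \<times> bool. 2 * fst (snd y) + of_bool False + (if snd (snd y) then g (fst y) else 0))"
      by (intro pt_add pt_shift_in pt_if pt_fst pt_snd pt_id pt_const pt_o[OF assms(2)])
    show "pl (\<lambda>n. P n + Q n)" by (intro pl_intros P Q)
    fix x ys zs assume e: "rev (bin (f x)) = ys @ zs"
    have "msb ys * g x < 2 ^ length ys * 2 ^ sz (g x)"
      using msb_less[of ys] less_power_bin[of "g x"] by (intro mult_strict_mono) (auto simp: sz_nat)
    then have "sz (msb ys * g x) \<le> length ys + sz (g x)" by (intro sz_nat_le) (simp add: power_add)
    moreover have "length ys \<le> sz (f x)" using arg_cong[OF e, of length] by (simp add: sz_nat)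
    ultimately show "sz (foldl (\<lambda>v b. 2 * v + of_bool False + (if b then g x else 0)) 0 ys) \<le> P (sz x) + Q (sz x)"
      unfolding fold using P(2)[of x] Q(2)[of x] by linarith
  qed
  then show ?thesis unfolding fold msb_rev_bin .
qed

text \<open>The exponent comes in unary, as the length of a list, because a power of two with a
  binary exponent would be too long to write down.\<close>

lemma pt_mult_power2: assumes "pt f" "pt us" shows "pt (\<lambda>x. f x * 2 ^ length (us x) :: nat)"
proof -
  obtain P where P: "pl P" "\<And>x. sz (f x) \<le> P (sz x)" using pt_length[OF assms(1)] by blast
  obtain Q where Q: "pl Q" "\<And>x. sz (us x) \<le> Q (sz x)" using pt_length[OF assms(2)] by blast
  have it: "((\<lambda>v. 2 * v + of_bool False) ^^ m) n = n * 2 ^ m" for m n :: nat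
    by (induction m) auto
  have "pt (\<lambda>x. ((\<lambda>v. 2 * v + of_bool False) ^^ length (us x)) (f x))"
  proof (rule pt_repeat[OF _ assms])
    show "pt (\<lambda>y :: 'a \<times> nat. 2 * snd y + of_bool False)" by (intro pt_shift_in pt_snd pt_id pt_const)
    show "pl (\<lambda>n. P n + Q n)" by (intro pl_intros P Q)
    fix x m assume "m \<le> length (us x)"
    then have "m \<le> Q (sz x)" using Q(2)[of x] length_le_sz[of "us x"] by linarith
    moreover have "sz (f x * 2 ^ m) \<le> sz (f x) + m"
      by (rule sz_nat_le) (use less_power_bin[of "f x"] in \<open>simp add: sz_nat power_add\<close>)
    ultimately show "sz (((\<lambda>v. 2 * v + of_bool False) ^^ m) (f x)) \<le> P (sz x) + Q (sz x)"
      using P(2)[of x] unfolding it by linarith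
  qed
  then show ?thesis unfolding it .
qed

lemma pt_div_power2: assumes "pt f" "pt us" shows "pt (\<lambda>x. (f x :: nat) div 2 ^ length (us x))"
proof -
  obtain P where P: "pl P" "\<And>x. sz (f x) \<le> P (sz x)" using pt_length[OF assms(1)] by blast
  have it: "((\<lambda>v. v div 2) ^^ m) n = n div 2 ^ m" for m n :: nat
    by (induction m) (auto simp: div_mult2_eq[symmetric] mult.commute)
  have "pt (\<lambda>x. ((\<lambda>v. v div 2) ^^ length (us x)) (f x))"
  proof (rule pt_repeat[OF _ assms P(1)])
    show "pt (\<lambda>y :: 'a \<times> nat. snd y div 2)" by (intro pt_div2 pt_snd pt_id)
    fix x m
    show "sz (((\<lambda>v. v div 2) ^^ m) (f x)) \<le> P (sz x)"
      unfolding it using sz_nat_mono[of "f x div 2 ^ m" "f x"] P(2)[of x] by (simp add: div_le_dividend)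
  qed
  then show ?thesis unfolding it .
qed

lemma pt_length_list: assumes "pt xs" shows "pt (\<lambda>x. length (xs x))"
proof -
  obtain P where P: "pl P" "\<And>x. sz (xs x) \<le> P (sz x)" using pt_length[OF assms] by blast
  have it: "((\<lambda>v. v + 1) ^^ m) 0 = m" for m :: nat by (induction m) auto
  have "pt (\<lambda>x. ((\<lambda>v. v + 1) ^^ length (xs x)) (0 :: nat))"
  proof (rule pt_repeat[OF _ pt_const assms P(1)])
    show "pt (\<lambda>y :: 'a \<times> nat. snd y + 1)" by (intro pt_add pt_snd pt_id pt_const)
    fix x m assume "m \<le> length (xs x)"
    then show "sz (((\<lambda>v. v + 1) ^^ m) (0 :: nat)) \<le> P (sz x)"
      unfolding it using sz_nat_self[of m] P(2)[of x] length_le_sz[of "xs x"] by linarith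
  qed
  then show ?thesis unfolding it .
qed

lemma pt_sum_list: assumes "pt xs" shows "pt (\<lambda>x. sum_list (xs x) :: nat)"
proof -
  obtain P where P: "pl P" "\<And>x. sz (xs x) \<le> P (sz x)" using pt_length[OF assms] by blast
  have fold: "foldl (\<lambda>a b. a + b) k ys = k + sum_list ys" for k :: nat and ys
    by (induction ys arbitrary: k) auto
  have "sum_list ys < 2 ^ sz ys" for ys :: "nat list"
  proof (induction ys)
    case (Cons a ys)
    have "a < 2 ^ sz a" using less_power_bin[of a] by (simp add: sz_nat)
    then have "a + sum_list ys < 2 ^ sz a + 2 ^ sz ys" using Cons by linarith
    also have "\<dots> \<le> 2 ^ (sz a + sz ys) + 2 ^ (sz a + sz ys)" by (intro add_mono power_increasing) auto
    also have "\<dots> = 2 ^ Suc (sz a + sz ys)" by simp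
    also have "\<dots> \<le> 2 ^ sz (a # ys)" by (rule power_increasing) (auto simp: sz_simps)
    finally show ?case by simp
  qed simp
  then have szs: "sz (sum_list ys) \<le> sz ys" for ys :: "nat list" by (rule sz_nat_le)
  have "pt (\<lambda>x. foldl (\<lambda>a b. a + b) 0 (xs x))"
  proof (rule pt_foldl[OF _ pt_const assms P(1)])
    show "pt (\<lambda>y :: 'a \<times> nat \<times> nat. fst (snd y) + snd (snd y))" by (intro pt_add pt_fst pt_snd pt_id)
    fix x ys zs assume "xs x = ys @ zs"
    then show "sz (foldl (\<lambda>a b. a + b) 0 ys) \<le> P (sz x)"
      using P(2)[of x] szs[of ys] by (simp add: fold sz_simps)
  qed
  then show ?thesis by (simp add: fold)
qed

lemmas pt_intros = pt_pair pt_fst pt_snd pt_if pt_not pt_conj pt_disj pt_Cons pt_append pt_null pt_hd pt_tl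
  pt_concat pt_filter pt_Ball pt_Bex pt_rev pt_zip pt_map pt_add pt_less pt_le pt_diff pt_mult
  pt_mult_power2 pt_div_power2 pt_length_list pt_sum_list pt_id pt_const

section \<open>Finite-dimensional norms\<close>

definition lp :: "real \<Rightarrow> 'i set \<Rightarrow> ('i \<Rightarrow> real) \<Rightarrow> real" where
  "lp p I x = (\<Sum>i\<in>I. \<bar>x i\<bar> powr p) powr (1 / p)"

lemma lp_nonneg [simp]: "0 \<le> lp p I x"
  by (simp add: lp_def)

lemma lp_powr: "0 < p \<Longrightarrow> lp p I x powr p = (\<Sum>i\<in>I. \<bar>x i\<bar> powr p)"
  by (simp add: lp_def powr_powr sum_nonneg)

lemma lp_cong: "(\<And>i. i \<in> I \<Longrightarrow> \<bar>x i\<bar> = \<bar>y i\<bar>) \<Longrightarrow> lp p I x = lp p I y"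
  by (simp add: lp_def)

lemma lp_eq_0_iff: "finite I \<Longrightarrow> lp p I x = 0 \<longleftrightarrow> (\<forall>i\<in>I. x i = 0)"
  by (simp add: lp_def sum_nonneg_eq_0_iff)

lemma lp_scale: "0 < p \<Longrightarrow> lp p I (\<lambda>i. k * x i) = \<bar>k\<bar> * lp p I x"
  by (simp add: lp_def abs_mult powr_mult flip: sum_distrib_left) (simp add: powr_mult powr_powr sum_nonneg)

lemma Hoelder:
  assumes p: "1 < p" "1 < q" "1 / p + 1 / q = 1"
  shows "(\<Sum>i\<in>I. \<bar>x i * y i\<bar>) \<le> lp p I x * lp q I y"
proof (cases "finite I \<and> lp p I x \<noteq> 0 \<and> lp q I y \<noteq> 0")
  case False
  then consider "infinite I" | "finite I" "\<forall>i\<in>I. x i = 0" | "finite I" "\<forall>i\<in>I. y i = 0"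
    by (auto simp: lp_eq_0_iff)
  then show ?thesis by cases simp_all
next
  case True
  let ?a = "lp p I x" and ?b = "lp q I y"
  from True have pos: "0 < ?a" "0 < ?b" by (simp_all add: less_le)
  have "\<bar>x i * y i\<bar> / (?a * ?b) \<le> \<bar>x i\<bar> powr p / (?a powr p * p) + \<bar>y i\<bar> powr q / (?b powr q * q)" for i
  proof -
    have "(\<bar>x i\<bar> / ?a) * (\<bar>y i\<bar> / ?b) \<le> (\<bar>x i\<bar> / ?a) powr p / p + (\<bar>y i\<bar> / ?b) powr q / q"
      by (rule Youngs_inequality) (use p pos in auto)
    then show ?thesis using pos by (simp add: abs_mult powr_divide)
  qed
  then have "(\<Sum>i\<in>I. \<bar>x i * y i\<bar> / (?a * ?b)) \<le>
      (\<Sum>i\<in>I. \<bar>x i\<bar> powr p / (?a powr p * p) + \<bar>y i\<bar> powr q / (?b powr q * q))"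
    by (intro sum_mono)
  also have "\<dots> = (\<Sum>i\<in>I. \<bar>x i\<bar> powr p) / (?a powr p * p) + (\<Sum>i\<in>I. \<bar>y i\<bar> powr q) / (?b powr q * q)"
    by (simp add: sum.distrib sum_divide_distrib)
  also have "\<dots> = 1 / p + 1 / q"
  proof -
    have "(\<Sum>i\<in>I. \<bar>x i\<bar> powr p) = ?a powr p" "(\<Sum>i\<in>I. \<bar>y i\<bar> powr q) = ?b powr q"
      using lp_powr[of p I x] lp_powr[of q I y] p by simp_all
    with pos show ?thesis by simp
  qed
  finally have *: "(\<Sum>i\<in>I. \<bar>x i * y i\<bar>) / (?a * ?b) \<le> 1" using p by (simp add: sum_divide_distrib)
  have "0 < ?a * ?b" using pos by simp
  with * show ?thesis by (simp only: pos_divide_le_eq mult_1)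
qed

text \<open>The witness is the equality case of the Hoelder inequality: the sign of
  \<open>x i\<close> times the power \<open>q - 1\<close> of the normalized entry. It has norm 1
  because \<open>(q - 1) * p = q\<close>.\<close>

lemma lp_dual:
  assumes p: "1 < p" "1 < q" "1 / p + 1 / q = 1" and I: "finite I" "lp q I x \<noteq> 0"
  shows "\<exists>y. (\<Sum>i\<in>I. y i * x i) = lp q I x \<and> lp p I y = 1"
proof -
  let ?a = "lp q I x"
  have a: "0 < ?a" using I by (simp add: less_le)
  define y where "y i = sgn (x i) * (\<bar>x i\<bar> / ?a) powr (q - 1)" for i
  have pq: "(q - 1) * p = q" using p by (simp add: field_simps)
  have "\<bar>y i\<bar> powr p = \<bar>x i\<bar> powr q / ?a powr q" if "i \<in> I" for i
    using a p pq by (cases "x i = 0") (auto simp: y_def abs_mult powr_powr powr_divide abs_sgn_eq)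
  then have "(\<Sum>i\<in>I. \<bar>y i\<bar> powr p) = (\<Sum>i\<in>I. \<bar>x i\<bar> powr q) / ?a powr q"
    by (simp add: sum_divide_distrib)
  also have "\<dots> = 1" using lp_powr[of q I x, symmetric] p a by simp
  finally have 1: "lp p I y = 1" by (simp add: lp_def)
  have "y i * x i = \<bar>x i\<bar> powr q / ?a powr (q - 1)" for i
  proof (cases "x i = 0")
    case False
    have "y i * x i = \<bar>x i\<bar> * (\<bar>x i\<bar> / ?a) powr (q - 1)"
      by (simp add: y_def sgn_mult_abs mult.assoc[symmetric] abs_sgn mult.commute[of _ "x i"])
    also have "\<dots> = \<bar>x i\<bar> powr q / ?a powr (q - 1)"
      using a powr_mult_base[of "\<bar>x i\<bar>" "q - 1"] by (simp add: powr_divide)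
    finally show ?thesis .
  qed (use p in simp)
  then have "(\<Sum>i\<in>I. y i * x i) = ?a powr q / ?a powr (q - 1)"
    using lp_powr[of q I x] p by (simp flip: sum_divide_distrib)
  also have "\<dots> = ?a" using a by (simp flip: powr_diff)
  finally show ?thesis using 1 by blast
qed

text \<open>Testing the sum against its dual vector leaves two Hoelder inequalities.\<close>

lemma Minkowski:
  assumes p: "1 < p" "1 < q" "1 / p + 1 / q = 1" and I: "finite I"
  shows "lp p I (\<lambda>i. x i + y i) \<le> lp p I x + lp p I y"
proof (cases "lp p I (\<lambda>i. x i + y i) = 0")
  case False
  then obtain z where z: "(\<Sum>i\<in>I. z i * (x i + y i)) = lp p I (\<lambda>i. x i + y i)" "lp q I z = 1"
    using lp_dual[of q p I "\<lambda>i. x i + y i"] p I by (auto simp: add.commute)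
  have "(\<Sum>i\<in>I. z i * (x i + y i)) \<le> (\<Sum>i\<in>I. \<bar>x i * z i\<bar> + \<bar>y i * z i\<bar>)"
  proof (rule sum_mono)
    fix i
    have "z i * (x i + y i) = x i * z i + y i * z i" by (simp add: algebra_simps)
    then show "z i * (x i + y i) \<le> \<bar>x i * z i\<bar> + \<bar>y i * z i\<bar>" by linarith
  qed
  also have "\<dots> \<le> lp p I x * lp q I z + lp p I y * lp q I z"
    using Hoelder[OF p, of x z I] Hoelder[OF p, of y z I] by (simp add: sum.distrib)
  finally show ?thesis using z by simp
qed simp


section \<open>Small sets and level sets\<close>

text \<open>Split \<open>g\<close> into its minimum \<open>m\<close> and the rest. The constant part
  contributes \<open>m\<close> times the weight inside \<open>H\<close>, which the hypothesis bounds
  for \<open>S = H\<close>; the rest vanishes where the minimum is attained, so induction applies to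
  the smaller level set \<open>H'\<close>.\<close>

lemma layer_cake:
  fixes w :: "'a \<Rightarrow> 'a \<Rightarrow> real" and g :: "'a \<Rightarrow> real"
  assumes "finite H" "\<And>u. u \<in> H \<Longrightarrow> 0 \<le> g u"
    "\<And>S. S \<subseteq> H \<Longrightarrow> (\<Sum>u\<in>S. \<Sum>v\<in>S. w u v) \<le> c * real (card S)"
  shows "(\<Sum>u\<in>H. \<Sum>v\<in>H. w u v * min (g u) (g v)) \<le> c * (\<Sum>u\<in>H. g u)"
  using assms
proof (induction "card H" arbitrary: H g rule: less_induct)
  case less
  show ?case
  proof (cases "H = {}")
    case False
    define m where "m = Min (g ` H)"
    have m: "m \<le> g u" if "u \<in> H" for u using that less.prems(1) by (simp add: m_def)
    have "m \<in> g ` H" unfolding m_def by (rule Min_in) (use False less.prems(1) in auto)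
    then obtain u0 where u0: "u0 \<in> H" "g u0 = m" by (metis imageE)
    have m0: "0 \<le> m" using less.prems(2) u0 by auto
    define H' where "H' = {u \<in> H. m < g u}"
    have H': "H' \<subseteq> H" "finite H'" "u0 \<notin> H'" using less.prems(1) u0 by (auto simp: H'_def)
    have "card H' < card H" using H' u0 less.prems(1) by (intro psubset_card_mono) auto
    then have IH: "(\<Sum>u\<in>H'. \<Sum>v\<in>H'. w u v * min (g u - m) (g v - m)) \<le> c * (\<Sum>u\<in>H'. g u - m)"
      by (rule less.hyps) (use H' less.prems in \<open>auto simp: H'_def\<close>)
    have min_m: "min (g u) (g v) = m + min (g u - m) (g v - m)" for u v by simp
    have zero: "min (g u - m) (g v - m) = 0" if "u \<in> H" "v \<in> H" "u \<notin> H' \<or> v \<notin> H'" for u v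
      using that m[of u] m[of v] by (auto simp: H'_def)
    have "(\<Sum>u\<in>H. \<Sum>v\<in>H. w u v * min (g u) (g v)) =
       m * (\<Sum>u\<in>H. \<Sum>v\<in>H. w u v) + (\<Sum>u\<in>H. \<Sum>v\<in>H. w u v * min (g u - m) (g v - m))"
      by (simp only: min_m distrib_left sum.distrib) (simp add: sum_distrib_left mult.commute)
    also have "(\<Sum>u\<in>H. \<Sum>v\<in>H. w u v * min (g u - m) (g v - m)) =
       (\<Sum>u\<in>H'. \<Sum>v\<in>H'. w u v * min (g u - m) (g v - m))"
    proof -
      have "(\<Sum>v\<in>H. w u v * min (g u - m) (g v - m)) = (\<Sum>v\<in>H'. w u v * min (g u - m) (g v - m))"
        if "u \<in> H" for u
        by (rule sum.mono_neutral_right) (use less.prems(1) H' zero that in auto)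
      moreover have "(\<Sum>u\<in>H. \<Sum>v\<in>H'. w u v * min (g u - m) (g v - m)) =
          (\<Sum>u\<in>H'. \<Sum>v\<in>H'. w u v * min (g u - m) (g v - m))"
        by (rule sum.mono_neutral_right) (use less.prems(1) H' zero in \<open>auto intro!: sum.neutral\<close>)
      ultimately show ?thesis by simp
    qed
    also have "m * (\<Sum>u\<in>H. \<Sum>v\<in>H. w u v) \<le> m * (c * card H)"
      by (rule mult_left_mono[OF less.prems(3) m0]) simp
    also note IH
    also have "(\<Sum>u\<in>H'. g u - m) = (\<Sum>u\<in>H. g u - m)"
      by (rule sum.mono_neutral_left) (use less.prems(1) H' m in \<open>force simp: H'_def\<close>)+
    also have "m * (c * card H) + c * (\<Sum>u\<in>H. g u - m) = c * (\<Sum>u\<in>H. g u)"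
      by (simp add: sum_subtractf algebra_simps)
    finally show ?thesis by simp
  qed simp
qed

text \<open>Either \<open>b\<close> is at most \<open>\<rho> * a\<close> and the first term
  suffices, or \<open>a\<close> is below \<open>b / \<rho>\<close> and the second does.\<close>

lemma powr_split:
  fixes a b :: real
  assumes "0 \<le> a" "0 \<le> b" "0 < \<rho>" "1 < q"
  shows "a powr (q - 1) * b \<le> \<rho> * a powr q + \<rho> powr (1 - q) * b powr q"
proof (cases "b \<le> \<rho> * a")
  case True
  then have "a powr (q - 1) * b \<le> a powr (q - 1) * (\<rho> * a)" by (intro mult_left_mono) auto
  also have "\<dots> = \<rho> * a powr q" using powr_mult_base[of a "q - 1"] assms(1) by (simp add: mult_ac)
  finally show ?thesis by (smt (verit) mult_nonneg_nonneg powr_ge_zero)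
next
  case False
  then have "a \<le> b / \<rho>" using assms by (simp add: field_simps)
  then have "a powr (q - 1) * b \<le> (b / \<rho>) powr (q - 1) * b" using assms by (intro mult_right_mono powr_mono2) auto
  also have "\<dots> = \<rho> powr (1 - q) * (b * b powr (q - 1))"
    using assms by (simp add: powr_divide powr_minus_divide[of \<rho> "q - 1", simplified])
  also have "\<dots> = \<rho> powr (1 - q) * b powr q" using powr_mult_base[of b "q - 1"] assms by simp
  finally show ?thesis using assms by (smt (verit) mult_nonneg_nonneg powr_ge_zero)
qed

text \<open>The large coefficient now falls on a minimum, the quantity that
  \<open>layer_cake\<close> controls by expansion. For \<open>a < b\<close> the roles of
  \<open>a\<close> and \<open>b\<close> are exchanged first, which is where \<open>2 \<le> q\<close>
  enters.\<close>

lemma powr_split_min: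
  fixes a b :: real
  assumes "0 \<le> a" "0 \<le> b" "0 < \<rho>" "\<rho> \<le> 1" "2 \<le> q"
  shows "a powr (q - 1) * b \<le> \<rho> * (a powr q + b powr q) + \<rho> powr (1 - q) * min (a powr q) (b powr q)"
proof (cases "b \<le> a")
  case True
  then have "b powr q \<le> a powr q" using assms by (intro powr_mono2) auto
  then have mn: "min (a powr q) (b powr q) = b powr q" by simp
  have "0 \<le> \<rho> * b powr q" using assms by simp
  moreover have "a powr (q - 1) * b \<le> \<rho> * a powr q + \<rho> powr (1 - q) * b powr q"
    using powr_split[of a b \<rho> q] assms by simp
  ultimately show ?thesis unfolding distrib_left mn by linarith
next
  case False
  then have ab: "a \<le> b" by simp
  have "a powr (q - 1) * b \<le> b powr (q - 1) * a"
  proof -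
    have "a powr (q - 2) \<le> b powr (q - 2)" using assms ab by (intro powr_mono2) auto
    then have "a powr (q - 2) * (a * b) \<le> b powr (q - 2) * (a * b)" using assms by (intro mult_right_mono) auto
    moreover have "c powr (q - 1) = c powr (q - 2) * c" if "0 \<le> c" for c :: real
      using powr_mult_base[OF that, of "q - 2"] by (simp add: mult.commute)
    ultimately show ?thesis using assms by (simp add: mult.assoc mult.commute[of b a])
  qed
  also have "\<dots> \<le> \<rho> * b powr q + \<rho> powr (1 - q) * a powr q"
    using powr_split[of b a \<rho> q] assms by simp
  also have "\<dots> \<le> \<rho> * (a powr q + b powr q) + \<rho> powr (1 - q) * min (a powr q) (b powr q)"
  proof -
    have "a powr q \<le> b powr q" using assms ab by (intro powr_mono2) auto
    then have "min (a powr q) (b powr q) = a powr q" by simp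
    moreover have "0 \<le> \<rho> * a powr q" using assms by simp
    ultimately show ?thesis by (simp add: distrib_left)
  qed
  finally show ?thesis .
qed

text \<open>The increments are nondecreasing. Exceeding \<open>c i\<close> needs a positive
  increment before \<open>j\<close>, and from then on the sequence cannot fall below
  \<open>c j\<close>.\<close>

lemma convex_seq_le_max:
  fixes c :: "nat \<Rightarrow> real"
  assumes conv: "\<And>j. 2 * c (Suc j) \<le> c j + c (Suc (Suc j))" and ij: "i \<le> j" "j \<le> k"
  shows "c j \<le> max (c i) (c k)"
proof -
  have inc: "c (Suc l) - c l \<le> c (Suc l') - c l'" if "l \<le> l'" for l l'
    using that
  proof (induction l' rule: dec_induct)
    case (step n)
    with conv[of n] show ?case by linarith
  qed simp
  show ?thesis
  proof (rule ccontr)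
    assume a: "\<not> c j \<le> max (c i) (c k)"
    have "\<exists>l. i \<le> l \<and> l < j \<and> c l < c (Suc l)"
    proof (rule ccontr)
      assume n: "\<not> (\<exists>l. i \<le> l \<and> l < j \<and> c l < c (Suc l))"
      have "c n \<le> c i" if "i \<le> n" "n \<le> j" for n
        using that
      proof (induction n rule: dec_induct)
        case (step m)
        then have "\<not> c m < c (Suc m)" using n by auto
        with step show ?case by auto
      qed simp
      from this[OF ij(1) order_refl] a show False by simp
    qed
    then obtain l where l: "i \<le> l" "l < j" "c l < c (Suc l)" by blast
    have "c j \<le> c n" if "j \<le> n" for n
      using that
    proof (induction n rule: dec_induct)
      case (step m)
      with inc[of l m] l show ?case by auto
    qed simp
    from this[OF ij(2)] a show False by simp
  qed
qed


section \<open>The quadratic form of a regular graph\<close>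

text \<open>The constant in the bound on the power sum \<open>s 0\<close> of the lemma
  \<open>spread\<close>, raised to \<open>2 / q\<close> when that bound is solved for the
  norm.\<close>

definition spread_const :: "real \<Rightarrow> real" where
  "spread_const q = (4 + 6 * 16 powr (q - 1)) powr (2 / q)"

text \<open>\<open>w\<close> will be an adjacency matrix. \<open>R\<close> replaces the degree as
  normalization because it will be a power of two, which turns division by its powers into a shift
  of bits.\<close>

locale regular =
  fixes N r :: nat and w :: "nat \<Rightarrow> nat \<Rightarrow> real" and R :: real
  assumes w: "\<And>u v. 0 \<le> w u v" and sym: "\<And>u v. u < N \<Longrightarrow> v < N \<Longrightarrow> w u v = w v u"
    and deg: "\<And>u. u < N \<Longrightarrow> (\<Sum>v<N. w u v) = real r"
    and r: "0 < r" and R: "real r \<le> R" "R \<le> 2 * real r"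
begin

definition D :: "(nat \<Rightarrow> real) \<Rightarrow> nat \<Rightarrow> real" where
  "D x u = 64 / R * (real r * x u - (\<Sum>v<N. w u v * x v))"

definition ip :: "(nat \<Rightarrow> real) \<Rightarrow> (nat \<Rightarrow> real) \<Rightarrow> real" where
  "ip x y = (\<Sum>u<N. x u * y u)"

lemma R_pos: "0 < R"
  using r R by linarith

lemma deg_swap: "v < N \<Longrightarrow> (\<Sum>u<N. w u v) = real r"
  using deg[of v] sum.cong[of "{..<N}" "{..<N}" "\<lambda>u. w u v" "\<lambda>u. of_bool (e v u)"] sym[of _ v]
  by fastforce

lemma ip_commute: "ip x y = ip y x"
  by (simp add: ip_def mult.commute)

lemma ip_nonneg: "0 \<le> ip x x"
  by (simp add: ip_def sum_nonneg)

lemma ip_linear: "ip (\<lambda>u. x u + k * y u) z = ip x z + k * ip y z" "ip z (\<lambda>u. x u + k * y u) = ip z x + k * ip z y"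
  by (simp_all add: ip_def algebra_simps sum.distrib sum_distrib_left)

lemma D_linear: "D (\<lambda>u. x u + k * y u) = (\<lambda>u. D x u + k * D y u)"
  by (simp add: D_def fun_eq_iff algebra_simps sum.distrib sum_distrib_left sum_divide_distrib add_divide_distrib diff_divide_distrib)

lemma Dn_linear: "(D ^^ m) (\<lambda>u. x u + k * y u) = (\<lambda>u. (D ^^ m) x u + k * (D ^^ m) y u)"
  by (induction m) (simp_all add: D_linear)

lemma ip_D: "ip x (D y) = ip (D x) y"
proof -
  have sw: "(\<Sum>u<N. \<Sum>v<N. x u * (w u v * y v)) = (\<Sum>u<N. \<Sum>v<N. w u v * x v * y u)"
    by (subst sum.swap) (auto intro!: sum.cong simp: sym)
  have L: "ip x (D y) = 64 / R * ((\<Sum>u<N. real r * x u * y u) - (\<Sum>u<N. \<Sum>v<N. x u * (w u v * y v)))"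
    unfolding ip_def D_def
    by (simp add: sum_distrib_left right_diff_distrib sum_subtractf sum_divide_distrib diff_divide_distrib mult_ac)
  have R: "ip (D x) y = 64 / R * ((\<Sum>u<N. real r * x u * y u) - (\<Sum>u<N. \<Sum>v<N. w u v * x v * y u))"
    unfolding ip_def D_def
    by (simp add: sum_distrib_left sum_distrib_right left_diff_distrib right_diff_distrib sum_subtractf sum_divide_distrib diff_divide_distrib mult_ac)
  show ?thesis unfolding L R sw ..
qed

lemma D_form: "ip x (D x) = 32 / R * (\<Sum>u<N. \<Sum>v<N. w u v * (x u - x v)\<^sup>2)"
proof -
  have "(\<Sum>u<N. \<Sum>v<N. w u v * (x u - x v)\<^sup>2) =
     (\<Sum>u<N. \<Sum>v<N. w u v * (x u)\<^sup>2) + (\<Sum>u<N. \<Sum>v<N. w u v * (x v)\<^sup>2)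
       - 2 * (\<Sum>u<N. x u * (\<Sum>v<N. w u v * x v))"
    by (simp add: power2_diff algebra_simps sum.distrib sum_subtractf sum_distrib_left)
  also have "(\<Sum>u<N. \<Sum>v<N. w u v * (x u)\<^sup>2) = (\<Sum>u<N. real r * (x u)\<^sup>2)"
    by (intro sum.cong refl) (simp add: deg flip: sum_distrib_right)
  also have "(\<Sum>u<N. \<Sum>v<N. w u v * (x v)\<^sup>2) = (\<Sum>v<N. real r * (x v)\<^sup>2)"
    by (subst sum.swap, intro sum.cong refl) (simp add: deg_swap flip: sum_distrib_right)
  finally have *: "(\<Sum>u<N. \<Sum>v<N. w u v * (x u - x v)\<^sup>2) =
     2 * (\<Sum>u<N. real r * (x u)\<^sup>2) - 2 * (\<Sum>u<N. x u * (\<Sum>v<N. w u v * x v))" by simp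
  have "ip x (D x) = 64 / R * ((\<Sum>u<N. real r * (x u)\<^sup>2) - (\<Sum>u<N. x u * (\<Sum>v<N. w u v * x v)))"
    unfolding ip_def D_def
    by (simp add: sum_distrib_left right_diff_distrib sum_subtractf sum_divide_distrib diff_divide_distrib power2_eq_square mult_ac)
  then show ?thesis unfolding * by (simp add: algebra_simps diff_divide_distrib)
qed

lemma D_psd: "0 \<le> ip x (D x)"
  unfolding D_form using R_pos w by (intro mult_nonneg_nonneg sum_nonneg) auto

lemma ip_Dn: "ip x ((D ^^ (a + b)) y) = ip ((D ^^ a) x) ((D ^^ b) y)"
proof (induction a arbitrary: x)
  case (Suc a)
  have "ip x ((D ^^ (Suc a + b)) y) = ip (D x) ((D ^^ (a + b)) y)" by (simp add: ip_D)
  also have "\<dots> = ip ((D ^^ a) (D x)) ((D ^^ b) y)" by (rule Suc)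
  finally show ?case by (simp add: funpow_swap1)
qed simp

text \<open>An even power gives the square of a norm; an odd power \<open>2 * k + 1\<close> gives
  the form of \<open>D\<close> at the vector \<open>(D ^^ k) x\<close>.\<close>

lemma Dn_psd: "0 \<le> ip x ((D ^^ m) x)"
proof (cases "even m")
  case True
  then obtain k where "m = k + k" by (metis mult_2 evenE)
  then show ?thesis using ip_Dn[of x k k x] ip_nonneg by simp
next
  case False
  then obtain k where "m = k + Suc k" by (metis add_Suc_right mult_2 oddE Suc_eq_plus1)
  then show ?thesis using ip_Dn[of x k "Suc k" x] D_psd[of "(D ^^ k) x"] by simp
qed

text \<open>The second difference of the moments is the form of \<open>D ^^ j\<close> at the vector
  \<open>x - D x\<close>, hence nonnegative.\<close>

lemma Dn_convex: "2 * ip x ((D ^^ Suc j) x) \<le> ip x ((D ^^ j) x) + ip x ((D ^^ Suc (Suc j)) x)"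
proof -
  let ?y = "\<lambda>u. x u + (- 1) * D x u"
  have sw: "(D ^^ j) (D x) = (D ^^ Suc j) x" by (simp add: funpow_swap1)
  have a: "ip (D x) ((D ^^ j) x) = ip x ((D ^^ Suc j) x)" "ip x ((D ^^ j) (D x)) = ip x ((D ^^ Suc j) x)"
    "ip (D x) ((D ^^ j) (D x)) = ip x ((D ^^ Suc (Suc j)) x)"
    unfolding sw by (simp_all flip: ip_D)
  have "0 \<le> ip ?y ((D ^^ j) ?y)" by (rule Dn_psd)
  also have "\<dots> = ip x ((D ^^ j) x) - 2 * ip x ((D ^^ Suc j) x) + ip x ((D ^^ Suc (Suc j)) x)"
    unfolding Dn_linear ip_linear a by simp
  finally show ?thesis by simp
qed

lemma Dn_le_max: "i \<le> j \<Longrightarrow> j \<le> k \<Longrightarrow> ip x ((D ^^ j) x) \<le> max (ip x ((D ^^ i) x)) (ip x ((D ^^ k) x))"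
  by (rule convex_seq_le_max[where c = "\<lambda>j. ip x ((D ^^ j) x)"]) (rule Dn_convex)

text \<open>The bound expresses \<open>D\<^sup>2\<^sup>T (1 + D\<^sup>2\<^sup>T)\<^sup>-\<^sup>1 \<le> D\<close>.\<close>

lemma resolvent_bound:
  assumes T: "0 < T" and s: "\<And>u. u < N \<Longrightarrow> x u + (D ^^ (2 * T)) x u = s u"
  shows "ip s s - ip s (D s) \<le> ip s x"
proof -
  define c where "c j = ip x ((D ^^ j) x)" for j
  define s' where "s' u = x u + 1 * (D ^^ (2 * T)) x u" for u
  have ss: "ip s y = ip s' y" "ip y s = ip y s'" for y
    using s by (simp_all add: ip_def s'_def)
  have D_cong: "u < N \<Longrightarrow> D s u = D s' u" for u
    using s by (simp add: D_def s'_def)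
  have Ds: "ip s (D s) = ip s' (D s')"
    unfolding ss by (simp add: ip_def D_cong)
  have cc: "ip ((D ^^ a) x) ((D ^^ b) x) = c (a + b)" for a b
    by (simp add: c_def ip_Dn)
  have c0: "ip x ((D ^^ b) x) = c b" "ip ((D ^^ b) x) x = c b" for b
    by (simp_all add: c_def ip_commute)
  have 1: "ip s' x = c 0 + c (2 * T)"
    unfolding s'_def ip_linear c0 using c0(1)[of 0] by simp
  have 2: "ip s' s' = c 0 + 2 * c (2 * T) + c (4 * T)"
    unfolding s'_def ip_linear c0 cc using c0(1)[of 0] by simp
  have Ds': "D s' = (\<lambda>u. (D ^^ 1) x u + 1 * (D ^^ (Suc (2 * T))) x u)"
    unfolding s'_def D_linear by simp
  have 3: "ip s' (D s') = c 1 + 2 * c (2 * T + 1) + c (4 * T + 1)"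
    unfolding Ds' unfolding s'_def ip_linear c0 cc by simp
  \<comment> \<open>In moments the claim is \<open>c (2 * T) + c (4 * T) \<le> c 1 + 2 * c (2 * T +
    1) + c (4 * T + 1)\<close>. Convexity bounds each term on the left by two terms on the right
    whose indices enclose its own; the indices are in order because \<open>T\<close> is
    positive.\<close>
  have "c (2 * T) \<le> max (c 1) (c (2 * T + 1))" "c (4 * T) \<le> max (c (2 * T + 1)) (c (4 * T + 1))"
    unfolding c_def by (rule Dn_le_max; use T in simp)+
  moreover have "0 \<le> c j" for j unfolding c_def by (rule Dn_psd)
  ultimately have "c (2 * T) + c (4 * T) \<le> c 1 + 2 * c (2 * T + 1) + c (4 * T + 1)"
    by (smt (verit))
  moreover have "ip s x = ip s' x" "ip s s = ip s' s'" by (simp_all only: ss(1)[of x] ss(1)[of s] ss(2)[of s'])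
  ultimately show ?thesis unfolding Ds 1 2 3 by simp
qed

lemma indicator_form:
  assumes S: "S \<subseteq> {..<N}"
  shows "ip (indicator S) (D (indicator S)) =
    64 / R * (real r * real (card S) - (\<Sum>u\<in>S. \<Sum>v\<in>S. w u v))"
proof -
  have sum_ind: "(\<Sum>v<N. f v * indicator S v) = (\<Sum>v\<in>S. f v)" for f :: "nat \<Rightarrow> real"
  proof -
    have "(\<Sum>v<N. f v * indicator S v) = (\<Sum>v\<in>S. f v * indicator S v)"
      by (rule sum.mono_neutral_right) (use S in auto)
    then show ?thesis by simp
  qed
  have "ip (indicator S) (D (indicator S)) = (\<Sum>u\<in>S. D (indicator S) u)"
    unfolding ip_def using sum_ind[of "D (indicator S)"] by (simp add: mult.commute)
  also have "\<dots> = (\<Sum>u\<in>S. 64 / R * (real r - (\<Sum>v\<in>S. w u v)))"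
    by (intro sum.cong refl) (simp add: D_def sum_ind)
  also have "\<dots> = 64 / R * (\<Sum>u\<in>S. real r - (\<Sum>v\<in>S. w u v))" by (simp only: sum_distrib_left)
  finally show ?thesis by (simp add: sum_subtractf mult.commute)
qed

lemma D_eq_iff: "real r * x u = (\<Sum>v<N. w u v * x v) + R / 64 * D x u"
  using R_pos by (simp add: D_def field_simps)

text \<open>One step of the argument that a vector whose iterates under \<open>D\<close> stay bounded is spread out:
  on the level set of large entries the averaging operator contracts.\<close>

lemma level_step:
  assumes q: "2 \<le> q" and m: "0 < m" and B: "ip z z \<le> B"
    and small: "\<And>S. S \<subseteq> {..<N} \<Longrightarrow> real (card S) \<le> m \<Longrightarrow>
       (\<Sum>u\<in>S. \<Sum>v\<in>S. w u v) \<le> \<epsilon> * real r * real (card S)"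
    and eps: "0 \<le> \<epsilon>" "\<epsilon> \<le> 16 powr (1 - q) / 4"
  shows "(\<Sum>u<N. \<bar>z u\<bar> powr q) \<le> (1 + 2 * 16 powr (q - 1)) * (B powr (q / 2) * m powr (1 - q / 2))
     + 1 / 32 * (\<Sum>u<N. \<bar>D z u\<bar> powr q)"
proof -
  \<comment> \<open>The squares sum to at most \<open>B\<close>, so at most \<open>m\<close> entries
    exceed this threshold, and every set of large entries falls under the assumption
    \<open>small\<close>.\<close>
  define t where "t = sqrt (B / m)"
  define H where "H = {u. u < N \<and> t < \<bar>z u\<bar>}"
  define L where "L = {u. u < N \<and> \<not> t < \<bar>z u\<bar>}"
  define g where "g u = \<bar>z u\<bar> powr q" for u
  have B0: "0 \<le> B" using ip_nonneg B by (rule order_trans)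
  have t0: "0 \<le> t" using B0 m by (simp add: t_def)
  have t2: "t\<^sup>2 = B / m" using B0 m by (simp add: t_def)
  have HL: "H \<union> L = {..<N}" "H \<inter> L = {}" "finite H" "finite L" "H \<subseteq> {..<N}" by (auto simp: H_def L_def)
  have split: "(\<Sum>u<N. f u) = (\<Sum>u\<in>H. f u) + (\<Sum>u\<in>L. f u)" for f :: "nat \<Rightarrow> real"
    unfolding HL(1)[symmetric] by (rule sum.union_disjoint) (use HL in auto)
  have ip2: "ip z z = (\<Sum>u<N. (z u)\<^sup>2)" by (simp add: ip_def power2_eq_square)
  have cardH: "real (card H) \<le> m"
  proof (cases "H = {}")
    case False
    have "real (card H) * t\<^sup>2 < (\<Sum>u\<in>H. (z u)\<^sup>2)"
    proof -
      have "(\<Sum>u\<in>H. t\<^sup>2) < (\<Sum>u\<in>H. (z u)\<^sup>2)"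
      proof (rule sum_strict_mono)
        fix u assume "u \<in> H"
        then have "t < \<bar>z u\<bar>" by (simp add: H_def)
        then have "t\<^sup>2 < \<bar>z u\<bar>\<^sup>2" using t0 by (intro power_strict_mono) auto
        then show "t\<^sup>2 < (z u)\<^sup>2" by simp
      qed (use False HL in auto)
      then show ?thesis by simp
    qed
    also have "\<dots> \<le> B" using split[of "\<lambda>u. (z u)\<^sup>2"] B ip2 sum_nonneg[of L "\<lambda>u. (z u)\<^sup>2"] by simp
    finally have "real (card H) * (B / m) < B" unfolding t2 .
    then show ?thesis using B0 m by (cases "B = 0") (auto simp: field_simps)
  qed (use m in simp)
  have low: "(\<Sum>u\<in>L. g u) \<le> B powr (q / 2) * m powr (1 - q / 2)"
  proof -
    have "g u \<le> t powr (q - 2) * (z u)\<^sup>2" if "u \<in> L" for u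
    proof (cases "z u = 0")
      case False
      have "g u = \<bar>z u\<bar> powr (q - 2) * (z u)\<^sup>2"
      proof -
        have "(z u)\<^sup>2 = \<bar>z u\<bar> powr 2" using False by (simp add: powr_numeral)
        then have "\<bar>z u\<bar> powr (q - 2) * (z u)\<^sup>2 = \<bar>z u\<bar> powr (q - 2 + 2)" by (simp only: powr_add)
        then show ?thesis by (simp add: g_def)
      qed
      also have "\<dots> \<le> t powr (q - 2) * (z u)\<^sup>2"
        using that q by (intro mult_right_mono powr_mono2) (auto simp: L_def)
      finally show ?thesis .
    qed (use q in \<open>simp add: g_def\<close>)
    then have "(\<Sum>u\<in>L. g u) \<le> t powr (q - 2) * (\<Sum>u\<in>L. (z u)\<^sup>2)"
      unfolding sum_distrib_left by (rule sum_mono)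
    also have "\<dots> \<le> t powr (q - 2) * B"
      using split[of "\<lambda>u. (z u)\<^sup>2"] B ip2 sum_nonneg[of H "\<lambda>u. (z u)\<^sup>2"] by (intro mult_left_mono) auto
    also have "t powr (q - 2) = (B / m) powr ((q - 2) / 2)"
      using B0 m by (simp add: t_def powr_half_sqrt[symmetric] powr_powr)
    also have "(B / m) powr ((q - 2) / 2) * B = B powr (q / 2) * m powr (1 - q / 2)"
    proof (cases "B = 0")
      case False
      have "B powr (q / 2) = B powr ((q - 2) / 2) * B"
        using powr_mult_base[OF B0, of "q / 2 - 1"] by (simp add: diff_divide_distrib mult.commute)
      moreover have "m powr (1 - q / 2) = 1 / m powr ((q - 2) / 2)"
        by (simp add: diff_divide_distrib flip: powr_minus_divide)
      ultimately show ?thesis using B0 m False by (simp add: powr_divide)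
    qed (use q in simp)
    finally show ?thesis .
  qed
  define Z where "Z = (\<Sum>u\<in>H. g u)"
  \<comment> \<open>With 1 / 16 the coefficients of \<open>Z\<close> on the right will add up to 3 /
    8 + 1 / 16 + 1 / 16 = 1 / 2, so half of \<open>Z\<close> remains after moving them to the
    left.\<close>
  define \<rho> :: real where "\<rho> = 1 / 16"
  have rho: "\<rho> powr (1 - q) = 16 powr (q - 1)"
    by (simp add: \<rho>_def powr_divide powr_minus_divide[of 16 "q - 1", simplified])
  define K where "K = 16 powr (q - 1)"
  have K0: "0 < K" by (simp add: K_def)
  define a where "a = R / (64 * real r)"
  have a: "0 \<le> a" "a \<le> 1 / 32" using R R_pos r by (auto simp: a_def field_simps)
  have g0: "0 \<le> g u" for u by (simp add: g_def)
  \<comment> \<open>\<open>D_eq_iff\<close> expresses \<open>z u\<close> by the average over its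
    neighbours and by \<open>D z u\<close>; this is multiplied by the power \<open>q - 1\<close> of
    the entry.\<close>
  have pt: "g u \<le> (\<Sum>v\<in>H. w u v * (\<bar>z u\<bar> powr (q - 1) * \<bar>z v\<bar>)) / r
      + (\<Sum>v\<in>L. w u v * (\<bar>z u\<bar> powr (q - 1) * \<bar>z v\<bar>)) / r + \<bar>z u\<bar> powr (q - 1) * (a * \<bar>D z u\<bar>)" for u
  proof -
    have "real r * \<bar>z u\<bar> = \<bar>(\<Sum>v<N. w u v * z v) + R / 64 * D z u\<bar>"
      unfolding D_eq_iff[symmetric] by (simp add: abs_mult)
    also have "\<dots> \<le> \<bar>\<Sum>v<N. w u v * z v\<bar> + \<bar>R / 64 * D z u\<bar>" by (rule abs_triangle_ineq)
    also have "\<bar>\<Sum>v<N. w u v * z v\<bar> \<le> (\<Sum>v<N. \<bar>w u v * z v\<bar>)" by (rule sum_abs)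
    also have "\<dots> = (\<Sum>v<N. w u v * \<bar>z v\<bar>)" by (simp add: abs_mult w)
    also have "\<bar>R / 64 * D z u\<bar> = real r * (a * \<bar>D z u\<bar>)" using r R_pos by (simp add: a_def abs_mult)
    finally have "\<bar>z u\<bar> \<le> (\<Sum>v<N. w u v * \<bar>z v\<bar>) / r + a * \<bar>D z u\<bar>"
      using r by (simp add: field_simps)
    then have "\<bar>z u\<bar> powr (q - 1) * \<bar>z u\<bar> \<le> \<bar>z u\<bar> powr (q - 1) * ((\<Sum>v<N. w u v * \<bar>z v\<bar>) / r + a * \<bar>D z u\<bar>)"
      by (rule mult_left_mono) simp
    moreover have "\<bar>z u\<bar> powr (q - 1) * \<bar>z u\<bar> = g u"
      using powr_mult_base[of "\<bar>z u\<bar>" "q - 1"] by (simp add: g_def mult.commute)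
    ultimately show ?thesis
      by (simp add: split distrib_left sum_distrib_left add_divide_distrib mult_ac)
  qed
  have degH: "(\<Sum>v\<in>A. w u v) \<le> real r" if "A \<subseteq> {..<N}" "u < N" for A u
    unfolding deg[OF that(2), symmetric] by (rule sum_mono2) (use that w in auto)
  have degH': "(\<Sum>u\<in>A. w u v) \<le> real r" if "A \<subseteq> {..<N}" "v < N" for A v
    unfolding deg_swap[OF that(2), symmetric] by (rule sum_mono2) (use that w in auto)
  have wsum: "(\<Sum>u\<in>A. \<Sum>v\<in>A'. w u v * h u) \<le> real r * (\<Sum>u\<in>A. h u)"
    if "A \<subseteq> {..<N}" "A' \<subseteq> {..<N}" "\<And>u. 0 \<le> h u" for A A' and h :: "nat \<Rightarrow> real"
    unfolding sum_distrib_left using that degH[of A']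
    by (intro sum_mono) (auto simp flip: sum_distrib_right intro!: mult_right_mono)
  have wsum': "(\<Sum>u\<in>A. \<Sum>v\<in>A'. w u v * h v) \<le> real r * (\<Sum>v\<in>A'. h v)"
    if "A \<subseteq> {..<N}" "A' \<subseteq> {..<N}" "\<And>u. 0 \<le> h u" for A A' and h :: "nat \<Rightarrow> real"
    unfolding sum_distrib_left using that degH'[of A]
    by (subst sum.swap, intro sum_mono) (auto simp flip: sum_distrib_right intro!: mult_right_mono)
  have LN: "L \<subseteq> {..<N}" by (auto simp: L_def)
  \<comment> \<open>Inside \<open>H\<close> expansion enters: the part with the large coefficient
    \<open>K\<close> is a layer-cake sum, and \<open>\<epsilon>\<close> is small enough that
    \<open>K * \<epsilon>\<close> is at most 1 / 4.\<close>
  have 1: "(\<Sum>u\<in>H. \<Sum>v\<in>H. w u v * (\<bar>z u\<bar> powr (q - 1) * \<bar>z v\<bar>)) \<le> real r * (3 / 8 * Z)"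
  proof -
    have "(\<Sum>u\<in>H. \<Sum>v\<in>H. w u v * (\<bar>z u\<bar> powr (q - 1) * \<bar>z v\<bar>)) \<le>
       (\<Sum>u\<in>H. \<Sum>v\<in>H. w u v * (\<rho> * (g u + g v) + K * min (g u) (g v)))"
      using powr_split_min[of _ _ \<rho> q] q rho w
      by (intro sum_mono mult_left_mono) (auto simp: g_def \<rho>_def K_def)
    also have "\<dots> = \<rho> * (\<Sum>u\<in>H. \<Sum>v\<in>H. w u v * g u) + \<rho> * (\<Sum>u\<in>H. \<Sum>v\<in>H. w u v * g v)
       + K * (\<Sum>u\<in>H. \<Sum>v\<in>H. w u v * min (g u) (g v))"
      by (simp add: distrib_left sum.distrib sum_distrib_left mult_ac)
    also have "\<dots> \<le> \<rho> * (real r * Z) + \<rho> * (real r * Z) + K * (\<epsilon> * real r * Z)"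
    proof (intro add_mono mult_left_mono)
      show "(\<Sum>u\<in>H. \<Sum>v\<in>H. w u v * min (g u) (g v)) \<le> \<epsilon> * real r * Z"
        unfolding Z_def
      proof (rule layer_cake[OF HL(3) g0])
        fix S assume S: "S \<subseteq> H"
        then have "real (card S) \<le> m" using card_mono[OF HL(3) S] cardH by linarith
        with S HL(5) show "(\<Sum>u\<in>S. \<Sum>v\<in>S. w u v) \<le> \<epsilon> * real r * real (card S)"
          by (intro small) auto
      qed
    qed (use wsum[OF HL(5) HL(5), of g] wsum'[OF HL(5) HL(5), of g] g0 K0 in \<open>auto simp: Z_def \<rho>_def\<close>)
    also have "K * (\<epsilon> * real r * Z) \<le> 1 / 4 * (real r * Z)"
    proof -
      have "K * \<epsilon> \<le> K * (16 powr (1 - q) / 4)" using eps K0 by (intro mult_left_mono) auto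
      also have "\<dots> = 1 / 4" by (simp add: K_def flip: powr_add)
      finally have "K * \<epsilon> * (real r * Z) \<le> 1 / 4 * (real r * Z)"
        by (rule mult_right_mono) (auto simp: Z_def g0 sum_nonneg)
      then show ?thesis by (simp add: mult_ac)
    qed
    finally show ?thesis by (simp add: \<rho>_def algebra_simps)
  qed
  \<comment> \<open>Edges that leave \<open>H\<close> end at small entries, so here the large
    coefficient can be put entirely on \<open>L\<close>.\<close>
  have 2: "(\<Sum>u\<in>H. \<Sum>v\<in>L. w u v * (\<bar>z u\<bar> powr (q - 1) * \<bar>z v\<bar>)) \<le>
      real r * (1 / 16 * Z + K * (\<Sum>v\<in>L. g v))"
  proof -
    have "(\<Sum>u\<in>H. \<Sum>v\<in>L. w u v * (\<bar>z u\<bar> powr (q - 1) * \<bar>z v\<bar>)) \<le>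
       (\<Sum>u\<in>H. \<Sum>v\<in>L. w u v * (\<rho> * g u + K * g v))"
      using powr_split[of _ _ \<rho> q] q rho w
      by (intro sum_mono mult_left_mono) (auto simp: g_def \<rho>_def K_def)
    also have "\<dots> = \<rho> * (\<Sum>u\<in>H. \<Sum>v\<in>L. w u v * g u) + K * (\<Sum>u\<in>H. \<Sum>v\<in>L. w u v * g v)"
      by (simp add: distrib_left sum.distrib sum_distrib_left mult_ac)
    also have "\<dots> \<le> \<rho> * (real r * Z) + K * (real r * (\<Sum>v\<in>L. g v))"
      using wsum[OF HL(5) LN, of g] wsum'[OF HL(5) LN, of g] g0 K0
      by (intro add_mono mult_left_mono) (auto simp: Z_def \<rho>_def)
    finally show ?thesis by (simp add: \<rho>_def algebra_simps)
  qed
  have 3: "(\<Sum>u\<in>H. \<bar>z u\<bar> powr (q - 1) * (a * \<bar>D z u\<bar>)) \<le> 1 / 16 * Z + K * a powr q * (\<Sum>u<N. \<bar>D z u\<bar> powr q)"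
  proof -
    have "(\<Sum>u\<in>H. \<bar>z u\<bar> powr (q - 1) * (a * \<bar>D z u\<bar>)) \<le> (\<Sum>u\<in>H. \<rho> * g u + K * (a * \<bar>D z u\<bar>) powr q)"
      using powr_split[of _ _ \<rho> q] q rho a by (intro sum_mono) (auto simp: g_def \<rho>_def K_def)
    also have "\<dots> = \<rho> * Z + K * a powr q * (\<Sum>u\<in>H. \<bar>D z u\<bar> powr q)"
      using a by (simp add: Z_def sum.distrib sum_distrib_left powr_mult mult_ac)
    also have "\<dots> \<le> \<rho> * Z + K * a powr q * (\<Sum>u<N. \<bar>D z u\<bar> powr q)"
      using HL K0 by (intro add_left_mono mult_left_mono sum_mono2) auto
    finally show ?thesis by (simp add: \<rho>_def)
  qed
  have "Z \<le> (\<Sum>u\<in>H. (\<Sum>v\<in>H. w u v * (\<bar>z u\<bar> powr (q - 1) * \<bar>z v\<bar>)) / r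
      + (\<Sum>v\<in>L. w u v * (\<bar>z u\<bar> powr (q - 1) * \<bar>z v\<bar>)) / r + \<bar>z u\<bar> powr (q - 1) * (a * \<bar>D z u\<bar>))"
    unfolding Z_def by (rule sum_mono) (rule pt)
  also have "\<dots> = (\<Sum>u\<in>H. \<Sum>v\<in>H. w u v * (\<bar>z u\<bar> powr (q - 1) * \<bar>z v\<bar>)) / r
      + (\<Sum>u\<in>H. \<Sum>v\<in>L. w u v * (\<bar>z u\<bar> powr (q - 1) * \<bar>z v\<bar>)) / r
      + (\<Sum>u\<in>H. \<bar>z u\<bar> powr (q - 1) * (a * \<bar>D z u\<bar>))"
    by (simp add: sum.distrib flip: sum_divide_distrib)
  also have "\<dots> \<le> 3 / 8 * Z + (1 / 16 * Z + K * (\<Sum>v\<in>L. g v)) + (1 / 16 * Z + K * a powr q * (\<Sum>u<N. \<bar>D z u\<bar> powr q))"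
    using 1 2 3 r by (intro add_mono) (simp_all add: divide_le_eq mult.commute)
  finally have "Z \<le> 2 * K * (\<Sum>v\<in>L. g v) + 2 * K * a powr q * (\<Sum>u<N. \<bar>D z u\<bar> powr q)"
    by (simp add: algebra_simps)
  \<comment> \<open>The factor 64 in \<open>D\<close> gives \<open>a \<le> 1 / 32\<close>, which
    beats \<open>K\<close>: the product is at most \<open>(1 / 2) powr q / 8\<close>, and
    \<open>q\<close> is at least 2.\<close>
  also have "2 * K * a powr q \<le> 1 / 32"
  proof -
    have "2 * K * a powr q \<le> 2 * K * (1 / 32) powr q"
      using a q K0 by (intro mult_left_mono powr_mono2) auto
    also have "\<dots> = 1 / 8 * (16 powr q * (1 / 32) powr q)"
      by (simp add: K_def powr_diff)
    also have "16 powr q * (1 / 32) powr q = (1 / 2 :: real) powr q"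
      by (simp flip: powr_mult)
    also have "(1 / 2 :: real) powr q \<le> (1 / 2) powr 2"
      using q by (intro powr_mono') auto
    finally show ?thesis by (simp add: power2_eq_square)
  qed
  then have "2 * K * a powr q * (\<Sum>u<N. \<bar>D z u\<bar> powr q) \<le> 1 / 32 * (\<Sum>u<N. \<bar>D z u\<bar> powr q)"
    by (intro mult_right_mono sum_nonneg) auto
  finally have "Z \<le> 2 * K * (\<Sum>v\<in>L. g v) + 1 / 32 * (\<Sum>u<N. \<bar>D z u\<bar> powr q)" by simp
  then have "(\<Sum>u<N. g u) \<le> (1 + 2 * K) * (\<Sum>v\<in>L. g v) + 1 / 32 * (\<Sum>u<N. \<bar>D z u\<bar> powr q)"
    using split[of g] by (simp add: Z_def algebra_simps)
  also have "(1 + 2 * K) * (\<Sum>v\<in>L. g v) \<le> (1 + 2 * K) * (B powr (q / 2) * m powr (1 - q / 2))"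
    using low K0 by (intro mult_left_mono) auto
  finally show ?thesis by (simp add: g_def K_def)
qed

text \<open>By convexity the squared norms of the first \<open>T\<close> iterates are all at most
  \<open>B = ip z y\<close>, so \<open>level_step\<close> applies to each of them and can be
  chained. This bounds the power sum of \<open>z\<close> by a multiple of
  \<open>B powr (q / 2)\<close>, and Hoelder's \<open>B \<le> X * Y\<close> turns it into a linear
  inequality between the two norms.\<close>

lemma spread:
  assumes pq: "1 < p" "1 / p + 1 / q = 1" and q: "2 \<le> q" and m: "0 < m"
    and small: "\<And>S. S \<subseteq> {..<N} \<Longrightarrow> real (card S) \<le> m \<Longrightarrow>
       (\<Sum>u\<in>S. \<Sum>v\<in>S. w u v) \<le> \<epsilon> * real r * real (card S)"
    and eps: "0 \<le> \<epsilon>" "\<epsilon> \<le> 16 powr (1 - q) / 4"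
    and T: "m powr (q / 2 - 1) \<le> 32 ^ T"
  shows "lp q {..<N} z * m powr (1 - 2 / q) \<le> spread_const q * lp p {..<N} (\<lambda>u. z u + (D ^^ (2 * T)) z u)"
proof -
  define y where "y u = z u + 1 * (D ^^ (2 * T)) z u" for u
  define B where "B = ip z y"
  define s where "s i = (\<Sum>u<N. \<bar>(D ^^ i) z u\<bar> powr q)" for i
  define C where "C = 1 + 2 * 16 powr (q - 1)"
  define F where "F = B powr (q / 2) * m powr (1 - q / 2)"
  have C0: "0 \<le> C" by (simp add: C_def add_nonneg_nonneg)
  have F0: "0 \<le> F" by (simp add: F_def)
  have B_eq: "B = ip z ((D ^^ 0) z) + ip z ((D ^^ (2 * T)) z)"
    unfolding B_def y_def ip_linear by simp
  have Bi: "ip ((D ^^ i) z) ((D ^^ i) z) \<le> B" if "i \<le> T" for i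
  proof -
    have "ip ((D ^^ i) z) ((D ^^ i) z) = ip z ((D ^^ (2 * i)) z)" using ip_Dn[of z i i z] by (simp add: mult_2)
    also have "\<dots> \<le> max (ip z ((D ^^ 0) z)) (ip z ((D ^^ (2 * T)) z))" by (rule Dn_le_max) (use that in auto)
    also have "\<dots> \<le> B" unfolding B_eq using Dn_psd[of z 0] Dn_psd[of z "2 * T"] by linarith
    finally show ?thesis .
  qed
  have B0: "0 \<le> B" using Bi[of 0] ip_nonneg[of z] by simp
  have step: "s i \<le> C * F + 1 / 32 * s (Suc i)" if "i \<le> T" for i
    using level_step[OF q m Bi[OF that] small eps] by (simp add: s_def C_def F_def)
  \<comment> \<open>The factor \<open>3 - 2 / 2 ^ i\<close> is a bounded majorant of the partial
    sums of the geometric series in 1 / 32 that is easy to carry through the induction.\<close>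
  have iter: "i \<le> T \<Longrightarrow> s 0 \<le> C * F * (3 - 2 / 2 ^ i) + 1 / 32 ^ i * s i" for i
  proof (induction i)
    case 0
    then show ?case using C0 F0 by simp
  next
    case (Suc i)
    then have "s 0 \<le> C * F * (3 - 2 / 2 ^ i) + 1 / 32 ^ i * s i" by simp
    also have "1 / 32 ^ i * s i \<le> 1 / 32 ^ i * (C * F + 1 / 32 * s (Suc i))"
      using step[of i] Suc.prems by (intro mult_left_mono) auto
    also have "C * F * (3 - 2 / 2 ^ i) + 1 / 32 ^ i * (C * F + 1 / 32 * s (Suc i)) =
        C * F * (3 - 2 / 2 ^ i + 1 / 32 ^ i) + 1 / 32 ^ Suc i * s (Suc i)" by (simp add: algebra_simps)
    also have "C * F * (3 - 2 / 2 ^ i + 1 / 32 ^ i) \<le> C * F * (3 - 2 / 2 ^ Suc i)"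
    proof (intro mult_left_mono)
      have "(2::real) ^ i \<le> 32 ^ i" by (rule power_mono) auto
      then have "1 / 32 ^ i \<le> 1 / (2 ^ i :: real)" by (intro divide_left_mono) auto
      then show "3 - 2 / 2 ^ i + 1 / 32 ^ i \<le> 3 - 2 / (2 ^ Suc i :: real)" by simp
    qed (use C0 F0 in auto)
    finally show ?case by simp
  qed
  \<comment> \<open>For the last iterate a crude bound suffices, each square of an entry being at
    most \<open>B\<close>: the factor \<open>1 / 32 ^ T\<close> in front pays for the missing power
    of \<open>m\<close>.\<close>
  have sT: "s T \<le> B powr (q / 2)"
  proof -
    let ?w = "(D ^^ T) z"
    have ipw: "ip ?w ?w = (\<Sum>u<N. (?w u)\<^sup>2)" by (simp add: ip_def power2_eq_square)
    have "\<bar>?w u\<bar> powr q \<le> B powr (q / 2 - 1) * (?w u)\<^sup>2" if "u < N" for u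
    proof (cases "?w u = 0")
      case False
      have "(?w u)\<^sup>2 \<le> ip ?w ?w" unfolding ipw by (rule member_le_sum) (use that in auto)
      then have wB: "(?w u)\<^sup>2 \<le> B" using Bi[of T] by simp
      have "\<bar>?w u\<bar> powr q = ((?w u)\<^sup>2) powr (q / 2)"
      proof -
        have "(?w u)\<^sup>2 = \<bar>?w u\<bar> powr 2" using False by (simp add: powr_numeral)
        then show ?thesis by (simp only: powr_powr) simp
      qed
      also have "((?w u)\<^sup>2) powr (q / 2) = ((?w u)\<^sup>2) powr (q / 2 - 1) * (?w u)\<^sup>2"
        using powr_mult_base[of "(?w u)\<^sup>2" "q / 2 - 1"] by (simp add: mult.commute)
      also have "\<dots> \<le> B powr (q / 2 - 1) * (?w u)\<^sup>2"
        using wB q False by (auto intro!: mult_right_mono powr_mono2)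
      finally show ?thesis .
    qed (use q in auto)
    then have "s T \<le> B powr (q / 2 - 1) * (\<Sum>u<N. (?w u)\<^sup>2)"
      unfolding s_def sum_distrib_left by (intro sum_mono) auto
    also have "\<dots> \<le> B powr (q / 2 - 1) * B"
      using Bi[of T] unfolding ipw by (intro mult_left_mono) auto
    also have "\<dots> = B powr (q / 2)"
      using powr_mult_base[OF B0, of "q / 2 - 1"] by (simp add: mult.commute)
    finally show ?thesis .
  qed
  have "s 0 \<le> C * F * 3 + 1 / 32 ^ T * s T"
  proof -
    have "C * F * (3 - 2 / 2 ^ T) \<le> C * F * 3" using C0 F0 by (intro mult_left_mono) auto
    then show ?thesis using iter[of T] by simp
  qed
  also have "1 / 32 ^ T * s T \<le> m powr (1 - q / 2) * B powr (q / 2)"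
  proof (rule mult_mono)
    have "m powr (1 - q / 2) = 1 / m powr (q / 2 - 1)" by (simp flip: powr_minus_divide)
    moreover have "1 / 32 ^ T \<le> 1 / m powr (q / 2 - 1)" using T m by (intro divide_left_mono) auto
    ultimately show "1 / 32 ^ T \<le> m powr (1 - q / 2)" by simp
  qed (use sT in \<open>auto simp: s_def sum_nonneg\<close>)
  finally have s0: "s 0 \<le> (4 + 6 * 16 powr (q - 1)) * F" by (simp add: F_def C_def algebra_simps)
  define X where "X = lp q {..<N} z"
  define Y where "Y = lp p {..<N} y"
  have Y_eq: "lp p {..<N} (\<lambda>u. z u + (D ^^ (2 * T)) z u) = Y" unfolding Y_def by (rule arg_cong[of _ _ "lp p {..<N}"]) (simp add: y_def fun_eq_iff)
  show ?thesis
  proof (cases "X = 0")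
    case True
    then show ?thesis by (simp add: X_def spread_const_def)
  next
    case False
    then have X: "0 < X" by (simp add: X_def less_le)
    have BXY: "B \<le> X * Y"
    proof -
      have "B \<le> (\<Sum>u<N. \<bar>z u * y u\<bar>)" unfolding B_def ip_def by (intro sum_mono) simp
      also have "\<dots> \<le> X * Y"
        unfolding X_def Y_def by (rule Hoelder) (use pq q in \<open>auto simp: add.commute\<close>)
      finally show ?thesis .
    qed
    define K where "K = 4 + 6 * 16 powr (q - 1)"
    have K0: "0 < K" unfolding K_def by (intro add_pos_pos mult_pos_pos) auto
    have "X powr q = s 0" using lp_powr[of q "{..<N}" z] q by (simp add: X_def s_def)
    also have "\<dots> \<le> K * F" using s0 by (simp add: K_def)
    also have "\<dots> \<le> K * (m powr (1 - q / 2) * (X * Y) powr (q / 2))"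
    proof -
      have "B powr (q / 2) \<le> (X * Y) powr (q / 2)" using BXY B0 q by (intro powr_mono2) auto
      then show ?thesis unfolding F_def using K0 by (subst mult.commute, intro mult_left_mono) auto
    qed
    finally have "X powr q \<le> K * (m powr (1 - q / 2) * (X * Y) powr (q / 2))" .
    moreover have "X powr q = X powr (q / 2) * X powr (q / 2)" by (simp flip: powr_add)
    moreover have "(X * Y) powr (q / 2) = X powr (q / 2) * Y powr (q / 2)"
      by (rule powr_mult)
    ultimately have "X powr (q / 2) * X powr (q / 2) \<le> X powr (q / 2) * (K * Y powr (q / 2) * m powr (1 - q / 2))"
      by (simp add: mult_ac)
    moreover have "0 < X powr (q / 2)" using X by simp
    ultimately have "X powr (q / 2) \<le> K * Y powr (q / 2) * m powr (1 - q / 2)" by (rule mult_left_le_imp_le)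
    then have le: "(X powr (q / 2)) powr (2 / q) \<le> (K * Y powr (q / 2) * m powr (1 - q / 2)) powr (2 / q)"
      using q by (intro powr_mono2) auto
    have l: "(X powr (q / 2)) powr (2 / q) = X"
    proof -
      have "q / 2 * (2 / q) = 1" using q by simp
      then show ?thesis using X by (simp only: powr_powr) simp
    qed
    have "(K * Y powr (q / 2) * m powr (1 - q / 2)) powr (2 / q) =
        K powr (2 / q) * (Y powr (q / 2)) powr (2 / q) * (m powr (1 - q / 2)) powr (2 / q)"
      using K0 by (simp only: powr_mult mult_nonneg_nonneg powr_ge_zero less_imp_le)
    moreover have "(Y powr (q / 2)) powr (2 / q) = Y"
    proof -
      have "q / 2 * (2 / q) = 1" using q by simp
      moreover have "0 \<le> Y" by (simp add: Y_def)
      ultimately show ?thesis by (simp only: powr_powr) simp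
    qed
    moreover have "(m powr (1 - q / 2)) powr (2 / q) = m powr (- (1 - 2 / q))"
    proof -
      have "(1 - q / 2) * (2 / q) = - (1 - 2 / q)" using q by (simp add: field_simps)
      then show ?thesis by (simp only: powr_powr)
    qed
    ultimately have "X \<le> K powr (2 / q) * Y * m powr (- (1 - 2 / q))" using le l by (simp only:)
    then have "X * m powr (1 - 2 / q) \<le> K powr (2 / q) * Y * m powr (- (1 - 2 / q)) * m powr (1 - 2 / q)"
      by (rule mult_right_mono) simp
    also have "\<dots> = K powr (2 / q) * Y" 
    proof -
      have "m powr (- (1 - 2 / q)) * m powr (1 - 2 / q) = 1" using m by (simp flip: powr_add)
      then show ?thesis by (simp only: mult.assoc mult_1_right)
    qed
    finally show ?thesis unfolding Y_eq X_def spread_const_def K_def .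
  qed
qed

end

section \<open>Linear systems and factorizations\<close>

lemma mat_inverse_ex:
  fixes A :: "real mat"
  assumes A: "A \<in> carrier_mat n n" "det A \<noteq> 0"
  shows "\<exists>B \<in> carrier_mat n n. A * B = 1\<^sub>m n"
  using det_non_zero_imp_unit[OF A, of "()"] by (auto simp: Units_def ring_mat_def)

lemma mat_vec_sum: "i < n \<Longrightarrow> (mat n m (\<lambda>(i, j). a i j) *\<^sub>v v) $ i = (\<Sum>j<m. a i j * v $ j)" if "v \<in> carrier_vec m"
  using that by (simp add: scalar_prod_def lessThan_atLeast0)

lemma linear_system_solvable:
  fixes a :: "nat \<Rightarrow> nat \<Rightarrow> real"
  assumes inj: "\<And>x. \<forall>u<n. (\<Sum>v<n. a u v * x v) = 0 \<Longrightarrow> \<forall>u<n. x u = 0"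
  shows "\<exists>x. \<forall>u<n. (\<Sum>v<n. a u v * x v) = s u"
proof -
  define A where "A = mat n n (\<lambda>(i, j). a i j)"
  have A: "A \<in> carrier_mat n n" by (simp add: A_def)
  have "det A \<noteq> 0"
  proof
    assume "det A = 0"
    then obtain v where v: "v \<in> carrier_vec n" "v \<noteq> 0\<^sub>v n" "A *\<^sub>v v = 0\<^sub>v n"
      using det_0_iff_vec_prod_zero_field[OF A] by blast
    have "\<forall>u<n. (\<Sum>j<n. a u j * v $ j) = 0"
    proof (intro allI impI)
      fix u assume u: "u < n"
      have "(A *\<^sub>v v) $ u = 0" using v(3) u by simp
      then show "(\<Sum>j<n. a u j * v $ j) = 0" using mat_vec_sum[OF v(1) u, of a] by (simp add: A_def)
    qed
    from inj[OF this] have "v = 0\<^sub>v n" using v(1) by (intro eq_vecI) auto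
    with v(2) show False by simp
  qed
  then obtain B where B: "B \<in> carrier_mat n n" "A * B = 1\<^sub>m n" using mat_inverse_ex[OF A] by blast
  define y where "y = B *\<^sub>v vec n s"
  have y: "y \<in> carrier_vec n" using B by (simp add: y_def)
  have "A *\<^sub>v y = vec n s"
    unfolding y_def using A B by (simp flip: assoc_mult_mat_vec)
  then have "(\<Sum>v<n. a u v * y $ v) = s u" if "u < n" for u
    using mat_vec_sum[OF y that, of a] that by (simp add: A_def)
  then show ?thesis by blast
qed

text \<open>Zero rows complete the system to a square one. Without a kernel vector it could be
  solved for the right-hand side 1, but its zero row \<open>k\<close> always yields 0.\<close>

lemma ex_kernel_vec:
  fixes a :: "nat \<Rightarrow> nat \<Rightarrow> real"
  assumes "k < d"
  shows "\<exists>x. (\<exists>j<d. x j \<noteq> 0) \<and> (\<forall>i<k. (\<Sum>j<d. a i j * x j) = 0)"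
proof (rule ccontr)
  assume n: "\<not> ?thesis"
  define b where "b i j = (if i < k then a i j else 0)" for i j
  have inj: "\<forall>u<d. x u = 0" if x: "\<forall>u<d. (\<Sum>v<d. b u v * x v) = 0" for x
  proof (rule ccontr)
    assume "\<not> (\<forall>u<d. x u = 0)"
    then have "\<exists>j<d. x j \<noteq> 0" by simp
    moreover have "(\<Sum>j<d. a i j * x j) = 0" if "i < k" for i
    proof -
      have "(\<Sum>v<d. b i v * x v) = 0" using x that assms by (meson order.strict_trans)
      moreover have "b i v = a i v" for v using that by (simp add: b_def)
      ultimately show ?thesis by (simp only:)
    qed
    ultimately have "(\<exists>j<d. x j \<noteq> 0) \<and> (\<forall>i<k. (\<Sum>j<d. a i j * x j) = 0)" by (intro conjI allI impI)
    then have "\<exists>x. (\<exists>j<d. x j \<noteq> 0) \<and> (\<forall>i<k. (\<Sum>j<d. a i j * x j) = 0)" by (rule exI[of _ x])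
    with n show False by (rule notE)
  qed
  from linear_system_solvable[OF inj, where s = "\<lambda>_. 1"]
  obtain x where x: "\<And>u. u < d \<Longrightarrow> (\<Sum>v<d. b u v * x v) = 1" by metis
  show False using x[OF assms] by (simp add: b_def)
qed

text \<open>As \<open>x j\<close> is nonzero, the kernel vector expresses column \<open>j\<close> by
  the others. So \<open>U\<close> consists of the other columns, enumerated by \<open>sk\<close>,
  and \<open>V\<close> records the coefficients.\<close>

lemma rank_factorization:
  fixes Y :: "real mat"
  assumes Y: "Y \<in> carrier_mat n (Suc k)" and j: "j < Suc k" "x j \<noteq> 0"
    and ker: "\<And>i. i < n \<Longrightarrow> (\<Sum>l<Suc k. Y $$ (i, l) * x l) = 0"
  shows "\<exists>U \<in> carrier_mat n k. \<exists>V \<in> carrier_mat k (Suc k). Y = U * V"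
proof -
  define sk where "sk l = (if l < j then l else Suc l)" for l
  define U where "U = mat n k (\<lambda>(i, l). Y $$ (i, sk l))"
  define V where "V = mat k (Suc k) (\<lambda>(l, c). if c = j then - x (sk l) / x j else of_bool (sk l = c))"
  have bij: "bij_betw sk {..<k} ({..<Suc k} - {j})"
    unfolding bij_betw_def
  proof
    show "inj_on sk {..<k}" by (auto simp: inj_on_def sk_def split: if_splits)
    show "sk ` {..<k} = {..<Suc k} - {j}"
    proof
      show "sk ` {..<k} \<subseteq> {..<Suc k} - {j}" using j by (auto simp: sk_def)
      show "{..<Suc k} - {j} \<subseteq> sk ` {..<k}"
      proof
        fix c assume c: "c \<in> {..<Suc k} - {j}"
        then have "c = sk (if c < j then c else c - 1)" "(if c < j then c else c - 1) < k"
          using j by (auto simp: sk_def)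
        then show "c \<in> sk ` {..<k}" by blast
      qed
    qed
  qed
  have re: "(\<Sum>l<k. f (sk l)) = (\<Sum>l\<in>{..<Suc k} - {j}. f l)" for f :: "nat \<Rightarrow> real"
    by (rule sum.reindex_bij_betw[OF bij])
  have "Y = U * V"
  proof (rule eq_matI)
    fix i c assume ic: "i < dim_row (U * V)" "c < dim_col (U * V)"
    then have i: "i < n" and c: "c < Suc k" by (simp_all add: U_def V_def)
    have "(U * V) $$ (i, c) = (\<Sum>l<k. U $$ (i, l) * V $$ (l, c))"
      using ic by (simp add: scalar_prod_def U_def V_def lessThan_atLeast0)
    also have "\<dots> = (\<Sum>l<k. Y $$ (i, sk l) * (if c = j then - x (sk l) / x j else of_bool (sk l = c)))"
      using i c by (intro sum.cong) (auto simp: U_def V_def)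
    also have "\<dots> = (\<Sum>l\<in>{..<Suc k} - {j}. Y $$ (i, l) * (if c = j then - x l / x j else of_bool (l = c)))"
      by (rule re)
    also have "\<dots> = Y $$ (i, c)"
    proof (cases "c = j")
      case True
      have "0 = Y $$ (i, j) * x j + (\<Sum>l\<in>{..<Suc k} - {j}. Y $$ (i, l) * x l)"
        using ker[OF i] j by (subst sum.remove[of _ j, symmetric]) auto
      then have "(\<Sum>l\<in>{..<Suc k} - {j}. Y $$ (i, l) * x l) = - Y $$ (i, j) * x j" by simp
      then show ?thesis using True j(2)
        by (simp add: sum_negf sum_divide_distrib[symmetric])
    next
      case False
      have "(\<Sum>l\<in>{..<Suc k} - {j}. Y $$ (i, l) * of_bool (l = c)) = (\<Sum>l\<in>{c}. Y $$ (i, l) * of_bool (l = c))"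
        using c False by (intro sum.mono_neutral_right) auto
      then show ?thesis using False by simp
    qed
    finally show "Y $$ (i, c) = (U * V) $$ (i, c)" ..
  qed (use Y in \<open>auto simp: U_def V_def\<close>)
  moreover have "U \<in> carrier_mat n k" "V \<in> carrier_mat k (Suc k)" by (simp_all add: U_def V_def)
  ultimately show ?thesis by blast
qed

lemma mult_mat_kernel:
  fixes U V :: "real mat"
  assumes U: "U \<in> carrier_mat n k" and V: "V \<in> carrier_mat k d" and kd: "k < d"
  shows "\<exists>x. (\<exists>j<d. x j \<noteq> 0) \<and> (\<forall>i<n. (\<Sum>j<d. (U * V) $$ (i, j) * x j) = 0)"
proof -
  obtain x where x: "\<exists>j<d. x j \<noteq> 0" "\<forall>i<k. (\<Sum>j<d. V $$ (i, j) * x j) = 0"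
    using ex_kernel_vec[OF kd, of "\<lambda>i j. V $$ (i, j)"] by blast
  have "(\<Sum>j<d. (U * V) $$ (i, j) * x j) = 0" if "i < n" for i
  proof -
    have "(\<Sum>j<d. (U * V) $$ (i, j) * x j) = (\<Sum>j<d. \<Sum>l<k. U $$ (i, l) * (V $$ (l, j) * x j))"
      using U V that by (intro sum.cong refl) (auto simp: scalar_prod_def lessThan_atLeast0 sum_distrib_right mult.assoc)
    also have "\<dots> = (\<Sum>l<k. U $$ (i, l) * (\<Sum>j<d. V $$ (l, j) * x j))"
      by (subst sum.swap) (simp add: sum_distrib_left)
    finally show ?thesis using x(2) by simp
  qed
  with x(1) show ?thesis by blast
qed


section \<open>A rank constraint that detects small values of an operator\<close>

text \<open>Hoelder row by row: the entrywise \<open>p\<close>-norm of an error matrix bounds it as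
  an operator from the \<open>q\<close>-norm to the \<open>p\<close>-norm. This is how the cost of
  an approximation constrains its kernel vectors.\<close>

lemma op_bound:
  assumes p: "1 < p" "1 < q" "1 / p + 1 / q = 1" and C: "0 \<le> C"
    and b: "(\<Sum>i\<in>I. \<Sum>j\<in>J. \<bar>\<Delta> i j\<bar> powr p) \<le> C powr p"
  shows "lp p I (\<lambda>i. \<Sum>j\<in>J. \<Delta> i j * x j) \<le> C * lp q J x"
proof -
  let ?X = "lp q J x"
  have "(\<Sum>i\<in>I. \<bar>\<Sum>j\<in>J. \<Delta> i j * x j\<bar> powr p) \<le> (\<Sum>i\<in>I. (\<Sum>j\<in>J. \<bar>\<Delta> i j\<bar> powr p) * ?X powr p)"
  proof (rule sum_mono)
    fix i assume "i \<in> I"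
    have "\<bar>\<Sum>j\<in>J. \<Delta> i j * x j\<bar> \<le> (\<Sum>j\<in>J. \<bar>\<Delta> i j * x j\<bar>)" by (rule sum_abs)
    also have "\<dots> \<le> lp p J (\<Delta> i) * ?X" by (rule Hoelder[OF p])
    finally have "\<bar>\<Sum>j\<in>J. \<Delta> i j * x j\<bar> powr p \<le> (lp p J (\<Delta> i) * ?X) powr p"
      using p by (intro powr_mono2) auto
    also have "\<dots> = (\<Sum>j\<in>J. \<bar>\<Delta> i j\<bar> powr p) * ?X powr p"
      using p by (simp add: powr_mult lp_powr)
    finally show "\<bar>\<Sum>j\<in>J. \<Delta> i j * x j\<bar> powr p \<le> (\<Sum>j\<in>J. \<bar>\<Delta> i j\<bar> powr p) * ?X powr p" .
  qed
  also have "\<dots> = (\<Sum>i\<in>I. \<Sum>j\<in>J. \<bar>\<Delta> i j\<bar> powr p) * ?X powr p" by (simp only: sum_distrib_right)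
  also have "\<dots> \<le> C powr p * ?X powr p" using b by (intro mult_right_mono) auto
  also have "\<dots> = (C * ?X) powr p" by (simp add: powr_mult)
  finally have "lp p I (\<lambda>i. \<Sum>j\<in>J. \<Delta> i j * x j) \<le> ((C * ?X) powr p) powr (1 / p)"
    unfolding lp_def[of p I] using p by (intro powr_mono2) (auto simp: sum_nonneg)
  also have "\<dots> = C * ?X"
  proof -
    have "p * (1 / p) = 1" using p by simp
    moreover have "0 \<le> C * ?X" using C by simp
    ultimately show ?thesis by (simp only: powr_powr) simp
  qed
  finally show ?thesis .
qed

lemma sum_le_lp:
  assumes p: "1 < p" "1 < q" "1 / p + 1 / q = 1"
  shows "(\<Sum>i\<in>I. \<bar>x i\<bar>) \<le> lp p I x * real (card I) powr (1 / q)"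
  using Hoelder[OF p, of x "\<lambda>_. 1" I] by (simp add: lp_def)

text \<open>Polymorphic, because the algorithm receives an integer matrix while the analysis takes
  place over the reals.\<close>

definition gap_mat :: "nat \<Rightarrow> nat \<Rightarrow> (nat \<Rightarrow> nat \<Rightarrow> 'a :: zero) \<Rightarrow> 'a \<Rightarrow> 'a mat" where
  "gap_mat N m a \<beta> = mat (N + m) (Suc N) (\<lambda>(i, j). if i < N \<longleftrightarrow> j < N then if i < N then a i j else \<beta> else 0)"

lemma gap_mat_carrier [simp]: "gap_mat N m a \<beta> \<in> carrier_mat (N + m) (Suc N)"
  by (simp add: gap_mat_def)

lemma entrywise_norm_pow_nonneg: "0 \<le> entrywise_norm_pow p B"
  by (simp add: entrywise_norm_pow_def sum_nonneg)

lemma opt_cost_le: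
  assumes "A \<in> carrier_mat n d" "U \<in> carrier_mat n k" "V \<in> carrier_mat k d"
  shows "opt_cost p k A \<le> entrywise_norm_pow p (A - U * V)"
  unfolding opt_cost_def
  by (rule cINF_lower2[where x = "(U, V)"])
     (use assms in \<open>auto intro!: bdd_belowI2[where m = 0] simp: entrywise_norm_pow_nonneg\<close>)

text \<open>The rank bound is one less than the number of columns, so exhibiting a kernel vector of
  \<open>Y\<close> replaces the construction of factors.\<close>

lemma opt_cost_kernel:
  assumes A: "A \<in> carrier_mat n (Suc k)" and Y: "Y \<in> carrier_mat n (Suc k)"
    and j: "j < Suc k" "x j \<noteq> 0" "\<And>i. i < n \<Longrightarrow> (\<Sum>l<Suc k. Y $$ (i, l) * x l) = 0"
  shows "opt_cost p k A \<le> entrywise_norm_pow p (A - Y)"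
proof -
  obtain U V where "U \<in> carrier_mat n k" "V \<in> carrier_mat k (Suc k)" "Y = U * V"
    using rank_factorization[OF Y j] by blast
  then show ?thesis using opt_cost_le[OF A] by blast
qed

lemma gap_mat_opt_le:
  assumes p: "1 < p"
  shows "opt_cost p N (gap_mat N m a \<beta>) \<le> real m * \<bar>\<beta>\<bar> powr p"
proof -
  let ?A = "gap_mat N m a \<beta>"
  define Y where "Y = mat (N + m) (Suc N) (\<lambda>(i, j). if j < N then ?A $$ (i, j) else 0)"
  have "opt_cost p N ?A \<le> entrywise_norm_pow p (?A - Y)"
    by (rule opt_cost_kernel[where j = N and x = "\<lambda>l. of_bool (l = N)"])
       (auto simp: Y_def gap_mat_def sum.neutral)
  also have "\<dots> = (\<Sum>i<N + m. if i < N then 0 else \<bar>\<beta>\<bar> powr p)"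
    unfolding entrywise_norm_pow_def by (intro sum.cong) (auto simp: Y_def gap_mat_def sum.neutral)
  also have "\<dots> = (\<Sum>i\<in>{N..<N + m}. \<bar>\<beta>\<bar> powr p)"
    by (rule sum.mono_neutral_cong_right) auto
  finally show ?thesis by simp
qed

text \<open>With \<open>z\<close> the image of \<open>x\<close> and \<open>y\<close> its dual vector
  of norm 1, subtracting \<open>z i * y l / X\<close> moves \<open>x\<close> into the kernel. The
  entrywise norm of this rank-one change is the product of the norms of its factors, here at most
  \<open>\<eta>\<close>.\<close>

lemma gap_mat_opt_le_operator:
  assumes p: "1 < p" "1 < q" "1 / p + 1 / q = 1"
    and x: "j < N" "x j \<noteq> 0" and b: "lp p {..<N} (\<lambda>i. \<Sum>l<N. a i l * x l) \<le> \<eta> * lp q {..<N} x"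
  shows "opt_cost p N (gap_mat N m a \<beta>) \<le> \<eta> powr p"
proof -
  let ?A = "gap_mat N m a \<beta>"
  define X where "X = lp q {..<N} x"
  have "X \<noteq> 0" using x unfolding X_def by (subst lp_eq_0_iff) auto
  then have X: "0 < X" by (simp add: X_def less_le)
  then obtain y where y: "(\<Sum>i<N. y i * x i) = X" "lp p {..<N} y = 1"
    using lp_dual[OF p, of "{..<N}" x] using X unfolding X_def by fastforce
  define z where "z i = (\<Sum>l<N. a i l * x l)" for i
  define Y where "Y = mat (N + m) (Suc N)
    (\<lambda>(i, l). if i < N \<and> l < N then a i l - z i * y l / X else ?A $$ (i, l))"
  have "opt_cost p N ?A \<le> entrywise_norm_pow p (?A - Y)"
  proof (rule opt_cost_kernel[where j = j and x = "\<lambda>l. if l < N then x l else 0"])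
    fix i assume i: "i < N + m"
    have "(\<Sum>l<Suc N. Y $$ (i, l) * (if l < N then x l else 0)) = (\<Sum>l<N. Y $$ (i, l) * x l)"
      by simp
    also have "\<dots> = 0"
    proof (cases "i < N")
      case True
      have "(\<Sum>l<N. Y $$ (i, l) * x l) = (\<Sum>l<N. a i l * x l - z i / X * (y l * x l))"
        using True i by (intro sum.cong) (auto simp: Y_def algebra_simps)
      also have "\<dots> = z i - z i / X * (\<Sum>l<N. y l * x l)"
        unfolding sum_distrib_left z_def[of i] by (rule sum_subtractf)
      also have "\<dots> = z i - z i / X * X" unfolding y(1) ..
      finally show ?thesis using X by simp
    next
      case False
      then show ?thesis using i by (intro sum.neutral) (auto simp: Y_def gap_mat_def)
    qed
    finally show "(\<Sum>l<Suc N. Y $$ (i, l) * (if l < N then x l else 0)) = 0" .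
  qed (use x in \<open>auto simp: Y_def\<close>)
  also have "\<dots> = (\<Sum>i<N + m. \<Sum>l<Suc N. if i < N \<and> l < N then (\<bar>z i\<bar> / X) powr p * \<bar>y l\<bar> powr p else 0)"
    unfolding entrywise_norm_pow_def using X
    by (intro sum.cong) (auto simp: Y_def gap_mat_def abs_mult powr_divide powr_mult)
  also have "\<dots> = (\<Sum>i<N + m. if i < N then (\<bar>z i\<bar> / X) powr p * (\<Sum>l<N. \<bar>y l\<bar> powr p) else 0)"
    by (intro sum.cong) (auto simp: sum_distrib_left)
  also have "\<dots> = (\<Sum>i<N. (\<bar>z i\<bar> / X) powr p * (\<Sum>l<N. \<bar>y l\<bar> powr p))"
    by (rule sum.mono_neutral_cong_right) auto
  also have "(\<Sum>l<N. \<bar>y l\<bar> powr p) = 1" using lp_powr[of p "{..<N}" y] p y(2) by simp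
  also have "(\<Sum>i<N. (\<bar>z i\<bar> / X) powr p * 1) = lp p {..<N} z powr p / X powr p"
    using p X by (simp add: lp_powr powr_divide sum_divide_distrib)
  also have "\<dots> = (lp p {..<N} z / X) powr p" using X by (simp add: powr_divide)
  also have "\<dots> \<le> \<eta> powr p"
    using b X p unfolding z_def[symmetric] X_def[symmetric]
    by (intro powr_mono2) (auto simp: divide_le_eq)
  finally show ?thesis .
qed

text \<open>The bound on \<open>C\<close> says that the error is at most a quarter of the norm of
  the new column. By Hoelder the column sum loses at most a quarter of its value, which leaves more
  than the threshold of one half.\<close>

lemma gap_yes:
  fixes Y :: "nat \<Rightarrow> nat \<Rightarrow> real"
  assumes p: "1 < p" "1 < q" "1 / p + 1 / q = 1" and \<beta>: "0 < \<beta>"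
    and c: "(\<Sum>i<N + m. \<Sum>j<Suc N. \<bar>gap_mat N m a \<beta> $$ (i, j) - Y i j\<bar> powr p) \<le> C powr p" "0 \<le> C"
    and C: "C \<le> real m powr (1 / p) * \<beta> / 4"
  shows "real m * \<beta> / 2 \<le> (\<Sum>i\<in>{N..<N + m}. Y i N)"
proof -
  let ?I = "{N..<N + m}"
  have mm: "real m powr (1 / p) * real m powr (1 / q) = real m"
    using p(3) by (simp flip: powr_add)
  have "(\<Sum>i\<in>?I. \<bar>\<beta> - Y i N\<bar> powr p) = (\<Sum>i\<in>?I. \<bar>gap_mat N m a \<beta> $$ (i, N) - Y i N\<bar> powr p)"
    by (intro sum.cong) (auto simp: gap_mat_def)
  also have "\<dots> \<le> (\<Sum>i\<in>?I. \<Sum>j<Suc N. \<bar>gap_mat N m a \<beta> $$ (i, j) - Y i j\<bar> powr p)"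
    by (intro sum_mono member_le_sum) auto
  also have "\<dots> \<le> (\<Sum>i<N + m. \<Sum>j<Suc N. \<bar>gap_mat N m a \<beta> $$ (i, j) - Y i j\<bar> powr p)"
    by (intro sum_mono2 sum_nonneg) auto
  finally have "(\<Sum>i\<in>?I. \<bar>\<beta> - Y i N\<bar> powr p) \<le> C powr p" using c by simp
  then have "lp p ?I (\<lambda>i. \<beta> - Y i N) powr p \<le> C powr p" using p by (simp add: lp_powr)
  then have l: "lp p ?I (\<lambda>i. \<beta> - Y i N) \<le> C"
    using p c(2) powr_less_mono2[of p C "lp p ?I (\<lambda>i. \<beta> - Y i N)"] by fastforce
  have "real m * \<beta> - (\<Sum>i\<in>?I. Y i N) = (\<Sum>i\<in>?I. \<beta> - Y i N)" by (simp add: sum_subtractf)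
  also have "\<dots> \<le> (\<Sum>i\<in>?I. \<bar>\<beta> - Y i N\<bar>)" by (intro sum_mono) simp
  also have "\<dots> \<le> lp p ?I (\<lambda>i. \<beta> - Y i N) * real m powr (1 / q)"
    using sum_le_lp[OF p, of "\<lambda>i. \<beta> - Y i N" ?I] by simp
  also have "\<dots> \<le> (real m powr (1 / p) * \<beta> / 4) * real m powr (1 / q)"
    using l C by (intro mult_right_mono) auto
  also have "\<dots> = real m * \<beta> / 4" using mm by (simp add: mult_ac)
  finally have "real m * \<beta> - (\<Sum>i\<in>?I. Y i N) \<le> real m * \<beta> / 4" .
  moreover have "0 \<le> real m * \<beta>" using \<beta> by simp
  ultimately show ?thesis by linarith
qed

text \<open>The operator is so large that the error budget forces a kernel vector to be almost
  concentrated on the new coordinate: \<open>4 * a1 * X \<le> \<bar>x N\<bar>\<close>. The lower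
  rows then express \<open>Y i N * x N\<close> by errors times the small part of \<open>x\<close>,
  so the column sum is at most a quarter of its full value.\<close>

lemma gap_no:
  fixes Y :: "nat \<Rightarrow> nat \<Rightarrow> real"
  assumes p: "1 < p" "1 < q" "1 / p + 1 / q = 1" and \<beta>: "0 < \<beta>" and m: "0 < m" and a1: "1 \<le> a1"
    and c: "(\<Sum>i<N + m. \<Sum>j<Suc N. \<bar>gap_mat N m a \<beta> $$ (i, j) - Y i j\<bar> powr p)
      \<le> (a1 * (real m powr (1 / p) * \<beta>)) powr p"
    and ker: "\<exists>j<Suc N. x j \<noteq> 0" "\<And>i. i < N + m \<Longrightarrow> (\<Sum>j<Suc N. Y i j * x j) = 0"
    and big: "\<And>x. (4 * a1\<^sup>2 + a1) * (real m powr (1 / p) * \<beta>) * lp q {..<N} x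
      \<le> lp p {..<N} (\<lambda>i. \<Sum>l<N. a i l * x l)"
  shows "(\<Sum>i\<in>{N..<N + m}. Y i N) < real m * \<beta> / 2"
proof -
  define s where "s = real m powr (1 / p) * \<beta>"
  have s: "0 < s" using m \<beta> by (simp add: s_def)
  have s1: "0 \<le> a1 * s" using s a1 by simp
  let ?A = "gap_mat N m a \<beta>"
  define X where "X = lp q {..<N} x"
  have X0: "0 \<le> X" by (simp add: X_def)
  \<comment> \<open>The summand \<open>a1\<close> of the constant absorbs the share of
    \<open>X\<close> on the right; what remains is the comparison of \<open>X\<close> with
    \<open>x N\<close>.\<close>
  have top: "(4 * a1\<^sup>2 + a1) * s * X \<le> a1 * s * (X + \<bar>x N\<bar>)"
  proof -
    have "(4 * a1\<^sup>2 + a1) * s * X \<le> lp p {..<N} (\<lambda>i. \<Sum>l<N. a i l * x l)"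
      using big[of x] by (simp add: s_def X_def)
    also have "\<dots> = lp p {..<N} (\<lambda>i. \<Sum>j<Suc N. (?A $$ (i, j) - Y i j) * x j)"
    proof (rule lp_cong)
      fix i assume "i \<in> {..<N}"
      then have i: "i < N" by simp
      have "(\<Sum>j<Suc N. (?A $$ (i, j) - Y i j) * x j) = (\<Sum>j<Suc N. ?A $$ (i, j) * x j)"
        using ker(2)[of i] i by (simp add: left_diff_distrib sum_subtractf)
      also have "\<dots> = (\<Sum>l<N. a i l * x l)" using i by (simp add: gap_mat_def)
      finally show "\<bar>\<Sum>l<N. a i l * x l\<bar> = \<bar>\<Sum>j<Suc N. (?A $$ (i, j) - Y i j) * x j\<bar>" by simp
    qed
    also have "\<dots> \<le> a1 * s * lp q {..<Suc N} x"
    proof (rule op_bound[OF p s1])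
      have "(\<Sum>i<N. \<Sum>j<Suc N. \<bar>?A $$ (i, j) - Y i j\<bar> powr p) \<le>
          (\<Sum>i<N + m. \<Sum>j<Suc N. \<bar>?A $$ (i, j) - Y i j\<bar> powr p)"
        by (intro sum_mono2 sum_nonneg) auto
      then show "(\<Sum>i<N. \<Sum>j<Suc N. \<bar>?A $$ (i, j) - Y i j\<bar> powr p) \<le> (a1 * s) powr p"
        using c by (simp add: s_def)
    qed
    also have "\<dots> \<le> a1 * s * (X + \<bar>x N\<bar>)"
    proof -
      have "1 / q + 1 / p = 1" using p by simp
      from Minkowski[OF p(2) p(1) this, of "{..<Suc N}" "\<lambda>j. if j < N then x j else 0" "\<lambda>j. if j < N then 0 else x j"]
      have "lp q {..<Suc N} x \<le> lp q {..<Suc N} (\<lambda>j. if j < N then x j else 0) + lp q {..<Suc N} (\<lambda>j. if j < N then 0 else x j)"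
        by (simp add: if_distrib cong: if_cong)
      also have "lp q {..<Suc N} (\<lambda>j. if j < N then x j else 0) = X" by (simp add: lp_def X_def)
      also have "lp q {..<Suc N} (\<lambda>j. if j < N then 0 else x j) = \<bar>x N\<bar>"
        using p by (simp add: lp_def powr_powr)
      finally show ?thesis using s1 by (rule mult_left_mono)
    qed
    finally show ?thesis .
  qed
  then have "(a1 * s) * (4 * a1 * X) \<le> (a1 * s) * \<bar>x N\<bar>" by (simp add: algebra_simps power2_eq_square)
  moreover have "0 < a1 * s" using s a1 by simp
  ultimately have X: "4 * a1 * X \<le> \<bar>x N\<bar>" by (rule mult_left_le_imp_le)
  have xN: "x N \<noteq> 0"
  proof
    assume "x N = 0"
    then have "X = 0" using X X0 a1 mult_nonneg_nonneg[of a1 X] by (auto simp: mult_le_0_iff)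
    then have "\<forall>j<N. x j = 0" unfolding X_def using lp_eq_0_iff[of "{..<N}" q x] by simp
    with \<open>x N = 0\<close> ker(1) show False by (metis less_Suc_eq)
  qed
  let ?I = "{N..<N + m}"
  have "\<bar>x N\<bar> * (\<Sum>i\<in>?I. Y i N) \<le> (\<Sum>i\<in>?I. \<bar>Y i N * x N\<bar>)"
    unfolding sum_distrib_left by (intro sum_mono) (simp add: abs_mult mult.commute mult_left_mono)
  also have "\<dots> = (\<Sum>i\<in>?I. \<bar>\<Sum>j<N. (?A $$ (i, j) - Y i j) * x j\<bar>)"
  proof (intro sum.cong refl)
    fix i assume i: "i \<in> ?I"
    have "(\<Sum>j<N. (?A $$ (i, j) - Y i j) * x j) = (\<Sum>j<N. - (Y i j * x j))"
      using i by (intro sum.cong) (auto simp: gap_mat_def)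
    also have "\<dots> = Y i N * x N" using ker(2)[of i] i by (simp add: sum_negf)
    finally show "\<bar>Y i N * x N\<bar> = \<bar>\<Sum>j<N. (?A $$ (i, j) - Y i j) * x j\<bar>" by simp
  qed
  also have "\<dots> \<le> lp p ?I (\<lambda>i. \<Sum>j<N. (?A $$ (i, j) - Y i j) * x j) * real m powr (1 / q)"
    using sum_le_lp[OF p, of _ ?I] by simp
  also have "\<dots> \<le> (a1 * s * X) * real m powr (1 / q)"
  proof (rule mult_right_mono)
    have "(\<Sum>i\<in>?I. \<Sum>j<N. \<bar>?A $$ (i, j) - Y i j\<bar> powr p) \<le> (\<Sum>i\<in>?I. \<Sum>j<Suc N. \<bar>?A $$ (i, j) - Y i j\<bar> powr p)"
      by (intro sum_mono sum_mono2) auto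
    also have "\<dots> \<le> (\<Sum>i<N + m. \<Sum>j<Suc N. \<bar>?A $$ (i, j) - Y i j\<bar> powr p)"
      by (intro sum_mono2 sum_nonneg) auto
    finally show "lp p ?I (\<lambda>i. \<Sum>j<N. (?A $$ (i, j) - Y i j) * x j) \<le> a1 * s * X"
      unfolding X_def using c by (intro op_bound[OF p s1]) (simp add: s_def)
  qed simp
  also have "\<dots> = a1 * X * (real m * \<beta>)"
  proof -
    have "real m powr (1 / p) * real m powr (1 / q) = real m" using p(3) by (simp flip: powr_add)
    moreover have "a1 * s * X * real m powr (1 / q) = a1 * X * (real m powr (1 / p) * real m powr (1 / q) * \<beta>)"
      by (simp add: s_def mult_ac)
    ultimately show ?thesis by simp
  qed
  also have "\<dots> \<le> \<bar>x N\<bar> / 4 * (real m * \<beta>)"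
    using X \<beta> by (intro mult_right_mono) auto
  also have "\<dots> < \<bar>x N\<bar> * (real m * \<beta> / 2)"
  proof -
    have "0 < \<bar>x N\<bar> * (real m * \<beta>)" using xN m \<beta> by simp
    then show ?thesis by (simp add: mult_ac)
  qed
  finally show ?thesis using xN by simp
qed

section \<open>The operator as a matrix, and its values on expanding and non-expanding sets\<close>

context regular
begin

definition dm :: "nat \<Rightarrow> nat \<Rightarrow> nat \<Rightarrow> real" where
  "dm m u v = (D ^^ m) (\<lambda>x. of_bool (x = v)) u"

lemma dm_0: "dm 0 u v = of_bool (u = v)"
  and dm_Suc: "dm (Suc m) u v = 64 / R * (real r * dm m u v - (\<Sum>x<N. w u x * dm m x v))"
  by (simp_all add: dm_def D_def)

lemma Dn_eq: "u < N \<Longrightarrow> (D ^^ m) x u = (\<Sum>v<N. dm m u v * x v)"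
proof (induction m arbitrary: u)
  case 0
  have "(\<Sum>v<N. dm 0 u v * x v) = (\<Sum>v\<in>{u}. dm 0 u v * x v)"
    using 0 by (intro sum.mono_neutral_right) (auto simp: dm_0)
  then show ?case by (simp add: dm_0)
next
  case (Suc m)
  have "(\<Sum>y<N. w u y * (D ^^ m) x y) = (\<Sum>y<N. \<Sum>v<N. w u y * (dm m y v * x v))"
    using Suc.IH by (intro sum.cong refl) (simp add: sum_distrib_left)
  also have "\<dots> = (\<Sum>v<N. (\<Sum>y<N. w u y * dm m y v) * x v)"
    by (subst sum.swap) (simp add: sum_distrib_right mult.assoc)
  finally have "(D ^^ Suc m) x u = 64 / R * (real r * (\<Sum>v<N. dm m u v * x v) - (\<Sum>v<N. (\<Sum>y<N. w u y * dm m y v) * x v))"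
    using Suc.IH[OF Suc.prems] by (simp only: funpow.simps o_apply D_def[of "(D ^^ m) x"])
  also have "\<dots> = 64 / R * (\<Sum>v<N. (real r * dm m u v - (\<Sum>y<N. w u y * dm m y v)) * x v)"
    by (simp only: left_diff_distrib sum_subtractf sum_distrib_left mult.assoc)
  also have "\<dots> = (\<Sum>v<N. dm (Suc m) u v * x v)"
    by (simp only: dm_Suc sum_distrib_left mult.assoc)
  finally show ?case .
qed

text \<open>The absolute row sums of the Laplacian are at most \<open>2 * r\<close>, and
  \<open>64 / R\<close> times this is at most 128.\<close>

lemma dm_bound: "u < N \<Longrightarrow> \<bar>dm m u v\<bar> \<le> 128 ^ m"
proof (induction m arbitrary: u)
  case (Suc m)
  have "\<bar>\<Sum>x<N. w u x * dm m x v\<bar> \<le> (\<Sum>x<N. w u x * 128 ^ m)"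
    using Suc w by (intro order_trans[OF sum_abs] sum_mono) (auto simp: abs_mult intro!: mult_left_mono)
  also have "\<dots> = real r * 128 ^ m" using deg[OF Suc.prems] by (simp flip: sum_distrib_right)
  finally have "\<bar>real r * dm m u v - (\<Sum>x<N. w u x * dm m x v)\<bar> \<le> \<bar>real r * dm m u v\<bar> + real r * 128 ^ m"
    by linarith
  also have "\<dots> \<le> 2 * real r * 128 ^ m"
    using mult_left_mono[OF Suc.IH[OF Suc.prems], of "real r"] unfolding abs_mult by simp
  finally have "\<bar>dm (Suc m) u v\<bar> \<le> 64 / R * (2 * real r * 128 ^ m)"
    unfolding dm_Suc abs_mult using R_pos by (intro mult_mono) auto
  also have "\<dots> = (128 * 128 ^ m) * (real r / R)" by (simp only: times_divide_eq_left times_divide_eq_right mult_ac)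
  also have "\<dots> \<le> (128 * 128 ^ m) * 1" using R R_pos by (intro mult_left_mono) auto
  finally show ?case by simp
qed (simp add: dm_0)

lemma id_plus_Dn_eq:
  assumes "u < N"
  shows "x u + (D ^^ m) x u = (\<Sum>v<N. (of_bool (u = v) + dm m u v) * x v)"
proof -
  have "(\<Sum>v<N. of_bool (u = v) * x v) = x u" using Dn_eq[OF assms, of 0 x] by (simp only: dm_0 funpow.simps id_apply)
  then show ?thesis unfolding Dn_eq[OF assms, of m] by (simp only: distrib_right sum.distrib)
qed

text \<open>As a quadratic form the operator is at least the identity; hence it is injective, and
  onto by finite dimension.\<close>

lemma resolvent_ex: "\<exists>x. \<forall>u<N. x u + (D ^^ (2 * T)) x u = s u"
proof -
  define a where "a u v = of_bool (u = v) + dm (2 * T) u v" for u v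
  have a: "(\<Sum>v<N. a u v * x v) = x u + (D ^^ (2 * T)) x u" if "u < N" for u x
    unfolding id_plus_Dn_eq[OF that] by (simp only: a_def)
  have "\<forall>u<N. x u = 0" if x: "\<forall>u<N. (\<Sum>v<N. a u v * x v) = 0" for x
  proof -
    define y where "y u = x u + 1 * (D ^^ (2 * T)) x u" for u
    have "ip x y = 0" using x a[of _ x] by (simp add: ip_def y_def)
    moreover have "ip x y = ip x x + 1 * ip x ((D ^^ (2 * T)) x)" unfolding y_def by (rule ip_linear)
    ultimately have "ip x x = 0" using Dn_psd[of x "2 * T"] ip_nonneg[of x] by linarith
    then show ?thesis by (simp add: ip_def sum_nonneg_eq_0_iff)
  qed
  from linear_system_solvable[of N a, OF this, of s] obtain x where "\<forall>u<N. (\<Sum>v<N. a u v * x v) = s u" ..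
  then show ?thesis by (intro exI[of _ x]) (simp add: a)
qed

text \<open>Let \<open>x\<close> be the preimage of the indicator of \<open>S\<close>; its image has
  norm \<open>n powr (1 / p)\<close>. Few edges leave \<open>S\<close>, so
  \<open>resolvent_bound\<close> yields \<open>n / 2 \<le> ip (indicator S) x\<close>, and Hoelder
  forces the \<open>q\<close>-norm of \<open>x\<close> to be large. The half comes from 1 / 128
  times the factor 64 in \<open>D\<close>.\<close>

lemma nonexpanding_set:
  assumes pq: "1 < p" "1 < q" "1 / p + 1 / q = 1" and T: "0 < T"
    and S: "S \<subseteq> {..<N}" "S \<noteq> {}"
    and e: "(1 - \<epsilon>) * (real r * real (card S)) \<le> (\<Sum>u\<in>S. \<Sum>v\<in>S. w u v)" and eps: "0 \<le> \<epsilon>" "\<epsilon> \<le> 1 / 128"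
  shows "\<exists>x. (\<exists>j<N. x j \<noteq> 0) \<and> lp p {..<N} (\<lambda>u. x u + (D ^^ (2 * T)) x u)
    \<le> 2 * real (card S) powr (2 / p - 1) * lp q {..<N} x"
proof -
  from resolvent_ex[of T "indicator S"]
  obtain x where x': "\<forall>u<N. x u + (D ^^ (2 * T)) x u = indicator S u" ..
  then have x: "u < N \<Longrightarrow> x u + (D ^^ (2 * T)) x u = indicator S u" for u by simp
  have fS: "finite S" using S finite_subset by blast
  define n where "n = real (card S)"
  have n: "0 < n" using S fS by (simp add: n_def card_gt_0_iff)
  have sum_ind: "(\<Sum>u<N. indicator S u) = n" unfolding n_def
    using S by (simp add: indicator_def sum.If_cases inf.absorb2)
  define X where "X = lp q {..<N} x"
  define c where "c = n powr (1 / p)"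
  have c: "0 < c" using n by (simp add: c_def)
  have lps: "lp p {..<N} (indicator S) = c"
  proof -
    have "(\<Sum>u<N. \<bar>indicator S u :: real\<bar> powr p) = (\<Sum>u<N. indicator S u)"
      by (intro sum.cong) (auto simp: indicator_def)
    then show ?thesis by (simp add: lp_def sum_ind c_def)
  qed
  have "ip (indicator S) (indicator S) = n"
    unfolding ip_def sum_ind[symmetric] by (intro sum.cong) (auto simp: indicator_def)
  moreover have "ip (indicator S) (D (indicator S)) \<le> n / 2"
  proof -
    have "ip (indicator S) (D (indicator S)) \<le> 64 / R * (\<epsilon> * (real r * n))"
      unfolding indicator_form[OF S(1)] using e R_pos
      by (intro mult_left_mono) (auto simp: n_def algebra_simps)
    also have "\<dots> = 64 * \<epsilon> * n * (real r / R)" by simp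
    also have "\<dots> \<le> 64 * \<epsilon> * n * 1" using R R_pos n eps by (intro mult_left_mono) auto
    also have "\<dots> \<le> 64 * (1 / 128) * n * 1" using eps n by (intro mult_right_mono mult_left_mono) auto
    finally show ?thesis by simp
  qed
  ultimately have "n / 2 \<le> ip (indicator S) x" using resolvent_bound[OF T x] by simp
  also have "\<dots> \<le> (\<Sum>u<N. \<bar>indicator S u * x u\<bar>)" unfolding ip_def by (intro sum_mono) simp
  also have "\<dots> \<le> c * X" unfolding X_def lps[symmetric] by (rule Hoelder[OF pq])
  finally have nX: "n \<le> 2 * c * X" by simp
  have "lp p {..<N} (\<lambda>u. x u + (D ^^ (2 * T)) x u) = c"
    unfolding lps[symmetric] by (rule lp_cong) (simp add: x)
  also have "c \<le> 2 * n powr (2 / p - 1) * X"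
  proof -
    have "n powr (2 / p - 1) = n powr (2 / p) / n" using n by (simp add: powr_diff)
    moreover have "n powr (2 / p) = c * c" by (simp add: c_def flip: powr_add)
    ultimately have nc: "n * n powr (2 / p - 1) = c * c" using n by simp
    have "n * c \<le> (2 * c * X) * c" using nX c by (intro mult_right_mono) auto
    also have "\<dots> = 2 * (c * c) * X" by simp
    also have "\<dots> = n * (2 * n powr (2 / p - 1) * X)" unfolding nc[symmetric] by simp
    finally have "n * c \<le> n * (2 * n powr (2 / p - 1) * X)" .
    then show ?thesis using n by (rule mult_left_le_imp_le)
  qed
  finally have "lp p {..<N} (\<lambda>u. x u + (D ^^ (2 * T)) x u) \<le> 2 * n powr (2 / p - 1) * X" .
  moreover have "\<exists>j<N. x j \<noteq> 0"
  proof (rule ccontr)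
    assume "\<not> ?thesis"
    then have "X = 0" unfolding X_def by (subst lp_eq_0_iff) auto
    with nX n show False by simp
  qed
  ultimately show ?thesis unfolding n_def X_def by blast
qed

text \<open>Averaging over the subsets of a fixed size: the density \<open>e(S) / (s (s - 1))\<close> of the densest
  set with \<open>s\<close> vertices does not increase with \<open>s\<close>.\<close>

lemma density_antimono:
  assumes loop: "\<And>u. u < N \<Longrightarrow> w u u = 0" and h: "2 \<le> h" and c: "0 \<le> c"
    and base: "\<And>S. S \<subseteq> {..<N} \<Longrightarrow> card S = h \<Longrightarrow> (\<Sum>u\<in>S. \<Sum>v\<in>S. w u v) \<le> c * real h"
    and S: "S \<subseteq> {..<N}" "h \<le> card S"
  shows "(\<Sum>u\<in>S. \<Sum>v\<in>S. w u v) * (real h - 1) \<le> c * real (card S) * (real (card S) - 1)"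
proof -
  define e where "e S = (\<Sum>u\<in>S. \<Sum>v\<in>S. w u v)" for S
  have "e S * (real h - 1) \<le> c * real s * (real s - 1)" if "h \<le> s" "S \<subseteq> {..<N}" "card S = s" for s S
    using that
  proof (induction s arbitrary: S rule: dec_induct)
    case base
    then show ?case using assms(4)[of S] h by (auto simp: e_def intro!: mult_right_mono)
  next
    case (step s)
    have fS: "finite S" using step.prems finite_subset by blast
    have rem: "e (S - {x}) = e S - (\<Sum>u\<in>S. w u x) - (\<Sum>v\<in>S. w x v)" if x: "x \<in> S" for x
    proof -
      have wx: "w x x = 0" using loop x step.prems by auto
      have "e S = (\<Sum>v\<in>S. w x v) + (\<Sum>u\<in>S - {x}. \<Sum>v\<in>S. w u v)"
        unfolding e_def by (rule sum.remove[OF fS x])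
      also have "(\<Sum>u\<in>S - {x}. \<Sum>v\<in>S. w u v) = (\<Sum>u\<in>S - {x}. w u x + (\<Sum>v\<in>S - {x}. w u v))"
        by (intro sum.cong refl sum.remove[OF fS x])
      also have "\<dots> = (\<Sum>u\<in>S - {x}. w u x) + e (S - {x})"
        by (simp add: sum.distrib e_def)
      also have "(\<Sum>u\<in>S - {x}. w u x) = (\<Sum>u\<in>S. w u x)"
        using wx by (subst sum.remove[OF fS x]) simp
      finally show ?thesis by simp
    qed
    have "(\<Sum>x\<in>S. e (S - {x})) = (\<Sum>x\<in>S. e S - (\<Sum>u\<in>S. w u x) - (\<Sum>v\<in>S. w x v))"
      by (intro sum.cong refl rem)
    also have "\<dots> = real (card S) * e S - (\<Sum>x\<in>S. \<Sum>u\<in>S. w u x) - e S"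
      by (simp add: sum_subtractf e_def)
    also have "(\<Sum>x\<in>S. \<Sum>u\<in>S. w u x) = e S" unfolding e_def by (rule sum.swap)
    \<comment> \<open>\<open>S\<close> has \<open>s + 1\<close> elements, and a pair of distinct
      vertices is lost in two of the \<open>s + 1\<close> deletions; so the deletions together count
      \<open>e S\<close> exactly \<open>s - 1\<close> times.\<close>
    finally have "(real s - 1) * e S = (\<Sum>x\<in>S. e (S - {x}))" using step.prems by (simp add: algebra_simps)
    then have "(real s - 1) * (e S * (real h - 1)) = (\<Sum>x\<in>S. e (S - {x}) * (real h - 1))"
      by (simp only: sum_distrib_right mult.assoc[symmetric])
    also have "\<dots> \<le> (\<Sum>x\<in>S. c * real s * (real s - 1))"
      using step.prems fS by (intro sum_mono step.IH) auto
    also have "\<dots> = (real s - 1) * (c * real (Suc s) * (real (Suc s) - 1))" using step.prems by simp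
    finally show ?case using step.hyps h by (simp add: mult_le_cancel_left)
  qed
  from this[OF S(2,1) refl] show ?thesis by (simp add: e_def)
qed

text \<open>Sets with at least \<open>h = nat \<lfloor>X\<rfloor>\<close> elements are compared with
  those of exactly this size. The factor 3 comes from \<open>X < h + 1 \<le> 3 * (h - 1)\<close>,
  valid as \<open>h\<close> is at least 2.\<close>

lemma larger_sets_expand:
  assumes loop: "\<And>u. u < N \<Longrightarrow> w u u = 0" and X: "2 \<le> X" and M: "1 \<le> M" and eps: "0 \<le> \<epsilon>"
    and small: "\<And>S. S \<subseteq> {..<N} \<Longrightarrow> S \<noteq> {} \<Longrightarrow> real (card S) \<le> X \<Longrightarrow>
      (\<Sum>u\<in>S. \<Sum>v\<in>S. w u v) \<le> \<epsilon> * (real r * real (card S))"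
    and S: "S \<subseteq> {..<N}" "real (card S) \<le> M * X"
  shows "(\<Sum>u\<in>S. \<Sum>v\<in>S. w u v) \<le> 3 * M * \<epsilon> * real r * real (card S)"
proof -
  define h where "h = nat \<lfloor>X\<rfloor>"
  have hX: "real h \<le> X" "X < real h + 1" "2 \<le> h" using X by (auto simp: h_def le_nat_floor of_nat_floor)
  define e where "e = (\<Sum>u\<in>S. \<Sum>v\<in>S. w u v)"
  define s where "s = real (card S)"
  consider "S = {}" | "S \<noteq> {}" "card S < h" | "h \<le> card S" by linarith
  then show ?thesis
  proof cases
    case 2
    then have "e \<le> 1 * (\<epsilon> * (real r * s))" using small[OF S(1)] hX by (simp add: e_def s_def)
    also have "\<dots> \<le> (3 * M) * (\<epsilon> * (real r * s))"
      using M eps by (intro mult_right_mono) (auto simp: s_def)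
    finally show ?thesis by (simp add: e_def s_def mult_ac)
  next
    case 3
    have h1: "0 < real h - 1" using hX by simp
    have "e * (real h - 1) \<le> (\<epsilon> * real r) * s * (s - 1)"
      unfolding e_def s_def
    proof (rule density_antimono[OF loop hX(3)])
      fix S' assume S': "S' \<subseteq> {..<N}" "card S' = h"
      then have "S' \<noteq> {}" using hX by auto
      then show "(\<Sum>u\<in>S'. \<Sum>v\<in>S'. w u v) \<le> \<epsilon> * real r * real h"
        using small[OF S'(1)] S' hX by (simp add: mult.assoc)
    qed (use 3 S eps in auto)
    also have "\<dots> \<le> (\<epsilon> * real r) * s * (3 * M * (real h - 1))"
    proof (rule mult_left_mono)
      have "s - 1 \<le> M * X" using S by (simp add: s_def)
      also have "\<dots> \<le> M * (3 * (real h - 1))" using hX M by (intro mult_left_mono) auto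
      finally show "s - 1 \<le> 3 * M * (real h - 1)" by (simp add: algebra_simps)
    qed (use eps in \<open>auto simp: s_def\<close>)
    also have "\<dots> = (3 * M * \<epsilon> * real r * s) * (real h - 1)" by simp
    finally show ?thesis unfolding e_def[symmetric] s_def[symmetric] using h1 by (rule mult_right_le_imp_le)
  qed simp
qed

text \<open>A matrix with entries of absolute value at most 1 has entrywise \<open>p\<close>-norm at
  most \<open>N powr (2 / p)\<close>, so \<open>op_bound\<close> and the triangle inequality apply
  in both directions.\<close>

lemma rounding:
  assumes pq: "1 < p" "1 < q" "1 / p + 1 / q = 1"
    and a: "\<And>u v. u < N \<Longrightarrow> v < N \<Longrightarrow> \<bar>a u v - S * (of_bool (u = v) + dm (2 * T) u v)\<bar> \<le> 1" and S: "0 \<le> S"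
  shows "lp p {..<N} (\<lambda>u. \<Sum>v<N. a u v * x v)
      \<le> S * lp p {..<N} (\<lambda>u. x u + (D ^^ (2 * T)) x u) + real N powr (2 / p) * lp q {..<N} x" (is ?A)
    and "S * lp p {..<N} (\<lambda>u. x u + (D ^^ (2 * T)) x u)
      \<le> lp p {..<N} (\<lambda>u. \<Sum>v<N. a u v * x v) + real N powr (2 / p) * lp q {..<N} x" (is ?B)
proof -
  define b where "b u v = of_bool (u = v) + dm (2 * T) u v" for u v
  define E where "E u v = a u v - S * b u v" for u v
  define y where "y u = x u + (D ^^ (2 * T)) x u" for u
  have b: "(\<Sum>v<N. b u v * x v) = y u" if "u < N" for u
    unfolding y_def id_plus_Dn_eq[OF that] by (simp only: b_def)
  have split: "(\<Sum>v<N. a u v * x v) = S * y u + (\<Sum>v<N. E u v * x v)" if "u < N" for u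
    unfolding b[OF that, symmetric] sum_distrib_left sum.distrib[symmetric]
    by (intro sum.cong) (auto simp: E_def algebra_simps)
  have lE: "lp p {..<N} (\<lambda>u. \<Sum>v<N. E u v * x v) \<le> real N powr (2 / p) * lp q {..<N} x"
  proof (rule op_bound[OF pq])
    have "(\<Sum>u<N. \<Sum>v<N. \<bar>E u v\<bar> powr p) \<le> (\<Sum>u<N. \<Sum>v<N. 1)"
    proof (intro sum_mono)
      fix u v assume "u \<in> {..<N}" "v \<in> {..<N}"
      then have "\<bar>E u v\<bar> powr p \<le> 1 powr p"
        using a[of u v] pq by (intro powr_mono2) (auto simp: E_def b_def)
      then show "\<bar>E u v\<bar> powr p \<le> 1" by simp
    qed
    also have "\<dots> = (real N powr (2 / p)) powr p"
    proof -
      have "2 / p * p = 2" using pq by simp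
      then show ?thesis by (cases "N = 0") (simp_all only: powr_powr, simp_all add: power2_eq_square powr_numeral)
    qed
    finally show "(\<Sum>u<N. \<Sum>v<N. \<bar>E u v\<bar> powr p) \<le> (real N powr (2 / p)) powr p" .
  qed simp
  have ly: "lp p {..<N} (\<lambda>u. S * y u) = S * lp p {..<N} y" using pq S by (simp add: lp_scale)
  have "lp p {..<N} (\<lambda>u. \<Sum>v<N. a u v * x v) = lp p {..<N} (\<lambda>u. S * y u + (\<Sum>v<N. E u v * x v))"
    by (rule lp_cong) (simp add: split)
  also have "\<dots> \<le> S * lp p {..<N} y + lp p {..<N} (\<lambda>u. \<Sum>v<N. E u v * x v)"
    unfolding ly[symmetric] by (rule Minkowski[OF pq]) simp
  finally show ?A using lE unfolding y_def by linarith
  have "lp p {..<N} (\<lambda>u. S * y u) = lp p {..<N} (\<lambda>u. (\<Sum>v<N. a u v * x v) + - (\<Sum>v<N. E u v * x v))"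
    by (rule lp_cong) (simp add: split)
  also have "\<dots> \<le> lp p {..<N} (\<lambda>u. \<Sum>v<N. a u v * x v) + lp p {..<N} (\<lambda>u. - (\<Sum>v<N. E u v * x v))"
    by (rule Minkowski[OF pq]) simp
  also have "lp p {..<N} (\<lambda>u. - (\<Sum>v<N. E u v * x v)) = lp p {..<N} (\<lambda>u. \<Sum>v<N. E u v * x v)"
    by (rule lp_cong) simp
  finally show ?B using lE unfolding y_def[symmetric] ly by linarith
qed

end

section \<open>Small set expansion and the hard matrices\<close>

text \<open>Every vertex has \<open>r\<close> equally likely neighbours, so staying in
  \<open>S\<close> is a matter of counting ordered edges inside \<open>S\<close>. This is the form
  in which the quadratic form sees expansion.\<close>

lemma expansion_eq:
  assumes S: "finite S" "S \<noteq> {}" and r: "0 < r" and f: "finite (parcs G)"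
    and deg: "\<And>v. v \<in> S \<Longrightarrow> card {u. (v, u) \<in> parcs G} = r"
  shows "expansion G S = 1 - (\<Sum>u\<in>S. \<Sum>v\<in>S. of_bool ((u, v) \<in> parcs G)) / (real r * real (card S))"
proof -
  define nb where "nb v = {u. (v, u) \<in> parcs G}" for v
  have fin: "finite (nb v)" for v
  proof (rule finite_subset)
    show "nb v \<subseteq> snd ` parcs G" by (force simp: nb_def)
  qed (use f in simp)
  have ne: "nb v \<noteq> {}" if "v \<in> S" for v
  proof
    assume "nb v = {}"
    then show False using deg[OF that] r by (simp only: nb_def card.empty)
  qed
  have cS: "0 < real (card S)" using S by (simp add: card_gt_0_iff)
  have "expansion G S = measure_pmf.expectation (pmf_of_set S) (\<lambda>v. measure_pmf.prob (pmf_of_set (nb v)) (- S))"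
    unfolding expansion_def nb_def[symmetric]
    by (simp add: measure_pmf_bind measure_pmf.measure_bind[where N = "count_space UNIV"] measure_pmf_in_subprob_algebra)
  also have "\<dots> = (\<Sum>v\<in>S. measure_pmf.prob (pmf_of_set (nb v)) (- S)) / real (card S)"
    by (rule integral_pmf_of_set[OF S(2,1)])
  also have "(\<Sum>v\<in>S. measure_pmf.prob (pmf_of_set (nb v)) (- S)) =
      (\<Sum>v\<in>S. 1 - (\<Sum>u\<in>S. of_bool ((v, u) \<in> parcs G)) / real r)"
  proof (intro sum.cong refl)
    fix v assume v: "v \<in> S"
    have "nb v \<inter> - S = nb v - nb v \<inter> S" by blast
    then have "real (card (nb v \<inter> - S)) = real (card (nb v)) - real (card (nb v \<inter> S))"
      using fin[of v] by (simp add: card_Diff_subset card_mono of_nat_diff)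
    moreover have "(\<Sum>u\<in>S. of_bool ((v, u) \<in> parcs G)) = real (card (nb v \<inter> S))"
      using S by (simp add: nb_def Int_def conj_commute)
    ultimately show "measure_pmf.prob (pmf_of_set (nb v)) (- S) = 1 - (\<Sum>u\<in>S. of_bool ((v, u) \<in> parcs G)) / real r"
      using measure_pmf_of_set[OF ne[OF v] fin, of "- S"] deg[OF v] r by (simp add: nb_def[symmetric] diff_divide_distrib)
  qed
  also have "\<dots> = real (card S) - (\<Sum>v\<in>S. \<Sum>u\<in>S. of_bool ((v, u) \<in> parcs G)) / real r"
    by (simp only: sum_subtractf sum_divide_distrib) simp
  finally show ?thesis using cS by (simp add: diff_divide_distrib)
qed

text \<open>Rounding toward zero acts on the absolute value alone, which suits the sign-magnitude
  code \<open>enc_int\<close>.\<close>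

definition trunc_shift :: "int \<Rightarrow> nat \<Rightarrow> int" where
  "trunc_shift z y = sgn z * (\<bar>z\<bar> div 2 ^ y)"

lemma trunc_shift: "\<bar>real_of_int (trunc_shift z y) - real_of_int z / 2 ^ y\<bar> \<le> 1"
proof -
  have "real_of_int (\<bar>z\<bar> div 2 ^ y) = of_int \<lfloor>real_of_int \<bar>z\<bar> / 2 ^ y\<rfloor>"
    by (metis floor_divide_of_int_eq of_int_numeral of_int_power)
  then have *: "\<bar>real_of_int (\<bar>z\<bar> div 2 ^ y) - real_of_int \<bar>z\<bar> / 2 ^ y\<bar> \<le> 1" by linarith
  have "real_of_int (trunc_shift z y) - real_of_int z / 2 ^ y =
      of_int (sgn z) * (real_of_int (\<bar>z\<bar> div 2 ^ y) - real_of_int \<bar>z\<bar> / 2 ^ y)"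
  proof -
    have "real_of_int z = real_of_int (sgn z) * real_of_int \<bar>z\<bar>" by (simp only: of_int_mult[symmetric] sgn_mult_abs)
    then show ?thesis unfolding trunc_shift_def of_int_mult right_diff_distrib by (metis times_divide_eq_right)
  qed
  then show ?thesis using * by (simp add: abs_mult sgn_if split: if_splits)
qed

text \<open>Powers of the unnormalized Laplacian, which stay integral; the normalization is
  postponed to a final shift.\<close>

fun lap_pow :: "(nat \<Rightarrow> nat \<Rightarrow> bool) \<Rightarrow> nat \<Rightarrow> nat \<Rightarrow> nat \<Rightarrow> nat \<Rightarrow> nat \<Rightarrow> int" where
  "lap_pow E N r 0 u v = of_bool (u = v)"
| "lap_pow E N r (Suc m) u v = int r * lap_pow E N r m u v - (\<Sum>x<N. of_bool (E u x) * lap_pow E N r m x v)"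

text \<open>An entry of the operator, scaled by \<open>2 ^ (s + \<nu>)\<close> and rounded, for
  \<open>T = t * \<nu>\<close>. As \<open>64 ^ (2 * T)\<close> is \<open>2 ^ (12 * T)\<close> and
  \<open>R ^ (2 * T)\<close> is \<open>2 ^ y\<close>, all scaling consists of shifts: both summands
  are put over the denominator \<open>2 ^ y\<close>, which is divided out last.\<close>

definition hard_entry :: "(nat \<Rightarrow> nat \<Rightarrow> bool) \<Rightarrow> nat \<Rightarrow> nat \<Rightarrow> nat \<Rightarrow> nat \<Rightarrow> nat \<Rightarrow> nat \<Rightarrow> int" where
  "hard_entry E N r s t u v =
    (let \<nu> = length (bin N); y = 2 * (t * \<nu>) * length (bin r) in
     trunc_shift (lap_pow E N r (2 * (t * \<nu>)) u v * 2 ^ (s + \<nu> + 12 * (t * \<nu>)) + of_bool (u = v) * 2 ^ (s + \<nu> + y)) y)"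

definition hard_mat :: "(nat \<Rightarrow> nat \<Rightarrow> bool) \<Rightarrow> nat \<Rightarrow> nat \<Rightarrow> nat \<Rightarrow> nat \<Rightarrow> nat \<Rightarrow> int mat" where
  "hard_mat E N r s b t = gap_mat N (N * N) (hard_entry E N r s t) (2 ^ b)"

lemma (in regular) dm_lap_pow:
  assumes w: "\<And>u v. w u v = of_bool (E u v)"
  shows "dm m u v = (64 / R) ^ m * lap_pow E N r m u v"
proof (induction m arbitrary: u)
  case (Suc m)
  have "(\<Sum>x<N. w u x * dm m x v) = (64 / R) ^ m * (\<Sum>x<N. of_bool (E u x) * of_int (lap_pow E N r m x v))"
    unfolding sum_distrib_left by (intro sum.cong refl) (simp only: Suc.IH w mult_ac)
  then have "dm (Suc m) u v = 64 / R * (real r * ((64 / R) ^ m * of_int (lap_pow E N r m u v))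
      - (64 / R) ^ m * (\<Sum>x<N. of_bool (E u x) * of_int (lap_pow E N r m x v)))"
    unfolding dm_Suc Suc.IH by (simp only:)
  also have "\<dots> = (64 / R) ^ Suc m * (real r * of_int (lap_pow E N r m u v)
      - (\<Sum>x<N. of_bool (E u x) * of_int (lap_pow E N r m x v)))"
    by (simp only: power_Suc right_diff_distrib mult_ac)
  also have "real r * of_int (lap_pow E N r m u v) - (\<Sum>x<N. of_bool (E u x) * of_int (lap_pow E N r m x v)) =
      of_int (lap_pow E N r (Suc m) u v)"
    by simp
  finally show ?case .
qed (simp add: dm_0)

lemma (in regular) hard_entry_approx:
  fixes s t
  assumes w: "\<And>u v. w u v = of_bool (E u v)" and R2: "R = 2 ^ length (bin r)"
  shows "\<bar>real_of_int (hard_entry E N r s t u v)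
    - 2 ^ (s + length (bin N)) * (of_bool (u = v) + dm (2 * (t * length (bin N))) u v)\<bar> \<le> 1"
proof -
  define \<nu> where "\<nu> = length (bin N)"
  define k where "k = t * \<nu>"
  define y where "y = 2 * k * length (bin r)"
  define z where "z = lap_pow E N r (2 * k) u v * 2 ^ (s + \<nu> + 12 * k) + of_bool (u = v) * 2 ^ (s + \<nu> + y)"
  have Ry: "R ^ (2 * k) = 2 ^ y" by (simp add: R2 y_def mult.commute flip: power_mult)
  have "(64 :: real) ^ (2 * k) = 2 ^ (12 * k)" using power_mult[of "2 :: real" 6 "2 * k"] by simp
  then have "dm (2 * k) u v = 2 ^ (12 * k) * of_int (lap_pow E N r (2 * k) u v) / 2 ^ y"
    unfolding dm_lap_pow[OF w] power_divide Ry by simp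
  then have "real_of_int z / 2 ^ y = 2 ^ (s + \<nu>) * (of_bool (u = v) + dm (2 * k) u v)"
    by (simp add: z_def power_add field_simps)
  then show ?thesis
    using trunc_shift[of z y] by (simp add: hard_entry_def Let_def z_def y_def k_def \<nu>_def)
qed

lemma (in regular) hard_entry_bound:
  assumes w: "\<And>u v. w u v = of_bool (E u v)" and R2: "R = 2 ^ length (bin r)" and uv: "u < N" and N: "1 \<le> N"
  shows "\<bar>hard_entry E N r s t u v\<bar> \<le> int (2 ^ (s + 3 + 14 * t) * N ^ (14 * t + 1))"
proof -
  define \<nu> where "\<nu> = length (bin N)"
  have nu: "2 ^ \<nu> \<le> 2 * N" unfolding \<nu>_def using N by (intro power_bin_le) auto
  have "(128 :: real) ^ (2 * (t * \<nu>)) = (2 ^ \<nu>) ^ (14 * t)"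
    using power_mult[of "2 :: real" 7 "2 * (t * \<nu>)"] by (simp add: mult_ac flip: power_mult)
  also have "\<dots> \<le> (2 * real N) ^ (14 * t)"
  proof (rule power_mono)
    show "2 ^ \<nu> \<le> 2 * real N" using nu by (metis of_nat_le_iff of_nat_mult of_nat_numeral of_nat_power)
  qed simp
  finally have d: "\<bar>dm (2 * (t * \<nu>)) u v\<bar> \<le> (2 * real N) ^ (14 * t)" using dm_bound[OF uv] order_trans by blast
  define B where "B = (2 * real N) ^ (14 * t)"
  have B1: "1 \<le> B" unfolding B_def using N by (intro one_le_power) auto
  have S: "(2 :: real) ^ (s + \<nu>) \<le> 2 ^ s * (2 * real N)"
    using nu unfolding power_add by (intro mult_left_mono) (metis of_nat_le_iff of_nat_mult of_nat_numeral of_nat_power, simp)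
  have "\<bar>real_of_int (hard_entry E N r s t u v)\<bar> \<le> 1 + 2 ^ (s + \<nu>) * \<bar>of_bool (u = v) + dm (2 * (t * \<nu>)) u v\<bar>"
  proof -
    define d where "d = of_bool (u = v) + dm (2 * (t * \<nu>)) u v"
    have "\<bar>real_of_int (hard_entry E N r s t u v) - 2 ^ (s + \<nu>) * d\<bar> \<le> 1"
      using hard_entry_approx[OF w R2, of s t u v] unfolding \<nu>_def[symmetric] d_def .
    moreover have "\<bar>2 ^ (s + \<nu>) * d\<bar> = 2 ^ (s + \<nu>) * \<bar>d\<bar>" by (simp add: abs_mult)
    ultimately show ?thesis unfolding d_def[symmetric] by linarith
  qed
  also have "\<dots> \<le> 1 + 2 ^ s * (2 * real N) * (2 * B)"
    using d S B1 by (intro add_left_mono mult_mono) (auto simp: B_def of_bool_def)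
  also have "\<dots> \<le> 2 ^ s * (2 * real N) * (4 * B)"
  proof -
    have "1 * 1 * 1 \<le> 2 ^ s * (2 * real N) * (2 * B)"
      using N B1 by (intro mult_mono) (auto intro: one_le_power)
    then show ?thesis by (simp add: mult_ac)
  qed
  also have "\<dots> = real (2 ^ (s + 3 + 14 * t) * N ^ (14 * t + 1))"
    by (simp add: B_def power_mult_distrib power_add)
  finally show ?thesis by (metis of_int_abs of_int_le_iff of_int_of_nat_eq)
qed

lemma poly_bound_mono_exp: "K \<le> c \<Longrightarrow> e \<le> c \<Longrightarrow> 1 \<le> N \<Longrightarrow> N \<le> n \<Longrightarrow> K * N ^ e \<le> poly_bound c n"
proof -
  assume a: "K \<le> c" "e \<le> c" "1 \<le> N" "N \<le> n"
  have "K * N ^ e \<le> c * n ^ e" using a by (intro mult_mono power_mono) auto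
  also have "\<dots> \<le> c * n ^ c" using a by (intro mult_left_mono power_increasing) auto
  finally show ?thesis by (simp add: poly_bound_def)
qed

section \<open>Instances of small set expansion as weighted regular graphs\<close>

lemma sse_instanceE:
  assumes "sse_instance \<delta> G"
  obtains N r where "pverts G = {..<N}" "0 < r" "0 < N" "finite (parcs G)" "\<forall>v<N. card {u. (v, u) \<in> parcs G} = r"
    "\<forall>u v. (u, v) \<in> parcs G \<longrightarrow> u < N \<and> v < N \<and> u \<noteq> v \<and> (v, u) \<in> parcs G"
proof -
  from assms obtain N r where N: "pverts G = {..<N}" "pair_graph G" "0 < r"
    "\<And>v. v < N \<Longrightarrow> out_degree (with_proj G) v = r" and S: "small_sets G \<delta> \<noteq> {}"
    unfolding sse_instance_def regular_graph_def by auto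
  interpret pair_graph G by fact
  have "card {u. (v, u) \<in> parcs G} = r" if "v < N" for v
  proof -
    have "out_arcs (with_proj G) v = Pair v ` {u. (v, u) \<in> parcs G}" by (auto simp: out_arcs_def)
    then have "out_degree (with_proj G) v = card {u. (v, u) \<in> parcs G}"
      by (simp add: out_degree_def card_image inj_on_def)
    then show ?thesis using N that by simp
  qed
  moreover have "u < N \<and> v < N \<and> u \<noteq> v \<and> (v, u) \<in> parcs G" if "(u, v) \<in> parcs G" for u v
    using arc_fst_in_verts[OF that] arc_snd_in_verts[OF that] pair_no_loops[OF that] pair_sym_arcs that N
    by (auto simp: symmetric_def sym_def)
  moreover have "0 < N" using S N by (auto simp: small_sets_def)
  ultimately show ?thesis using that N S pair_finite_arcs by blast
qed

lemma expansion_profile_cases: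
  assumes "sse_instance \<delta> G" "pverts G = {..<N}"
  shows "\<exists>S \<in> small_sets G \<delta>. expansion G S = expansion_profile G \<delta>"
    and "S \<in> small_sets G \<delta> \<Longrightarrow> expansion_profile G \<delta> \<le> expansion G S"
proof -
  have "finite (small_sets G \<delta>)"
    by (rule finite_subset[of _ "Pow {..<N}"]) (use assms in \<open>auto simp: small_sets_def\<close>)
  moreover have "small_sets G \<delta> \<noteq> {}" using assms by (simp add: sse_instance_def)
  ultimately have f: "finite (expansion G ` small_sets G \<delta>)" "expansion G ` small_sets G \<delta> \<noteq> {}" by auto
  from Min_in[OF this] show "\<exists>S \<in> small_sets G \<delta>. expansion G S = expansion_profile G \<delta>"
    unfolding expansion_profile_def by (metis imageE)
  show "S \<in> small_sets G \<delta> \<Longrightarrow> expansion_profile G \<delta> \<le> expansion G S"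
    unfolding expansion_profile_def by (rule Min_le[OF f(1)]) simp
qed

lemma regular_of_sse:
  assumes r: "0 < r" and deg: "\<And>v. v < N \<Longrightarrow> card {u. (v, u) \<in> parcs G} = r"
    and arcs: "\<And>u v. (u, v) \<in> parcs G \<Longrightarrow> u < N \<and> v < N \<and> u \<noteq> v \<and> (v, u) \<in> parcs G"
  shows "regular N r (\<lambda>u v. of_bool ((u, v) \<in> parcs G)) (2 ^ length (bin r))"
proof
  fix u v assume "u < N" "v < N"
  show "of_bool ((u, v) \<in> parcs G) = (of_bool ((v, u) \<in> parcs G) :: real)"
    using arcs by auto
next
  fix u assume u: "u < N"
  have "(\<Sum>v<N. of_bool ((u, v) \<in> parcs G)) = real (card ({..<N} \<inter> {v. (u, v) \<in> parcs G}))"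
    by simp
  also have "{..<N} \<inter> {v. (u, v) \<in> parcs G} = {v. (u, v) \<in> parcs G}" using arcs by auto
  finally show "(\<Sum>v<N. of_bool ((u, v) \<in> parcs G)) = real r" using deg[OF u] by simp
next
  have "real r < real (2 ^ length (bin r))" unfolding of_nat_less_iff by (rule less_power_bin)
  then show "real r \<le> 2 ^ length (bin r)" by simp
  have "real (2 ^ length (bin r)) \<le> real (2 * r)" unfolding of_nat_le_iff using r by (intro power_bin_le) auto
  then show "(2 :: real) ^ length (bin r) \<le> 2 * real r" by simp
qed (use r in auto)


text \<open>Yes-instances have an operator that is small on some vector, no-instances one that is large on
  every vector. The parameter \<open>2\<^sup>b\<close> separates the two cases by the factor that \<open>\<alpha>\<close> calls for.\<close>

theorem hard_mat_gap:
  fixes p \<alpha> :: real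
  assumes p: "1 < p" "p < 2" and \<alpha>: "1 < \<alpha>"
  shows "\<exists>\<epsilon>. 0 < \<epsilon> \<and> \<epsilon> < 1 \<and> (\<forall>\<delta>. 0 < \<delta> \<and> \<delta> < 1 \<longrightarrow> (\<exists>s b t N0. \<forall>G N r U V.
     sse_instance \<delta> G \<longrightarrow> pverts G = {..<N} \<longrightarrow> (\<forall>v<N. card {u. (v, u) \<in> parcs G} = r) \<longrightarrow>
     U \<in> carrier_mat (N + N * N) N \<longrightarrow> V \<in> carrier_mat N (Suc N) \<longrightarrow>
     entrywise_norm_pow p (map_mat real_of_int (hard_mat (\<lambda>u v. (u, v) \<in> parcs G) N r s b t) - U * V)
       \<le> \<alpha> * opt_cost p N (map_mat real_of_int (hard_mat (\<lambda>u v. (u, v) \<in> parcs G) N r s b t)) \<longrightarrow>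
     (let dec = N0 \<le> N \<and> real (N * N) * 2 ^ b / 2 \<le> (\<Sum>i\<in>{N..<N + N * N}. (U * V) $$ (i, N)) in
       (expansion_profile G \<delta> \<le> \<epsilon> \<longrightarrow> dec) \<and> (1 - \<epsilon> \<le> expansion_profile G \<delta> \<longrightarrow> \<not> dec))))"
proof -
  define q where "q = p / (p - 1)"
  have q2: "2 \<le> q" using p by (simp add: q_def field_simps)
  have pq: "1 / p + 1 / q = 1" using p by (simp add: q_def field_simps)
  have q1: "1 < q" using q2 by simp
  note pq' = p(1) q1 pq
  define \<gamma> where "\<gamma> = 2 / p - 1"
  have \<gamma>: "0 < \<gamma>" using p by (simp add: \<gamma>_def)
  have \<gamma>q: "1 - 2 / q = \<gamma>" using pq by (simp add: \<gamma>_def)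
  \<comment> \<open>Costs are \<open>p\<close>-th powers, so a factor \<open>\<alpha>\<close> in
    cost is a factor \<open>a1\<close> in norm.\<close>
  define a1 where "a1 = \<alpha> powr (1 / p)"
  have a1: "1 \<le> a1" using \<alpha> p by (simp add: a1_def ge_one_powr_ge_zero)
  have a1p: "a1 powr p = \<alpha>" using \<alpha> p by (simp add: a1_def powr_powr)
  define K where "K = 4 * a1\<^sup>2 + a1"
  have K: "0 < K" unfolding K_def using a1 by (intro add_pos_pos) auto
  define sc where "sc = spread_const q"
  have sc: "0 < sc"
  proof -
    have "0 < 4 + 6 * 16 powr (q - 1)" by (intro add_pos_pos mult_pos_pos) auto
    then show ?thesis unfolding sc_def spread_const_def by simp
  qed
  \<comment> \<open>What \<open>M powr \<gamma>\<close> has to reach: the spread constant and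
    \<open>K + 1\<close> come from the no-case, \<open>a1\<close> and 32 from the scale that the
    yes-case requires, and another 2 because that scale is rounded to a power of two.\<close>
  define M0 where "M0 = 64 * a1 * sc * (K + 1)"
  have M0: "0 < M0" using a1 sc K by (simp add: M0_def)
  obtain \<mu> :: nat where \<mu>: "M0 powr (1 / \<gamma>) < 2 ^ \<mu>" using real_arch_pow[of 2] by auto
  define M where "M = (2 :: real) ^ \<mu>"
  have M1: "1 \<le> M" by (simp add: M_def)
  have M\<gamma>: "M0 \<le> M powr \<gamma>"
  proof -
    have "M0 = (M0 powr (1 / \<gamma>)) powr \<gamma>" using M0 \<gamma> by (simp add: powr_powr)
    also have "\<dots> \<le> M powr \<gamma>" using \<mu> \<gamma> by (intro powr_mono2) (auto simp: M_def)
    finally show ?thesis .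
  qed
  \<comment> \<open>1 / 128 serves \<open>nonexpanding_set\<close>; the other value is still small
    enough for \<open>spread\<close> after \<open>larger_sets_expand\<close> has multiplied it by
    \<open>3 * M\<close>.\<close>
  define \<epsilon> where "\<epsilon> = min (1 / 128) (16 powr (1 - q) / 4 / (3 * M))"
  have \<epsilon>: "0 < \<epsilon>" "\<epsilon> \<le> 1 / 128" "3 * M * \<epsilon> \<le> 16 powr (1 - q) / 4"
  proof -
    show "0 < \<epsilon>" using M1 by (simp add: \<epsilon>_def)
    show "\<epsilon> \<le> 1 / 128" by (simp add: \<epsilon>_def)
    have "\<epsilon> \<le> 16 powr (1 - q) / 4 / (3 * M)" unfolding \<epsilon>_def by (rule min.cobounded2)
    then show "3 * M * \<epsilon> \<le> 16 powr (1 - q) / 4" using M1 by (simp add: pos_le_divide_eq mult_ac)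
  qed
  \<comment> \<open>Large enough that \<open>T = t * \<nu>\<close> satisfies the requirement of
    \<open>spread\<close> on \<open>32 ^ T\<close>.\<close>
  define t where "t = Suc (nat \<lceil>(real \<mu> + 1) * q\<rceil>)"
  have t: "(real \<mu> + 1) * q \<le> real t" "0 < t" unfolding t_def by linarith+
  \<comment> \<open>The constant \<open>2 ^ b\<close> must dwarf the rounding error, which is 1 in
    units of \<open>N powr (2 / p)\<close>.\<close>
  obtain b :: nat where b: "32 * a1 < 2 ^ b" using real_arch_pow[of 2] by auto
  show ?thesis
  proof (rule exI[of _ \<epsilon>], intro conjI allI impI)
    show "\<epsilon> < 1" using \<epsilon> by simp
    fix \<delta> :: real assume \<delta>: "0 < \<delta> \<and> \<delta> < 1"
    \<comment> \<open>\<open>2 ^ s\<close> will be the largest power of two up to \<open>X\<close>.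
      At this scale the bound on the operator in the yes-case fits below the budget of order
      \<open>2 ^ b / a1\<close>.\<close>
    define X where "X = 2 ^ b / (32 * a1 * \<delta> powr \<gamma>)"
    have d\<gamma>: "0 < \<delta> powr \<gamma>" "\<delta> powr \<gamma> \<le> 1" using \<delta> \<gamma> by (auto intro: powr_le1)
    have X1: "1 \<le> X"
    proof -
      have "32 * a1 * \<delta> powr \<gamma> \<le> 32 * a1 * 1" using a1 d\<gamma> by (intro mult_left_mono) auto
      then have "32 * a1 * \<delta> powr \<gamma> \<le> 2 ^ b" using b by linarith
      moreover have "0 < 32 * a1 * \<delta> powr \<gamma>" using a1 d\<gamma> by (intro mult_pos_pos) auto
      ultimately show ?thesis unfolding X_def by (simp only: le_divide_eq_1_pos)
    qed
    obtain s :: nat where s: "2 ^ s \<le> X" "X < 2 ^ Suc s"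
    proof -
      obtain n :: nat where n: "X < 2 ^ n" using real_arch_pow[of 2] by auto
      define k where "k = (LEAST k. X < 2 ^ k)"
      have k: "X < 2 ^ k" unfolding k_def by (rule LeastI[of _ n]) (rule n)
      then obtain s where s: "k = Suc s" using X1 by (cases k) auto
      have "\<not> X < 2 ^ s" using not_less_Least[of s "\<lambda>k. X < 2 ^ k"] s by (simp add: k_def)
      then show thesis using that[of s] k s by simp
    qed
    have sl: "2 ^ s * \<delta> powr \<gamma> \<le> 2 ^ b / (32 * a1)" "2 ^ b / (64 * a1) \<le> 2 ^ s * \<delta> powr \<gamma>"
      using s a1 d\<gamma> by (auto simp: X_def field_simps)
    \<comment> \<open>In a graph with fewer vertices every small set is a single vertex, whose
      expansion is 1. So yes-instances satisfy \<open>N0 \<le> N\<close>, and smaller graphs may be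
      rejected outright.\<close>
    define N0 where "N0 = nat \<lceil>2 / \<delta>\<rceil>"
    have N0: "N0 \<le> N \<longleftrightarrow> 2 \<le> \<delta> * real N" for N
    proof -
      have "N0 \<le> N \<longleftrightarrow> 2 / \<delta> \<le> real N" unfolding N0_def by (simp add: nat_le_iff ceiling_le_iff)
      then show ?thesis using \<delta> by (simp add: field_simps)
    qed
    show "\<exists>s b t N0. \<forall>G N r U V.
     sse_instance \<delta> G \<longrightarrow> pverts G = {..<N} \<longrightarrow> (\<forall>v<N. card {u. (v, u) \<in> parcs G} = r) \<longrightarrow>
     U \<in> carrier_mat (N + N * N) N \<longrightarrow> V \<in> carrier_mat N (Suc N) \<longrightarrow>
     entrywise_norm_pow p (map_mat real_of_int (hard_mat (\<lambda>u v. (u, v) \<in> parcs G) N r s b t) - U * V)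
       \<le> \<alpha> * opt_cost p N (map_mat real_of_int (hard_mat (\<lambda>u v. (u, v) \<in> parcs G) N r s b t)) \<longrightarrow>
     (let dec = N0 \<le> N \<and> real (N * N) * 2 ^ b / 2 \<le> (\<Sum>i\<in>{N..<N + N * N}. (U * V) $$ (i, N)) in
       (expansion_profile G \<delta> \<le> \<epsilon> \<longrightarrow> dec) \<and> (1 - \<epsilon> \<le> expansion_profile G \<delta> \<longrightarrow> \<not> dec))"
    proof (rule exI[of _ s], rule exI[of _ b], rule exI[of _ t], rule exI[of _ N0], intro allI impI)
      fix G :: "nat pair_pre_digraph" and N r :: nat and U V :: "real mat"
      assume G: "sse_instance \<delta> G" and NG: "pverts G = {..<N}" and rG: "\<forall>v<N. card {u. (v, u) \<in> parcs G} = r"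
        and U: "U \<in> carrier_mat (N + N * N) N" and V: "V \<in> carrier_mat N (Suc N)"
        and cost: "entrywise_norm_pow p (map_mat real_of_int (hard_mat (\<lambda>u v. (u, v) \<in> parcs G) N r s b t) - U * V)
          \<le> \<alpha> * opt_cost p N (map_mat real_of_int (hard_mat (\<lambda>u v. (u, v) \<in> parcs G) N r s b t))"
      define E where "E u v \<longleftrightarrow> (u, v) \<in> parcs G" for u v
      have GE: "0 < r" "0 < N" "finite (parcs G)"
        and arcs: "\<And>u v. (u, v) \<in> parcs G \<Longrightarrow> u < N \<and> v < N \<and> u \<noteq> v \<and> (v, u) \<in> parcs G"
      proof -
        obtain N' r' where *: "pverts G = {..<N'}" "0 < r'" "0 < N'" "finite (parcs G)" "\<forall>v<N'. card {u. (v, u) \<in> parcs G} = r'"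
          "\<forall>u v. (u, v) \<in> parcs G \<longrightarrow> u < N' \<and> v < N' \<and> u \<noteq> v \<and> (v, u) \<in> parcs G"
          by (rule sse_instanceE[OF G])
        have "N' = N" using *(1) NG by simp
        moreover have "r' = r" using *(5) rG *(3) \<open>N' = N\<close> by metis
        ultimately show "0 < r" "0 < N" "finite (parcs G)" "\<And>u v. (u, v) \<in> parcs G \<Longrightarrow> u < N \<and> v < N \<and> u \<noteq> v \<and> (v, u) \<in> parcs G"
          using * by auto
      qed
      define w where "w u v = (of_bool ((u, v) \<in> parcs G) :: real)" for u v
      interpret regular N r w "2 ^ length (bin r)"
        unfolding w_def using GE(1) rG arcs by (intro regular_of_sse) auto
      have wE: "w u v = of_bool (E u v)" for u v by (simp add: w_def E_def)
      define A where "A = map_mat real_of_int (hard_mat E N r s b t)"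
      define a where "a u v = real_of_int (hard_entry E N r s t u v)" for u v
      define \<nu> where "\<nu> = length (bin N)"
      define S where "S = (2 :: real) ^ (s + \<nu>)"
      have S0: "0 \<le> S" by (simp add: S_def)
      have nu: "real N \<le> 2 ^ \<nu>" "2 ^ \<nu> \<le> 2 * real N"
      proof -
        have "real N < real (2 ^ \<nu>)" unfolding of_nat_less_iff \<nu>_def by (rule less_power_bin)
        then show "real N \<le> 2 ^ \<nu>" by simp
        have "real (2 ^ \<nu>) \<le> real (2 * N)" unfolding of_nat_le_iff \<nu>_def using GE by (intro power_bin_le) auto
        then show "2 ^ \<nu> \<le> 2 * real N" by simp
      qed
      have nu0: "0 < \<nu>" using GE by (cases "\<nu> = 0") (auto simp: \<nu>_def bin.simps[of N])
      define T where "T = t * \<nu>"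
      have T0: "0 < T" using t nu0 by (simp add: T_def)
      have app: "\<bar>a u v - S * (of_bool (u = v) + dm (2 * T) u v)\<bar> \<le> 1" for u v
        using hard_entry_approx[OF wE refl, of s t u v] by (simp add: a_def S_def T_def \<nu>_def)
      have A: "A = gap_mat N (N * N) a (2 ^ b)"
        unfolding A_def hard_mat_def gap_mat_def a_def by (rule eq_matI) auto
      have Ac: "A \<in> carrier_mat (N + N * N) (Suc N)" by (simp add: A)
      define Y where "Y i j = (U * V) $$ (i, j)" for i j
      have normY: "entrywise_norm_pow p (A - U * V) =
          (\<Sum>i<N + N * N. \<Sum>j<Suc N. \<bar>gap_mat N (N * N) a (2 ^ b) $$ (i, j) - Y i j\<bar> powr p)"
        unfolding entrywise_norm_pow_def A[symmetric] using U V Ac by (intro sum.cong) (auto simp: Y_def)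
      have cost: "entrywise_norm_pow p (A - U * V) \<le> \<alpha> * opt_cost p N A"
        using cost unfolding A_def E_def .
      have m: "real (N * N) powr (1 / p) = real N powr (2 / p)"
        using GE by (simp add: powr_mult flip: powr_add)
      have N2p: "real N * real N powr \<gamma> = real N powr (2 / p)"
        using GE powr_mult_base[of "real N" \<gamma>] by (simp add: \<gamma>_def)
      have Np: "0 < real N powr (2 / p)" using GE by simp
      have exps: "expansion G S' = 1 - (\<Sum>u\<in>S'. \<Sum>v\<in>S'. w u v) / (real r * real (card S'))"
        if "S' \<subseteq> {..<N}" "S' \<noteq> {}" for S'
        unfolding w_def using that GE rG by (intro expansion_eq) (auto intro: finite_subset)
      have cpos: "0 < real r * real (card S')" if "S' \<subseteq> {..<N}" "S' \<noteq> {}" for S'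
        using that GE finite_subset[of S' "{..<N}"] by (simp add: card_gt_0_iff)
      have smallI: "S' \<in> small_sets G \<delta> \<longleftrightarrow> S' \<subseteq> {..<N} \<and> S' \<noteq> {} \<and> real (card S') \<le> \<delta> * real N" for S'
        using GE by (auto simp: small_sets_def NG mu_def field_simps)
      have yes: "N0 \<le> N \<and> real (N * N) * 2 ^ b / 2 \<le> (\<Sum>i\<in>{N..<N + N * N}. Y i N)"
        if le: "expansion_profile G \<delta> \<le> \<epsilon>"
      proof -
        obtain S' where S': "S' \<in> small_sets G \<delta>" "expansion G S' \<le> \<epsilon>"
          using expansion_profile_cases(1)[OF G NG] le by auto
        then have S1: "S' \<subseteq> {..<N}" "S' \<noteq> {}" "real (card S') \<le> \<delta> * real N" using smallI by auto
        have e: "(1 - \<epsilon>) * (real r * real (card S')) \<le> (\<Sum>u\<in>S'. \<Sum>v\<in>S'. w u v)"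
        proof -
          have "1 - \<epsilon> \<le> (\<Sum>u\<in>S'. \<Sum>v\<in>S'. w u v) / (real r * real (card S'))"
            using S'(2) unfolding exps[OF S1(1,2)] by linarith
          then show ?thesis by (simp only: pos_le_divide_eq[OF cpos[OF S1(1,2)]])
        qed
        have "\<not> card S' \<le> 1"
        proof
          assume "card S' \<le> 1"
          moreover have "0 < card S'" using S1 finite_subset[of S' "{..<N}"] by (simp add: card_gt_0_iff)
          ultimately have "card S' = 1" by simp
          then obtain u where "S' = {u}" by (rule card_1_singletonE)
          then have "(\<Sum>u\<in>S'. \<Sum>v\<in>S'. w u v) = 0" using arcs by (auto simp: w_def)
          moreover have "0 < (1 - \<epsilon>) * (real r * real (card S'))" by (rule mult_pos_pos) (use \<epsilon> in simp, rule cpos[OF S1(1,2)])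
          ultimately show False using e by simp
        qed
        then have "N0 \<le> N" using S1 N0[of N] by linarith
        moreover obtain x where x: "\<exists>j<N. x j \<noteq> 0"
          "lp p {..<N} (\<lambda>u. x u + (D ^^ (2 * T)) x u) \<le> 2 * real (card S') powr \<gamma> * lp q {..<N} x"
          using nonexpanding_set[OF pq' T0 S1(1,2) e] \<epsilon> unfolding \<gamma>_def by auto
        \<comment> \<open>Chosen so that \<open>a1 * \<eta>\<close> is a quarter of the norm of the
          new column, as \<open>gap_yes\<close> asks.\<close>
        define \<eta> where "\<eta> = real N powr (2 / p) * 2 ^ b / (4 * a1)"
        have "lp p {..<N} (\<lambda>i. \<Sum>l<N. a i l * x l) \<le> \<eta> * lp q {..<N} x"
        proof -
          have "lp p {..<N} (\<lambda>i. \<Sum>l<N. a i l * x l) \<le> S * (2 * real (card S') powr \<gamma> * lp q {..<N} x) + real N powr (2 / p) * lp q {..<N} x"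
            using rounding(1)[OF pq' app S0, of x] mult_left_mono[OF x(2) S0] by linarith
          also have "\<dots> = (S * (2 * real (card S') powr \<gamma>) + real N powr (2 / p)) * lp q {..<N} x"
            by (simp add: algebra_simps)
          also have "\<dots> \<le> \<eta> * lp q {..<N} x"
          proof (rule mult_right_mono)
            have "real (card S') powr \<gamma> \<le> (\<delta> * real N) powr \<gamma>" using S1 \<gamma> by (intro powr_mono2) auto
            also have "\<dots> = \<delta> powr \<gamma> * real N powr \<gamma>" by (rule powr_mult)
            finally have "S * (2 * real (card S') powr \<gamma>) \<le> (2 ^ s * (2 * real N)) * (2 * (\<delta> powr \<gamma> * real N powr \<gamma>))"
              unfolding S_def power_add using nu by (intro mult_mono) auto
            also have "\<dots> = 4 * (2 ^ s * \<delta> powr \<gamma>) * real N powr (2 / p)" unfolding N2p[symmetric] by simp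
            also have "\<dots> \<le> 4 * (2 ^ b / (32 * a1)) * real N powr (2 / p)"
              using sl by (intro mult_right_mono mult_left_mono) auto
            finally have "S * (2 * real (card S') powr \<gamma>) + real N powr (2 / p) \<le> (2 ^ b / (8 * a1) + 1) * real N powr (2 / p)"
              by (simp add: distrib_right)
            also have "\<dots> \<le> (2 ^ b / (4 * a1)) * real N powr (2 / p)"
            proof (rule mult_right_mono)
              have "1 \<le> 2 ^ b / (8 * a1)" using b a1 by (simp add: le_divide_eq)
              moreover have "2 ^ b / (4 * a1) = 2 ^ b / (8 * a1) + 2 ^ b / (8 * a1)" using a1 by (simp add: field_simps)
              ultimately show "2 ^ b / (8 * a1) + 1 \<le> 2 ^ b / (4 * a1)" by simp
            qed simp
            finally show "S * (2 * real (card S') powr \<gamma>) + real N powr (2 / p) \<le> \<eta>" by (simp add: \<eta>_def mult.commute)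
          qed simp
          finally show ?thesis .
        qed
        with x(1) have "opt_cost p N A \<le> \<eta> powr p"
          unfolding A using gap_mat_opt_le_operator[OF pq', of _ N x a \<eta> "N * N" "2 ^ b"] by blast
        then have "entrywise_norm_pow p (A - U * V) \<le> \<alpha> * \<eta> powr p"
          using cost \<alpha> mult_left_mono[of "opt_cost p N A" "\<eta> powr p" \<alpha>] by linarith
        then have c: "entrywise_norm_pow p (A - U * V) \<le> (a1 * \<eta>) powr p" by (simp add: powr_mult a1p)
        have "real (N * N) * 2 ^ b / 2 \<le> (\<Sum>i\<in>{N..<N + N * N}. Y i N)"
          by (rule gap_yes[OF pq' _ c[unfolded normY]]) (use a1 m in \<open>auto simp: \<eta>_def\<close>)
        ultimately show ?thesis by blast
      qed
      have no: "\<not> (N0 \<le> N \<and> real (N * N) * 2 ^ b / 2 \<le> (\<Sum>i\<in>{N..<N + N * N}. Y i N))"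
        if le: "1 - \<epsilon> \<le> expansion_profile G \<delta>"
      proof
        assume *: "N0 \<le> N \<and> real (N * N) * 2 ^ b / 2 \<le> (\<Sum>i\<in>{N..<N + N * N}. Y i N)"
        then have X2: "2 \<le> \<delta> * real N" using N0[of N] by simp
        have small: "(\<Sum>u\<in>S'. \<Sum>v\<in>S'. w u v) \<le> \<epsilon> * (real r * real (card S'))"
          if "S' \<subseteq> {..<N}" "S' \<noteq> {}" "real (card S') \<le> \<delta> * real N" for S'
        proof -
          have "S' \<in> small_sets G \<delta>" unfolding smallI using that by simp
          from expansion_profile_cases(2)[OF G NG this] have "1 - \<epsilon> \<le> expansion G S'" using le by linarith
          then have "(\<Sum>u\<in>S'. \<Sum>v\<in>S'. w u v) / (real r * real (card S')) \<le> \<epsilon>"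
            unfolding exps[OF that(1,2)] by linarith
          then show ?thesis by (simp only: pos_divide_le_eq[OF cpos[OF that(1,2)]])
        qed
        have loop: "w u u = 0" for u using arcs by (auto simp: w_def)
        define MX where "MX = M * (\<delta> * real N)"
        have MX: "0 < MX" unfolding MX_def using M1 \<delta> GE by simp
        \<comment> \<open>\<open>MX\<close> is at most \<open>2 ^ (\<mu> + \<nu>)\<close>, and
          \<open>\<mu>\<close> is absorbed by a multiple of \<open>\<nu>\<close>, which is positive.
          The estimate is generous: \<open>T\<close> alone would do as exponent of 2.\<close>
        have TM: "MX powr (q / 2 - 1) \<le> 32 ^ T"
        proof -
          have "MX \<le> 2 ^ \<mu> * (1 * 2 ^ \<nu>)" unfolding MX_def M_def using \<delta> nu by (intro mult_left_mono mult_mono) auto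
          also have "\<dots> = 2 powr real (\<mu> + \<nu>)" by (simp add: powr_add powr_realpow)
          finally have "MX powr (q / 2 - 1) \<le> (2 powr real (\<mu> + \<nu>)) powr (q / 2 - 1)"
            using MX q2 by (intro powr_mono2) auto
          also have "\<dots> = 2 powr (real (\<mu> + \<nu>) * (q / 2 - 1))" by (rule powr_powr)
          also have "\<dots> \<le> 2 powr real (5 * T)"
          proof (rule powr_mono)
            have "real (\<mu> + \<nu>) * (q / 2 - 1) \<le> ((real \<mu> + 1) * real \<nu>) * q"
            proof (rule mult_mono)
              have "real \<mu> * 1 \<le> real \<mu> * real \<nu>" using nu0 by (intro mult_left_mono) auto
              then show "real (\<mu> + \<nu>) \<le> (real \<mu> + 1) * real \<nu>" by (simp add: algebra_simps)
            qed (use q2 in auto)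
            also have "\<dots> = ((real \<mu> + 1) * q) * real \<nu>" by simp
            also have "\<dots> \<le> real t * real \<nu>" using t by (intro mult_right_mono) auto
            finally show "real (\<mu> + \<nu>) * (q / 2 - 1) \<le> real (5 * T)"
            proof -
              assume "real (\<mu> + \<nu>) * (q / 2 - 1) \<le> real t * real \<nu>"
              moreover have "real (5 * T) = 5 * (real t * real \<nu>)" "0 \<le> real t * real \<nu>" by (simp_all add: T_def)
              ultimately show ?thesis by linarith
            qed
          qed simp
          also have "\<dots> = 2 ^ (5 * T)" by (rule powr_realpow) simp
          finally show ?thesis by (simp add: power_mult)
        qed
        have big: "K * (real (N * N) powr (1 / p) * 2 ^ b) * lp q {..<N} x \<le> lp p {..<N} (\<lambda>i. \<Sum>l<N. a i l * x l)" for x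
        proof -
          define L where "L = lp p {..<N} (\<lambda>u. x u + (D ^^ (2 * T)) x u)"
          have "lp q {..<N} x * MX powr (1 - 2 / q) \<le> sc * L" unfolding sc_def L_def
          proof (rule spread[OF p(1) pq q2 MX _ _ \<epsilon>(3) TM])
            fix S' assume "S' \<subseteq> {..<N}" "real (card S') \<le> MX"
            then show "(\<Sum>u\<in>S'. \<Sum>v\<in>S'. w u v) \<le> 3 * M * \<epsilon> * real r * real (card S')"
              unfolding MX_def using larger_sets_expand[OF loop X2 M1 _ small] \<epsilon> by simp
          qed (use M1 \<epsilon> in auto)
          then have 1: "lp q {..<N} x * MX powr \<gamma> \<le> sc * L" unfolding \<gamma>q .
          \<comment> \<open>Here \<open>M0\<close> is spent. The operator must supply
            \<open>K * 2 ^ b\<close> for \<open>gap_no\<close>, and the summand 1 pays for the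
            rounding.\<close>
          have 2: "sc * ((K * 2 ^ b + 1) * real N powr (2 / p)) \<le> S * MX powr \<gamma>"
          proof -
            have "sc * (K * 2 ^ b + 1) \<le> sc * (K * 2 ^ b + 2 ^ b)" using sc by (intro mult_left_mono add_left_mono) auto
            also have "\<dots> = 2 ^ b / (64 * a1) * M0" using a1 by (simp add: M0_def field_simps)
            also have "\<dots> \<le> (2 ^ s * \<delta> powr \<gamma>) * M powr \<gamma>" using sl M\<gamma> M0 d\<gamma> by (intro mult_mono) auto
            finally have "sc * (K * 2 ^ b + 1) * (real N * real N powr \<gamma>) \<le> (2 ^ s * \<delta> powr \<gamma>) * M powr \<gamma> * (real N * real N powr \<gamma>)"
              by (rule mult_right_mono) simp
            also have "\<dots> = (2 ^ s * real N) * MX powr \<gamma>" unfolding MX_def powr_mult by simp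
            also have "\<dots> \<le> S * MX powr \<gamma>" unfolding S_def power_add using nu by (intro mult_right_mono mult_left_mono) auto
            finally show ?thesis unfolding N2p by (simp only: mult.assoc)
          qed
          have "sc * ((K * 2 ^ b + 1) * real N powr (2 / p) * lp q {..<N} x) \<le> S * MX powr \<gamma> * lp q {..<N} x"
            using mult_right_mono[OF 2, of "lp q {..<N} x"] by (simp only: mult.assoc lp_nonneg)
          also have "\<dots> \<le> sc * (S * L)"
            using mult_left_mono[OF 1, of S] by (simp add: S_def mult_ac)
          finally have "(K * 2 ^ b + 1) * real N powr (2 / p) * lp q {..<N} x \<le> S * L"
            using sc by simp
          also have "S * L \<le> lp p {..<N} (\<lambda>i. \<Sum>l<N. a i l * x l) + real N powr (2 / p) * lp q {..<N} x"
            unfolding L_def by (rule rounding(2)[OF pq' app]) (simp_all add: S_def)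
          finally show ?thesis unfolding m by (simp add: algebra_simps)
        qed
        have "opt_cost p N A \<le> real (N * N) * (2 ^ b) powr p"
          unfolding A using gap_mat_opt_le[OF p(1), of N "N * N" a "2 ^ b"] by simp
        then have "entrywise_norm_pow p (A - U * V) \<le> \<alpha> * (real (N * N) * (2 ^ b) powr p)"
          using cost \<alpha> mult_left_mono[of "opt_cost p N A" "real (N * N) * (2 ^ b) powr p" \<alpha>] by linarith
        also have "\<dots> = (a1 * (real (N * N) powr (1 / p) * 2 ^ b)) powr p"
        proof -
          have "(real (N * N) powr (1 / p)) powr p = real (N * N)" using p by (simp only: powr_powr) simp
          then show ?thesis by (simp only: powr_mult a1p)
        qed
        finally have c: "entrywise_norm_pow p (A - U * V) \<le> (a1 * (real (N * N) powr (1 / p) * 2 ^ b)) powr p" .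
        obtain x where x: "\<exists>j<Suc N. x j \<noteq> 0" "\<forall>i<N + N * N. (\<Sum>j<Suc N. (U * V) $$ (i, j) * x j) = 0"
          using mult_mat_kernel[OF U V lessI] by metis
        have "(\<Sum>i\<in>{N..<N + N * N}. Y i N) < real (N * N) * 2 ^ b / 2"
        proof (rule gap_no[OF pq' _ _ a1 c[unfolded normY] x(1)])
          show "(\<Sum>j<Suc N. Y i j * x j) = 0" if "i < N + N * N" for i
            using x(2) that unfolding Y_def by blast
          show "(4 * a1\<^sup>2 + a1) * (real (N * N) powr (1 / p) * 2 ^ b) * lp q {..<N} x \<le> lp p {..<N} (\<lambda>i. \<Sum>l<N. a i l * x l)" for x
            using big[of x] unfolding K_def .
        qed (use GE in auto)
        with * show False by linarith
      qed
      show "let dec = N0 \<le> N \<and> real (N * N) * 2 ^ b / 2 \<le> (\<Sum>i\<in>{N..<N + N * N}. (U * V) $$ (i, N)) in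
       (expansion_profile G \<delta> \<le> \<epsilon> \<longrightarrow> dec) \<and> (1 - \<epsilon> \<le> expansion_profile G \<delta> \<longrightarrow> \<not> dec)"
        unfolding Let_def using yes no unfolding Y_def by blast
    qed
  qed (use \<epsilon> in auto)
qed

section \<open>Satisfiability in NP\<close>

lemma pt_thd: assumes "pt f" shows "pt (\<lambda>x. Str (thd (raw (f x))))"
  using pc_thd[OF assms[unfolded pt_def]] by (simp add: pt_def enc_str_def)

lemma pt_ttl: assumes "pt f" shows "pt (\<lambda>x. Str (ttl (raw (f x))))"
  using pc_ttl[OF assms[unfolded pt_def]] by (simp add: pt_def enc_str_def)

lemma sz_str: "sz (s :: str) = length (raw s)"
  by (simp add: enc_str_def)

lemma pt_app2:
  assumes "pt (\<lambda>y. c (fst y) (snd y))" "pt f" "pt g" shows "pt (\<lambda>x. c (f x) (g x))"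
  using pt_o[OF assms(1) pt_pair[OF assms(2,3)]] by simp

definition split_tuple :: "str list \<times> str \<Rightarrow> str list \<times> str" where
  "split_tuple p = (if raw (snd p) = [] then p else (fst p @ [Str (thd (raw (snd p)))], Str (ttl (raw (snd p)))))"

text \<open>The inverse of the list encoding. Each round strips one component and a tuple has no
  more components than bits, so \<open>sz s\<close> rounds suffice.\<close>

definition untuple :: "str \<Rightarrow> str list" where
  "untuple s = fst ((split_tuple ^^ sz s) ([], s))"

lemma untuple [simp]: "untuple (Str (enc xs)) = xs"
proof -
  have fix0: "(split_tuple ^^ m) (acc, Str []) = (acc, Str [])" for m acc
    by (induction m) (simp_all add: split_tuple_def)
  have "(split_tuple ^^ m) (acc, Str (enc xs)) = (acc @ xs, Str [])" if "length xs \<le> m" for m acc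
    using that
  proof (induction xs arbitrary: acc m)
    case Nil
    then show ?case by (simp add: fix0 enc_simps)
  next
    case (Cons a xs)
    then obtain m' where m: "m = Suc m'" "length xs \<le> m'" by (cases m) auto
    have "split_tuple (acc, Str (enc (a # xs))) = (acc @ [a], Str (enc xs))"
      by (simp add: split_tuple_def enc_simps thd_ttl enc_str_def)
    then show ?case using Cons.IH[OF m(2), of "acc @ [a]"] by (simp add: m(1) funpow_Suc_right del: funpow.simps)
  qed
  from this[of "sz (Str (enc xs))" "[]"] show ?thesis
    unfolding untuple_def using length_le_sz[of xs] by (simp add: sz_simps)
qed

lemma pt_untuple: assumes "pt f" shows "pt (\<lambda>x. untuple (f x))"
proof -
  have inv: "length (raw (snd r)) \<le> sz s \<and> length (fst r) \<le> m \<and> (\<forall>a \<in> set (fst r). sz a \<le> sz s)"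
    if "r = (split_tuple ^^ m) ([], s)" for m r s
    using that
  proof (induction m arbitrary: r)
    case (Suc m)
    define r' where "r' = (split_tuple ^^ m) ([], s)"
    have r: "r = split_tuple r'" using Suc.prems by (simp add: r'_def)
    have "length (raw (snd r')) \<le> sz s \<and> length (fst r') \<le> m \<and> (\<forall>a \<in> set (fst r'). sz a \<le> sz s)"
      by (rule Suc.IH) (simp add: r'_def)
    moreover have "length (thd (raw (snd r'))) \<le> length (raw (snd r'))" "length (ttl (raw (snd r'))) \<le> length (raw (snd r'))"
      by (rule length_thd_ttl)+
    ultimately show ?case unfolding r split_tuple_def by (auto simp: sz_str)
  qed (auto simp: sz_str)
  have "pt (\<lambda>s. (split_tuple ^^ sz s) ([], s))"
  proof (rule pt_iter)
    show "pt (\<lambda>y :: str \<times> str list \<times> str. split_tuple (snd y))"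
      unfolding split_tuple_def by (intro pt_intros pt_raw_null pt_thd pt_ttl)
    show "pl (\<lambda>n. 2 * (n * (2 * n + 1)) + 2 * n + 2)" by (intro pl_intros)
    fix s :: str and m assume m: "m \<le> sz s"
    define r where "r = (split_tuple ^^ m) ([], s)"
    note i = inv[OF r_def]
    have "sz (fst r) \<le> length (fst r) * (2 * sz s + 1)" by (rule sz_list_le) (use i in blast)
    also have "\<dots> \<le> sz s * (2 * sz s + 1)" by (rule mult_right_mono) (use i m in auto)
    finally have "sz r \<le> 2 * (sz s * (2 * sz s + 1)) + 2 * sz s + 2"
      using i by (cases r) (simp add: sz_simps sz_str)
    then show "sz ((split_tuple ^^ m) ([], s)) \<le> 2 * (sz s * (2 * sz s + 1)) + 2 * sz s + 2" by (simp only: r_def)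
  qed (intro pt_intros)+
  from pt_o[OF pt_fst[OF this] assms] show ?thesis by (simp add: untuple_def)
qed

definition dedup :: "'a list \<Rightarrow> 'a list" where
  "dedup xs = foldl (\<lambda>acc v. if v \<in> set acc then acc else acc @ [v]) [] xs"

lemma dedup: "set (dedup xs) = set xs" "distinct (dedup xs)"
  unfolding dedup_def by (induction xs rule: rev_induct) auto

lemma pt_dedup: fixes f :: "'a::enc \<Rightarrow> 'b::enc list" assumes "pt f" shows "pt (\<lambda>x. dedup (f x))"
proof -
  obtain P where P: "pl P" "\<And>x. sz (f x) \<le> P (sz x)" using pt_length[OF assms] by blast
  have b: "sz (foldl (\<lambda>acc v. if v \<in> set acc then acc else acc @ [v]) [] ys) \<le> sz ys" for ys :: "'b list"
    by (induction ys rule: rev_induct) (auto simp: sz_simps)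
  show ?thesis
    unfolding dedup_def
  proof (rule pt_foldl[OF _ pt_const assms P(1)])
    show "pt (\<lambda>y :: 'a \<times> 'b list \<times> 'b. if snd (snd y) \<in> set (fst (snd y)) then fst (snd y) else fst (snd y) @ [snd (snd y)])"
      by (intro pt_intros pt_mem)
    fix x ys zs assume "f x = ys @ zs"
    then have "sz ys \<le> sz (f x)" by (simp add: sz_simps)
    then show "sz (foldl (\<lambda>acc v. if v \<in> set acc then acc else acc @ [v]) [] ys) \<le> P (sz x)"
      using b[of ys] P(2)[of x] by linarith
  qed
qed

definition position :: "'a list \<Rightarrow> 'a \<Rightarrow> nat" where
  "position vs v = length (takeWhile (\<lambda>u. u \<noteq> v) vs)"

lemma position_less: "v \<in> set vs \<Longrightarrow> position vs v < length vs"
  by (induction vs) (auto simp: position_def)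

lemma nth_position: "v \<in> set vs \<Longrightarrow> vs ! position vs v = v"
  by (induction vs) (auto simp: position_def)

lemma position_inj: "inj_on (position vs) (set vs)"
  by (rule inj_on_inverseI[of _ "\<lambda>i. vs ! i"]) (rule nth_position)

text \<open>The index is produced in unary, as the length of a string, because that string becomes
  the new name of a variable.\<close>

lemma pt_position:
  fixes f :: "'a::enc \<Rightarrow> 'b::enc list"
  assumes "pt f" "pt g" shows "pt (\<lambda>x. Str (replicate (position (f x) (g x)) False))"
proof -
  define F where "F nm s v = (if fst s \<or> v = nm then (True, snd s) else (False, Str (False # raw (snd s))))" for nm v :: 'b and s
  have T: "foldl (F nm) (True, s) vs = (True, s)" for nm s vs
    by (induction vs) (auto simp: F_def)
  have R: "foldl (F nm) (False, Str (replicate k False)) vs = (nm \<in> set vs, Str (replicate (k + position vs nm) False))" for nm k vs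
  proof (induction vs arbitrary: k)
    case (Cons v vs)
    show ?case
    proof (cases "v = nm")
      case False
      then have "F nm (False, Str (replicate k False)) v = (False, Str (replicate (Suc k) False))" by (simp add: F_def)
      then show ?thesis using Cons.IH[of "Suc k"] False by (auto simp: position_def)
    qed (simp add: F_def T[unfolded F_def] position_def)
  qed (simp add: position_def)
  have "pt (\<lambda>y. foldl (F (snd y)) (False, Str []) (fst y))"
  proof (rule pt_foldl[where B = "\<lambda>n. 2 * n + 4"])
    show "pt (\<lambda>y :: ('b list \<times> 'b) \<times> (bool \<times> str) \<times> 'b. F (snd (fst y)) (fst (snd y)) (snd (snd y)))"
      unfolding F_def by (intro pt_intros pt_eq pt_raw_Cons)
    show "pl (\<lambda>n. 2 * n + 4)" by (intro pl_intros)
    fix x :: "'b list \<times> 'b" and ys zs assume e: "fst x = ys @ zs"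
    have "position ys (snd x) \<le> length ys" by (simp add: position_def length_takeWhile_le)
    also have "\<dots> \<le> sz (fst x)" using length_le_sz[of "fst x"] e by simp
    also have "\<dots> \<le> sz x" by (cases x) (simp add: sz_simps)
    finally show "sz (foldl (F (snd x)) (False, Str []) ys) \<le> 2 * sz x + 4"
      using R[of "snd x" 0 ys] by (simp add: sz_simps)
  qed (intro pt_intros)+
  from pt_o[OF pt_snd[OF this] pt_pair[OF assms]] show ?thesis
    using R[of _ 0] by simp
qed

lemma pt_drop:
  assumes f: "pt f" and g: "pt g" shows "pt (\<lambda>x. Str (drop (length (raw (f x))) (raw (g x))))"
proof -
  have it: "((\<lambda>s. Str (tl (raw s))) ^^ m) w = Str (drop m (raw w))" for m w
    by (induction m) (simp_all add: drop_Suc tl_drop)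
  obtain P where P: "pl P" "\<And>x. sz (g x) \<le> P (sz x)" using pt_length[OF g] by blast
  have "pt (\<lambda>x. ((\<lambda>s. Str (tl (raw s))) ^^ sz (f x)) (g x))"
  proof (rule pt_iter[OF _ g f P(1)])
    show "sz (((\<lambda>s. Str (tl (raw s))) ^^ m) (g x)) \<le> P (sz x)" for m x
      using P(2)[of x] by (simp add: it sz_str)
  qed (intro pt_raw_tl pt_intros)
  then show ?thesis by (simp add: it sz_str)
qed

text \<open>A literal is a sign followed by the name of a variable. An assignment is a string that gives the
  value of the variables whose name has length \<open>i\<close> at index \<open>i\<close>; so satisfiability in this sense agrees
  with the usual one only for formulas whose variables have names of different lengths.\<close>

definition satisfies :: "str \<Rightarrow> str list list \<Rightarrow> bool" where
  "satisfies W F \<longleftrightarrow> (\<forall>C \<in> set F. \<exists>l \<in> set C. tt (drop (length (tl (raw l))) (raw W)) = tt (raw l))"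

lemma pt_satisfies: assumes "pt f" "pt g" shows "pt (\<lambda>x. satisfies (f x) (g x))"
proof (rule pt_app2[OF _ assms])
  have "pt (\<lambda>y :: str \<times> str list list. \<forall>C \<in> set (snd y). \<exists>l \<in> set C.
      tt (raw (Str (drop (length (raw (Str (tl (raw l))))) (raw (fst y))))) = tt (raw l))"
    by (intro pt_intros pt_iff pt_tt pt_drop pt_raw_tl)
  then show "pt (\<lambda>y. satisfies (fst y) (snd y))" by (simp add: satisfies_def)
qed

text \<open>Decoding is total, so this is a set of arbitrary strings. A witness as long as the input
  is enough for encoded formulas, because every name in a formula is shorter than its code.\<close>

definition sat_set :: "bool list set" where
  "sat_set = {x. \<exists>w. length w \<le> length x \<and> satisfies (Str w) (map untuple (untuple (Str x)))}"

lemma sat_set_iff: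
  "enc F \<in> sat_set \<longleftrightarrow> (\<exists>W. \<forall>C \<in> set F. \<exists>l \<in> set C. W (length (tl (raw l))) = tt (raw l))" (is "?L \<longleftrightarrow> ?R")
proof -
  have F: "map untuple (untuple (Str (enc F))) = F"
  proof -
    have "enc F = enc (map (\<lambda>C. Str (enc C)) F)" by (induction F) (simp_all add: enc_simps)
    then show ?thesis by (simp add: o_def)
  qed
  have len: "length (tl (raw l)) < sz F" if "C \<in> set F" "l \<in> set C" for C l
  proof -
    have "sz C < sz F" using that(1) by (induction F) (auto simp: sz_simps)
    moreover have "sz l \<le> sz C" using that(2) by (rule sz_mem)
    ultimately show ?thesis by (simp add: sz_str)
  qed
  show ?thesis
  proof
    assume ?L
    then obtain w where "satisfies (Str w) F" unfolding sat_set_def F mem_Collect_eq by blast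
    then show ?R unfolding satisfies_def str.sel by (intro exI[of _ "\<lambda>k. tt (drop k w)"])
  next
    assume ?R
    then obtain W where W: "\<forall>C \<in> set F. \<exists>l \<in> set C. W (length (tl (raw l))) = tt (raw l)" ..
    define w where "w = map W [0..<sz F]"
    have "tt (drop k w) = W k" if "k < sz F" for k
      using that by (simp add: w_def tt_def hd_drop_conv_nth)
    then have "satisfies (Str w) F" unfolding satisfies_def str.sel using W len by metis
    then show ?L unfolding sat_set_def F mem_Collect_eq by (intro exI[of _ w]) (simp add: w_def)
  qed
qed

lemma poly_time_pt:
  assumes "pt (\<lambda>s. F s)" shows "poly_time (\<lambda>x. enc (F (Str x)))"
  using pc_reindex[OF assms[unfolded pt_def], of Str] by (simp add: poly_time_iff enc_simps)

lemma sat_set_NP: "sat_set \<in> class_NP"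
proof -
  \<comment> \<open>The second conjunct says that the witness is no longer than the input;
    \<open>poly_bound 1\<close> alone would admit one more bit.\<close>
  define Q where "Q s \<longleftrightarrow> satisfies (Str (thd (ttl (raw s)))) (map untuple (untuple (Str (thd (raw s)))))
    \<and> Str (drop (length (raw (Str (thd (raw s))))) (raw (Str (thd (ttl (raw s)))))) = Str []" for s
  define R where "R = {z. Q (Str z)}"
  have "pt (\<lambda>s. Q s)" unfolding Q_def
    by (intro pt_conj pt_satisfies pt_map pt_untuple pt_thd pt_thd[OF pt_ttl[OF pt_id], unfolded str.sel] pt_eq pt_drop
        pt_snd pt_id pt_const)
  from poly_time_pt[OF this] have "R \<in> class_P" by (simp add: class_P_def R_def enc_simps)
  moreover have "x \<in> sat_set \<longleftrightarrow> (\<exists>w. length w \<le> poly_bound 1 (length x) \<and> tuple [x, w] \<in> R)" for x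
  proof -
    have z: "tuple [x, w] \<in> R \<longleftrightarrow> satisfies (Str w) (map untuple (untuple (Str x))) \<and> length w \<le> length x" for w
      by (simp add: R_def Q_def)
    have pb: "length w \<le> length x \<Longrightarrow> length w \<le> poly_bound 1 (length x)" for w :: "bool list"
      by (simp add: poly_bound_def)
    show ?thesis unfolding sat_set_def mem_Collect_eq z using pb by blast
  qed
  ultimately show ?thesis unfolding class_NP_def by blast
qed

definition var_names :: "str list list \<Rightarrow> str list" where
  "var_names F = dedup (concat (map (map (\<lambda>l. Str (tl (raw l)))) F))"

text \<open>The new names are unary indices, which have different lengths as
  \<open>satisfies\<close> requires. Repeated clauses are merged after the renaming, so that their
  number is bounded in terms of the variables.\<close>

definition rename_vars :: "str list list \<Rightarrow> str list list" where
  "rename_vars F = dedup (map (map (\<lambda>l. Str (tt (raw l) # replicate (position (var_names F) (Str (tl (raw l)))) False))) F)"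

lemma pt_rename_vars: "pt rename_vars"
proof -
  have v: "pt f \<Longrightarrow> pt (\<lambda>x. var_names (f x))" for f :: "'a::enc \<Rightarrow> str list list"
    unfolding var_names_def by (intro pt_dedup pt_intros pt_raw_tl)
  have "pt (\<lambda>F. dedup (map (map (\<lambda>l. Str (tt (raw l) # raw (Str (replicate (position (var_names F) (Str (tl (raw l)))) False))))) F))"
    by (intro pt_dedup pt_intros pt_raw_Cons pt_tt pt_position v pt_raw_tl)
  then show ?thesis by (simp add: rename_vars_def[abs_def])
qed

definition str_cnf :: "cnf \<Rightarrow> str list list" where
  "str_cnf F = map (map (\<lambda>(v, s). Str (s # bin v))) F"

lemma enc_str_cnf: "enc (str_cnf F) = enc_cnf F"
  by (simp add: str_cnf_def enc_cnf_def enc_list_def enc_str_def o_def case_prod_unfold)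

lemma set_var_names: "set (var_names (str_cnf F)) = (\<lambda>v. Str (bin v)) ` fst ` \<Union> (set ` set F)"
  by (force simp: var_names_def dedup str_cnf_def)

lemma length_var_names: "length (var_names (str_cnf F)) = num_vars F"
proof -
  have "length (var_names (str_cnf F)) = card (set (var_names (str_cnf F)))"
    by (rule distinct_card[symmetric]) (simp add: var_names_def dedup)
  also have "\<dots> = num_vars F"
    unfolding set_var_names num_vars_def by (intro card_image inj_onI) (auto dest: bin_inj)
  finally show ?thesis .
qed

lemma satisfiable_iff_sat_set: "satisfiable F \<longleftrightarrow> enc (rename_vars (str_cnf F)) \<in> sat_set"
proof -
  define pos where "pos v = position (var_names (str_cnf F)) (Str (bin v))" for v
  define Vs where "Vs = fst ` \<Union> (set ` set F)"
  have inj: "inj_on pos Vs"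
  proof (rule inj_onI)
    fix u v assume "u \<in> Vs" "v \<in> Vs" "pos u = pos v"
    have mem: "Str (bin x) \<in> set (var_names (str_cnf F))" if "x \<in> Vs" for x
      unfolding set_var_names using that unfolding Vs_def by (rule imageI)
    have "Str (bin u) = Str (bin v)"
      using \<open>pos u = pos v\<close> unfolding pos_def
      by (rule inj_onD[OF position_inj]) (rule mem, fact)+
    then show "u = v" by (auto dest: bin_inj)
  qed
  have r: "set (rename_vars (str_cnf F)) = set (map (map (\<lambda>(v, s). Str (s # replicate (pos v) False))) F)"
    by (simp add: rename_vars_def dedup str_cnf_def pos_def[abs_def] image_image o_def case_prod_unfold tt_def)
  have "enc (rename_vars (str_cnf F)) \<in> sat_set \<longleftrightarrow> (\<exists>W. \<forall>C \<in> set F. \<exists>(v, s) \<in> set C. W (pos v) = s)"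
    unfolding sat_set_iff r by (simp add: case_prod_unfold tt_def)
  also have "\<dots> \<longleftrightarrow> satisfiable F"
  proof
    assume "\<exists>W. \<forall>C \<in> set F. \<exists>(v, s) \<in> set C. W (pos v) = s"
    then obtain W where "\<forall>C \<in> set F. \<exists>(v, s) \<in> set C. W (pos v) = s" ..
    then show "satisfiable F" unfolding satisfiable_def by (intro exI[of _ "\<lambda>v. W (pos v)"])
  next
    assume "satisfiable F"
    then obtain \<sigma> where \<sigma>: "\<forall>C \<in> set F. \<exists>(v, s) \<in> set C. \<sigma> v = s" unfolding satisfiable_def ..
    have i: "inv_into Vs pos (pos v) = v" if "v \<in> Vs" for v using inv_into_f_f[OF inj that] .
    have "\<exists>(v, s) \<in> set C. \<sigma> (inv_into Vs pos (pos v)) = s" if C: "C \<in> set F" for C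
    proof -
      have "\<exists>(v, s) \<in> set C. \<sigma> v = s" using \<sigma> C by (rule bspec)
      then obtain v s where vs: "(v, s) \<in> set C" "\<sigma> v = s" by auto
      have "v \<in> Vs" unfolding Vs_def by (rule rev_image_eqI[of "(v, s)"]) (use vs(1) C in auto)
      from i[OF this] vs(2) have "\<sigma> (inv_into Vs pos (pos v)) = s" by simp
      then show ?thesis by (intro bexI[OF _ vs(1)]) simp
    qed
    then show "\<exists>W. \<forall>C \<in> set F. \<exists>(v, s) \<in> set C. W (pos v) = s"
      by (intro exI[of _ "\<lambda>k. \<sigma> (inv_into Vs pos k)"]) blast
  qed
  finally show ?thesis ..
qed

text \<open>With \<open>n\<close> variables there are at most \<open>2 * n\<close> literals, each of
  at most \<open>n\<close> bits besides the sign, hence polynomially many distinct clauses of length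
  up to three. ETH counts variables, so a bound in terms of the input length would not do.\<close>

lemma rename_vars_size: "\<exists>P. pl P \<and> (\<forall>F. is_3cnf F \<longrightarrow> sz (rename_vars (str_cnf F)) \<le> P (num_vars F))"
proof -
  define Q where "Q n = (\<Sum>i\<le>3. (2 * n) ^ i) * (2 * (3 * (2 * (n + 1) + 1)) + 1)" for n :: nat
  have "pl Q" unfolding Q_def by (simp add: numeral_3_eq_3) (intro pl_intros pl_Suc)
  moreover have "sz (rename_vars (str_cnf F)) \<le> Q (num_vars F)" if F: "is_3cnf F" for F
  proof -
    define n where "n = num_vars F"
    define Ls where "Ls = (\<lambda>(s, k). Str (s # replicate k False)) ` (UNIV \<times> {..<n})"
    have fin: "finite Ls" by (simp add: Ls_def)
    have "card Ls \<le> card ((UNIV :: bool set) \<times> {..<n})" unfolding Ls_def by (rule card_image_le) simp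
    then have cL: "card Ls \<le> 2 * n" by simp
    have C: "set C \<subseteq> Ls \<and> length C \<le> 3" if Cin: "C \<in> set (rename_vars (str_cnf F))" for C
    proof -
      define rn where "rn l = Str (tt (raw l) # replicate (position (var_names (str_cnf F)) (Str (tl (raw l)))) False)" for l
      have "rename_vars (str_cnf F) = dedup (map (map rn) (str_cnf F))" by (simp only: rename_vars_def rn_def[abs_def])
      then obtain D where D: "D \<in> set (str_cnf F)" "C = map rn D" using Cin by (auto simp: dedup)
      then obtain C' where C': "C' \<in> set F" and CC: "C = map rn (map (\<lambda>(v, s). Str (s # bin v)) C')"
        by (auto simp: str_cnf_def)
      have "length C \<le> 3" using F C' by (auto simp: CC is_3cnf_def)
      moreover have "x \<in> Ls" if x: "x \<in> set C" for x
      proof -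
        obtain v s where vs: "(v, s) \<in> set C'" and xe: "x = Str (s # replicate (position (var_names (str_cnf F)) (Str (bin v))) False)"
          using x by (auto simp: CC rn_def tt_def)
        have "Str (bin v) \<in> set (var_names (str_cnf F))" unfolding set_var_names
          by (intro imageI, rule rev_image_eqI[of "(v, s)"]) (use vs(1) C' in auto)
        from position_less[OF this] have "position (var_names (str_cnf F)) (Str (bin v)) < n"
          by (simp add: n_def length_var_names)
        then show ?thesis unfolding xe Ls_def by force
      qed
      ultimately show ?thesis by blast
    qed
    have "length (rename_vars (str_cnf F)) = card (set (rename_vars (str_cnf F)))"
      by (rule distinct_card[symmetric]) (simp add: rename_vars_def dedup)
    also have "\<dots> \<le> card {C. set C \<subseteq> Ls \<and> length C \<le> 3}"
      by (rule card_mono) (use C finite_lists_length_le[OF fin] in auto)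
    also have "\<dots> = (\<Sum>i\<le>3. card Ls ^ i)" by (rule card_lists_length_le[OF fin])
    also have "\<dots> \<le> (\<Sum>i\<le>3. (2 * n) ^ i)" by (intro sum_mono power_mono cL) simp
    finally have len: "length (rename_vars (str_cnf F)) \<le> (\<Sum>i\<le>3. (2 * n) ^ i)" .
    have "sz (rename_vars (str_cnf F)) \<le> length (rename_vars (str_cnf F)) * (2 * (3 * (2 * (n + 1) + 1)) + 1)"
    proof (rule sz_list_le)
      fix C assume "C \<in> set (rename_vars (str_cnf F))"
      note c = C[OF this]
      have "sz C \<le> length C * (2 * (n + 1) + 1)"
        by (rule sz_list_le) (use c in \<open>auto simp: Ls_def sz_simps\<close>)
      also have "\<dots> \<le> 3 * (2 * (n + 1) + 1)" using c by (intro mult_right_mono) auto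
      finally show "sz C \<le> 3 * (2 * (n + 1) + 1)" .
    qed
    also have "\<dots> \<le> Q n" unfolding Q_def by (rule mult_right_mono[OF len]) simp
    finally show ?thesis by (simp add: n_def)
  qed
  ultimately show ?thesis by blast
qed

section \<open>Computing the hard matrix in polynomial time\<close>

definition nat_of_str :: "str \<Rightarrow> nat" where
  "nat_of_str s = msb (rev (raw s))"

lemma nat_of_str_bin [simp]: "nat_of_str (Str (bin n)) = n"
  by (simp add: nat_of_str_def msb_rev_bin)

lemma pt_nat_of_str: assumes "pt f" shows "pt (\<lambda>x. nat_of_str (f x))"
proof -
  define F where "F p = (tt (raw (snd p)) # fst p, Str (tl (raw (snd p))))" for p :: "bool list \<times> str"
  define G where "G p = (if raw (snd p) = [] then p else F p)" for p
  have it: "(G ^^ m) (acc, Str w) = (rev (take m w) @ acc, Str (drop m w))" for m acc w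
  proof (induction m)
    case (Suc m)
    show ?case
    proof (cases "m < length w")
      case True
      then have "drop m w = w ! m # drop (Suc m) w" "take (Suc m) w = take m w @ [w ! m]"
        by (simp_all add: Cons_nth_drop_Suc take_Suc_conv_app_nth)
      with Suc show ?thesis by (simp add: G_def F_def tt_def)
    qed (use Suc in \<open>simp add: G_def\<close>)
  qed simp
  have "pt (\<lambda>s. (G ^^ sz s) ([], s))"
  proof (rule pt_iter[where B = "\<lambda>n. 2 * (3 * n) + 2 * n + 2"])
    show "pt (\<lambda>y :: str \<times> bool list \<times> str. G (snd y))"
      unfolding G_def F_def by (intro pt_intros pt_raw_null pt_raw_tl pt_tt)
    show "pl (\<lambda>n. 2 * (3 * n) + 2 * n + 2)" by (intro pl_intros)
    show "sz ((G ^^ m) ([], s)) \<le> 2 * (3 * sz s) + 2 * sz s + 2" for m s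
      using it[of m "[]" "raw s"] by (simp add: sz_simps sz_bools sz_str)
  qed (intro pt_intros)+
  from pt_o[OF pt_msb[OF pt_fst[OF this]] assms]
  have "pt (\<lambda>x. msb (fst ((G ^^ sz (f x)) ([], f x))))" .
  moreover have "fst ((G ^^ sz s) ([], s)) = rev (raw s)" for s
    using it[of "sz s" "[]" "raw s"] by (simp add: sz_str)
  ultimately show ?thesis by (simp only: nat_of_str_def)
qed

definition chunks :: "nat \<Rightarrow> 'a list \<Rightarrow> 'a list list" where
  "chunks n xs = fst (foldl (\<lambda>s x. if Suc (length (snd s)) = n then (fst s @ [snd s @ [x]], []) else (fst s, snd s @ [x])) ([], []) xs)"

lemma chunks_concat:
  assumes "\<And>r. r \<in> set rs \<Longrightarrow> length r = n" "0 < n"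
  shows "chunks n (concat rs) = rs"
proof -
  define F where "F s x = (if Suc (length (snd s)) = n then (fst s @ [snd s @ [x]], []) else (fst s, snd s @ [x]))" for s :: "'a list list \<times> 'a list" and x
  have p: "foldl F (acc, cur) ys = (acc, cur @ ys)" if "length cur + length ys < n" for acc cur ys
    using that by (induction ys arbitrary: cur) (auto simp: F_def)
  have rw: "foldl F (acc, []) r = (acc @ [r], [])" if ln: "length r = n" for acc r
  proof -
    obtain ys x where r: "r = ys @ [x]" using ln assms(2) by (cases r rule: rev_cases) auto
    then show ?thesis using p[of "[]" ys acc] ln by (auto simp: F_def)
  qed
  have "foldl F (acc, []) (concat rs) = (acc @ rs, [])" for acc
    using assms(1) by (induction rs arbitrary: acc) (simp_all add: rw)
  from this[of "[]"] show ?thesis by (simp add: chunks_def F_def[abs_def])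
qed

lemma pt_Suc: assumes "pt f" shows "pt (\<lambda>x. Suc (f x))"
  using pt_add[OF assms pt_const[of 1]] by simp

lemma pt_chunks:
  fixes g :: "'a::enc \<Rightarrow> 'b::enc list"
  assumes f: "pt f" and g: "pt g" shows "pt (\<lambda>x. chunks (f x) (g x))"
proof -
  define F where "F n s x = (if Suc (length (snd s)) = n then (fst s @ [snd s @ [x]], []) else (fst s, snd s @ [x]))" for n and s :: "'b list list \<times> 'b list" and x
  have b: "sz (fst (foldl (F n) ([], []) ys)) + 2 * sz (snd (foldl (F n) ([], []) ys)) \<le> 3 * sz ys" for n ys
    by (induction ys rule: rev_induct) (auto simp: F_def sz_simps)
  have "pt (\<lambda>y. foldl (F (fst y)) ([], []) (snd y))"
  proof (rule pt_foldl[where B = "\<lambda>n. 6 * n + 2"])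
    show "pt (\<lambda>y :: (nat \<times> 'b list) \<times> ('b list list \<times> 'b list) \<times> 'b. F (fst (fst y)) (fst (snd y)) (snd (snd y)))"
      unfolding F_def by (intro pt_intros pt_eq pt_Suc)
    show "pl (\<lambda>n. 6 * n + 2)" by (intro pl_intros)
    fix y :: "nat \<times> 'b list" and ys zs assume e: "snd y = ys @ zs"
    then have "sz ys \<le> sz y" by (cases y) (simp add: sz_simps)
    then show "sz (foldl (F (fst y)) ([], []) ys) \<le> 6 * sz y + 2"
      using b[of "fst y" ys] by (cases "foldl (F (fst y)) ([], []) ys") (simp add: sz_simps)
  qed (intro pt_intros)+
  from pt_fst[OF pt_o[OF this pt_pair[OF f g]]] show ?thesis by (simp add: chunks_def F_def[abs_def])
qed

lemma sz_nat_list: "(\<And>a. a \<in> set xs \<Longrightarrow> a \<le> m) \<Longrightarrow> sz (xs :: nat list) \<le> length xs * (2 * m + 1)"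
  by (rule sz_list_le) (meson order_trans sz_nat_self)

lemma pt_iota: fixes f :: "'a::enc \<Rightarrow> 'b::enc list" assumes "pt f" shows "pt (\<lambda>x. [0..<length (f x)])"
proof -
  obtain P where P: "pl P" "\<And>x. sz (f x) \<le> P (sz x)" using pt_length[OF assms] by blast
  have it: "foldl (\<lambda>acc _. acc @ [length acc]) [] xs = [0..<length xs]" for xs :: "'b list"
    by (induction xs rule: rev_induct) auto
  have "pt (\<lambda>x. foldl (\<lambda>acc _. acc @ [length acc]) [] (f x))"
  proof (rule pt_foldl[where B = "\<lambda>n. P n * (2 * P n + 1)"])
    show "pl (\<lambda>n. P n * (2 * P n + 1))" by (intro pl_intros P)
    fix x ys zs assume e: "f x = ys @ zs"
    have l: "length ys \<le> P (sz x)" using e P(2)[of x] length_le_sz[of "f x"] by simp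
    have "sz [0..<length ys] \<le> length [0..<length ys] * (2 * P (sz x) + 1)"
      by (rule sz_nat_list) (use l in auto)
    also have "\<dots> \<le> P (sz x) * (2 * P (sz x) + 1)" using l by (intro mult_right_mono) auto
    finally show "sz (foldl (\<lambda>acc _. acc @ [length acc]) [] ys) \<le> P (sz x) * (2 * P (sz x) + 1)" by (simp only: it)
  qed (intro pt_intros assms)+
  then show ?thesis by (simp only: it)
qed

text \<open>Integer matrices are kept as lists of rows, with an entry \<open>z\<close> represented by a pair of natural
  numbers of difference \<open>z\<close>. The second factor of the product is read by rows instead of columns, which
  is correct because it is symmetric.\<close>

definition lap_entry :: "nat \<Rightarrow> bool list \<Rightarrow> nat \<times> nat \<Rightarrow> (nat \<times> nat) list \<Rightarrow> nat \<times> nat" where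
  "lap_entry r as m rw =
    (r * fst m + sum_list (map (\<lambda>y. if fst y then snd (snd y) else 0) (zip as rw)),
     r * snd m + sum_list (map (\<lambda>y. if fst y then fst (snd y) else 0) (zip as rw)))"

definition lap_step :: "nat \<times> bool list list \<Rightarrow> (nat \<times> nat) list list \<Rightarrow> (nat \<times> nat) list list" where
  "lap_step x M = map (\<lambda>y. map (\<lambda>z. lap_entry (fst x) (fst y) (fst z) (snd z)) (zip (snd y) M)) (zip (snd x) M)"

definition id_rows :: "'a list \<Rightarrow> (nat \<times> nat) list list" where
  "id_rows rs = map (\<lambda>u. map (\<lambda>v. if u = v then (1, 0) else (0, 0)) [0..<length rs]) [0..<length rs]"

text \<open>A new number is at most \<open>r + l\<close> times the old bound \<open>2 ^ k\<close>,
  where \<open>r\<close> is \<open>fst x\<close>; so a step adds at most \<open>c\<close> bits, and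
  sizes stay polynomial over polynomially many steps.\<close>

lemma lap_step_bound:
  assumes "length M \<le> l" "length (snd x) \<le> l" "\<And>rw. rw \<in> set M \<Longrightarrow> length rw \<le> l"
    "\<And>rw m. rw \<in> set M \<Longrightarrow> m \<in> set rw \<Longrightarrow> fst m < 2 ^ k \<and> snd m < 2 ^ k" "fst x + l < 2 ^ c"
  shows "length (lap_step x M) \<le> l" "\<And>rw. rw \<in> set (lap_step x M) \<Longrightarrow> length rw \<le> l"
    "\<And>rw m. rw \<in> set (lap_step x M) \<Longrightarrow> m \<in> set rw \<Longrightarrow> fst m < 2 ^ (k + c) \<and> snd m < 2 ^ (k + c)"
proof -
  have s: "sum_list (map f (zip as rw)) \<le> l * 2 ^ k"
    if "rw \<in> set M" "\<And>y. y \<in> set (zip as rw) \<Longrightarrow> f y \<le> 2 ^ k" for f :: "bool \<times> nat \<times> nat \<Rightarrow> nat" and as rw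
  proof -
    have "sum_list (map f (zip as rw)) \<le> sum_list (map (\<lambda>_. 2 ^ k) (zip as rw))"
      by (rule sum_list_mono) (use that in auto)
    also have "\<dots> = length (zip as rw) * 2 ^ k" by (simp add: sum_list_triv)
    also have "\<dots> \<le> l * 2 ^ k" using assms(3)[OF that(1)] by (intro mult_right_mono) auto
    finally show ?thesis .
  qed
  show "length (lap_step x M) \<le> l" "\<And>rw. rw \<in> set (lap_step x M) \<Longrightarrow> length rw \<le> l"
    using assms(1) by (auto simp: lap_step_def)
  fix rw m assume "rw \<in> set (lap_step x M)" "m \<in> set rw"
  then obtain as own m' rw' where y: "own \<in> set M" "m' \<in> set own" "rw' \<in> set M" and m: "m = lap_entry (fst x) as m' rw'"
    by (auto simp: lap_step_def dest!: set_zip_rightD set_zip_leftD in_set_zipE elim!: in_set_zipE)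
  have b: "fst x * n + sum_list (map f (zip as rw')) < 2 ^ (k + c)"
    if "n < 2 ^ k" "\<And>y. y \<in> set (zip as rw') \<Longrightarrow> f y \<le> 2 ^ k" for n and f :: "bool \<times> nat \<times> nat \<Rightarrow> nat"
  proof -
    have "fst x * n + sum_list (map f (zip as rw')) \<le> fst x * 2 ^ k + l * 2 ^ k"
      using s[OF y(3) that(2)] that(1) by (intro add_mono mult_left_mono) auto
    also have "\<dots> = (fst x + l) * 2 ^ k" by (simp add: distrib_right)
    also have "\<dots> < 2 ^ c * 2 ^ k" using assms(5) by (intro mult_strict_right_mono) auto
    finally show ?thesis by (simp add: power_add mult.commute)
  qed
  have e: "fst (snd y) \<le> 2 ^ k \<and> snd (snd y) \<le> 2 ^ k" if "y \<in> set (zip as rw')" for y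
    using assms(4)[OF y(3), of "snd y"] that by (cases y) (auto dest: set_zip_rightD)
  show "fst m < 2 ^ (k + c) \<and> snd m < 2 ^ (k + c)"
    unfolding m lap_entry_def fst_conv snd_conv
    by (intro conjI b) (use assms(4)[OF y(1,2)] e in auto)
qed

lemma sz_rows:
  assumes "length M \<le> l" "\<And>rw. rw \<in> set M \<Longrightarrow> length rw \<le> l"
    "\<And>rw m. rw \<in> set M \<Longrightarrow> m \<in> set rw \<Longrightarrow> fst m < 2 ^ k \<and> snd m < 2 ^ k"
  shows "sz (M :: (nat \<times> nat) list list) \<le> l * (2 * (l * (2 * (4 * k + 2) + 1)) + 1)"
proof -
  have "sz M \<le> length M * (2 * (l * (2 * (4 * k + 2) + 1)) + 1)"
  proof (rule sz_list_le)
    fix rw assume rw: "rw \<in> set M"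
    have "sz rw \<le> length rw * (2 * (4 * k + 2) + 1)"
    proof (rule sz_list_le)
      fix m assume "m \<in> set rw"
      with assms(3)[OF rw this] have "sz (fst m) \<le> k" "sz (snd m) \<le> k" by (auto intro: sz_nat_le)
      then show "sz m \<le> 4 * k + 2" by (cases m) (simp add: sz_simps)
    qed
    also have "\<dots> \<le> l * (2 * (4 * k + 2) + 1)" using assms(2)[OF rw] by (intro mult_right_mono) auto
    finally show "sz rw \<le> l * (2 * (4 * k + 2) + 1)" .
  qed
  also have "\<dots> \<le> l * (2 * (l * (2 * (4 * k + 2) + 1)) + 1)" using assms(1) by (intro mult_right_mono) auto
  finally show ?thesis .
qed

definition lap_rows :: "nat \<times> bool list list \<Rightarrow> nat \<Rightarrow> (nat \<times> nat) list list" where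
  "lap_rows x m = (lap_step x ^^ m) (id_rows (snd x))"

lemma pt_lap_rows:
  fixes us :: "'a::enc \<Rightarrow> unit list"
  assumes "pt r" "pt rs" and us: "pt us" shows "pt (\<lambda>x. lap_rows (r x, rs x) (length (us x)))"
proof -
  have "pt (\<lambda>y. (lap_step (fst y) ^^ length (snd y :: unit list)) (id_rows (snd (fst y))))"
  proof (rule pt_repeat[where B = "\<lambda>n. n * (2 * (n * (2 * (4 * (1 + n * (2 * n + 1)) + 2) + 1)) + 1)"])
    show "pt (\<lambda>y :: ((nat \<times> bool list list) \<times> unit list) \<times> (nat \<times> nat) list list. lap_step (fst (fst y)) (snd y))"
      unfolding lap_step_def lap_entry_def by (intro pt_intros)
    show "pt (\<lambda>y :: (nat \<times> bool list list) \<times> unit list. id_rows (snd (fst y)))"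
      unfolding id_rows_def by (intro pt_intros pt_iota pt_eq)
    show "pl (\<lambda>n. n * (2 * (n * (2 * (4 * (1 + n * (2 * n + 1)) + 2) + 1)) + 1))" by (intro pl_intros)
    fix y :: "(nat \<times> bool list list) \<times> unit list" and m assume m: "m \<le> length (snd y)"
    define l where "l = sz y"
    have l: "length (snd (fst y)) \<le> l" "length (snd y) \<le> l"
      using length_le_sz[of "snd (fst y)"] length_le_sz[of "snd y"] by (cases y; cases "fst y"; simp add: l_def sz_simps)+
    have c: "fst (fst y) + l < 2 ^ (2 * l + 1)"
    proof -
      have "fst (fst y) < 2 ^ sz (fst (fst y))" by (simp add: sz_nat less_power_bin)
      also have "\<dots> \<le> 2 ^ (2 * l)" by (rule power_increasing) (cases y; cases "fst y"; simp add: l_def sz_simps)+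
      finally have "fst (fst y) < 2 ^ (2 * l)" .
      moreover have "l < 2 ^ (2 * l)" using less_exp[of l] power_increasing[of l "2 * l" "2 :: nat"] by linarith
      ultimately show ?thesis by simp
    qed
    \<comment> \<open>One bit for the entries 0 and 1 of the identity, then \<open>2 * l + 1\<close>
      more bits per step.\<close>
    define k where "k m = 1 + m * (2 * l + 1)" for m
    have "length ((lap_step (fst y) ^^ m) (id_rows (snd (fst y)))) \<le> l \<and>
      (\<forall>rw \<in> set ((lap_step (fst y) ^^ m) (id_rows (snd (fst y)))). length rw \<le> l \<and> (\<forall>e \<in> set rw. fst e < 2 ^ k m \<and> snd e < 2 ^ k m))" for m
    proof (induction m)
      case 0
      then show ?case using l by (auto simp: id_rows_def k_def)
    next
      case (Suc m)
      define M where "M = (lap_step (fst y) ^^ m) (id_rows (snd (fst y)))"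
      have kS: "k (Suc m) = k m + (2 * l + 1)" by (simp add: k_def)
      from Suc.IH[folded M_def] have Mb: "length M \<le> l" "\<And>rw. rw \<in> set M \<Longrightarrow> length rw \<le> l"
        "\<And>rw e. rw \<in> set M \<Longrightarrow> e \<in> set rw \<Longrightarrow> fst e < 2 ^ k m \<and> snd e < 2 ^ k m" by blast+
      have "length (lap_step (fst y) M) \<le> l"
        by (rule lap_step_bound(1)[of M l _ "k m" "2 * l + 1"]) (use Mb l(1) c in simp_all)
      moreover have "length rw \<le> l" if "rw \<in> set (lap_step (fst y) M)" for rw
        by (rule lap_step_bound(2)[of M l _ "k m" "2 * l + 1", OF _ _ _ _ _ that]) (use Mb l(1) c in simp_all)
      moreover have "fst e < 2 ^ (k m + (2 * l + 1)) \<and> snd e < 2 ^ (k m + (2 * l + 1))"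
        if "rw \<in> set (lap_step (fst y) M)" "e \<in> set rw" for rw e
        by (rule lap_step_bound(3)[of M l _ "k m" "2 * l + 1", OF _ _ _ _ _ that]) (use Mb l(1) c in simp_all)
      ultimately      show ?case unfolding funpow.simps o_apply M_def[symmetric] kS by blast
    qed
    note i = this[of m]
    have "sz ((lap_step (fst y) ^^ m) (id_rows (snd (fst y)))) \<le> l * (2 * (l * (2 * (4 * k m + 2) + 1)) + 1)"
      by (rule sz_rows) (use i in blast)+
    also have "\<dots> \<le> l * (2 * (l * (2 * (4 * (1 + l * (2 * l + 1)) + 2) + 1)) + 1)"
      using m l unfolding k_def by (intro mult_left_mono add_mono mult_right_mono) auto
    finally show "sz ((lap_step (fst y) ^^ m) (id_rows (snd (fst y)))) \<le>
      sz y * (2 * (sz y * (2 * (4 * (1 + sz y * (2 * sz y + 1)) + 2) + 1)) + 1)" by (simp only: l_def)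
  qed (intro pt_intros)+
  from pt_o[OF this pt_pair[OF pt_pair[OF assms(1,2)] us]] show ?thesis by (simp add: lap_rows_def)
qed

lemma lap_rows_correct:
  assumes sym: "\<And>m u v. u < N \<Longrightarrow> v < N \<Longrightarrow> lap_pow E N r m u v = lap_pow E N r m v u"
    and rs: "rs = map (\<lambda>u. map (E u) [0..<N]) [0..<N]"
  shows "length (lap_rows (r, rs) m) = N \<and> (\<forall>u<N. length (lap_rows (r, rs) m ! u) = N \<and>
    (\<forall>v<N. int (fst (lap_rows (r, rs) m ! u ! v)) - int (snd (lap_rows (r, rs) m ! u ! v)) = lap_pow E N r m u v))"
proof (induction m)
  case 0
  then show ?case by (simp add: lap_rows_def id_rows_def rs)
next
  case (Suc m)
  define M where "M = lap_rows (r, rs) m"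
  have S: "lap_rows (r, rs) (Suc m) = lap_step (r, rs) M" by (simp add: lap_rows_def M_def)
  have M: "length M = N" "\<And>u. u < N \<Longrightarrow> length (M ! u) = N"
    "\<And>u v. u < N \<Longrightarrow> v < N \<Longrightarrow> int (fst (M ! u ! v)) - int (snd (M ! u ! v)) = lap_pow E N r m u v"
    using Suc.IH by (auto simp: M_def)
  have len: "length (lap_step (r, rs) M) = N" by (simp add: lap_step_def rs M)
  have rw: "lap_step (r, rs) M ! u = map (\<lambda>z. lap_entry r (rs ! u) (fst z) (snd z)) (zip (M ! u) M)" if "u < N" for u
    using that by (simp add: lap_step_def rs M)
  have zs: "sum_list (map f (zip (rs ! u) (M ! v))) = (\<Sum>x<N. f (E u x, M ! v ! x))" if "u < N" "v < N" for u v and f :: "bool \<times> nat \<times> nat \<Rightarrow> nat"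
  proof -
    have "map f (zip (rs ! u) (M ! v)) = map (\<lambda>x. f (E u x, M ! v ! x)) [0..<N]"
      by (rule nth_equalityI) (use that M in \<open>auto simp: rs\<close>)
    then show ?thesis by (simp add: interv_sum_list_conv_sum_set_nat atLeast0LessThan)
  qed
  have "int (fst (lap_entry r (rs ! u) (M ! u ! v) (M ! v))) - int (snd (lap_entry r (rs ! u) (M ! u ! v) (M ! v))) = lap_pow E N r (Suc m) u v"
    if uv: "u < N" "v < N" for u v
  proof -
    have "(\<Sum>x<N. int (if E u x then snd (M ! v ! x) else 0)) - (\<Sum>x<N. int (if E u x then fst (M ! v ! x) else 0)) =
        (\<Sum>x<N. - (of_bool (E u x) * lap_pow E N r m x v))"
      unfolding sum_subtractf[symmetric]
    proof (intro sum.cong refl)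
      fix x assume "x \<in> {..<N}"
      then have "int (fst (M ! v ! x)) - int (snd (M ! v ! x)) = lap_pow E N r m x v" using M(3)[OF uv(2)] sym[OF uv(2)] by simp
      then show "int (if E u x then snd (M ! v ! x) else 0) - int (if E u x then fst (M ! v ! x) else 0) = - (of_bool (E u x) * lap_pow E N r m x v)"
        by simp
    qed
    then show ?thesis
      using M(3)[OF uv] unfolding lap_entry_def fst_conv snd_conv zs[OF uv]
      by (simp add: sum_negf algebra_simps flip: M(3)[OF uv])
  qed
  then show ?case unfolding S using len rw M by simp
qed

section \<open>Writing the instance of the approximation problem\<close>

definition quot :: "nat \<Rightarrow> nat \<Rightarrow> unit list \<Rightarrow> nat" where
  "quot pos neg us = (if pos < neg then neg - pos else pos - neg) div 2 ^ length us"

text \<open>The sign bit must be off when the quotient is 0, as \<open>enc_int\<close> has no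
  negative zero.\<close>

definition quot_str :: "nat \<Rightarrow> nat \<Rightarrow> unit list \<Rightarrow> str" where
  "quot_str pos neg us = Str ((pos < neg \<and> \<not> quot pos neg us = 0) # raw (Str (enc (quot pos neg us))))"

lemma pt_quot_str: "pt f \<Longrightarrow> pt g \<Longrightarrow> pt h \<Longrightarrow> pt (\<lambda>x. quot_str (f x) (g x) (h x))"
  unfolding quot_str_def quot_def
  by (intro pt_raw_Cons pt_conj pt_not pt_zero pt_enc pt_div_power2 pt_if pt_less pt_diff)

lemma quot_str: "quot_str pos neg us = Str (enc_int (trunc_shift (int pos - int neg) (length us)))"
proof -
  define z where "z = int pos - int neg"
  have q: "int (quot pos neg us) = \<bar>z\<bar> div 2 ^ length us"
    by (auto simp: quot_def z_def zdiv_int of_nat_diff)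
  have "trunc_shift z (length us) < 0 \<longleftrightarrow> z < 0 \<and> \<not> quot pos neg us = 0"
    unfolding trunc_shift_def q[symmetric] by (auto simp: mult_less_0_iff sgn_if)
  moreover have "nat \<bar>trunc_shift z (length us)\<bar> = quot pos neg us"
    unfolding trunc_shift_def q[symmetric] by (auto simp: abs_mult sgn_if quot_def z_def)
  ultimately show ?thesis by (simp add: quot_str_def enc_int_def enc_nat_def z_def)
qed

definition copies :: "nat \<Rightarrow> unit list \<Rightarrow> unit list" where
  "copies c us = concat (map (\<lambda>_. us) (replicate c ()))"

lemma length_copies: "length (copies c us) = c * length us"
  by (induction c) (simp_all add: copies_def)

lemma pt_copies: assumes "pt f" shows "pt (\<lambda>x. copies c (f x))"
  unfolding copies_def by (intro pt_concat pt_map pt_const pt_o[OF assms pt_fst[OF pt_id]])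

text \<open>The length is the number of binary digits of \<open>n\<close>, not \<open>n\<close>
  itself; this is the quantity \<open>\<nu>\<close> of \<open>hard_entry\<close>.\<close>

definition unary :: "nat \<Rightarrow> unit list" where
  "unary n = replicate (sz n) ()"

lemma pt_unary: "pt f \<Longrightarrow> pt (\<lambda>x. unary (f x))"
  unfolding unary_def by (rule pt_units)

definition prod_units :: "unit list \<Rightarrow> unit list \<Rightarrow> unit list" where
  "prod_units us vs = concat (map (\<lambda>_. vs) us)"

lemma length_prod_units: "length (prod_units us vs) = length us * length vs"
  by (induction us) (simp_all add: prod_units_def)

lemma pt_prod_units: assumes "pt f" "pt g" shows "pt (\<lambda>x. prod_units (f x) (g x))"
  unfolding prod_units_def by (intro pt_concat pt_map assms(1) pt_o[OF assms(2) pt_fst[OF pt_id]])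

definition degree_of :: "bool list list \<Rightarrow> nat" where
  "degree_of rs = length (filter (\<lambda>b. b) (hd rs))"

lemma pt_degree_of: "pt f \<Longrightarrow> pt (\<lambda>x. degree_of (f x))"
  unfolding degree_of_def by (intro pt_length_list pt_filter pt_hd pt_snd pt_id)

definition entry_str :: "unit list \<Rightarrow> unit list \<Rightarrow> unit list \<Rightarrow> bool \<Rightarrow> nat \<times> nat \<Rightarrow> str" where
  "entry_str us zs ys d m = quot_str (fst m * 2 ^ length us + (if d then 1 * 2 ^ length zs else 0)) (snd m * 2 ^ length us) ys"

lemma pt_entry_str:
  "pt us \<Longrightarrow> pt zs \<Longrightarrow> pt ys \<Longrightarrow> pt d \<Longrightarrow> pt m \<Longrightarrow> pt (\<lambda>x. entry_str (us x) (zs x) (ys x) (d x) (m x))"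
  unfolding entry_str_def
  by (intro pt_quot_str pt_add pt_if pt_mult_power2 pt_const pt_fst pt_snd)

text \<open>The three exponents of \<open>hard_entry\<close> in unary: for the power of the
  Laplacian, for the identity, and for the final division.\<close>

definition entry_shifts :: "nat \<Rightarrow> nat \<Rightarrow> bool list list \<Rightarrow> unit list \<times> unit list \<times> unit list" where
  "entry_shifts s t rs =
    (replicate s () @ unary (length rs) @ copies (12 * t) (unary (length rs)),
     replicate s () @ unary (length rs) @ prod_units (copies (2 * t) (unary (length rs))) (unary (degree_of rs)),
     prod_units (copies (2 * t) (unary (length rs))) (unary (degree_of rs)))"

lemma pt_entry_shifts: "pt f \<Longrightarrow> pt (\<lambda>x. entry_shifts s t (f x))"
  unfolding entry_shifts_def
  by (intro pt_pair pt_append pt_const pt_unary pt_copies pt_prod_units pt_length_list pt_degree_of)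

text \<open>\<open>Str [False]\<close> is the code of the integer 0, the entry of these rows in the
  new column.\<close>

definition hard_rows :: "nat \<Rightarrow> nat \<Rightarrow> bool list list \<Rightarrow> str list list" where
  "hard_rows s t rs =
    map (\<lambda>y. map (\<lambda>z. entry_str (fst (entry_shifts s t rs)) (fst (snd (entry_shifts s t rs))) (snd (snd (entry_shifts s t rs)))
          (fst y = fst z) (snd z)) (zip [0..<length rs] (snd y)) @ [Str [False]])
      (zip [0..<length rs] (lap_rows (degree_of rs, rs) (length (copies (2 * t) (unary (length rs))))))"

lemma pt_hard_rows: assumes "pt f" shows "pt (\<lambda>x. hard_rows s t (f x))"
proof -
  have "pt (hard_rows s t)"
    unfolding hard_rows_def[abs_def]
    by (intro pt_map pt_append pt_entry_str pt_eq pt_fst pt_snd pt_id pt_const pt_zip pt_iota pt_lap_rows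
        pt_degree_of pt_copies pt_unary pt_length_list pt_entry_shifts)
  from pt_o[OF this assms] show ?thesis .
qed

definition matrix_str :: "nat \<Rightarrow> nat \<Rightarrow> nat \<Rightarrow> bool list list \<Rightarrow> str" where
  "matrix_str s b t rs =
    Str (enc (Str (enc (length rs + length rs * length rs)) # Str (enc (Suc (length rs))) #
      concat (hard_rows s t rs @
        map (\<lambda>_. map (\<lambda>_. Str [False]) [0..<length rs] @ [Str (False # bin (2 ^ b))]) (concat (map (\<lambda>_. [0..<length rs]) [0..<length rs])))))"

definition query_str :: "nat \<Rightarrow> nat \<Rightarrow> nat \<Rightarrow> bool list list \<Rightarrow> str" where
  "query_str s b t rs = Str (enc (matrix_str s b t rs, length rs))"

lemma pt_query_str: assumes "pt f" shows "pt (\<lambda>x. query_str s b t (f x))"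
proof -
  have "pt (query_str s b t)"
    unfolding query_str_def[abs_def] matrix_str_def
    by (intro pt_enc pt_pair pt_Cons pt_add pt_mult pt_Suc pt_length_list pt_concat pt_append pt_hard_rows pt_map pt_const
        pt_iota pt_fst pt_snd pt_id)
  from pt_o[OF this assms] show ?thesis .
qed

text \<open>The code of a graph starts with its two dimensions; the first gives the row length, and
  both are dropped before the bits are cut into rows.\<close>

definition graph_rows :: "str \<Rightarrow> bool list list" where
  "graph_rows s = chunks (nat_of_str (hd (untuple s))) (map (\<lambda>e. tt (raw e)) (tl (tl (untuple s))))"

lemma pt_graph_rows: "pt f \<Longrightarrow> pt (\<lambda>x. graph_rows (f x))"
  unfolding graph_rows_def by (intro pt_chunks pt_nat_of_str pt_hd pt_untuple pt_map pt_tt pt_tl pt_snd pt_id)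

lemma tuple_eq_enc: "tuple ws = enc (map Str ws)"
  by (simp add: enc_list_def enc_str_def o_def)

lemma graph_rows_enc_graph:
  assumes "pverts G = {..<N}" "0 < N"
  shows "graph_rows (Str (enc_graph G)) = map (\<lambda>u. map (\<lambda>v. (u, v) \<in> parcs G) [0..<N]) [0..<N]"
proof -
  define rs where "rs = map (\<lambda>u. map (\<lambda>v. (u, v) \<in> parcs G) [0..<N]) [0..<N]"
  have "concat (map (\<lambda>i. map (\<lambda>j. [mat N N (\<lambda>uv. uv \<in> parcs G) $$ (i, j)]) [0..<N]) [0..<N]) = map (\<lambda>b. [b]) (concat rs)"
    unfolding map_concat rs_def map_map o_def
    by (intro arg_cong[of _ _ concat] map_cong refl) auto
  then have "enc_graph G = tuple (bin N # bin N # map (\<lambda>b. [b]) (concat rs))"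
    using assms by (simp add: enc_graph_def enc_mat_def)
  then have u: "untuple (Str (enc_graph G)) = Str (bin N) # Str (bin N) # map (\<lambda>b. Str [b]) (concat rs)"
    unfolding tuple_eq_enc by (simp only: untuple list.map map_map o_def)
  have "map (\<lambda>e. tt (raw e)) (map (\<lambda>b. Str [b]) xs) = xs" for xs by (induction xs) (simp_all add: tt_def)
  then have "graph_rows (Str (enc_graph G)) = chunks N (concat rs)"
    unfolding graph_rows_def u list.sel by (simp only: nat_of_str_bin)
  also have "\<dots> = rs"
  proof (rule chunks_concat[OF _ assms(2)])
    fix r assume "r \<in> set rs"
    then show "length r = N" unfolding rs_def by (simp only: set_map) (elim imageE, simp)
  qed
  finally show ?thesis by (simp only: rs_def)
qed

lemma upt_plus: "[0..<N + M] = [0..<N] @ [N..<N + M]"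
  by (rule upt_add_eq_append) simp

lemma query_str_correct:
  assumes sym: "\<And>m u v. u < N \<Longrightarrow> v < N \<Longrightarrow> lap_pow E N r m u v = lap_pow E N r m v u"
    and rs: "rs = map (\<lambda>u. map (E u) [0..<N]) [0..<N]" and N: "0 < N" and r: "card {v. v < N \<and> E 0 v} = r"
  shows "raw (query_str s b t rs) = tuple [enc_mat enc_int (hard_mat E N r s b t), bin N]"
proof -
  have lrs: "length rs = N" by (simp add: rs)
  have dr: "degree_of rs = r"
  proof -
    have "degree_of rs = length (filter (E 0) [0..<N])"
      using N by (simp add: degree_of_def rs hd_map filter_map o_def)
    also have "\<dots> = card {v. v < N \<and> E 0 v}"
      by (simp add: distinct_length_filter Int_def conj_commute)
    finally show ?thesis using r by simp
  qed
  define T where "T = 2 * (t * length (bin N))"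
  have T: "length (copies (2 * t) (unary (length rs))) = T"
    by (simp add: length_copies unary_def lrs T_def sz_nat)
  define M where "M = lap_rows (r, rs) T"
  have M: "length M = N" "\<And>u. u < N \<Longrightarrow> length (M ! u) = N"
    "\<And>u v. u < N \<Longrightarrow> v < N \<Longrightarrow> int (fst (M ! u ! v)) - int (snd (M ! u ! v)) = lap_pow E N r T u v"
    using lap_rows_correct[OF sym rs, of T] unfolding M_def by auto
  have ent: "entry_str (fst (entry_shifts s t rs)) (fst (snd (entry_shifts s t rs))) (snd (snd (entry_shifts s t rs))) (u = v) (M ! u ! v) =
      Str (enc_int (hard_entry E N r s t u v))" if uv: "u < N" "v < N" for u v
  proof -
    have l: "length (fst (entry_shifts s t rs)) = s + length (bin N) + 12 * (t * length (bin N))"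
      "length (fst (snd (entry_shifts s t rs))) = s + length (bin N) + T * length (bin r)"
      "length (snd (snd (entry_shifts s t rs))) = T * length (bin r)"
      by (simp_all add: entry_shifts_def length_copies length_prod_units unary_def lrs dr T_def sz_nat)
    show ?thesis
      unfolding entry_str_def quot_str l hard_entry_def Let_def T_def[symmetric]
      by (simp add: algebra_simps flip: M(3)[OF uv])
  qed
  have hr: "hard_rows s t rs = map (\<lambda>u. map (\<lambda>v. Str (enc_int (hard_entry E N r s t u v))) [0..<N] @ [Str [False]]) [0..<N]"
    unfolding hard_rows_def T unfolding dr M_def[symmetric] unfolding lrs
  proof (rule nth_equalityI)
    fix u assume "u < length (map (\<lambda>y. map (\<lambda>z. entry_str (fst (entry_shifts s t rs)) (fst (snd (entry_shifts s t rs)))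
      (snd (snd (entry_shifts s t rs))) (fst y = fst z) (snd z)) (zip [0..<N] (snd y)) @ [Str [False]]) (zip [0..<N] M))"
    then have u: "u < N" by (simp add: M)
    have "map (\<lambda>z. entry_str (fst (entry_shifts s t rs)) (fst (snd (entry_shifts s t rs))) (snd (snd (entry_shifts s t rs))) (u = fst z) (snd z)) (zip [0..<N] (M ! u)) =
        map (\<lambda>v. Str (enc_int (hard_entry E N r s t u v))) [0..<N]"
      by (rule nth_equalityI) (use u M ent in auto)
    then show "map (\<lambda>y. map (\<lambda>z. entry_str (fst (entry_shifts s t rs)) (fst (snd (entry_shifts s t rs)))
      (snd (snd (entry_shifts s t rs))) (fst y = fst z) (snd z)) (zip [0..<N] (snd y)) @ [Str [False]]) (zip [0..<N] M) ! u =
      map (\<lambda>u. map (\<lambda>v. Str (enc_int (hard_entry E N r s t u v))) [0..<N] @ [Str [False]]) [0..<N] ! u"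
      using u M by simp
  qed (simp add: M)
  define br where "br = map (\<lambda>_. Str [False]) [0..<N] @ [Str (False # bin (2 ^ b))]"
  have bot: "map (\<lambda>_. br) (concat (map (\<lambda>_. [0..<N]) [0..<N])) = map (\<lambda>_. br) [N..<N + N * N]"
  proof -
    have "sum_list (replicate n N) = n * N" for n by (induction n) auto
    then show ?thesis by (simp add: map_replicate_const length_concat o_def)
  qed
  have top: "map (\<lambda>j. enc_int (hard_mat E N r s b t $$ (i, j))) [0..<Suc N] =
      map raw (map (\<lambda>v. Str (enc_int (hard_entry E N r s t i v))) [0..<N] @ [Str [False]])" if "i < N" for i
    using that by (auto simp: hard_mat_def gap_mat_def enc_int_def bin.simps[of 0])
  have bottom: "map (\<lambda>j. enc_int (hard_mat E N r s b t $$ (i, j))) [0..<Suc N] = map raw br" if "N \<le> i" "i < N + N * N" for i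
    using that by (auto simp: hard_mat_def gap_mat_def enc_int_def bin.simps[of 0] br_def nat_power_eq)
  have "concat (map (\<lambda>i. map (\<lambda>j. enc_int (hard_mat E N r s b t $$ (i, j))) [0..<Suc N]) [0..<N + N * N]) =
      map raw (concat (hard_rows s t rs @ map (\<lambda>_. br) [N..<N + N * N]))"
    unfolding upt_plus map_append concat_append map_concat hr map_map o_def
    by (intro arg_cong2[of _ _ _ _ append] arg_cong[of _ _ concat] map_cong refl) (use top bottom in auto)
  moreover have "dim_row (hard_mat E N r s b t) = N + N * N" "dim_col (hard_mat E N r s b t) = Suc N"
    by (simp_all add: hard_mat_def gap_mat_def)
  moreover have "(enc :: str \<Rightarrow> bool list) = raw" by (simp add: fun_eq_iff enc_str_def)
  ultimately have "enc_mat enc_int (hard_mat E N r s b t) = raw (matrix_str s b t rs)"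
    unfolding matrix_str_def lrs br_def[symmetric] bot enc_mat_def
    by (simp only: enc_list_def list.map str.sel enc_nat_def)
  then show ?thesis by (simp add: query_str_def enc_prod_def enc_str_def enc_nat_def lrs)
qed

section \<open>Evaluating the output of the approximation algorithm\<close>

text \<open>A rational number is represented by \<open>(p, n, d)\<close> with value \<open>(p - n) / d\<close>.\<close>

definition frac_val :: "nat \<times> nat \<times> nat \<Rightarrow> real" where
  "frac_val x = (real (fst x) - real (fst (snd x))) / real (snd (snd x))"

definition frac_add :: "nat \<times> nat \<times> nat \<Rightarrow> nat \<times> nat \<times> nat \<Rightarrow> nat \<times> nat \<times> nat" where
  "frac_add x y = (fst x * snd (snd y) + fst y * snd (snd x), fst (snd x) * snd (snd y) + fst (snd y) * snd (snd x),
     snd (snd x) * snd (snd y))"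

definition frac_sum :: "(nat \<times> nat \<times> nat) list \<Rightarrow> nat \<times> nat \<times> nat" where
  "frac_sum xs = foldl frac_add (0, 0, 1) xs"

lemma frac_sum:
  assumes "\<forall>x \<in> set xs. 0 < snd (snd x)"
  shows "0 < snd (snd (frac_sum xs)) \<and> frac_val (frac_sum xs) = sum_list (map frac_val xs)"
  using assms unfolding frac_sum_def
  by (induction xs rule: rev_induct) (auto simp: frac_add_def frac_val_def field_simps)

text \<open>Fractions are added over the product of their denominators and never reduced. With at
  most \<open>k\<close> summands of \<open>k\<close> bits each, all numbers keep to about
  \<open>k * (k + 1)\<close> bits, so this stays polynomial.\<close>

lemma pt_frac_sum: assumes "pt f" shows "pt (\<lambda>x. frac_sum (f x))"
proof -
  have "pt (\<lambda>xs :: (nat \<times> nat \<times> nat) list. foldl frac_add (0, 0, 1) xs)"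
  proof (rule pt_foldl[where B = "\<lambda>n. 10 * (n * (n + 1) + 1) + 6"])
    show "pt (\<lambda>y :: (nat \<times> nat \<times> nat) list \<times> (nat \<times> nat \<times> nat) \<times> nat \<times> nat \<times> nat. frac_add (fst (snd y)) (snd (snd y)))"
      unfolding frac_add_def by (intro pt_intros)
    show "pl (\<lambda>n. 10 * (n * (n + 1) + 1) + 6)" by (intro pl_intros)
    fix xs ys zs :: "(nat \<times> nat \<times> nat) list" assume e: "xs = ys @ zs"
    define k where "k = sz xs"
    have el: "fst x \<le> 2 ^ k \<and> fst (snd x) \<le> 2 ^ k \<and> snd (snd x) \<le> 2 ^ k" if "x \<in> set ys" for x
    proof -
      have "sz x \<le> k" unfolding k_def by (rule sz_mem) (use that e in simp)
      then have "sz (fst x) \<le> k" "sz (fst (snd x)) \<le> k" "sz (snd (snd x)) \<le> k"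
        by (cases x; cases "snd x"; simp add: sz_simps)+
      moreover have "n \<le> 2 ^ k" if "sz n \<le> k" for n :: nat
      proof -
        have "n < 2 ^ sz n" by (simp add: sz_nat less_power_bin)
        also have "\<dots> \<le> 2 ^ k" by (rule power_increasing) (use that in auto)
        finally show ?thesis by simp
      qed
      ultimately show ?thesis by blast
    qed
    have B: "fst r \<le> 2 ^ (length us * (k + 1)) \<and> fst (snd r) \<le> 2 ^ (length us * (k + 1)) \<and> snd (snd r) \<le> 2 ^ (length us * (k + 1))"
      if "set us \<subseteq> set ys" "r = foldl frac_add (0, 0, 1) us" for us r
      using that
    proof (induction us arbitrary: r rule: rev_induct)
      case (snoc u us)
      define r' where "r' = foldl frac_add (0, 0, 1) us"
      define P where "P = (2 :: nat) ^ (length us * (k + 1))"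
      have r': "fst r' \<le> P" "fst (snd r') \<le> P" "snd (snd r') \<le> P"
        using snoc.IH[of r'] snoc.prems by (auto simp: r'_def P_def)
      have u: "fst u \<le> 2 ^ k" "fst (snd u) \<le> 2 ^ k" "snd (snd u) \<le> 2 ^ k"
        using el[of u] snoc.prems by auto
      have P': "2 ^ (length (us @ [u]) * (k + 1)) = P * 2 ^ k + 2 ^ k * P" by (simp add: P_def power_add)
      have r: "r = frac_add r' u" using snoc.prems by (simp add: r'_def)
      have m: "a * b \<le> P * 2 ^ k" if "a \<le> P" "b \<le> 2 ^ k" for a b :: nat using that by (rule mult_mono) auto
      have m': "a * b \<le> 2 ^ k * P" if "b \<le> P" "a \<le> 2 ^ k" for a b :: nat using that by (intro mult_mono) auto
      show ?case unfolding P' r frac_add_def fst_conv snd_conv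
        using m[OF r'(1) u(3)] m[OF r'(2) u(3)] m[OF r'(3) u(3)] m'[OF r'(3) u(1)] m'[OF r'(3) u(2)] by linarith
    qed simp
    define r where "r = foldl frac_add (0, 0, 1) ys"
    have "length ys \<le> k" using e length_le_sz[of xs] by (simp add: k_def)
    then have le: "length ys * (k + 1) \<le> k * (k + 1)" by (rule mult_right_mono) simp
    have s: "sz n \<le> k * (k + 1) + 1" if "n \<le> 2 ^ (length ys * (k + 1))" for n :: nat
    proof (rule sz_nat_le)
      have "n \<le> 2 ^ (k * (k + 1))" using that power_increasing[OF le, of "2 :: nat"] by linarith
      then show "n < 2 ^ (k * (k + 1) + 1)" by (rule le_less_trans) simp
    qed
    have "fst r \<le> 2 ^ (length ys * (k + 1)) \<and> fst (snd r) \<le> 2 ^ (length ys * (k + 1)) \<and> snd (snd r) \<le> 2 ^ (length ys * (k + 1))"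
      by (rule B[OF subset_refl r_def])
    then have "sz (fst r) \<le> k * (k + 1) + 1" "sz (fst (snd r)) \<le> k * (k + 1) + 1" "sz (snd (snd r)) \<le> k * (k + 1) + 1"
      by (blast intro: s)+
    moreover have "sz r = 2 * sz (fst r) + 2 * (2 * sz (fst (snd r)) + 2 * sz (snd (snd r)) + 2) + 2"
      by (cases r; cases "snd r") (simp only: sz_simps fst_conv snd_conv)
    moreover have "a \<le> K \<Longrightarrow> b \<le> K \<Longrightarrow> c \<le> K \<Longrightarrow> 2 * a + 2 * (2 * b + 2 * c + 2) + 2 \<le> 10 * K + 6" for a b c K :: nat by presburger
    ultimately have "sz r \<le> 10 * (k * (k + 1) + 1) + 6" by metis
    then show "sz (foldl frac_add (0, 0, 1) ys) \<le> 10 * (sz xs * (sz xs + 1) + 1) + 6" by (simp only: r_def k_def)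
  qed (intro pt_intros)+
  from pt_o[OF this assms] show ?thesis by (simp add: frac_sum_def)
qed

definition rat_sign :: "str \<Rightarrow> bool" where "rat_sign s = tt (raw (Str (thd (raw s))))"
definition rat_num :: "str \<Rightarrow> nat" where "rat_num s = nat_of_str (Str (tl (raw (Str (thd (raw s))))))"
definition rat_den :: "str \<Rightarrow> nat" where "rat_den s = nat_of_str (Str (tl (raw (Str (thd (raw (Str (ttl (raw s)))))))))"

lemma pt_rat: "pt f \<Longrightarrow> pt (\<lambda>x. rat_sign (f x))" "pt f \<Longrightarrow> pt (\<lambda>x. rat_num (f x))" "pt f \<Longrightarrow> pt (\<lambda>x. rat_den (f x))"
  unfolding rat_sign_def rat_num_def rat_den_def
  by (intro pt_tt pt_thd pt_nat_of_str pt_raw_tl pt_ttl, assumption)+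

definition frac_prod :: "str \<times> str \<Rightarrow> nat \<times> nat \<times> nat" where
  "frac_prod y = (if rat_sign (fst y) = rat_sign (snd y) then rat_num (fst y) * rat_num (snd y) else 0,
     if rat_sign (fst y) = rat_sign (snd y) then 0 else rat_num (fst y) * rat_num (snd y),
     rat_den (fst y) * rat_den (snd y))"

lemma pt_frac_prod: "pt f \<Longrightarrow> pt (\<lambda>x. frac_prod (f x))"
  unfolding frac_prod_def by (intro pt_pair pt_if pt_mult pt_iff pt_rat pt_const pt_fst pt_snd)

lemma frac_prod:
  "0 < snd (snd (frac_prod (Str (enc_rat a), Str (enc_rat b)))) \<and>
   frac_val (frac_prod (Str (enc_rat a), Str (enc_rat b))) = real_of_rat a * real_of_rat b"
proof -
  obtain m n where mn: "quotient_of a = (m, n)" by (cases "quotient_of a")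
  obtain m' n' where mn': "quotient_of b = (m', n')" by (cases "quotient_of b")
  have n: "0 < n" "0 < n'" using quotient_of_denom_pos mn mn' by auto
  have ab: "real_of_rat a = real_of_int m / real_of_int n" "real_of_rat b = real_of_int m' / real_of_int n'"
    using quotient_of_div[OF mn] quotient_of_div[OF mn'] by (simp_all add: of_rat_divide)
  have r: "rat_sign (Str (enc_rat a)) = (m < 0)" "rat_num (Str (enc_rat a)) = nat \<bar>m\<bar>" "rat_den (Str (enc_rat a)) = nat n"
    "rat_sign (Str (enc_rat b)) = (m' < 0)" "rat_num (Str (enc_rat b)) = nat \<bar>m'\<bar>" "rat_den (Str (enc_rat b)) = nat n'"
    using n by (simp_all add: rat_sign_def rat_num_def rat_den_def enc_rat_def mn mn' enc_int_def tt_def)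
  show ?thesis
    using n by (simp add: frac_prod_def frac_val_def r ab abs_if)
qed

text \<open>The test looks only at the last column of the product, in the rows from \<open>N\<close>
  on. So these rows of \<open>U\<close> are paired with the last column of \<open>V\<close>, and all
  products are summed at once.\<close>

definition output_frac :: "nat \<Rightarrow> str \<Rightarrow> nat \<times> nat \<times> nat" where
  "output_frac N s = frac_sum (map frac_prod (concat (map
     (\<lambda>y. zip (snd y) (map (\<lambda>r. hd (rev r)) (chunks (Suc N) (tl (tl (untuple (hd (tl (untuple s)))))))))
     (filter (\<lambda>y. N \<le> fst y) (zip [0..<length (chunks N (tl (tl (untuple (hd (untuple s))))))] (chunks N (tl (tl (untuple (hd (untuple s)))))))))))"

lemma pt_output_frac: assumes "pt f" "pt g" shows "pt (\<lambda>x. output_frac (f x) (g x))"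
proof (rule pt_app2[OF _ assms])
  show "pt (\<lambda>y. output_frac (fst y) (snd y))"
    unfolding output_frac_def
    by (intro pt_frac_sum pt_map pt_frac_prod pt_concat pt_zip pt_filter pt_le pt_iota pt_chunks pt_tl pt_untuple pt_hd pt_rev
      pt_Suc pt_fst pt_snd pt_id)
qed

text \<open>The threshold on the column sum, multiplied out so that only natural numbers
  occur.\<close>

definition accept :: "nat \<Rightarrow> nat \<Rightarrow> nat \<Rightarrow> str \<Rightarrow> bool" where
  "accept N0 b N s \<longleftrightarrow> N0 \<le> N \<and>
    N * N * 2 ^ b * snd (snd (output_frac N s)) + 2 * fst (snd (output_frac N s)) \<le> 2 * fst (output_frac N s)"

lemma pt_accept: "pt f \<Longrightarrow> pt g \<Longrightarrow> pt (\<lambda>x. accept N0 b (f x) (g x))"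
  unfolding accept_def
  by (intro pt_conj pt_le pt_add pt_mult pt_output_frac pt_fst pt_snd pt_const; assumption)

lemma accept_correct:
  assumes U: "U \<in> carrier_mat (N + N * N) N" and V: "V \<in> carrier_mat N (Suc N)" and N: "0 < N"
  shows "accept N0 b N (Str (tuple [enc_mat enc_rat U, enc_mat enc_rat V])) \<longleftrightarrow>
    N0 \<le> N \<and> real (N * N) * 2 ^ b / 2 \<le> (\<Sum>i\<in>{N..<N + N * N}. (map_mat real_of_rat U * map_mat real_of_rat V) $$ (i, N))"
proof -
  define s where "s = Str (tuple [enc_mat enc_rat U, enc_mat enc_rat V])"
  have ch: "chunks c (tl (tl (untuple (Str (enc_mat enc_rat A))))) = map (\<lambda>i. map (\<lambda>j. Str (enc_rat (A $$ (i, j)))) [0..<c]) [0..<n]"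
    if "A \<in> carrier_mat n c" "0 < c" for A n c
  proof -
    have "untuple (Str (enc_mat enc_rat A)) = Str (bin n) # Str (bin c) # concat (map (\<lambda>i. map (\<lambda>j. Str (enc_rat (A $$ (i, j)))) [0..<c]) [0..<n])"
      unfolding enc_mat_def tuple_eq_enc untuple using that(1) by (simp add: map_concat o_def)
    moreover have "chunks c (concat (map (\<lambda>i. map (\<lambda>j. Str (enc_rat (A $$ (i, j)))) [0..<c]) [0..<n])) =
        map (\<lambda>i. map (\<lambda>j. Str (enc_rat (A $$ (i, j)))) [0..<c]) [0..<n]"
      by (rule chunks_concat) (use that(2) in auto)
    ultimately show ?thesis by simp
  qed
  have us: "untuple s = [Str (enc_mat enc_rat U), Str (enc_mat enc_rat V)]"
    unfolding s_def tuple_eq_enc untuple by simp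
  define e where "e i l = (Str (enc_rat (U $$ (i, l))), Str (enc_rat (V $$ (l, N))))" for i l
  define xs where "xs = concat (map (\<lambda>i. map (e i) [0..<N]) [N..<N + N * N])"
  have "map (\<lambda>r. hd (rev r)) (map (\<lambda>i. map (\<lambda>j. Str (enc_rat (V $$ (i, j)))) [0..<Suc N]) [0..<N]) =
      map (\<lambda>l. Str (enc_rat (V $$ (l, N)))) [0..<N]"
    by simp
  moreover have "filter (\<lambda>y. N \<le> fst y) (zip [0..<N + N * N] (map (\<lambda>i. map (\<lambda>j. Str (enc_rat (U $$ (i, j)))) [0..<N]) [0..<N + N * N])) =
      map (\<lambda>i. (i, map (\<lambda>j. Str (enc_rat (U $$ (i, j)))) [0..<N])) [N..<N + N * N]"
  proof -
    have "zip [0..<N + N * N] (map (\<lambda>i. map (\<lambda>j. Str (enc_rat (U $$ (i, j)))) [0..<N]) [0..<N + N * N]) =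
        map (\<lambda>i. (i, map (\<lambda>j. Str (enc_rat (U $$ (i, j)))) [0..<N])) [0..<N + N * N]"
      by (rule nth_equalityI) auto
    also have "filter (\<lambda>y. N \<le> fst y) \<dots> = map (\<lambda>i. (i, map (\<lambda>j. Str (enc_rat (U $$ (i, j)))) [0..<N])) (filter (\<lambda>i. N \<le> i) [0..<N + N * N])"
      by (simp add: filter_map o_def)
    also have "filter (\<lambda>i. N \<le> i) [0..<N + N * N] = [N..<N + N * N]"
      unfolding upt_plus filter_append by (simp add: filter_id_conv)
    finally show ?thesis .
  qed
  ultimately have O: "output_frac N s = frac_sum (map frac_prod xs)"
    unfolding output_frac_def us list.sel ch[OF U N] ch[OF V zero_less_Suc] length_map length_upt diff_zero xs_def
    by (simp add: o_def zip_map_map zip_same_conv_map e_def[abs_def])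
  have pos: "\<forall>x \<in> set (map frac_prod xs). 0 < snd (snd x)"
    using frac_prod by (auto simp: xs_def e_def)
  define F where "F = frac_sum (map frac_prod xs)"
  have F: "0 < snd (snd F)" "frac_val F = sum_list (map frac_val (map frac_prod xs))"
    using frac_sum[OF pos] by (simp_all add: F_def)
  have "sum_list (map frac_val (map frac_prod xs)) = (\<Sum>i\<leftarrow>[N..<N + N * N]. \<Sum>l\<leftarrow>[0..<N]. real_of_rat (U $$ (i, l)) * real_of_rat (V $$ (l, N)))"
  proof -
    have c: "sum_list (concat xss) = sum_list (map sum_list xss)" for xss :: "real list list" by (induction xss) auto
    show ?thesis unfolding xs_def map_concat c by (simp add: e_def o_def frac_prod)
  qed
  also have "\<dots> = (\<Sum>i\<in>{N..<N + N * N}. \<Sum>l\<in>{0..<N}. real_of_rat (U $$ (i, l)) * real_of_rat (V $$ (l, N)))"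
    by (simp only: interv_sum_list_conv_sum_set_nat set_upt)
  also have "\<dots> = (\<Sum>i\<in>{N..<N + N * N}. (map_mat real_of_rat U * map_mat real_of_rat V) $$ (i, N))"
    using U V by (intro sum.cong refl) (auto simp: scalar_prod_def)
  finally have val: "frac_val F = (\<Sum>i\<in>{N..<N + N * N}. (map_mat real_of_rat U * map_mat real_of_rat V) $$ (i, N))"
    using F by simp
  have "N * N * 2 ^ b * snd (snd F) + 2 * fst (snd F) \<le> 2 * fst F \<longleftrightarrow>
      real (N * N * 2 ^ b * snd (snd F) + 2 * fst (snd F)) \<le> real (2 * fst F)" by (simp only: of_nat_le_iff)
  also have "\<dots> \<longleftrightarrow> real (N * N) * 2 ^ b / 2 \<le> frac_val F"
    using F(1) by (simp add: frac_val_def field_simps)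
  finally show ?thesis unfolding accept_def s_def[symmetric] O F_def[symmetric] val[symmetric] by simp
qed

section \<open>The reduction\<close>

text \<open>The operator is self-adjoint and the entries of its powers are inner products with unit
  vectors; the positive factor \<open>64 / R\<close> cancels.\<close>

lemma (in regular) lap_pow_sym:
  assumes w: "\<And>u v. w u v = of_bool (E u v)" and uv: "u < N" "v < N"
  shows "lap_pow E N r m u v = lap_pow E N r m v u"
proof -
  have unit: "ip (\<lambda>x. of_bool (x = u)) y = y u" if "u < N" for u y
  proof -
    have "ip (\<lambda>x. of_bool (x = u)) y = (\<Sum>x\<in>{u}. of_bool (x = u) * y x)"
      unfolding ip_def by (rule sum.mono_neutral_right) (use that in auto)
    then show ?thesis by simp
  qed
  have "dm m u v = ip (\<lambda>x. of_bool (x = u)) ((D ^^ m) (\<lambda>x. of_bool (x = v)))"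
    unfolding unit[OF uv(1)] dm_def ..
  also have "\<dots> = ip ((D ^^ m) (\<lambda>x. of_bool (x = u))) (\<lambda>x. of_bool (x = v))"
    using ip_Dn[of _ m 0] by simp
  also have "\<dots> = dm m v u" unfolding ip_commute[of "(D ^^ m) _"] unit[OF uv(2)] dm_def ..
  finally have "(64 / R) ^ m * real_of_int (lap_pow E N r m u v) = (64 / R) ^ m * real_of_int (lap_pow E N r m v u)"
    unfolding dm_lap_pow[OF w] .
  then show ?thesis using R_pos by simp
qed

text \<open>The dimension \<open>N\<close> is recovered as the number of columns of
  \<open>U\<close>, so the decision is a function of the output of the approximation algorithm
  alone.\<close>

definition decide :: "nat \<Rightarrow> nat \<Rightarrow> str \<Rightarrow> bool" where
  "decide N0 b s = accept N0 b (nat_of_str (hd (tl (untuple (hd (untuple s)))))) s"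

lemma pc_decide: "pc (\<lambda>x. x) (\<lambda>x. [decide N0 b (Str x)])"
proof -
  have "pt (\<lambda>s. decide N0 b s)"
    unfolding decide_def by (intro pt_accept pt_nat_of_str pt_hd pt_tl pt_untuple pt_id)
  from pc_reindex[OF this[unfolded pt_def], of Str] show ?thesis by (simp add: enc_simps)
qed

lemma decide_eq:
  assumes "U \<in> carrier_mat n N"
  shows "decide N0 b (Str (tuple [enc_mat enc_rat U, v])) = accept N0 b N (Str (tuple [enc_mat enc_rat U, v]))"
proof -
  have "untuple (Str (tuple [enc_mat enc_rat U, v])) = [Str (enc_mat enc_rat U), Str v]"
    unfolding tuple_eq_enc untuple by simp
  moreover have "\<exists>ws. untuple (Str (enc_mat enc_rat U)) = Str (bin n) # Str (bin N) # ws"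
    unfolding enc_mat_def tuple_eq_enc untuple using assms by simp
  ultimately show ?thesis by (auto simp: decide_def)
qed

text \<open>A reduction from a language \<open>L\<close> to low-rank approximation: the instance \<open>q x\<close> has rank parameter
  \<open>N x\<close>, and every \<open>\<alpha>\<close>-approximate solution reveals whether \<open>x \<in> L\<close>.\<close>

definition reduces :: "real \<Rightarrow> real \<Rightarrow> nat \<Rightarrow> nat \<Rightarrow> nat \<Rightarrow> bool list set \<Rightarrow> (bool list \<Rightarrow> bool list) \<Rightarrow> (bool list \<Rightarrow> nat) \<Rightarrow> bool" where
  "reduces p \<alpha> c N0 b L q N \<longleftrightarrow> (\<forall>x. \<exists>A \<in> carrier_mat (N x + N x * N x) (Suc (N x)). 0 < N x \<and>
     q x = tuple [enc_mat enc_int A, bin (N x)] \<and>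
     (\<forall>i < N x + N x * N x. \<forall>j < Suc (N x). \<bar>A $$ (i, j)\<bar> \<le> int (poly_bound c (N x + N x * N x))) \<and>
     (\<forall>U \<in> carrier_mat (N x + N x * N x) (N x). \<forall>V \<in> carrier_mat (N x) (Suc (N x)).
        entrywise_norm_pow p (map_mat real_of_int A - map_mat real_of_rat U * map_mat real_of_rat V)
          \<le> \<alpha> * opt_cost p (N x) (map_mat real_of_int A) \<longrightarrow>
        (decide N0 b (Str (tuple [enc_mat enc_rat U, enc_mat enc_rat V])) \<longleftrightarrow> x \<in> L)))"

text \<open>The order of choices matters: \<open>\<epsilon>\<close> depends on \<open>p\<close> and
  \<open>\<alpha>\<close> only, the hypothesis then supplies \<open>\<delta>\<close>, and only after
  that are \<open>s\<close>, \<open>b\<close>, \<open>t\<close> and \<open>N0\<close> fixed. All of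
  them are constants of the reduction.\<close>

lemma reduction_exists:
  assumes p: "1 < p" "p < 2" and \<alpha>: "1 < \<alpha>" and SSEH and L: "L \<in> class_NP"
  shows "\<exists>c N0 b q N P. reduces p \<alpha> c N0 b L q N \<and> pc (\<lambda>x. x) q \<and> pl P \<and> mono P \<and> (\<forall>x. N x \<le> P (length x))"
proof -
  define gp where "gp \<epsilon> \<delta> s b t N0 \<longleftrightarrow> (\<forall>G N r U V.
     sse_instance \<delta> G \<longrightarrow> pverts G = {..<N} \<longrightarrow> (\<forall>v<N. card {u. (v, u) \<in> parcs G} = r) \<longrightarrow>
     U \<in> carrier_mat (N + N * N) N \<longrightarrow> V \<in> carrier_mat N (Suc N) \<longrightarrow>
     entrywise_norm_pow p (map_mat real_of_int (hard_mat (\<lambda>u v. (u, v) \<in> parcs G) N r s b t) - U * V)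
       \<le> \<alpha> * opt_cost p N (map_mat real_of_int (hard_mat (\<lambda>u v. (u, v) \<in> parcs G) N r s b t)) \<longrightarrow>
     (let dec = N0 \<le> N \<and> real (N * N) * 2 ^ b / 2 \<le> (\<Sum>i\<in>{N..<N + N * N}. (U * V) $$ (i, N)) in
       (expansion_profile G \<delta> \<le> \<epsilon> \<longrightarrow> dec) \<and> (1 - \<epsilon> \<le> expansion_profile G \<delta> \<longrightarrow> \<not> dec)))" for \<epsilon> \<delta> :: real and s b t N0 :: nat
  have "\<exists>\<epsilon>. 0 < \<epsilon> \<and> \<epsilon> < 1 \<and> (\<forall>\<delta>. 0 < \<delta> \<and> \<delta> < 1 \<longrightarrow> (\<exists>s b t N0. gp \<epsilon> \<delta> s b t N0))"
    unfolding gp_def by (rule hard_mat_gap[OF p \<alpha>])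
  then obtain \<epsilon> where \<epsilon>: "0 < \<epsilon>" "\<epsilon> < 1" and gap: "\<And>\<delta>. 0 < \<delta> \<and> \<delta> < 1 \<Longrightarrow> \<exists>s b t N0. gp \<epsilon> \<delta> s b t N0"
    by blast
  from \<open>SSEH\<close>[unfolded SSEH_def, rule_format, OF \<epsilon>(1)]
  obtain \<delta> where \<delta>: "0 < \<delta> \<and> \<delta> < 1" and hard: "NP_hard_promise
       (enc_graph ` {G. sse_instance \<delta> G \<and> expansion_profile G \<delta> \<le> \<epsilon>})
       (enc_graph ` {G. sse_instance \<delta> G \<and> expansion_profile G \<delta> \<ge> 1 - \<epsilon>})"
    by (elim exE conjE) (rule that, intro conjI)
  from gap[OF \<delta>] obtain s b t N0 where g: "gp \<epsilon> \<delta> s b t N0" by blast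
  from bspec[OF hard[unfolded NP_hard_promise_def] L] obtain f where f0: "poly_time f \<and>
    (\<forall>x. (x \<in> L \<longrightarrow> f x \<in> enc_graph ` {G. sse_instance \<delta> G \<and> expansion_profile G \<delta> \<le> \<epsilon>}) \<and>
      (x \<notin> L \<longrightarrow> f x \<in> enc_graph ` {G. sse_instance \<delta> G \<and> expansion_profile G \<delta> \<ge> 1 - \<epsilon>}))" ..
  then have f: "poly_time f"
    "\<And>x. x \<in> L \<Longrightarrow> f x \<in> enc_graph ` {G. sse_instance \<delta> G \<and> expansion_profile G \<delta> \<le> \<epsilon>}"
    "\<And>x. x \<notin> L \<Longrightarrow> f x \<in> enc_graph ` {G. sse_instance \<delta> G \<and> expansion_profile G \<delta> \<ge> 1 - \<epsilon>}"
    by simp_all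
  have "\<exists>G. f x = enc_graph G \<and> sse_instance \<delta> G \<and> (x \<in> L \<longrightarrow> expansion_profile G \<delta> \<le> \<epsilon>) \<and> (x \<notin> L \<longrightarrow> 1 - \<epsilon> \<le> expansion_profile G \<delta>)" for x
  proof (cases "x \<in> L")
    case True
    from f(2)[OF True] obtain G where "f x = enc_graph G" "sse_instance \<delta> G" "expansion_profile G \<delta> \<le> \<epsilon>" by (elim imageE) simp
    with True show ?thesis by (intro exI[of _ G]) simp
  next
    case False
    from f(3)[OF False] obtain G where "f x = enc_graph G" "sse_instance \<delta> G" "1 - \<epsilon> \<le> expansion_profile G \<delta>" by (elim imageE) simp
    with False show ?thesis by (intro exI[of _ G]) simp
  qed
  \<comment> \<open>The graphs are chosen for the analysis only; the reduction itself computes with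
    their codes \<open>f x\<close>.\<close>
  then have "\<exists>G. \<forall>x. f x = enc_graph (G x) \<and> sse_instance \<delta> (G x) \<and> (x \<in> L \<longrightarrow> expansion_profile (G x) \<delta> \<le> \<epsilon>) \<and> (x \<notin> L \<longrightarrow> 1 - \<epsilon> \<le> expansion_profile (G x) \<delta>)"
    by (intro choice allI)
  then obtain G where G: "\<And>x. f x = enc_graph (G x)" "\<And>x. sse_instance \<delta> (G x)"
    "\<And>x. x \<in> L \<Longrightarrow> expansion_profile (G x) \<delta> \<le> \<epsilon>" "\<And>x. x \<notin> L \<Longrightarrow> 1 - \<epsilon> \<le> expansion_profile (G x) \<delta>"
    by blast
  define rs where "rs x = graph_rows (Str (f x))" for x
  define N where "N x = length (rs x)" for x
  define q where "q x = raw (query_str s b t (rs x))" for x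
  have fpc: "pc (\<lambda>x. x) f" using f(1) by (simp add: poly_time_iff)
  have q: "pc (\<lambda>x. x) q"
  proof (rule pc_comp[OF fpc])
    have "pt (\<lambda>y. query_str s b t (graph_rows y))" by (intro pt_query_str pt_graph_rows pt_id)
    from pc_reindex[OF this[unfolded pt_def], of "\<lambda>x. Str (f x)"]
    show "pc f q" unfolding q_def[abs_def] rs_def by (simp add: enc_str_def)
  qed
  obtain P where P: "pl P" "mono P" "\<And>x. N x \<le> P (length x)"
  proof -
    have "pt (\<lambda>y. graph_rows y)" by (intro pt_graph_rows pt_id)
    from pc_reindex[OF this[unfolded pt_def], of "\<lambda>x. Str (f x)"]
    have "pc f (\<lambda>x. enc (rs x))" unfolding rs_def by (simp add: enc_str_def)
    from pc_length[OF pc_comp[OF fpc this]] obtain P where P: "pl P \<and> mono P \<and> (\<forall>x. sz (rs x) \<le> P (length x))" ..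
    have "N x \<le> P (length x)" for x
    proof -
      have "sz (rs x) \<le> P (length x)" using P by simp
      then show ?thesis using length_le_sz[of "rs x"] unfolding N_def by (rule order_trans[rotated])
    qed
    then show thesis using that P by blast
  qed
  \<comment> \<open>Covers the coefficient and the exponent of \<open>hard_entry_bound\<close>, and
    the entry \<open>2 ^ b\<close> of the new column.\<close>
  define c where "c = 2 ^ (s + 3 + 14 * t) + (14 * t + 1) + 2 ^ b"
  have "reduces p \<alpha> c N0 b L q N"
    unfolding reduces_def
  proof
    fix x
    obtain N' r where Nr: "pverts (G x) = {..<N'}" "0 < r" "0 < N'" "finite (parcs (G x))" "\<forall>v<N'. card {u. (v, u) \<in> parcs (G x)} = r"
      "\<forall>u v. (u, v) \<in> parcs (G x) \<longrightarrow> u < N' \<and> v < N' \<and> u \<noteq> v \<and> (v, u) \<in> parcs (G x)"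
      by (rule sse_instanceE[OF G(2)])
    define E where "E u v \<longleftrightarrow> (u, v) \<in> parcs (G x)" for u v
    have rsx: "rs x = map (\<lambda>u. map (E u) [0..<N']) [0..<N']"
      unfolding rs_def G(1) graph_rows_enc_graph[OF Nr(1,3)] E_def ..
    have NN: "N' = N x" by (simp add: N_def rsx)
    interpret regular N' r "\<lambda>u v. of_bool (E u v)" "2 ^ length (bin r)"
      unfolding E_def using Nr(2,5,6) by (intro regular_of_sse) auto
    have E0: "card {v. v < N' \<and> E 0 v} = r"
    proof -
      have "{v. v < N' \<and> E 0 v} = {u. (0, u) \<in> parcs (G x)}" using Nr(6) by (auto simp: E_def)
      then show ?thesis using Nr(3,5) by simp
    qed
    define A where "A = hard_mat E N' r s b t"
    have A: "A \<in> carrier_mat (N' + N' * N') (Suc N')" by (simp add: A_def hard_mat_def)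
    have qx: "q x = tuple [enc_mat enc_int A, bin N']"
      unfolding q_def A_def by (rule query_str_correct[OF lap_pow_sym[OF refl] rsx Nr(3) E0])
    have bnd: "\<bar>A $$ (i, j)\<bar> \<le> int (poly_bound c (N' + N' * N'))" if "i < N' + N' * N'" "j < Suc N'" for i j
    proof -
      have h: "\<bar>hard_entry E N' r s t i j\<bar> \<le> int (poly_bound c (N' + N' * N'))" if "i < N'"
      proof -
        have "\<bar>hard_entry E N' r s t i j\<bar> \<le> int (2 ^ (s + 3 + 14 * t) * N' ^ (14 * t + 1))"
          using Nr(3) that by (intro hard_entry_bound refl) auto
        also have "\<dots> \<le> int (poly_bound c (N' + N' * N'))"
          unfolding of_nat_le_iff using Nr(3) by (intro poly_bound_mono_exp) (auto simp: c_def)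
        finally show ?thesis .
      qed
      have "2 ^ b \<le> poly_bound c (N' + N' * N')" unfolding poly_bound_def c_def by simp
      then have "(2 :: int) ^ b \<le> int (poly_bound c (N' + N' * N'))" by (metis of_nat_le_iff of_nat_numeral of_nat_power)
      then show ?thesis using that h by (auto simp: A_def hard_mat_def gap_mat_def)
    qed
    have dec: "decide N0 b (Str (tuple [enc_mat enc_rat U, enc_mat enc_rat V])) \<longleftrightarrow> x \<in> L"
      if U: "U \<in> carrier_mat (N' + N' * N') N'" and V: "V \<in> carrier_mat N' (Suc N')"
        and cost: "entrywise_norm_pow p (map_mat real_of_int A - map_mat real_of_rat U * map_mat real_of_rat V)
          \<le> \<alpha> * opt_cost p N' (map_mat real_of_int A)" for U V
    proof -
      have "map_mat real_of_rat U \<in> carrier_mat (N' + N' * N') N'" "map_mat real_of_rat V \<in> carrier_mat N' (Suc N')"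
        using U V by auto
      from g[unfolded gp_def, rule_format, OF G(2) Nr(1) Nr(5)[rule_format] this cost[unfolded A_def E_def]]
      show ?thesis
        unfolding decide_eq[OF U] accept_correct[OF U V Nr(3)] Let_def using G(3,4)[of x] by blast
    qed
    show "\<exists>A \<in> carrier_mat (N x + N x * N x) (Suc (N x)). 0 < N x \<and>
     q x = tuple [enc_mat enc_int A, bin (N x)] \<and>
     (\<forall>i < N x + N x * N x. \<forall>j < Suc (N x). \<bar>A $$ (i, j)\<bar> \<le> int (poly_bound c (N x + N x * N x))) \<and>
     (\<forall>U \<in> carrier_mat (N x + N x * N x) (N x). \<forall>V \<in> carrier_mat (N x) (Suc (N x)).
        entrywise_norm_pow p (map_mat real_of_int A - map_mat real_of_rat U * map_mat real_of_rat V)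
          \<le> \<alpha> * opt_cost p (N x) (map_mat real_of_int A) \<longrightarrow>
        (decide N0 b (Str (tuple [enc_mat enc_rat U, enc_mat enc_rat V])) \<longleftrightarrow> x \<in> L))"
      unfolding NN[symmetric] using A qx bnd dec Nr(3) by (intro bexI[of _ A] conjI) blast+
  qed
  then show ?thesis using q P by blast
qed

section \<open>From approximation algorithms to decision procedures\<close>

lemma approx_output:
  assumes red: "reduces p \<alpha> c N0 b L q N" and M: "approx_algorithm p \<alpha> (poly_bound c) T M"
  shows "\<exists>y. computes_within M (q x) y (T (N x + N x * N x) (N x)) \<and> (decide N0 b (Str y) \<longleftrightarrow> x \<in> L)"
proof -
  define n where "n = N x + N x * N x"
  from red obtain A where A: "A \<in> carrier_mat n (Suc (N x))" "0 < N x" "q x = tuple [enc_mat enc_int A, bin (N x)]"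
    "\<forall>i < n. \<forall>j < Suc (N x). \<bar>A $$ (i, j)\<bar> \<le> int (poly_bound c n)"
    and dec: "\<forall>U \<in> carrier_mat n (N x). \<forall>V \<in> carrier_mat (N x) (Suc (N x)).
        entrywise_norm_pow p (map_mat real_of_int A - map_mat real_of_rat U * map_mat real_of_rat V)
          \<le> \<alpha> * opt_cost p (N x) (map_mat real_of_int A) \<longrightarrow>
        (decide N0 b (Str (tuple [enc_mat enc_rat U, enc_mat enc_rat V])) \<longleftrightarrow> x \<in> L)"
    unfolding reduces_def n_def by blast
  \<comment> \<open>This gives \<open>Suc (N x) \<le> n\<close>: the instance has at least as many
    rows as columns because \<open>N x\<close> is positive.\<close>
  have "1 * 1 \<le> N x * N x" using A(2) by (intro mult_mono) auto
  then have "1 \<le> N x \<and> N x \<le> Suc (N x) \<and> Suc (N x) \<le> n \<and> (\<forall>i < n. \<forall>j < Suc (N x). \<bar>A $$ (i, j)\<bar> \<le> int (poly_bound c n))"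
    using A(2,4) by (auto simp: n_def)
  with M A(1) obtain U V where "U \<in> carrier_mat n (N x)" "V \<in> carrier_mat (N x) (Suc (N x))"
    "computes_within M (tuple [enc_mat enc_int A, bin (N x)]) (tuple [enc_mat enc_rat U, enc_mat enc_rat V]) (T n (N x))"
    "entrywise_norm_pow p (map_mat real_of_int A - map_mat real_of_rat U * map_mat real_of_rat V)
          \<le> \<alpha> * opt_cost p (N x) (map_mat real_of_int A)"
    unfolding approx_algorithm_def by blast
  then show ?thesis using dec A(3) unfolding n_def[symmetric] by metis
qed

lemma computes_within_mono: "computes_within M x y T \<Longrightarrow> T \<le> T' \<Longrightarrow> computes_within M x y T'"
  unfolding computes_within_def by (meson order_trans)

text \<open>Three programs in sequence build the query, simulate \<open>M\<close> and evaluate its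
  answer, whose length is bounded by the cost of the simulation. The time of \<open>M\<close> enters
  as an argument of the polynomial \<open>P\<close>, so one lemma serves polynomial and
  subexponential \<open>T\<close> alike.\<close>

lemma decider:
  assumes "wf_tm M" and u: "pc u q"
  shows "\<exists>M' P. wf_tm M' \<and> pl P \<and> mono P \<and> (\<forall>i y T. computes_within M (q i) y T \<longrightarrow>
    computes_within M' (u i) [decide N0 b (Str y)] (real (P (length (u i) + nat \<lfloor>T\<rfloor>))))"
proof -
  obtain c R C where M: "\<And>x y T. computes_within M x y T \<Longrightarrow> \<exists>t. real t \<le> T \<and> fn c R x y (C * (t + length x + 1))"
    using fn_sim[OF assms(1)] by blast
  obtain c1 R1 P1 where 1: "pl P1" "mono P1" "\<And>i. fn c1 R1 (u i) (q i) (P1 (length (u i)))" "\<And>i. length (q i) \<le> P1 (length (u i))"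
    using u by (rule pcE) blast
  obtain c2 R2 P2 where 2: "pl P2" "mono P2" "\<And>x. fn c2 R2 x [decide N0 b (Str x)] (P2 (length x))"
    using pc_decide[of N0 b] by (rule pcE) blast
  define S where "S m = P1 m + C * (m + P1 m + 1)" for m
  define Q where "Q m = S m + P2 (S m)" for m
  have S: "pl S" "mono S" unfolding S_def using 1(1,2) by (auto intro!: pl_intros monoI add_mono mult_left_mono dest: monoD)
  have Q: "pl Q" "mono Q" unfolding Q_def using 2(1,2) S
    by (auto intro!: pl_add pl_comp[of P2 S] monoI add_mono dest: monoD)
  have comp: "fn (c1 ;; c ;; c2) (max R1 (max R R2)) (u i) [decide N0 b (Str y)] (Q (length (u i) + nat \<lfloor>T\<rfloor>))"
    if "computes_within M (q i) y T" for i y T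
  proof -
    obtain t where t: "real t \<le> T" "fn c R (q i) y (C * (t + length (q i) + 1))" using M[OF \<open>computes_within M (q i) y T\<close>] by blast
    define m where "m = length (u i) + nat \<lfloor>T\<rfloor>"
    have tm: "t \<le> m" using t(1) by (simp add: m_def le_nat_floor trans_le_add2)
    have P1: "P1 (length (u i)) \<le> P1 m" using 1(2) by (rule monoD) (simp add: m_def)
    have le: "C * (t + length (q i) + 1) \<le> C * (m + P1 m + 1)"
      using tm P1 1(4)[of i] by (intro mult_left_mono) linarith+
    have "length y \<le> length (q i) + C * (t + length (q i) + 1)" by (rule fn_length[OF t(2)])
    then have ly: "length y \<le> S m" using le P1 1(4)[of i] unfolding S_def by linarith
    have "fn (c1 ;; c ;; c2) (max R1 (max R R2)) (u i) [decide N0 b (Str y)] (P1 m + (C * (m + P1 m + 1) + P2 (S m)))"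
    proof (intro fn_seq)
      show "fn c1 (max R1 (max R R2)) (u i) (q i) (P1 m)" by (rule fn_mono[OF 1(3)]) (use P1 in auto)
      show "fn c (max R1 (max R R2)) (q i) y (C * (m + P1 m + 1))" by (rule fn_mono[OF t(2)]) (use le in auto)
      show "fn c2 (max R1 (max R R2)) y [decide N0 b (Str y)] (P2 (S m))"
        by (rule fn_mono[OF 2(3)]) (use monoD[OF 2(2) ly] in auto)
    qed
    moreover have "P1 m + (C * (m + P1 m + 1) + P2 (S m)) = Q m" by (simp add: Q_def S_def)
    ultimately show ?thesis unfolding m_def by simp
  qed
  obtain M' where M': "wf_tm M'" "\<And>x y T. fn (c1 ;; c ;; c2) (max R1 (max R R2)) x y T \<Longrightarrow> computes_within M' x y (real (T + 5 * length x + 2 * length y + 5))"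
    using fn_computes[of "c1 ;; c ;; c2" "max R1 (max R R2)"] by blast
  define P where "P m = Q m + 5 * m + 7" for m
  show ?thesis
  proof (intro exI[of _ M'] exI[of _ P] conjI allI impI M'(1))
    show "pl P" unfolding P_def by (intro pl_intros Q)
    show "mono P"
    proof (rule monoI)
      fix a b :: nat assume "a \<le> b"
      then show "P a \<le> P b" using monoD[OF Q(2)] unfolding P_def by (intro add_mono) auto
    qed
    fix i y T assume "computes_within M (q i) y T"
    from M'(2)[OF comp[OF this]]
    show "computes_within M' (u i) [decide N0 b (Str y)] (real (P (length (u i) + nat \<lfloor>T\<rfloor>)))"
      by (rule computes_within_mono) (simp add: P_def)
  qed
qed

text \<open>The verifier looks at the first component only, so the empty witness always
  does.\<close>

lemma class_P_subset_NP: "class_P \<subseteq> class_NP"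
proof
  fix L assume "L \<in> class_P"
  then have "pc (\<lambda>x. x) (\<lambda>x. [x \<in> L])" by (simp add: class_P_def poly_time_iff)
  from pc_comp[OF pc_thd[OF pc_id] pc_reindex[OF this]] have "{z. thd z \<in> L} \<in> class_P"
    by (simp add: class_P_def poly_time_iff)
  moreover have "x \<in> L \<longleftrightarrow> (\<exists>w. length w \<le> poly_bound 0 (length x) \<and> tuple [x, w] \<in> {z. thd z \<in> L})" for x
    by (auto intro: exI[of _ "[]"])
  ultimately show "L \<in> class_NP" unfolding class_NP_def by blast
qed

lemma not_poly_time_approximable:
  assumes "1 < p" "p < 2" "1 < \<alpha>" SSEH and ne: "class_P \<noteq> class_NP"
  shows "\<not> approximable_in p \<alpha> poly_times"
proof
  assume app: "approximable_in p \<alpha> poly_times"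
  have "L \<in> class_P" if L: "L \<in> class_NP" for L
  proof -
    obtain c N0 b q N PN where r: "reduces p \<alpha> c N0 b L q N" "pc (\<lambda>x. x) q" and PN: "pl PN" "mono PN" "\<And>x. N x \<le> PN (length x)"
      using reduction_exists[OF assms(1-4) L] by blast
    obtain d M where M: "approx_algorithm p \<alpha> (poly_bound c) (\<lambda>n k. real (poly_bound d n)) M"
      using app unfolding approximable_in_def poly_times_def by blast
    then have "wf_tm M" by (simp add: approx_algorithm_def)
    from decider[OF this r(2), of N0 b] obtain M' P where M': "wf_tm M'" "pl P" "mono P"
      and dec: "\<And>x y T. computes_within M (q x) y T \<Longrightarrow> computes_within M' x [decide N0 b (Str y)] (real (P (length x + nat \<lfloor>T\<rfloor>)))"
      by blast
    define Q where "Q l = P (l + poly_bound d (PN l + PN l * PN l))" for l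
    have "pl Q" unfolding Q_def
      by (rule pl_comp[OF M'(2)]) (intro pl_add pl_id pl_comp[OF pl_poly_bound] pl_mult PN(1))
    from poly_bound_ge[OF this] obtain e where e: "\<And>l. Q l \<le> poly_bound e l" by blast
    have "computes_within M' x [x \<in> L] (real (poly_bound e (length x)))" for x
    proof -
      define n where "n = N x + N x * N x"
      obtain y where y: "computes_within M (q x) y (real (poly_bound d n))" "decide N0 b (Str y) \<longleftrightarrow> x \<in> L"
        using approx_output[OF r(1) M, of x] unfolding n_def by blast
      have "n \<le> PN (length x) + PN (length x) * PN (length x)"
        unfolding n_def using PN(3)[of x] by (intro add_mono mult_mono) auto
      then have "poly_bound d n \<le> poly_bound d (PN (length x) + PN (length x) * PN (length x))"
        unfolding poly_bound_def by (intro add_mono mult_left_mono power_mono) auto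
      then have "P (length x + poly_bound d n) \<le> Q (length x)" unfolding Q_def by (intro monoD[OF M'(3)]) simp
      also have "\<dots> \<le> poly_bound e (length x)" by (rule e)
      finally have "real (P (length x + nat \<lfloor>real (poly_bound d n)\<rfloor>)) \<le> real (poly_bound e (length x))" by simp
      from computes_within_mono[OF dec[OF y(1)] this] show ?thesis using y(2) by simp
    qed
    then show ?thesis using M'(1) unfolding class_P_def poly_time_def by blast
  qed
  with class_P_subset_NP ne show False by blast
qed

lemma not_subexp_time_approximable:
  assumes "1 < p" "p < 2" "1 < \<alpha>" SSEH and ETH
  shows "\<exists>\<delta>>0. \<not> approximable_in p \<alpha> (subexp_times \<delta>)"
proof -
  obtain c N0 b q N PN where r: "reduces p \<alpha> c N0 b sat_set q N" "pc (\<lambda>x. x) q" and PN: "pl PN" "mono PN" "\<And>x. N x \<le> PN (length x)"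
    using reduction_exists[OF assms(1-4) sat_set_NP] by blast
  define X where "X F = enc (rename_vars (str_cnf F))" for F
  obtain P1 where P1: "pl P1" "\<And>F. is_3cnf F \<Longrightarrow> length (X F) \<le> P1 (num_vars F)"
    using rename_vars_size unfolding X_def by blast
  \<comment> \<open>The rank parameter is at most a power of the number of variables. Its exponent
    \<open>e\<close> belongs to the reduction and is fixed before any algorithm is
    considered.\<close>
  obtain e where e: "\<And>v. PN (P1 v) \<le> (v + 2) ^ e" using pl_comp[OF PN(1) P1(1)] unfolding pl_def by blast
  \<comment> \<open>This makes \<open>e * \<delta>\<close> at most 1 / 2, so that the rank raised to
    \<open>\<delta>\<close> is at most \<open>sqrt (v + 2)\<close> for \<open>v\<close> variables,
    which is sublinear.\<close>
  define \<delta> where "\<delta> = 1 / (2 * (real e + 1))"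
  have "\<not> approximable_in p \<alpha> (subexp_times \<delta>)"
  proof
    assume "approximable_in p \<alpha> (subexp_times \<delta>)"
    then obtain d M where M: "approx_algorithm p \<alpha> (poly_bound c) (\<lambda>n k. real (poly_bound d n) * 2 powr (real k powr \<delta>)) M"
      unfolding approximable_in_def subexp_times_def by blast
    then have wf: "wf_tm M" by (simp add: approx_algorithm_def)
    \<comment> \<open>Formulas serve as the index, so nothing is asked of strings that encode no
      formula.\<close>
    have X: "pc enc_cnf X"
      using pc_reindex[OF pt_rename_vars[unfolded pt_def], of str_cnf] unfolding X_def enc_str_cnf .
    have qX: "pc enc_cnf (\<lambda>F. q (X F))" by (rule pc_comp[OF X pc_reindex[OF r(2)]])
    obtain PX where PX: "pl PX" "mono PX" "\<And>F. length (X F) \<le> PX (length (enc_cnf F))" using pc_length[OF X] by blast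
    from decider[OF wf qX, of N0 b] obtain M' P where M': "wf_tm M'" "pl P" "mono P"
      and dec: "\<And>F y T. computes_within M (q (X F)) y T \<Longrightarrow>
        computes_within M' (enc_cnf F) [decide N0 b (Str y)] (real (P (length (enc_cnf F) + nat \<lfloor>T\<rfloor>)))"
      by blast
    obtain h where h: "\<And>m. P m \<le> (m + 2) ^ h" using M'(2) unfolding pl_def by blast
    \<comment> \<open>The decider needs the power \<open>h\<close> of the time of \<open>M\<close>,
      which multiplies the exponent of 2 by \<open>h\<close>.\<close>
    define f where "f n = real h * sqrt (real n + 2)" for n
    \<comment> \<open>\<open>N x\<close> is bounded twice: here by the input length, for the
      polynomial factor, and later by the number of variables, for the exponent of 2.\<close>
    define Nl where "Nl l = PN (PX l) + PN (PX l) * PN (PX l)" for l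
    define Q where "Q l = (l + 2 + poly_bound d (Nl l)) ^ h" for l
    have "pl Q" unfolding Q_def Nl_def
      by (intro pl_power pl_add pl_id pl_const pl_comp[OF pl_poly_bound] pl_mult pl_comp[OF PN(1) PX(1)])
    from poly_bound_ge[OF this] obtain k where k: "\<And>l. Q l \<le> poly_bound k l" by blast
    have "f \<in> o(\<lambda>n. real n)" unfolding f_def by real_asymp
    moreover have "computes_within M' (enc_cnf F) [satisfiable F] (real (poly_bound k (length (enc_cnf F))) * 2 powr f (num_vars F))"
      if F: "is_3cnf F" for F
    proof -
      define x where "x = X F"
      define l where "l = length (enc_cnf F)"
      define v where "v = num_vars F"
      define n where "n = N x + N x * N x"
      define T where "T = real (poly_bound d n) * 2 powr (real (N x) powr \<delta>)"
      obtain y where y: "computes_within M (q x) y T" "decide N0 b (Str y) \<longleftrightarrow> x \<in> sat_set"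
        using approx_output[OF r(1) M, of x] unfolding n_def T_def by blast
      have sat: "decide N0 b (Str y) = satisfiable F"
        using y(2) satisfiable_iff_sat_set[of F] by (simp add: x_def X_def)
      have Nl: "N x \<le> PN (PX l)" using PN(3)[of x] monoD[OF PN(2) PX(3)[of F]] by (simp add: x_def l_def)
      have "n \<le> Nl l" unfolding n_def Nl_def using Nl by (intro add_mono mult_mono) auto
      then have n: "poly_bound d n \<le> poly_bound d (Nl l)"
        unfolding poly_bound_def by (intro add_mono mult_left_mono power_mono) auto
      have Nv: "N x \<le> (v + 2) ^ e"
        using PN(3)[of x] monoD[OF PN(2) P1(2)[OF F]] e[of v] unfolding x_def v_def by linarith
      define w where "w = 2 powr sqrt (real v + 2)"
      have w1: "1 \<le> w" unfolding w_def by (rule ge_one_powr_ge_zero) auto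
      have Nd: "real (N x) powr \<delta> \<le> sqrt (real v + 2)"
      proof -
        have "real (N x) \<le> real ((v + 2) ^ e)" using Nv by (simp only: of_nat_le_iff)
        then have "real (N x) powr \<delta> \<le> ((real v + 2) ^ e) powr \<delta>"
          by (intro powr_mono2) (auto simp: \<delta>_def add.commute)
        also have "\<dots> = (real v + 2) powr (real e * \<delta>)" by (simp add: powr_powr flip: powr_realpow)
        also have "\<dots> \<le> (real v + 2) powr (1 / 2)" by (intro powr_mono) (auto simp: \<delta>_def field_simps)
        finally show ?thesis by (simp add: powr_half_sqrt)
      qed
      have "2 powr (real (N x) powr \<delta>) \<le> w" unfolding w_def using Nd by (intro powr_mono) auto
      then have "T \<le> real (poly_bound d (Nl l)) * w" unfolding T_def using n by (intro mult_mono) auto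
      moreover have T0: "0 \<le> T" by (simp add: T_def)
      moreover have "real (nat \<lfloor>T\<rfloor>) \<le> T" using T0 by simp
      moreover have "real (l + 2) * 1 \<le> real (l + 2) * w" using w1 by (intro mult_left_mono) auto
      ultimately have m: "real (l + nat \<lfloor>T\<rfloor> + 2) \<le> real (l + 2 + poly_bound d (Nl l)) * w"
        by (simp add: distrib_right)
      have "real (P (l + nat \<lfloor>T\<rfloor>)) \<le> real ((l + nat \<lfloor>T\<rfloor> + 2) ^ h)" unfolding of_nat_le_iff by (rule h)
      also have "\<dots> \<le> (real (l + 2 + poly_bound d (Nl l)) * w) ^ h" unfolding of_nat_power using m by (intro power_mono) auto
      also have "\<dots> = real (Q l) * w ^ h" by (simp add: Q_def power_mult_distrib)
      also have "w ^ h = 2 powr f v" unfolding w_def f_def by (simp add: powr_powr mult.commute flip: powr_realpow)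
      also have "real (Q l) * 2 powr f v \<le> real (poly_bound k l) * 2 powr f v"
        using k[of l] by (intro mult_right_mono) (simp_all only: of_nat_le_iff powr_ge_zero)
      finally have "real (P (l + nat \<lfloor>T\<rfloor>)) \<le> real (poly_bound k l) * 2 powr f v" .
      from computes_within_mono[OF dec[of F, folded x_def l_def, OF y(1)] this] show ?thesis unfolding sat l_def v_def .
    qed
    ultimately have "\<not> ETH" unfolding ETH_def using M'(1) by blast
    with \<open>ETH\<close> show False by blast
  qed
  then show ?thesis by (intro exI[of _ \<delta>]) (simp add: \<delta>_def)
qed

theorem theorem1p4:
  fixes p \<alpha> :: real
  assumes "1 < p" and "p < 2" and "1 < \<alpha>"
    and "SSEH"
  shows "(class_P \<noteq> class_NP \<longrightarrow> \<not> approximable_in p \<alpha> poly_times) \<and>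
    (ETH \<longrightarrow> (\<exists>\<delta> > 0. \<not> approximable_in p \<alpha> (subexp_times \<delta>)))"
  using not_poly_time_approximable not_subexp_time_approximable assms by blast

end
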